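(* Assume $0<\beta<\beta_0$ and let $n\in\mathbb N$ be fixed. Then, as $N\to\infty$, the family $\{\sqrt N\,(R_S-q_{|S|})\}_{S\subseteq[n]}$, regarded as random variables under the disorder-averaged law $\nu$, converges jointly in distribution to the centered jointly Gaussian family $\{Z_S\}_{S\subseteq[n]}$ given by $$Z_S=\sum_{S'\subseteq S}Y_{S',\,|S|-|S'|},$$ so that $\mathbb E[Z_SZ_{\tilde S}]=\sum_{S'\subseteq S\cap\tilde S}A_{|S'|}\left(|S|-|S'|,\,|\tilde S|-|S'|\right)$ for $S,\tilde S\subseteq[n]$.
   Context: SK model. Fix $\beta>0$, $h>0$. For each $N$ let $(g_{i,j})_{1\le i<j\le N}$ be independent standard Gaussians and, for $\sigma\in\{-1,1\}^N$, let $H_N(\sigma)=\sum_{1\le i<j\le N}\frac1{\sqrt N}g_{i,j}\sigma_i\sigma_j+h\sum_{i=1}^N\sigma_i$. The (random) Gibbs measure gives $\sigma$ probability proportional to $e^{\beta H_N(\sigma)}$. Replicas $\sigma^1,\sigma^2,\dots$ are independent samples from the Gibbs measure with the same disorder $(g_{i,j})$; $\langle\cdot\rangle$ denotes expectation over replicas for fixed disorder, and $\nu(f)=\mathbb E[\langle f\rangle]$, with $\mathbb E$ the expectation over the disorder. Put $[n]=\{1,\dots,n\}$ and, for $S\subseteq[n]$, define the multi-overlap $R_S=\frac1N\sum_{i=1}^N\prod_{\ell\in S}\sigma_i^\ell$; also $R_{1,2}=R_{\{1,2\}}$. Let $Y$ be a standard Gaussian, let $q_2$ be the unique solution of $q_2=\mathbb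 E[\tanh^2(\beta\sqrt{q_2}\,Y+\beta h)]$, and let $q_p=\mathbb E[\tanh^p(\beta\sqrt{q_2}\,Y+\beta h)]$ for $p\ge0$ (so $q_0=1$). High temperature: $\beta_0>0$ is a constant independent of $h$ (known to exist by a theorem of Talagrand) such that for every $\beta<\beta_0$ there is $L>0$ with $\nu\left(\exp\left(\frac NL(R_{1,2}-q_2)^2\right)\right)\le L$ for all $N$. Gaussian family: $\{Y_{S,p}\}$ (indexed by finite $S\subset\mathbb N$ and integers $p\ge0$) is a centered jointly Gaussian family with $\mathbb E[Y_{S,p}Y_{\tilde S,\tilde p}]=\delta_{S,\tilde S}A_{|S|}(p,\tilde p)$, where $A_s$ is as follows. Let $\varrho_p=q_p-2q_{p+2}+q_{p+4}$; $\pi_p=q_{p+1}-q_{p+3}$ if $p\ge-1$ and $\pi_p=0$ otherwise; $\varphi_p=p\,\pi_{p-2}-(p+2)\pi_p$; and $$\lambda_p=\tbinom p2(q_{p-2}-q_pq_2)+\tbinom{p+1}2(q_{p+2}-q_pq_2)-p^2(q_p-q_pq_2),$$ $$\kappa_{p,\tilde p}=p\tilde p\,(q_p-q_pq_2)-\tilde p(p+1)(q_{p+2}-q_pq_2),\qquad \omega_{p,\tilde p}=\tbinom{\tilde p}2(q_{p+2}-q_pq_2).$$ For integers $p,\tilde p\ge0$: - $s\ge3$: $A_s(p,\tilde p)=\sum_{\ell=0}^s\binom s\ell(-1)^\ell q_{p+\tilde p+2\ell}$; - $s=2$: $A_2(p,\tilde p)=\varrho_{p+\tilde p}+\beta^2\varrho_p\varrho_{\tilde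 p}+\beta^4\varrho_p\varrho_{\tilde p}\frac{\varrho_0}{1-\beta^2\varrho_0}$; - $s=1$: $A_1(p,\tilde p)=\pi_{p+\tilde p-1}+\beta^2\varphi_pA_1(\tilde p,1)+\beta^2\tilde p\,\pi_pA_2(\tilde p-1,0)$; - $s=0$: $A_0(p,\tilde p)=(q_{p+\tilde p}-q_pq_{\tilde p})+\beta^2\lambda_pA_0(2,\tilde p)+\beta^2\kappa_{p,\tilde p}A_1(1,\tilde p-1)+\beta^2\omega_{p,\tilde p}A_2(0,\tilde p-2)$. Any term with coefficient $0$ is interpreted as $0$. The case $s=1$ is a linear system: $p=\tilde p=1$ determines $A_1(1,1)$, then $\tilde p=1$ determines $A_1(p,1)$, then all $A_1(p,\tilde p)$. For $s=0$, taking $p=2$ determines $A_0(2,\tilde p)$, then all $A_0(p,\tilde p)$. *)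

theory Defs
  imports "HOL-Probability.Probability"
begin

section \<open>Jointly Gaussian families and joint convergence in distribution\<close>

text \<open>Degenerate (almost surely constant) variables count as Gaussian, so that singular
  covariance matrices are allowed.\<close>

definition gaussian_rv :: "'a measure \<Rightarrow> ('a \<Rightarrow> real) \<Rightarrow> bool" where
  "gaussian_rv M X \<longleftrightarrow> X \<in> borel_measurable M \<and>
     (\<exists>\<mu> \<sigma>. (\<sigma> > 0 \<and> distributed M lborel X (normal_density \<mu> \<sigma>)) \<or> (AE x in M. X x = \<mu>))"

definition jointly_gaussian :: "'i set \<Rightarrow> 'a measure \<Rightarrow> ('i \<Rightarrow> 'a \<Rightarrow> real) \<Rightarrow> bool" where
  "jointly_gaussian I M X \<longleftrightarrow> prob_space M \<and>
     (\<forall>J c. finite J \<and> J \<subseteq> I \<longrightarrow> gaussian_rv M (\<lambda>\<omega>. \<Sum>i\<in>J. c i * X i \<omega>))"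

definition centered_gaussian_family ::
  "'i set \<Rightarrow> 'a measure \<Rightarrow> ('i \<Rightarrow> 'a \<Rightarrow> real) \<Rightarrow> bool" where
  "centered_gaussian_family I M X \<longleftrightarrow>
     jointly_gaussian I M X \<and> (\<forall>i\<in>I. prob_space.expectation M (X i) = 0)"

text \<open>Joint convergence in distribution of finite families indexed by \<open>I\<close>, tested against
  bounded continuous functions. The laws of the approximating families are given by expectation
  functionals \<open>E N\<close>. The topology on \<open>'i \<Rightarrow> real\<close> is the product topology; families are
  restricted to \<open>I\<close>, and every bounded continuous function of the coordinates in \<open>I\<close> arises
  as a restriction of such an \<open>F\<close>.\<close>

definition converges_jointly_in_distribution ::
  "'i set \<Rightarrow> (nat \<Rightarrow> ('a \<Rightarrow> real) \<Rightarrow> real) \<Rightarrow> (nat \<Rightarrow> 'i \<Rightarrow> 'a \<Rightarrow> real)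
     \<Rightarrow> 'b measure \<Rightarrow> ('i \<Rightarrow> 'b \<Rightarrow> real) \<Rightarrow> bool" where
  "converges_jointly_in_distribution I E X M Z \<longleftrightarrow>
     (\<forall>F :: ('i \<Rightarrow> real) \<Rightarrow> real. continuous_on UNIV F \<and> bounded (range F) \<longrightarrow>
        (\<lambda>N. E N (\<lambda>x. F (\<lambda>i\<in>I. X N i x)))
          \<longlonglongrightarrow> prob_space.expectation M (\<lambda>\<omega>. F (\<lambda>i\<in>I. Z i \<omega>)))"


section \<open>The Sherrington--Kirkpatrick model\<close>

definition sk_pairs :: "nat \<Rightarrow> (nat \<times> nat) set" where
  "sk_pairs N = {(i, j). 1 \<le> i \<and> i < j \<and> j \<le> N}"

definition sk_disorder :: "nat \<Rightarrow> (nat \<times> nat \<Rightarrow> real) measure" where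
  "sk_disorder N = PiM (sk_pairs N) (\<lambda>_. density lborel std_normal_density)"

definition sk_configs :: "nat \<Rightarrow> (nat \<Rightarrow> real) set" where
  "sk_configs N = {1..N} \<rightarrow>\<^sub>E {-1, 1}"

definition sk_H :: "nat \<Rightarrow> real \<Rightarrow> (nat \<times> nat \<Rightarrow> real) \<Rightarrow> (nat \<Rightarrow> real) \<Rightarrow> real" where
  "sk_H N h g \<sigma> =
     (\<Sum>(i, j)\<in>sk_pairs N. 1 / sqrt (real N) * g (i, j) * \<sigma> i * \<sigma> j) + h * (\<Sum>i=1..N. \<sigma> i)"

definition sk_gibbs ::
  "nat \<Rightarrow> real \<Rightarrow> real \<Rightarrow> (nat \<times> nat \<Rightarrow> real) \<Rightarrow> (nat \<Rightarrow> real) measure" where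
  "sk_gibbs N \<beta> h g = point_measure (sk_configs N)
     (\<lambda>\<sigma>. ennreal (exp (\<beta> * sk_H N h g \<sigma>) / (\<Sum>\<tau>\<in>sk_configs N. exp (\<beta> * sk_H N h g \<tau>))))"

text \<open>\<open>sk_nu N n \<beta> h f\<close> is the quantity \<open>\<nu>(f)\<close> for a function \<open>f\<close> of the replicas
  \<open>\<sigma> 1, \<dots>, \<sigma> n\<close>: the inner integral is over independent replicas at fixed disorder, the
  outer one over the disorder.\<close>

definition sk_nu ::
  "nat \<Rightarrow> nat \<Rightarrow> real \<Rightarrow> real \<Rightarrow> ((nat \<Rightarrow> nat \<Rightarrow> real) \<Rightarrow> real) \<Rightarrow> real" where
  "sk_nu N n \<beta> h f =
     (LINT g | sk_disorder N. (LINT \<sigma> | PiM {1..n} (\<lambda>_. sk_gibbs N \<beta> h g). f \<sigma>))"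

definition sk_overlap :: "nat \<Rightarrow> nat set \<Rightarrow> (nat \<Rightarrow> nat \<Rightarrow> real) \<Rightarrow> real" where
  "sk_overlap N S \<sigma> = 1 / real N * (\<Sum>i=1..N. \<Prod>l\<in>S. \<sigma> l i)"

definition sk_q2 :: "real \<Rightarrow> real \<Rightarrow> real" where
  "sk_q2 \<beta> h = (THE q. 0 \<le> q \<and>
     q = (LINT y | density lborel std_normal_density. tanh (\<beta> * sqrt q * y + \<beta> * h) ^ 2))"

definition sk_q :: "real \<Rightarrow> real \<Rightarrow> nat \<Rightarrow> real" where
  "sk_q \<beta> h p =
     (LINT y | density lborel std_normal_density. tanh (\<beta> * sqrt (sk_q2 \<beta> h) * y + \<beta> * h) ^ p)"

text \<open>The constant \<open>L\<close> may depend on \<open>\<beta>\<close> and \<open>h\<close>, but \<open>\<beta>0\<close> does not depend on \<open>h\<close>.\<close>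

definition sk_high_temperature :: "real \<Rightarrow> bool" where
  "sk_high_temperature \<beta>0 \<longleftrightarrow> \<beta>0 > 0 \<and>
     (\<forall>h>0. \<forall>\<beta>. 0 < \<beta> \<and> \<beta> < \<beta>0 \<longrightarrow>
        (\<exists>L>0. \<forall>N\<ge>1.
           sk_nu N 2 \<beta> h (\<lambda>\<sigma>. exp (real N / L * (sk_overlap N {1, 2} \<sigma> - sk_q2 \<beta> h)\<^sup>2)) \<le> L))"


section \<open>The limiting covariance\<close>

definition sk_rho :: "real \<Rightarrow> real \<Rightarrow> nat \<Rightarrow> real" where
  "sk_rho \<beta> h p = sk_q \<beta> h p - 2 * sk_q \<beta> h (p + 2) + sk_q \<beta> h (p + 4)"

definition sk_pi :: "real \<Rightarrow> real \<Rightarrow> int \<Rightarrow> real" where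
  "sk_pi \<beta> h p = (if p \<ge> -1 then sk_q \<beta> h (nat (p + 1)) - sk_q \<beta> h (nat (p + 3)) else 0)"

definition sk_phi :: "real \<Rightarrow> real \<Rightarrow> nat \<Rightarrow> real" where
  "sk_phi \<beta> h p = real p * sk_pi \<beta> h (int p - 2) - real (p + 2) * sk_pi \<beta> h (int p)"

text \<open>Below, truncated subtraction on \<open>nat\<close> only ever truncates inside terms whose coefficient
  is zero; these terms are to be read as zero.\<close>

definition sk_lambda :: "real \<Rightarrow> real \<Rightarrow> nat \<Rightarrow> real" where
  "sk_lambda \<beta> h p = (let q = sk_q \<beta> h in
     real (p choose 2) * (q (p - 2) - q p * q 2)
     + real ((p + 1) choose 2) * (q (p + 2) - q p * q 2)
     - (real p)\<^sup>2 * (q p - q p * q 2))"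

definition sk_kappa :: "real \<Rightarrow> real \<Rightarrow> nat \<Rightarrow> nat \<Rightarrow> real" where
  "sk_kappa \<beta> h p p' = (let q = sk_q \<beta> h in
     real p * real p' * (q p - q p * q 2) - real p' * real (p + 1) * (q (p + 2) - q p * q 2))"

definition sk_omega :: "real \<Rightarrow> real \<Rightarrow> nat \<Rightarrow> nat \<Rightarrow> real" where
  "sk_omega \<beta> h p p' = (let q = sk_q \<beta> h in real (p' choose 2) * (q (p + 2) - q p * q 2))"

definition sk_A_system :: "real \<Rightarrow> real \<Rightarrow> (nat \<Rightarrow> nat \<Rightarrow> nat \<Rightarrow> real) \<Rightarrow> bool" where
  "sk_A_system \<beta> h A \<longleftrightarrow>
     (let q = sk_q \<beta> h; \<rho> = sk_rho \<beta> h; \<pi> = sk_pi \<beta> h; \<phi> = sk_phi \<beta> h;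
          lam = sk_lambda \<beta> h; kap = sk_kappa \<beta> h; om = sk_omega \<beta> h in
      (\<forall>s\<ge>3. \<forall>p p'. A s p p' = (\<Sum>l=0..s. real (s choose l) * (-1) ^ l * q (p + p' + 2 * l))) \<and>
      (\<forall>p p'. A 2 p p' = \<rho> (p + p') + \<beta>^2 * \<rho> p * \<rho> p'
                 + \<beta>^4 * \<rho> p * \<rho> p' * (\<rho> 0 / (1 - \<beta>^2 * \<rho> 0))) \<and>
      (\<forall>p p'. A 1 p p' = \<pi> (int p + int p' - 1) + \<beta>^2 * \<phi> p * A 1 p' 1
                 + \<beta>^2 * real p' * \<pi> (int p) * A 2 (p' - 1) 0) \<and>
      (\<forall>p p'. A 0 p p' = (q (p + p') - q p * q p') + \<beta>^2 * lam p * A 0 2 p'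
                 + \<beta>^2 * kap p p' * A 1 1 (p' - 1) + \<beta>^2 * om p p' * A 2 0 (p' - 2)))"

text \<open>The system determines \<open>A\<close> uniquely as soon as \<open>\<beta>\<^sup>2 * sk_phi \<beta> h 1 \<noteq> 1\<close>
  (and \<open>sk_lambda \<beta> h 2 = sk_phi \<beta> h 1\<close>).\<close>

definition sk_A :: "real \<Rightarrow> real \<Rightarrow> nat \<Rightarrow> nat \<Rightarrow> nat \<Rightarrow> real" where
  "sk_A \<beta> h = (THE A. sk_A_system \<beta> h A)"

definition sk_limit_family ::
  "real \<Rightarrow> real \<Rightarrow> 'a measure \<Rightarrow> (nat set \<times> nat \<Rightarrow> 'a \<Rightarrow> real) \<Rightarrow> bool" where
  "sk_limit_family \<beta> h M Y \<longleftrightarrow>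
     centered_gaussian_family ({S. finite S} \<times> UNIV) M Y \<and>
     (\<forall>S S' p p'. finite S \<and> finite S' \<longrightarrow>
        prob_space.expectation M (\<lambda>\<omega>. Y (S, p) \<omega> * Y (S', p') \<omega>)
          = (if S = S' then sk_A \<beta> h (card S) p p' else 0))"

definition sk_Z :: "(nat set \<times> nat \<Rightarrow> 'a \<Rightarrow> real) \<Rightarrow> nat set \<Rightarrow> 'a \<Rightarrow> real" where
  "sk_Z Y S \<omega> = (\<Sum>S'\<in>Pow S. Y (S', card S - card S') \<omega>)"

end

theory Submission
  imports Defs
begin

text \<open>The proof is the cavity method. Rotating the Gaussian couplings of one site into an independent
  field of variance \<open>q\<^sub>2\<close> and integrating by parts expresses the effect of decoupling this site
  through the centred overlaps \<open>R\<^sub>l\<^sub>,\<^sub>l' - q\<^sub>2\<close>, whose second moments are \<open>O(1/N)\<close> by hypothesis.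
  A first expansion bounds the second moments of all multi-overlaps. For
  \<open>\<Theta> = (\<Sum>S. t S * sqrt N * (R S - q |S|))\<close> and \<open>f\<close> one of \<open>cos, sin\<close>, a second expansion gives, up to
  \<open>O(1/sqrt N)\<close>, a linear system for the numbers \<open>sqrt N * \<nu> ((R W - q |W|) * f \<Theta>)\<close>, whose solution is
  \<open>(\<Sum>S. t S * B W S) * \<nu> (f' \<Theta>)\<close> with
  \<open>B W S = (\<Sum>T \<subseteq> W \<inter> S. A |T| (|W| - |T|) (|S| - |T|))\<close>. Hence the characteristic function satisfies,
  along rays, the differential equation of a Gaussian one in the limit. As characteristic functions
  are bounded by \<open>1\<close>, \<open>B\<close> is positive semidefinite; Moebius inversion over fresh replicas transfers
  this to each \<open>A s\<close>, so that the Gaussian family exists. Second moments provide tightness, and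
  approximation by trigonometric polynomials turns the convergence of characteristic functions into
  convergence in distribution.\<close>

subsection \<open>Averages over independent replicas\<close>

text \<open>Three inputs are extracted from concentration itself. \<open>sk_q2\<close> is a
  \<open>THE\<close>: its sign follows because the two-replica overlap has nonnegative mean, and the
  equation \<open>q = qq 2\<close> because that overlap concentrates at both values. The
  denominators \<open>1 - \<beta>\<^sup>2 * rho 0\<close> and
  \<open>1 - \<beta>\<^sup>2 * phi1\<close> are nonzero because otherwise tightness would fail. The
  obstacle in the cavity equation is that each differentiation brings in fresh replicas. By
  exchangeability of the fresh ones the unknowns are one number for two fresh replicas, one for each
  old replica with a fresh one, and one for each pair of old ones; taking differences makes the
  system triangular. The resulting covariance depends on the sizes of \<open>W\<close>,
  \<open>S\<close> and \<open>W \<inter> S\<close> only. That it is the sum of \<open>A\<close> over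
  common subsets rests on a binomial identity for tanh moments, which \<open>A\<close> modifies only
  for \<open>s \<le> 2\<close>.\<close>

definition replica_avg ::
    "nat set \<Rightarrow> 'c set \<Rightarrow> ('c \<Rightarrow> real) \<Rightarrow> ((nat \<Rightarrow> 'c) \<Rightarrow> real) \<Rightarrow> real" where
  "replica_avg B \<Omega> p F = (\<Sum>\<sigma>\<in>PiE B (\<lambda>_. \<Omega>). F \<sigma> * (\<Prod>l\<in>B. p (\<sigma> l)))"

text \<open>Replicas that an observable does not see can be added or dropped at will; in this way
  all averages are brought to one common replica set.\<close>

definition depends_on :: "nat set \<Rightarrow> ((nat \<Rightarrow> 'c) \<Rightarrow> real) \<Rightarrow> bool" where
  "depends_on A F \<longleftrightarrow> (\<forall>\<sigma> \<sigma>'. (\<forall>l\<in>A. \<sigma> l = \<sigma>' l) \<longrightarrow> F \<sigma> = F \<sigma>')"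

definition boltzmann :: "'c set \<Rightarrow> ('c \<Rightarrow> real) \<Rightarrow> 'c \<Rightarrow> real" where
  "boltzmann \<Omega> x \<sigma> = exp (x \<sigma>) / (\<Sum>\<tau>\<in>\<Omega>. exp (x \<tau>))"

lemma depends_onD: "depends_on A F \<Longrightarrow> (\<And>l. l \<in> A \<Longrightarrow> \<sigma> l = \<sigma>' l) \<Longrightarrow> F \<sigma> = F \<sigma>'"
  by (auto simp: depends_on_def)

lemma depends_on_mono: "depends_on A F \<Longrightarrow> A \<subseteq> B \<Longrightarrow> depends_on B F"
  unfolding depends_on_def by blast

lemma depends_on_compose2:
  "depends_on A F \<Longrightarrow> depends_on A G \<Longrightarrow> depends_on A (\<lambda>\<sigma>. h (F \<sigma>) (G \<sigma>))"
  unfolding depends_on_def by metis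

lemma depends_on_compose: "depends_on A F \<Longrightarrow> depends_on A (\<lambda>\<sigma>. h (F \<sigma>))"
  unfolding depends_on_def by metis

lemma depends_on_eval: "l \<in> A \<Longrightarrow> depends_on A (\<lambda>\<sigma>. v (\<sigma> l))"
  unfolding depends_on_def by metis

lemma depends_on_const: "depends_on A (\<lambda>_. c)"
  unfolding depends_on_def by simp

lemma depends_on_sum: "(\<And>x. x \<in> X \<Longrightarrow> depends_on A (F x)) \<Longrightarrow> depends_on A (\<lambda>\<sigma>. \<Sum>x\<in>X. F x \<sigma>)"
  unfolding depends_on_def by (meson sum.cong)

lemma sum_PiE_insert:
  assumes "a \<notin> B"
  shows "(\<Sum>\<sigma>\<in>PiE (insert a B) (\<lambda>_. \<Omega>). f \<sigma>) = (\<Sum>\<sigma>\<in>PiE B (\<lambda>_. \<Omega>). \<Sum>y\<in>\<Omega>. f (\<sigma>(a := y)))"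
proof -
  have "(\<Sum>\<sigma>\<in>PiE (insert a B) (\<lambda>_. \<Omega>). f \<sigma>)
      = (\<Sum>(y, \<sigma>)\<in>\<Omega> \<times> PiE B (\<lambda>_. \<Omega>). f (\<sigma>(a := y)))"
    unfolding PiE_insert_eq
    by (subst sum.reindex[OF inj_combinator[OF assms]]) (auto simp: case_prod_unfold)
  also have "\<dots> = (\<Sum>y\<in>\<Omega>. \<Sum>\<sigma>\<in>PiE B (\<lambda>_. \<Omega>). f (\<sigma>(a := y)))"
    by (simp add: sum.cartesian_product)
  finally show ?thesis by (simp add: sum.swap[of _ \<Omega>])
qed

lemma replica_avg_insert:
  assumes "finite B" "a \<notin> B"
  shows "replica_avg (insert a B) \<Omega> p F
    = replica_avg B \<Omega> p (\<lambda>\<sigma>. \<Sum>y\<in>\<Omega>. p y * F (\<sigma>(a := y)))"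
proof -
  have "(\<Prod>l\<in>insert a B. p ((\<sigma>(a := y)) l)) = p y * (\<Prod>l\<in>B. p (\<sigma> l))" for \<sigma> y
  proof -
    have "(\<Prod>l\<in>B. p ((\<sigma>(a := y)) l)) = (\<Prod>l\<in>B. p (\<sigma> l))"
      by (rule prod.cong) (use assms in auto)
    then show ?thesis using assms by simp
  qed
  then show ?thesis unfolding replica_avg_def
    by (simp add: sum_PiE_insert[OF assms(2)] sum_distrib_left sum_distrib_right mult_ac
             del: fun_upd_apply)
qed

lemma replica_avg_cmult: "replica_avg B \<Omega> p (\<lambda>\<sigma>. c * F \<sigma>) = c * replica_avg B \<Omega> p F"
  by (simp add: replica_avg_def sum_distrib_left algebra_simps)

lemma replica_avg_diff: "replica_avg B \<Omega> p (\<lambda>\<sigma>. F \<sigma> - G \<sigma>) = replica_avg B \<Omega> p F - replica_avg B \<Omega> p G"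
  by (simp add: replica_avg_def sum_subtractf algebra_simps)

lemma replica_avg_sum: "replica_avg B \<Omega> p (\<lambda>\<sigma>. \<Sum>i\<in>I. F i \<sigma>) = (\<Sum>i\<in>I. replica_avg B \<Omega> p (F i))"
  unfolding replica_avg_def by (simp add: sum_distrib_right sum.swap[of _ I])

lemma replica_avg_cong:
  "(\<And>\<sigma>. \<sigma> \<in> PiE B (\<lambda>_. \<Omega>) \<Longrightarrow> F \<sigma> = G \<sigma>) \<Longrightarrow> replica_avg B \<Omega> p F = replica_avg B \<Omega> p G"
  by (simp add: replica_avg_def)

lemma replica_avg_marginal_insert:
  assumes "finite B" "a \<notin> B" "sum p \<Omega> = 1" "depends_on B F"
  shows "replica_avg (insert a B) \<Omega> p F = replica_avg B \<Omega> p F"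
proof -
  have "F (\<sigma>(a := y)) = F \<sigma>" for \<sigma> y
    by (rule depends_onD[OF assms(4)]) (use assms(2) in auto)
  then show ?thesis
    by (simp add: replica_avg_insert[OF assms(1,2)] sum_distrib_right[symmetric] assms(3))
qed

lemma replica_avg_marginal:
  assumes "finite B" "A \<subseteq> B" "sum p \<Omega> = 1" "depends_on A F"
  shows "replica_avg B \<Omega> p F = replica_avg A \<Omega> p F"
proof -
  have "finite A" using assms finite_subset by blast
  have "replica_avg (A \<union> C) \<Omega> p F = replica_avg A \<Omega> p F" if "finite C" "A \<inter> C = {}" for C
    using that
  proof (induction C rule: finite_induct)
    case (insert a C)
    then have "replica_avg (insert a (A \<union> C)) \<Omega> p F = replica_avg (A \<union> C) \<Omega> p F"
      using \<open>finite A\<close> assms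
      by (intro replica_avg_marginal_insert) (auto intro: depends_on_mono)
    then show ?case using insert by simp
  qed simp
  from this[of "B - A"] assms show ?thesis by (simp add: Un_absorb1)
qed

text \<open>Replicas are independent at fixed disorder, so one that \<open>F\<close> does not see
  splits off. Read from right to left, this turns a product with a Gibbs mean into a single average
  over one more replica.\<close>

lemma replica_avg_factor:
  assumes "finite B" "e \<in> B" "sum p \<Omega> = 1" "depends_on (B - {e}) F"
  shows "replica_avg B \<Omega> p (\<lambda>\<sigma>. F \<sigma> * v (\<sigma> e)) = replica_avg B \<Omega> p F * (\<Sum>\<tau>\<in>\<Omega>. p \<tau> * v \<tau>)"
proof -
  have B: "B = insert e (B - {e})" using assms by auto
  have F: "F (\<sigma>(e := y)) = F \<sigma>" for \<sigma> y
    by (rule depends_onD[OF assms(4)]) auto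
  have "replica_avg B \<Omega> p (\<lambda>\<sigma>. F \<sigma> * v (\<sigma> e))
     = replica_avg (B - {e}) \<Omega> p (\<lambda>\<sigma>. \<Sum>y\<in>\<Omega>. p y * (F \<sigma> * v y))"
    by (subst B, subst replica_avg_insert) (use assms in \<open>auto simp: F\<close>)
  also have "\<dots> = replica_avg (B - {e}) \<Omega> p (\<lambda>\<sigma>. (\<Sum>\<tau>\<in>\<Omega>. p \<tau> * v \<tau>) * F \<sigma>)"
    by (simp add: sum_distrib_left mult_ac)
  also have "\<dots> = (\<Sum>\<tau>\<in>\<Omega>. p \<tau> * v \<tau>) * replica_avg (B - {e}) \<Omega> p F"
    by (rule replica_avg_cmult)
  also have "replica_avg (B - {e}) \<Omega> p F = replica_avg B \<Omega> p F"
    by (rule replica_avg_marginal[symmetric]) (use assms in auto)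
  finally show ?thesis by simp
qed

lemma replica_avg_one:
  assumes "finite B" "sum p \<Omega> = 1"
  shows "replica_avg B \<Omega> p (\<lambda>_. 1) = 1"
  using replica_avg_marginal[OF assms(1) empty_subsetI assms(2) depends_on_const, of 1]
  by (simp add: replica_avg_def)

text \<open>Replicas are identically distributed. The restriction to \<open>B\<close> keeps the
  permuted tuple in \<open>PiE\<close>, whose elements are fixed outside \<open>B\<close>.\<close>

lemma replica_avg_permute:
  assumes "bij_betw \<pi> B B"
  shows "replica_avg B \<Omega> p (\<lambda>\<sigma>. F (\<lambda>l\<in>B. \<sigma> (\<pi> l))) = replica_avg B \<Omega> p F"
proof -
  define \<rho> where "\<rho> = inv_into B \<pi>"
  have \<rho>: "bij_betw \<rho> B B" unfolding \<rho>_def by (rule bij_betw_inv_into[OF assms])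
  have inv: "\<pi> (\<rho> l) = l" "\<rho> (\<pi> l) = l" if "l \<in> B" for l
    using that assms unfolding \<rho>_def
    by (auto simp: bij_betw_inv_into_right bij_betw_inv_into_left)
  have in_B: "\<pi> l \<in> B" "\<rho> l \<in> B" if "l \<in> B" for l
    using that assms \<rho> by (auto simp: bij_betw_def)
  have b: "bij_betw (\<lambda>\<sigma>. \<lambda>l\<in>B. \<sigma> (\<pi> l)) (PiE B (\<lambda>_. \<Omega>)) (PiE B (\<lambda>_. \<Omega>))"
  proof (rule bij_betwI[where g = "\<lambda>\<sigma>. \<lambda>l\<in>B. \<sigma> (\<rho> l)"])
    show "(\<lambda>l\<in>B. (\<lambda>l\<in>B. x (\<pi> l)) (\<rho> l)) = x" if "x \<in> PiE B (\<lambda>_. \<Omega>)" for x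
      using that inv in_B by (auto simp: restrict_def fun_eq_iff PiE_iff extensional_def)
    show "(\<lambda>l\<in>B. (\<lambda>l\<in>B. x (\<rho> l)) (\<pi> l)) = x" if "x \<in> PiE B (\<lambda>_. \<Omega>)" for x
      using that inv in_B by (auto simp: restrict_def fun_eq_iff PiE_iff extensional_def)
  qed (use in_B in auto)
  have pr: "(\<Prod>l\<in>B. p ((\<lambda>l\<in>B. \<sigma> (\<pi> l)) l)) = (\<Prod>l\<in>B. p (\<sigma> l))" for \<sigma>
  proof -
    have "(\<Prod>l\<in>B. p ((\<lambda>l\<in>B. \<sigma> (\<pi> l)) l)) = (\<Prod>l\<in>B. p (\<sigma> (\<pi> l)))"
      by (rule prod.cong) auto
    also have "\<dots> = (\<Prod>l\<in>B. p (\<sigma> l))"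
      using prod.reindex_bij_betw[OF assms, of "\<lambda>l. p (\<sigma> l)"] by simp
    finally show ?thesis .
  qed
  show ?thesis unfolding replica_avg_def
    using sum.reindex_bij_betw[OF b, of "\<lambda>\<sigma>. F \<sigma> * (\<Prod>l\<in>B. p (\<sigma> l))"] by (simp only: pr)
qed

subsection \<open>Gibbs averages and their derivatives\<close>

lemma boltzmann_partition_pos:
  assumes "finite \<Omega>" "\<Omega> \<noteq> {}"
  shows "(\<Sum>\<tau>\<in>\<Omega>. exp (x \<tau> :: real)) > 0"
  using assms by (intro sum_pos) auto

lemma sum_boltzmann:
  assumes "finite \<Omega>" "\<Omega> \<noteq> {}"
  shows "sum (boltzmann \<Omega> x) \<Omega> = 1"
  using boltzmann_partition_pos[OF assms, of x]
  by (simp add: boltzmann_def sum_divide_distrib[symmetric])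

lemma boltzmann_nonneg: "0 \<le> boltzmann \<Omega> x \<sigma>"
  by (auto simp: boltzmann_def intro!: divide_nonneg_nonneg sum_nonneg)

lemma boltzmann_eq_exp:
  assumes "finite \<Omega>" "\<Omega> \<noteq> {}"
  shows "boltzmann \<Omega> x \<sigma> = exp (x \<sigma> - ln (\<Sum>\<tau>\<in>\<Omega>. exp (x \<tau>)))"
  using boltzmann_partition_pos[OF assms, of x] by (simp add: boltzmann_def exp_diff)

lemma boltzmann_le_one:
  assumes "finite \<Omega>" "\<sigma> \<in> \<Omega>"
  shows "boltzmann \<Omega> x \<sigma> \<le> 1"
proof -
  have "\<Omega> \<noteq> {}" using assms by auto
  with assms sum_boltzmann[of \<Omega> x] member_le_sum[of \<sigma> \<Omega> "boltzmann \<Omega> x"]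
  show ?thesis by (auto simp: boltzmann_nonneg)
qed

lemma boltzmann_cong:
  assumes "\<And>\<tau>. \<tau> \<in> \<Omega> \<Longrightarrow> x \<tau> = y \<tau>" "\<sigma> \<in> \<Omega>"
  shows "boltzmann \<Omega> x \<sigma> = boltzmann \<Omega> y \<sigma>"
  unfolding boltzmann_def using assms by simp

text \<open>The product of the weights is the exponential of the sum of
  \<open>x s (\<sigma> l) - ln (Z s)\<close>, so its logarithmic derivative has one term per
  replica, \<open>v\<close> minus its Gibbs mean.\<close>

lemma has_derivative_replica_avg_boltzmann_centered:
  fixes x :: "real \<Rightarrow> 'c \<Rightarrow> real"
  assumes fin: "finite \<Omega>" "\<Omega> \<noteq> {}" "finite B"
    and x: "\<And>\<sigma>. \<sigma> \<in> \<Omega> \<Longrightarrow> ((\<lambda>s. x s \<sigma>) has_real_derivative v \<sigma>) (at s)"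
  shows "((\<lambda>s. replica_avg B \<Omega> (boltzmann \<Omega> (x s)) F) has_real_derivative
     replica_avg B \<Omega> (boltzmann \<Omega> (x s))
       (\<lambda>\<sigma>. F \<sigma> * (\<Sum>l\<in>B. v (\<sigma> l) - (\<Sum>\<tau>\<in>\<Omega>. boltzmann \<Omega> (x s) \<tau> * v \<tau>)))) (at s)"
proof -
  define Z where "Z s = (\<Sum>\<tau>\<in>\<Omega>. exp (x s \<tau>))" for s
  have Zpos: "Z s > 0" for s unfolding Z_def by (rule boltzmann_partition_pos[OF fin(1,2)])
  have pr: "(\<Prod>l\<in>B. boltzmann \<Omega> (x s) (\<sigma> l)) = exp (\<Sum>l\<in>B. x s (\<sigma> l) - ln (Z s))" for s \<sigma>
    using fin by (simp add: boltzmann_eq_exp exp_sum Z_def)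
  have dZ: "(Z has_real_derivative (\<Sum>\<tau>\<in>\<Omega>. exp (x s \<tau>) * v \<tau>)) (at s)"
    unfolding Z_def by (intro DERIV_sum DERIV_fun_exp x)
  have mean: "(\<Sum>\<tau>\<in>\<Omega>. exp (x s \<tau>) * v \<tau>) / Z s = (\<Sum>\<tau>\<in>\<Omega>. boltzmann \<Omega> (x s) \<tau> * v \<tau>)"
    by (simp add: boltzmann_def Z_def sum_divide_distrib)
  have dln: "((\<lambda>s. ln (Z s)) has_real_derivative (\<Sum>\<tau>\<in>\<Omega>. boltzmann \<Omega> (x s) \<tau> * v \<tau>)) (at s)"
    unfolding mean[symmetric] by (rule derivative_eq_intros dZ Zpos refl)+ simp
  have "((\<lambda>s. \<Sum>\<sigma>\<in>PiE B (\<lambda>_. \<Omega>). F \<sigma> * exp (\<Sum>l\<in>B. x s (\<sigma> l) - ln (Z s)))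
      has_real_derivative (\<Sum>\<sigma>\<in>PiE B (\<lambda>_. \<Omega>). F \<sigma> * (exp (\<Sum>l\<in>B. x s (\<sigma> l) - ln (Z s)) *
      (\<Sum>l\<in>B. v (\<sigma> l) - (\<Sum>\<tau>\<in>\<Omega>. boltzmann \<Omega> (x s) \<tau> * v \<tau>))))) (at s)"
    by (intro DERIV_sum DERIV_cmult DERIV_fun_exp DERIV_diff x dln) (auto simp: PiE_iff)
  then show ?thesis by (simp add: replica_avg_def pr mult_ac)
qed

text \<open>A replica outside \<open>A\<close> contributes a centred factor independent of
  \<open>F\<close>, hence zero. For the replicas in \<open>A\<close> the Gibbs mean of
  \<open>v\<close> is realised by the fresh replica \<open>e\<close>, once per element of
  \<open>A\<close>, so that no product of averages remains.\<close>

lemma has_derivative_replica_avg_boltzmann: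
  fixes x :: "real \<Rightarrow> 'c \<Rightarrow> real"
  assumes fin: "finite \<Omega>" "\<Omega> \<noteq> {}" "finite B"
    and A: "A \<subseteq> B" "e \<in> B - A" "depends_on A F"
    and x: "\<And>\<sigma>. \<sigma> \<in> \<Omega> \<Longrightarrow> ((\<lambda>s. x s \<sigma>) has_real_derivative v \<sigma>) (at s)"
  shows "((\<lambda>s. replica_avg B \<Omega> (boltzmann \<Omega> (x s)) F) has_real_derivative
     replica_avg B \<Omega> (boltzmann \<Omega> (x s))
       (\<lambda>\<sigma>. F \<sigma> * ((\<Sum>l\<in>A. v (\<sigma> l)) - real (card A) * v (\<sigma> e)))) (at s)"
proof -
  let ?p = "boltzmann \<Omega> (x s)"
  define m where "m = (\<Sum>\<tau>\<in>\<Omega>. ?p \<tau> * v \<tau>)"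
  have p1: "sum ?p \<Omega> = 1" by (rule sum_boltzmann[OF fin(1,2)])
  have fac: "replica_avg B \<Omega> ?p (\<lambda>\<sigma>. F \<sigma> * v (\<sigma> l)) = replica_avg B \<Omega> ?p F * m" if "l \<in> B - A" for l
    unfolding m_def using that A fin(3)
    by (intro replica_avg_factor p1) (auto intro: depends_on_mono)
  have "finite A" using A fin finite_subset by blast
  have "replica_avg B \<Omega> ?p (\<lambda>\<sigma>. F \<sigma> * (\<Sum>l\<in>B. v (\<sigma> l) - m))
      = replica_avg B \<Omega> ?p (\<lambda>\<sigma>. \<Sum>l\<in>B. F \<sigma> * v (\<sigma> l) - m * F \<sigma>)"
    by (simp add: sum_distrib_left right_diff_distrib mult_ac)
  also have "\<dots> = (\<Sum>l\<in>B. replica_avg B \<Omega> ?p (\<lambda>\<sigma>. F \<sigma> * v (\<sigma> l)) - m * replica_avg B \<Omega> ?p F)"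
    by (simp only: replica_avg_sum replica_avg_diff replica_avg_cmult)
  also have "\<dots> = (\<Sum>l\<in>A. replica_avg B \<Omega> ?p (\<lambda>\<sigma>. F \<sigma> * v (\<sigma> l)) - m * replica_avg B \<Omega> ?p F)"
    by (rule sum.mono_neutral_right) (use fin A fac in auto)
  also have "\<dots> = (\<Sum>l\<in>A. replica_avg B \<Omega> ?p (\<lambda>\<sigma>. F \<sigma> * v (\<sigma> l)))
       - real (card A) * replica_avg B \<Omega> ?p (\<lambda>\<sigma>. F \<sigma> * v (\<sigma> e))"
    using fac[OF A(2)] by (simp add: sum_subtractf)
  also have "\<dots> = replica_avg B \<Omega> ?p (\<lambda>\<sigma>. (\<Sum>l\<in>A. F \<sigma> * v (\<sigma> l)) - real (card A) * (F \<sigma> * v (\<sigma> e)))"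
    by (simp only: replica_avg_sum replica_avg_diff replica_avg_cmult)
  also have "\<dots> = replica_avg B \<Omega> ?p (\<lambda>\<sigma>. F \<sigma> * ((\<Sum>l\<in>A. v (\<sigma> l)) - real (card A) * v (\<sigma> e)))"
    by (simp add: sum_distrib_left right_diff_distrib mult_ac)
  finally show ?thesis
    using has_derivative_replica_avg_boltzmann_centered[where F = F and x = x and v = v, OF fin x] unfolding m_def by simp
qed

subsection \<open>Gaussian integration by parts\<close>

abbreviation gauss_product :: "'k set \<Rightarrow> ('k \<Rightarrow> real) measure" where
  "gauss_product K \<equiv> PiM K (\<lambda>_. density lborel std_normal_density)"

lemma prob_space_std_normal: "prob_space (density lborel std_normal_density)"
  by (rule prob_space_normal_density) simp

lemma prob_space_gauss_product: "prob_space (gauss_product K)"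
  by (intro prob_space_PiM prob_space_std_normal)

lemma integrable_std_normal_bounded:
  assumes "f \<in> borel_measurable borel" "\<And>y. \<bar>f y\<bar> \<le> C"
  shows "integrable (density lborel std_normal_density) (f :: real \<Rightarrow> real)"
proof -
  interpret prob_space "density lborel std_normal_density" by (rule prob_space_std_normal)
  show ?thesis using assms by (intro integrable_const_bound[where B = C]) auto
qed

lemma integrable_std_normal_linear_bounded:
  assumes "f \<in> borel_measurable borel" "\<And>y. \<bar>f y\<bar> \<le> C"
  shows "integrable (density lborel std_normal_density) (\<lambda>y. y * f y :: real)"
proof (rule Bochner_Integration.integrable_bound)
  show "integrable (density lborel std_normal_density) (\<lambda>y. C * y)"
    using integrable_std_normal_distribution_moment[of 1] by (intro integrable_mult_right) simp
  show "(\<lambda>y. y * f y) \<in> borel_measurable (density lborel std_normal_density)"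
    using assms(1) by simp
  show "AE y in density lborel std_normal_density. norm (y * f y) \<le> norm (C * y)"
  proof (rule AE_I2)
    fix y :: real
    have "\<bar>f y\<bar> * \<bar>y\<bar> \<le> \<bar>C\<bar> * \<bar>y\<bar>" by (intro mult_right_mono) (use assms(2)[of y] in auto)
    then show "norm (y * f y) \<le> norm (C * y)" by (simp add: abs_mult mult.commute)
  qed
qed

lemma std_normal_density_tendsto_0:
  "(std_normal_density \<longlongrightarrow> 0) at_top" "(std_normal_density \<longlongrightarrow> 0) at_bot"
  unfolding normal_density_def by real_asymp+

text \<open>The density satisfies \<open>d' = - y * d\<close>, so
  \<open>d * f' - d * (y * f)\<close> is the derivative of \<open>d * f\<close>, a function that
  vanishes at both ends because \<open>f\<close> is bounded.\<close>

lemma std_normal_integration_by_parts: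
  fixes f f' :: "real \<Rightarrow> real"
  assumes deriv: "\<And>y. (f has_real_derivative f' y) (at y)"
    and cont: "\<And>y. isCont f' y"
    and bound: "\<And>y. \<bar>f y\<bar> \<le> C" "\<And>y. \<bar>f' y\<bar> \<le> C'"
  shows "(LINT y|density lborel std_normal_density. y * f y)
    = (LINT y|density lborel std_normal_density. f' y)"
proof -
  let ?d = "std_normal_density"
  have contf: "isCont f y" for y using deriv by (rule DERIV_isCont)
  have meas: "f \<in> borel_measurable borel" "f' \<in> borel_measurable borel"
    using contf cont by (auto intro!: borel_measurable_continuous_onI continuous_at_imp_continuous_on)
  have int1: "integrable lborel (\<lambda>y. ?d y * (y * f y))"
    using integrable_std_normal_linear_bounded[OF meas(1) bound(1)] meas
    by (subst (asm) integrable_density) (auto simp: normal_density_nonneg)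
  have int2: "integrable lborel (\<lambda>y. ?d y * f' y)"
    using integrable_std_normal_bounded[OF meas(2) bound(2)] meas
    by (subst (asm) integrable_density) (auto simp: normal_density_nonneg)
  have dd: "(?d has_real_derivative - y * ?d y) (at y)" for y
    unfolding normal_density_def
    by (rule derivative_eq_intros refl | simp)+
  have der: "((\<lambda>y. ?d y * f y) has_real_derivative ?d y * f' y - ?d y * (y * f y)) (at y)" for y
    using DERIV_mult[OF dd deriv] by (rule DERIV_cong) (simp add: algebra_simps)
  have lim: "((\<lambda>y. ?d y * f y) \<longlongrightarrow> 0) F" if "(?d \<longlongrightarrow> 0) F" for F
  proof (rule Lim_null_comparison)
    show "\<forall>\<^sub>F y in F. norm (?d y * f y) \<le> ?d y * C"
      using bound(1) by (intro always_eventually)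
        (auto simp: abs_mult normal_density_nonneg intro!: mult_left_mono)
    show "((\<lambda>y. ?d y * C) \<longlongrightarrow> 0) F" using tendsto_mult_right[OF that, of C] by simp
  qed
  have cd: "isCont ?d y" for y using dd by (rule DERIV_isCont)
  have "(LBINT y=-\<infinity>..\<infinity>. ?d y * f' y - ?d y * (y * f y)) = 0 - 0"
  proof (rule interval_integral_FTC_integrable[where F = "\<lambda>y. ?d y * f y"])
    show "set_integrable lborel (einterval (- \<infinity>) \<infinity>) (\<lambda>y. ?d y * f' y - ?d y * (y * f y))"
      using int1 int2 by (simp add: set_integrable_def)
    show "(((\<lambda>y. ?d y * f y) \<circ> real_of_ereal) \<longlongrightarrow> 0) (at_right (- \<infinity>))"
      using lim[OF std_normal_density_tendsto_0(2)]
      by (simp only: ereal_tendsto_simps1)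
    show "(((\<lambda>y. ?d y * f y) \<circ> real_of_ereal) \<longlongrightarrow> 0) (at_left \<infinity>)"
      using lim[OF std_normal_density_tendsto_0(1)]
      by (simp only: ereal_tendsto_simps1)
  qed (use der in \<open>auto simp: has_real_derivative_iff_has_vector_derivative[symmetric]
        intro!: continuous_intros cd cont contf\<close>)
  then have "(LINT y|lborel. ?d y * f' y - ?d y * (y * f y)) = 0"
    by (simp add: interval_lebesgue_integral_def set_lebesgue_integral_def)
  then have "(LINT y|lborel. ?d y * f' y) = (LINT y|lborel. ?d y * (y * f y))"
    using int1 int2 by simp
  then show ?thesis using meas
    by (subst (1 2) integral_density) (auto simp: normal_density_nonneg)
qed

lemma integrable_gauss_product_coord:
  assumes "k \<in> K"
  shows "integrable (gauss_product K) (\<lambda>g. g k)"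
proof -
  have "integrable (density lborel std_normal_density) (\<lambda>y. y)"
    using integrable_std_normal_distribution_moment[of 1] by simp
  then have "integrable (distr (gauss_product K) (density lborel std_normal_density) (\<lambda>g. g k)) (\<lambda>y. y)"
    by (simp add: distr_PiM_component[OF prob_space_std_normal assms])
  then show ?thesis
    by (subst (asm) integrable_distr_eq) (use assms in auto)
qed

lemma integrable_gauss_product_bounded:
  assumes "\<Phi> \<in> borel_measurable (gauss_product K)" "\<And>g. \<bar>\<Phi> g\<bar> \<le> C"
  shows "integrable (gauss_product K) (\<Phi> :: _ \<Rightarrow> real)"
proof -
  interpret prob_space "gauss_product K" by (rule prob_space_gauss_product)
  show ?thesis using assms by (intro integrable_const_bound[where B = C]) auto
qed

lemma integrable_gauss_product_coord_bounded:
  assumes "k \<in> K" "\<Phi> \<in> borel_measurable (gauss_product K)" "\<And>g. \<bar>\<Phi> g\<bar> \<le> C"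
  shows "integrable (gauss_product K) (\<lambda>g. g k * \<Phi> g :: real)"
proof (rule Bochner_Integration.integrable_bound)
  show "integrable (gauss_product K) (\<lambda>g. C * g k)"
    by (intro integrable_mult_right integrable_gauss_product_coord assms)
  show "(\<lambda>g. g k * \<Phi> g) \<in> borel_measurable (gauss_product K)" using assms by simp
  show "AE g in gauss_product K. norm (g k * \<Phi> g) \<le> norm (C * g k)"
  proof (rule AE_I2)
    fix g :: "'a \<Rightarrow> real"
    have "\<bar>\<Phi> g\<bar> * \<bar>g k\<bar> \<le> \<bar>C\<bar> * \<bar>g k\<bar>" by (intro mult_right_mono) (use assms(3)[of g] in auto)
    then show "norm (g k * \<Phi> g) \<le> norm (C * g k)" by (simp add: abs_mult mult.commute)
  qed
qed

lemma gauss_product_integral_insert: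
  assumes "finite K" "k \<notin> K" "integrable (gauss_product (insert k K)) \<Phi>"
  shows "(LINT g|gauss_product (insert k K). \<Phi> g :: real)
     = (LINT g|gauss_product K. LINT y|density lborel std_normal_density. \<Phi> (g(k := y)))"
proof -
  interpret product_sigma_finite "\<lambda>_. density lborel std_normal_density"
    using prob_space_std_normal
    by (auto simp: product_sigma_finite_def intro!: prob_space_imp_sigma_finite)
  show ?thesis by (rule product_integral_insert[OF assms])
qed

lemma gauss_product_integration_by_parts:
  assumes "finite K" "k \<in> K"
    and meas: "\<Phi> \<in> borel_measurable (gauss_product K)" "\<Phi>' \<in> borel_measurable (gauss_product K)"
    and bound: "\<And>g. \<bar>\<Phi> g\<bar> \<le> C" "\<And>g. \<bar>\<Phi>' g\<bar> \<le> C'"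
    and deriv: "\<And>g y. ((\<lambda>y. \<Phi> (g(k := y))) has_real_derivative \<Phi>' (g(k := y))) (at y)"
    and cont: "\<And>g y. isCont (\<lambda>y. \<Phi>' (g(k := y))) y"
  shows "(LINT g|gauss_product K. g k * \<Phi> g) = (LINT g|gauss_product K. \<Phi>' g)"
proof -
  have K: "K = insert k (K - {k})" using assms(2) by auto
  have fin: "finite (K - {k})" and nk: "k \<notin> K - {k}" using assms(1) by auto
  have i1: "integrable (gauss_product (insert k (K - {k}))) (\<lambda>g. g k * \<Phi> g)"
    using integrable_gauss_product_coord_bounded[OF assms(2) meas(1) bound(1)] K by metis
  have i2: "integrable (gauss_product (insert k (K - {k}))) \<Phi>'"
    using integrable_gauss_product_bounded[OF meas(2) bound(2)] K by metis
  have "(LINT g|gauss_product (insert k (K - {k})). g k * \<Phi> g)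
      = (LINT g|gauss_product (insert k (K - {k})). \<Phi>' g)"
    unfolding gauss_product_integral_insert[OF fin nk i1] gauss_product_integral_insert[OF fin nk i2]
    by (rule Bochner_Integration.integral_cong[OF refl])
       (use std_normal_integration_by_parts[OF deriv cont bound(1) bound(2)] in simp)
  with K show ?thesis by metis
qed

subsection \<open>Disorder-averaged Gibbs expectations\<close>

abbreviation gauss_energy ::
    "'k set \<Rightarrow> ('c \<Rightarrow> real) \<Rightarrow> ('k \<Rightarrow> 'c \<Rightarrow> real) \<Rightarrow> ('k \<Rightarrow> real) \<Rightarrow> 'c \<Rightarrow> real" where
  "gauss_energy K a c g \<equiv> (\<lambda>\<sigma>. a \<sigma> + (\<Sum>k\<in>K. c k \<sigma> * g k))"

definition gauss_avg ::
    "'k set \<Rightarrow> nat set \<Rightarrow> 'c set \<Rightarrow> ('c \<Rightarrow> real) \<Rightarrow> ('k \<Rightarrow> 'c \<Rightarrow> real) \<Rightarrow> ((nat \<Rightarrow> 'c) \<Rightarrow> real) \<Rightarrow> real" where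
  "gauss_avg K B \<Omega> a c F =
     (LINT g|gauss_product K. replica_avg B \<Omega> (boltzmann \<Omega> (gauss_energy K a c g)) F)"

text \<open>The disorder-averaged law on tuples of configurations. The configuration space being
  finite, every averaged expectation is a finite sum against these weights, so linearity and
  monotonicity need no integrability checks.\<close>

definition gauss_weight ::
    "'k set \<Rightarrow> nat set \<Rightarrow> 'c set \<Rightarrow> ('c \<Rightarrow> real) \<Rightarrow> ('k \<Rightarrow> 'c \<Rightarrow> real) \<Rightarrow> (nat \<Rightarrow> 'c) \<Rightarrow> real" where
  "gauss_weight K B \<Omega> a c \<sigma> =
     (LINT g|gauss_product K. (\<Prod>l\<in>B. boltzmann \<Omega> (gauss_energy K a c g) (\<sigma> l)))"

lemma measurable_boltzmann:
  assumes "finite \<Omega>" "\<Omega> \<noteq> {}"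
  shows "(\<lambda>g. boltzmann \<Omega> (gauss_energy K a c g) \<sigma>) \<in> borel_measurable (gauss_product K)"
  unfolding boltzmann_def by measurable

lemma measurable_replica_avg_boltzmann:
  assumes "finite \<Omega>" "\<Omega> \<noteq> {}"
  shows "(\<lambda>g. replica_avg B \<Omega> (boltzmann \<Omega> (gauss_energy K a c g)) F) \<in> borel_measurable (gauss_product K)"
  unfolding replica_avg_def
  by (intro borel_measurable_sum borel_measurable_times borel_measurable_prod
        measurable_boltzmann assms borel_measurable_const)

lemma prod_boltzmann_bounds:
  assumes "finite \<Omega>" "\<sigma> \<in> PiE B (\<lambda>_. \<Omega>)"
  shows "0 \<le> (\<Prod>l\<in>B. boltzmann \<Omega> x (\<sigma> l))" "(\<Prod>l\<in>B. boltzmann \<Omega> x (\<sigma> l)) \<le> 1"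
  using assms by (auto intro!: prod_nonneg prod_le_1 boltzmann_nonneg boltzmann_le_one simp: PiE_iff)

lemma replica_avg_boltzmann_bound:
  assumes "finite \<Omega>"
  shows "\<bar>replica_avg B \<Omega> (boltzmann \<Omega> x) F\<bar> \<le> (\<Sum>\<sigma>\<in>PiE B (\<lambda>_. \<Omega>). \<bar>F \<sigma>\<bar>)"
  unfolding replica_avg_def
proof (rule order_trans[OF sum_abs sum_mono])
  fix \<sigma> assume \<sigma>: "\<sigma> \<in> PiE B (\<lambda>_. \<Omega>)"
  show "\<bar>F \<sigma> * (\<Prod>l\<in>B. boltzmann \<Omega> x (\<sigma> l))\<bar> \<le> \<bar>F \<sigma>\<bar>"
    using prod_boltzmann_bounds[OF assms \<sigma>, of x] by (simp add: abs_mult mult_left_le)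
qed

lemma integrable_prod_boltzmann:
  assumes "finite \<Omega>" "\<Omega> \<noteq> {}" "\<sigma> \<in> PiE B (\<lambda>_. \<Omega>)"
  shows "integrable (gauss_product K) (\<lambda>g. \<Prod>l\<in>B. boltzmann \<Omega> (gauss_energy K a c g) (\<sigma> l))"
  using prod_boltzmann_bounds[OF assms(1,3)]
  by (intro integrable_gauss_product_bounded[where C = 1] borel_measurable_prod measurable_boltzmann assms) auto

lemma gauss_avg_eq_sum:
  assumes "finite \<Omega>" "\<Omega> \<noteq> {}"
  shows "gauss_avg K B \<Omega> a c F = (\<Sum>\<sigma>\<in>PiE B (\<lambda>_. \<Omega>). F \<sigma> * gauss_weight K B \<Omega> a c \<sigma>)"
  unfolding gauss_avg_def gauss_weight_def replica_avg_def
  by (subst Bochner_Integration.integral_sum)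
     (auto intro!: integrable_mult_right integrable_prod_boltzmann assms)

lemma gauss_weight_nonneg: "\<sigma> \<in> PiE B (\<lambda>_. \<Omega>) \<Longrightarrow> 0 \<le> gauss_weight K B \<Omega> a c \<sigma>"
  unfolding gauss_weight_def by (intro integral_nonneg_AE AE_I2 prod_nonneg) (simp add: boltzmann_nonneg)

lemma gauss_avg_const:
  assumes "finite \<Omega>" "\<Omega> \<noteq> {}" "finite B"
  shows "gauss_avg K B \<Omega> a c (\<lambda>_. r) = r"
proof -
  interpret prob_space "gauss_product K" by (rule prob_space_gauss_product)
  have "replica_avg B \<Omega> (boltzmann \<Omega> x) (\<lambda>_. r) = r" for x
    using replica_avg_cmult[of B \<Omega> "boltzmann \<Omega> x" r "\<lambda>_. 1"]
      replica_avg_one[OF assms(3) sum_boltzmann[OF assms(1,2)], of x] by simp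
  then show ?thesis by (simp add: gauss_avg_def prob_space)
qed

lemma gauss_avg_marginal:
  assumes "finite \<Omega>" "\<Omega> \<noteq> {}" "finite B" "A \<subseteq> B" "depends_on A F"
  shows "gauss_avg K B \<Omega> a c F = gauss_avg K A \<Omega> a c F"
  unfolding gauss_avg_def
  by (simp add: replica_avg_marginal[OF assms(3,4) sum_boltzmann[OF assms(1,2)] assms(5)])

lemma gauss_avg_permute:
  assumes "bij_betw \<pi> B B"
  shows "gauss_avg K B \<Omega> a c (\<lambda>\<sigma>. F (\<lambda>l\<in>B. \<sigma> (\<pi> l))) = gauss_avg K B \<Omega> a c F"
  unfolding gauss_avg_def by (simp add: replica_avg_permute[OF assms])

text \<open>Integrating out a coupling that no configuration feels gives a factor one. This removes
  the auxiliary field at angle \<open>pi / 2\<close>, where its coefficient is a multiple of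
  \<open>cos (pi / 2)\<close>.\<close>

lemma gauss_avg_null_coord:
  assumes "finite \<Omega>" "\<Omega> \<noteq> {}" "finite K" "k \<notin> K" "\<And>\<sigma>. \<sigma> \<in> \<Omega> \<Longrightarrow> c k \<sigma> = 0"
  shows "gauss_avg (insert k K) B \<Omega> a c F = gauss_avg K B \<Omega> a c F"
proof -
  interpret prob_space "density lborel std_normal_density" by (rule prob_space_std_normal)
  have prob_UNIV: "prob UNIV = 1" using prob_space by simp
  let ?\<Phi> = "\<lambda>g. replica_avg B \<Omega> (boltzmann \<Omega> (gauss_energy (insert k K) a c g)) F"
  have "?\<Phi> (g(k := y)) = replica_avg B \<Omega> (boltzmann \<Omega> (gauss_energy K a c g)) F" for g y
  proof -
    have "(\<Sum>j\<in>K. c j \<sigma> * (g(k := y)) j) = (\<Sum>j\<in>K. c j \<sigma> * g j)" for \<sigma>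
      by (rule sum.cong) (use assms(4) in auto)
    then have "boltzmann \<Omega> (gauss_energy (insert k K) a c (g(k := y))) \<sigma>
        = boltzmann \<Omega> (gauss_energy K a c g) \<sigma>" if "\<sigma> \<in> \<Omega>" for \<sigma>
      using that assms(3-5) by (intro boltzmann_cong) (auto simp del: fun_upd_apply)
    then show ?thesis unfolding replica_avg_def
      by (intro sum.cong refl arg_cong2[where f = times] prod.cong) (auto simp: PiE_iff)
  qed
  moreover have "integrable (gauss_product (insert k K)) ?\<Phi>"
    by (rule integrable_gauss_product_bounded[OF measurable_replica_avg_boltzmann[OF assms(1,2)]
          replica_avg_boltzmann_bound[OF assms(1)]])
  ultimately show ?thesis unfolding gauss_avg_def
    by (subst gauss_product_integral_insert[OF assms(3,4)]) (simp_all add: prob_UNIV del: fun_upd_apply)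
qed

text \<open>Gaussian integration by parts differentiates the Gibbs average in \<open>g k\<close>,
  and differentiation costs one fresh replica \<open>e\<close>.\<close>

lemma gauss_avg_coord:
  fixes c :: "'k \<Rightarrow> 'c \<Rightarrow> real"
  assumes fin: "finite \<Omega>" "\<Omega> \<noteq> {}" "finite B" "finite K" "k \<in> K"
    and A: "A \<subseteq> B" "e \<in> B - A" "depends_on A F"
  shows "(LINT g|gauss_product K. g k * replica_avg B \<Omega> (boltzmann \<Omega> (gauss_energy K a c g)) F)
      = gauss_avg K B \<Omega> a c (\<lambda>\<sigma>. F \<sigma> * ((\<Sum>l\<in>A. c k (\<sigma> l)) - real (card A) * c k (\<sigma> e)))"
  unfolding gauss_avg_def
proof (rule gauss_product_integration_by_parts[OF fin(4,5)])
  let ?F' = "\<lambda>\<sigma>. F \<sigma> * ((\<Sum>l\<in>A. c k (\<sigma> l)) - real (card A) * c k (\<sigma> e))"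
  have dx: "((\<lambda>y. gauss_energy K a c (g(k := y)) \<sigma>) has_real_derivative c k \<sigma>) (at y)" for g \<sigma> y
  proof -
    have "gauss_energy K a c (g(k := y)) \<sigma> = a \<sigma> + (\<Sum>j\<in>K - {k}. c j \<sigma> * g j) + c k \<sigma> * y" for y
      using fin(4,5) by (simp add: sum.remove[of K k])
    then show ?thesis by (auto intro!: derivative_eq_intros)
  qed
  show "((\<lambda>y. replica_avg B \<Omega> (boltzmann \<Omega> (gauss_energy K a c (g(k := y)))) F) has_real_derivative
      replica_avg B \<Omega> (boltzmann \<Omega> (gauss_energy K a c (g(k := y)))) ?F') (at y)" for g y
    by (rule has_derivative_replica_avg_boltzmann[OF fin(1-3) A dx])
  show "isCont (\<lambda>y. replica_avg B \<Omega> (boltzmann \<Omega> (gauss_energy K a c (g(k := y)))) ?F') y" for g y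
    by (rule DERIV_isCont[OF has_derivative_replica_avg_boltzmann_centered[OF fin(1-3) dx]])
  show "\<bar>replica_avg B \<Omega> (boltzmann \<Omega> (gauss_energy K a c g)) F\<bar> \<le> (\<Sum>\<sigma>\<in>PiE B (\<lambda>_. \<Omega>). \<bar>F \<sigma>\<bar>)" for g
    by (rule replica_avg_boltzmann_bound[OF fin(1)])
  show "\<bar>replica_avg B \<Omega> (boltzmann \<Omega> (gauss_energy K a c g)) ?F'\<bar>
      \<le> (\<Sum>\<sigma>\<in>PiE B (\<lambda>_. \<Omega>). \<bar>?F' \<sigma>\<bar>)" for g
    by (rule replica_avg_boltzmann_bound[OF fin(1)])
qed (rule measurable_replica_avg_boltzmann[OF fin(1,2)])+

text \<open>The mean value inequality bounds every difference quotient by \<open>b\<close>, so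
  dominated convergence applies along each null sequence of increments.\<close>

lemma has_derivative_integral_dominated:
  fixes G G' :: "real \<Rightarrow> 'a \<Rightarrow> real"
  assumes deriv: "\<And>\<theta> g. ((\<lambda>\<theta>. G \<theta> g) has_real_derivative G' \<theta> g) (at \<theta>)"
    and bound: "\<And>\<theta> g. \<bar>G' \<theta> g\<bar> \<le> b g" and b: "integrable M b"
    and G: "\<And>\<theta>. integrable M (G \<theta>)" and meas: "\<And>\<theta>. G' \<theta> \<in> borel_measurable M"
  shows "((\<lambda>\<theta>. LINT g|M. G \<theta> g) has_real_derivative (LINT g|M. G' \<theta> g)) (at \<theta>)"
  unfolding DERIV_def tendsto_at_iff_sequentially comp_def
proof (intro allI impI)
  fix X :: "nat \<Rightarrow> real" assume X: "\<forall>n. X n \<in> UNIV - {0}" "X \<longlonglongrightarrow> 0"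
  have lip: "\<bar>(G (\<theta> + h) g - G \<theta> g) / h\<bar> \<le> b g" if "h \<noteq> 0" for h g
  proof -
    have "norm (G (\<theta> + h) g - G \<theta> g) \<le> b g * norm (\<theta> + h - \<theta>)"
      by (rule field_differentiable_bound[where S = UNIV and f' = "\<lambda>\<theta>. G' \<theta> g"])
         (use deriv bound in auto)
    then show ?thesis using that by (simp add: field_simps)
  qed
  have "(\<lambda>n. LINT g|M. (G (\<theta> + X n) g - G \<theta> g) / X n) \<longlonglongrightarrow> (LINT g|M. G' \<theta> g)"
  proof (rule integral_dominated_convergence[where w = b])
    show "AE g in M. (\<lambda>n. (G (\<theta> + X n) g - G \<theta> g) / X n) \<longlonglongrightarrow> G' \<theta> g"
      using deriv X unfolding DERIV_def tendsto_at_iff_sequentially comp_def by auto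
    show "AE g in M. norm ((G (\<theta> + X n) g - G \<theta> g) / X n) \<le> b g" for n
      using lip X by auto
    show "(\<lambda>g. (G (\<theta> + X n) g - G \<theta> g) / X n) \<in> borel_measurable M" for n
      using G by (intro borel_measurable_divide borel_measurable_diff) auto
  qed (use b meas in auto)
  then show "(\<lambda>n. ((LINT g|M. G (\<theta> + X n) g) - (LINT g|M. G \<theta> g)) / X n) \<longlonglongrightarrow> (LINT g|M. G' \<theta> g)"
    using G by simp
qed

lemma gauss_avg_add:
  assumes "finite \<Omega>" "\<Omega> \<noteq> {}"
  shows "gauss_avg K B \<Omega> a c (\<lambda>\<sigma>. F \<sigma> + G \<sigma>) = gauss_avg K B \<Omega> a c F + gauss_avg K B \<Omega> a c G"
  by (simp add: gauss_avg_eq_sum[OF assms] sum.distrib algebra_simps)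

lemma gauss_avg_diff:
  assumes "finite \<Omega>" "\<Omega> \<noteq> {}"
  shows "gauss_avg K B \<Omega> a c (\<lambda>\<sigma>. F \<sigma> - G \<sigma>) = gauss_avg K B \<Omega> a c F - gauss_avg K B \<Omega> a c G"
  by (simp add: gauss_avg_eq_sum[OF assms] sum_subtractf algebra_simps)

lemma gauss_avg_cmult:
  assumes "finite \<Omega>" "\<Omega> \<noteq> {}"
  shows "gauss_avg K B \<Omega> a c (\<lambda>\<sigma>. r * F \<sigma>) = r * gauss_avg K B \<Omega> a c F"
  by (simp add: gauss_avg_eq_sum[OF assms] sum_distrib_left algebra_simps)

lemma gauss_avg_sum:
  assumes "finite \<Omega>" "\<Omega> \<noteq> {}"
  shows "gauss_avg K B \<Omega> a c (\<lambda>\<sigma>. \<Sum>i\<in>I. F i \<sigma>) = (\<Sum>i\<in>I. gauss_avg K B \<Omega> a c (F i))"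
  by (simp add: gauss_avg_eq_sum[OF assms] sum_distrib_right sum.swap[of _ I])

lemma gauss_avg_mono:
  assumes "finite \<Omega>" "\<Omega> \<noteq> {}" "\<And>\<sigma>. \<sigma> \<in> PiE B (\<lambda>_. \<Omega>) \<Longrightarrow> F \<sigma> \<le> G \<sigma>"
  shows "gauss_avg K B \<Omega> a c F \<le> gauss_avg K B \<Omega> a c G"
  unfolding gauss_avg_eq_sum[OF assms(1,2)]
  by (intro sum_mono mult_right_mono gauss_weight_nonneg assms)

lemma gauss_avg_cong:
  assumes "\<And>\<sigma>. \<sigma> \<in> PiE B (\<lambda>_. \<Omega>) \<Longrightarrow> F \<sigma> = G \<sigma>"
  shows "gauss_avg K B \<Omega> a c F = gauss_avg K B \<Omega> a c G"
  unfolding gauss_avg_def by (simp cong: replica_avg_cong add: assms)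

text \<open>Interpolation of the covariance: the derivative of the averaged Gibbs expectation only
  involves the derivative \<open>D\<close> of half the covariance of the energies.\<close>

lemma has_derivative_gauss_avg:
  fixes u :: "'k \<Rightarrow> 'c \<Rightarrow> real" and \<alpha> \<alpha>' :: "'k \<Rightarrow> real \<Rightarrow> real"
  assumes fin: "finite \<Omega>" "\<Omega> \<noteq> {}" "finite B" "finite K"
    and A: "A \<subseteq> B" "e \<in> B - A" "depends_on A F" and e': "e' \<in> B - insert e A"
    and \<alpha>: "\<And>k \<theta>. (\<alpha> k has_real_derivative \<alpha>' k \<theta>) (at \<theta>)" "\<And>k \<theta>. \<bar>\<alpha>' k \<theta>\<bar> \<le> 1"
    and D: "\<And>\<sigma> \<tau>. \<sigma> \<in> \<Omega> \<Longrightarrow> \<tau> \<in> \<Omega> \<Longrightarrow> D \<sigma> \<tau> = (\<Sum>k\<in>K. \<alpha>' k \<theta> * \<alpha> k \<theta> * u k \<sigma> * u k \<tau>)"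
  shows "((\<lambda>\<theta>. gauss_avg K B \<Omega> a (\<lambda>k \<sigma>. \<alpha> k \<theta> * u k \<sigma>) F) has_real_derivative
     gauss_avg K B \<Omega> a (\<lambda>k \<sigma>. \<alpha> k \<theta> * u k \<sigma>) (\<lambda>\<sigma>. F \<sigma> *
       ((\<Sum>l\<in>A. \<Sum>l'\<in>A. D (\<sigma> l) (\<sigma> l')) + (\<Sum>l\<in>A. D (\<sigma> l) (\<sigma> e))
        - (real (card A) + 1) * (\<Sum>l\<in>A. D (\<sigma> l) (\<sigma> e')) - real (card A) * (\<Sum>l\<in>A. D (\<sigma> e) (\<sigma> l))
        - real (card A) * D (\<sigma> e) (\<sigma> e) + real (card A) * (real (card A) + 1) * D (\<sigma> e) (\<sigma> e')))) (at \<theta>)"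
proof -
  define c where "c \<theta> = (\<lambda>k \<sigma>. \<alpha> k \<theta> * u k \<sigma>)" for \<theta>
  define p where "p \<theta> g = boltzmann \<Omega> (gauss_energy K a (c \<theta>) g)" for \<theta> g
  define Fk where "Fk k \<sigma> = F \<sigma> * ((\<Sum>l\<in>A. u k (\<sigma> l)) - real (card A) * u k (\<sigma> e))" for k \<sigma>
  define G' where "G' \<theta> g = (\<Sum>k\<in>K. \<alpha>' k \<theta> * (g k * replica_avg B \<Omega> (p \<theta> g) (Fk k)))" for \<theta> g
  \<comment> \<open>Dominates the derivative at every angle:
    \<open>\<bar>\<alpha>' k \<theta>\<bar> \<le> 1\<close>, and an average is bounded by the sum
    over the finite configuration space.\<close>
  define b where "b g = (\<Sum>k\<in>K. \<bar>g k\<bar> * (\<Sum>\<sigma>\<in>PiE B (\<lambda>_. \<Omega>). \<bar>Fk k \<sigma>\<bar>))" for g :: "'k \<Rightarrow> real"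
  have finA: "finite A" using A(1) fin(3) finite_subset by blast
  have dFk: "depends_on (insert e A) (Fk k)" for k unfolding Fk_def
    by (intro depends_on_compose2[where h = "(*)"] depends_on_compose2[where h = "(-)"] depends_on_sum)
       (auto intro: depends_on_mono[OF A(3)] depends_on_eval)
  have der: "((\<lambda>\<theta>. replica_avg B \<Omega> (p \<theta> g) F) has_real_derivative G' \<theta> g) (at \<theta>)" for \<theta> g
  proof -
    define v where "v \<sigma> = (\<Sum>k\<in>K. \<alpha>' k \<theta> * u k \<sigma> * g k)" for \<sigma>
    have "((\<lambda>\<theta>. gauss_energy K a (c \<theta>) g \<sigma>) has_real_derivative v \<sigma>) (at \<theta>)" for \<sigma>
      unfolding c_def v_def by (auto intro!: derivative_eq_intros \<alpha>(1) simp: mult_ac)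
    from has_derivative_replica_avg_boltzmann[OF fin(1-3) A this]
    have "((\<lambda>\<theta>. replica_avg B \<Omega> (p \<theta> g) F) has_real_derivative
       replica_avg B \<Omega> (p \<theta> g) (\<lambda>\<sigma>. F \<sigma> * ((\<Sum>l\<in>A. v (\<sigma> l)) - real (card A) * v (\<sigma> e)))) (at \<theta>)"
      unfolding p_def .
    also have "(\<lambda>\<sigma>. F \<sigma> * ((\<Sum>l\<in>A. v (\<sigma> l)) - real (card A) * v (\<sigma> e)))
       = (\<lambda>\<sigma>. \<Sum>k\<in>K. (\<alpha>' k \<theta> * g k) * Fk k \<sigma>)"
    proof
      fix \<sigma>
      have "(\<Sum>l\<in>A. v (\<sigma> l)) = (\<Sum>k\<in>K. \<alpha>' k \<theta> * g k * (\<Sum>l\<in>A. u k (\<sigma> l)))"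
        unfolding v_def by (subst sum.swap) (simp add: sum_distrib_left mult_ac)
      moreover have "v (\<sigma> e) = (\<Sum>k\<in>K. \<alpha>' k \<theta> * g k * u k (\<sigma> e))"
        unfolding v_def by (simp add: mult_ac)
      ultimately show "F \<sigma> * ((\<Sum>l\<in>A. v (\<sigma> l)) - real (card A) * v (\<sigma> e))
          = (\<Sum>k\<in>K. (\<alpha>' k \<theta> * g k) * Fk k \<sigma>)"
        by (simp add: Fk_def sum_distrib_left right_diff_distrib sum_subtractf mult_ac)
    qed
    also have "replica_avg B \<Omega> (p \<theta> g) \<dots> = G' \<theta> g"
      by (simp only: replica_avg_sum replica_avg_cmult G'_def mult.assoc)
    finally show ?thesis .
  qed
  have mr: "(\<lambda>g. replica_avg B \<Omega> (p \<theta> g) H) \<in> borel_measurable (gauss_product K)" for \<theta> H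
    unfolding p_def by (rule measurable_replica_avg_boltzmann[OF fin(1,2)])
  have bd: "\<bar>replica_avg B \<Omega> (p \<theta> g) H\<bar> \<le> (\<Sum>\<sigma>\<in>PiE B (\<lambda>_. \<Omega>). \<bar>H \<sigma>\<bar>)" for \<theta> g H
    unfolding p_def by (rule replica_avg_boltzmann_bound[OF fin(1)])
  have "((\<lambda>\<theta>. LINT g|gauss_product K. replica_avg B \<Omega> (p \<theta> g) F) has_real_derivative
      (LINT g|gauss_product K. G' \<theta> g)) (at \<theta>)"
  proof (rule has_derivative_integral_dominated[where b = b, OF der])
    show "\<bar>G' \<theta> g\<bar> \<le> b g" for \<theta> g unfolding G'_def b_def
    proof (rule order_trans[OF sum_abs sum_mono])
      fix k
      show "\<bar>\<alpha>' k \<theta> * (g k * replica_avg B \<Omega> (p \<theta> g) (Fk k))\<bar>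
          \<le> \<bar>g k\<bar> * (\<Sum>\<sigma>\<in>PiE B (\<lambda>_. \<Omega>). \<bar>Fk k \<sigma>\<bar>)"
        unfolding abs_mult
        using mult_mono[OF \<alpha>(2)[of k \<theta>] mult_left_mono[OF bd[of \<theta> g "Fk k"], of "\<bar>g k\<bar>"]] by simp
    qed
    show "integrable (gauss_product K) b" unfolding b_def
      by (intro Bochner_Integration.integrable_sum integrable_mult_left integrable_abs
            integrable_gauss_product_coord)
    show "integrable (gauss_product K) (\<lambda>g. replica_avg B \<Omega> (p \<theta> g) F)" for \<theta>
      by (rule integrable_gauss_product_bounded[OF mr bd])
    show "G' \<theta> \<in> borel_measurable (gauss_product K)" for \<theta> unfolding G'_def using mr by measurable
  qed
  also have "(LINT g|gauss_product K. G' \<theta> g)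
      = (\<Sum>k\<in>K. \<alpha>' k \<theta> * (LINT g|gauss_product K. g k * replica_avg B \<Omega> (p \<theta> g) (Fk k)))"
    unfolding G'_def
    by (subst Bochner_Integration.integral_sum)
       (auto intro!: integrable_mult_right integrable_gauss_product_coord_bounded[OF _ mr bd])
  \<comment> \<open>\<open>Fk\<close> already involves the replica \<open>e\<close> of the first
    differentiation, so integration by parts now runs with \<open>insert e A\<close> and needs a
    second fresh replica \<open>e'\<close>.\<close>
  also have "\<dots> = (\<Sum>k\<in>K. \<alpha>' k \<theta> * gauss_avg K B \<Omega> a (c \<theta>) (\<lambda>\<sigma>. Fk k \<sigma> *
      ((\<Sum>l\<in>insert e A. c \<theta> k (\<sigma> l)) - real (card (insert e A)) * c \<theta> k (\<sigma> e'))))"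
  proof (rule sum.cong[OF refl])
    fix k assume k: "k \<in> K"
    have eq: "(LINT g|gauss_product K. g k * replica_avg B \<Omega> (p \<theta> g) (Fk k)) =
      gauss_avg K B \<Omega> a (c \<theta>) (\<lambda>\<sigma>. Fk k \<sigma> *
      ((\<Sum>l\<in>insert e A. c \<theta> k (\<sigma> l)) - real (card (insert e A)) * c \<theta> k (\<sigma> e')))"
      unfolding p_def
      by (rule gauss_avg_coord[OF fin(1-4) k _ e' dFk]) (use A in auto)
    show "\<alpha>' k \<theta> * (LINT g|gauss_product K. g k * replica_avg B \<Omega> (p \<theta> g) (Fk k))
      = \<alpha>' k \<theta> * gauss_avg K B \<Omega> a (c \<theta>) (\<lambda>\<sigma>. Fk k \<sigma> *
      ((\<Sum>l\<in>insert e A. c \<theta> k (\<sigma> l)) - real (card (insert e A)) * c \<theta> k (\<sigma> e')))" by (simp only: eq)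
  qed
  also have "\<dots> = gauss_avg K B \<Omega> a (c \<theta>) (\<lambda>\<sigma>. \<Sum>k\<in>K. \<alpha>' k \<theta> * (Fk k \<sigma> *
      ((\<Sum>l\<in>insert e A. c \<theta> k (\<sigma> l)) - real (card (insert e A)) * c \<theta> k (\<sigma> e'))))"
    by (simp only: gauss_avg_sum[OF fin(1,2)] gauss_avg_cmult[OF fin(1,2)])
  also have "\<dots> = gauss_avg K B \<Omega> a (c \<theta>) (\<lambda>\<sigma>. F \<sigma> *
       ((\<Sum>l\<in>A. \<Sum>l'\<in>A. D (\<sigma> l) (\<sigma> l')) + (\<Sum>l\<in>A. D (\<sigma> l) (\<sigma> e))
        - (real (card A) + 1) * (\<Sum>l\<in>A. D (\<sigma> l) (\<sigma> e')) - real (card A) * (\<Sum>l\<in>A. D (\<sigma> e) (\<sigma> l))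
        - real (card A) * D (\<sigma> e) (\<sigma> e) + real (card A) * (real (card A) + 1) * D (\<sigma> e) (\<sigma> e')))"
  proof (rule gauss_avg_cong)
    fix \<sigma> assume \<sigma>: "\<sigma> \<in> PiE B (\<lambda>_. \<Omega>)"
    let ?w = "\<lambda>k. \<alpha>' k \<theta> * \<alpha> k \<theta>"
    let ?m = "real (card A)"
    have in\<Omega>: "\<sigma> l \<in> \<Omega>" if "l \<in> B" for l using \<sigma> that by auto
    have eB: "e \<in> B" "e' \<in> B" "e \<notin> A" and AB: "\<And>l. l \<in> A \<Longrightarrow> l \<in> B" using A e' by auto
    have s1: "(\<Sum>l\<in>A. \<Sum>l'\<in>A. D (\<sigma> l) (\<sigma> l')) = (\<Sum>k\<in>K. ?w k * ((\<Sum>l\<in>A. u k (\<sigma> l)) * (\<Sum>l\<in>A. u k (\<sigma> l))))"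
    proof -
      have "(\<Sum>l\<in>A. \<Sum>l'\<in>A. D (\<sigma> l) (\<sigma> l')) = (\<Sum>l\<in>A. \<Sum>l'\<in>A. \<Sum>k\<in>K. ?w k * u k (\<sigma> l) * u k (\<sigma> l'))"
        by (intro sum.cong refl D in\<Omega> AB)
      also have "\<dots> = (\<Sum>l\<in>A. \<Sum>k\<in>K. \<Sum>l'\<in>A. ?w k * u k (\<sigma> l) * u k (\<sigma> l'))"
        by (intro sum.cong refl sum.swap)
      also have "\<dots> = (\<Sum>k\<in>K. \<Sum>l\<in>A. \<Sum>l'\<in>A. ?w k * u k (\<sigma> l) * u k (\<sigma> l'))" by (rule sum.swap)
      finally show ?thesis by (simp add: sum_product sum_distrib_left mult_ac)
    qed
    have s2: "(\<Sum>l\<in>A. D (\<sigma> l) (\<sigma> x)) = (\<Sum>k\<in>K. ?w k * ((\<Sum>l\<in>A. u k (\<sigma> l)) * u k (\<sigma> x)))"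
      if "x \<in> B" for x
    proof -
      have "(\<Sum>l\<in>A. D (\<sigma> l) (\<sigma> x)) = (\<Sum>l\<in>A. \<Sum>k\<in>K. ?w k * u k (\<sigma> l) * u k (\<sigma> x))"
        by (intro sum.cong refl D in\<Omega> AB that)
      also have "\<dots> = (\<Sum>k\<in>K. \<Sum>l\<in>A. ?w k * u k (\<sigma> l) * u k (\<sigma> x))" by (rule sum.swap)
      finally show ?thesis by (simp add: sum_distrib_left sum_distrib_right mult_ac)
    qed
    have sym: "D \<sigma> \<tau> = D \<tau> \<sigma>" if "\<sigma> \<in> \<Omega>" "\<tau> \<in> \<Omega>" for \<sigma> \<tau>
      using that by (simp add: D mult_ac)
    have s3: "(\<Sum>l\<in>A. D (\<sigma> e) (\<sigma> l)) = (\<Sum>l\<in>A. D (\<sigma> l) (\<sigma> e))"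
      by (intro sum.cong refl sym in\<Omega> AB eB)
    have s4: "D (\<sigma> x) (\<sigma> y) = (\<Sum>k\<in>K. ?w k * (u k (\<sigma> x) * u k (\<sigma> y)))" if "x \<in> B" "y \<in> B" for x y
      using D[OF in\<Omega>[OF that(1)] in\<Omega>[OF that(2)]] by (simp add: mult_ac)
    have pt: "\<alpha>' k \<theta> * (Fk k \<sigma> * ((\<Sum>l\<in>insert e A. c \<theta> k (\<sigma> l)) - real (card (insert e A)) * c \<theta> k (\<sigma> e')))
      = F \<sigma> * (?w k * ((\<Sum>l\<in>A. u k (\<sigma> l)) * (\<Sum>l\<in>A. u k (\<sigma> l)))
        + ?w k * ((\<Sum>l\<in>A. u k (\<sigma> l)) * u k (\<sigma> e))
        - (?m + 1) * (?w k * ((\<Sum>l\<in>A. u k (\<sigma> l)) * u k (\<sigma> e')))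
        - ?m * (?w k * ((\<Sum>l\<in>A. u k (\<sigma> l)) * u k (\<sigma> e)))
        - ?m * (?w k * (u k (\<sigma> e) * u k (\<sigma> e))) + ?m * (?m + 1) * (?w k * (u k (\<sigma> e) * u k (\<sigma> e'))))" for k
    proof -
      have "(\<Sum>l\<in>insert e A. c \<theta> k (\<sigma> l)) = \<alpha> k \<theta> * (u k (\<sigma> e) + (\<Sum>l\<in>A. u k (\<sigma> l)))"
        using finA eB(3) by (simp add: c_def sum_distrib_left distrib_left)
      moreover have "real (card (insert e A)) = ?m + 1" using finA eB(3) by simp
      ultimately show ?thesis unfolding Fk_def c_def by algebra
    qed
    show "(\<Sum>k\<in>K. \<alpha>' k \<theta> * (Fk k \<sigma> * ((\<Sum>l\<in>insert e A. c \<theta> k (\<sigma> l)) - real (card (insert e A)) * c \<theta> k (\<sigma> e'))))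
      = F \<sigma> * ((\<Sum>l\<in>A. \<Sum>l'\<in>A. D (\<sigma> l) (\<sigma> l')) + (\<Sum>l\<in>A. D (\<sigma> l) (\<sigma> e))
        - (?m + 1) * (\<Sum>l\<in>A. D (\<sigma> l) (\<sigma> e')) - ?m * (\<Sum>l\<in>A. D (\<sigma> e) (\<sigma> l))
        - ?m * D (\<sigma> e) (\<sigma> e) + ?m * (?m + 1) * D (\<sigma> e) (\<sigma> e'))"
      unfolding pt s3 s1 s2[OF eB(1)] s2[OF eB(2)] s4[OF eB(1) eB(1)] s4[OF eB(1) eB(2)]
      by (simp only: sum_distrib_left[symmetric] sum.distrib sum_subtractf)
  qed
  finally show ?thesis unfolding gauss_avg_def p_def c_def .
qed

subsection \<open>The SK measure as a disorder-averaged Gibbs expectation\<close>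

text \<open>Bridge from the measures of the definitions to finite sums: the product of finite point
  measures gives each singleton the product of the weights.\<close>

lemma integral_PiM_point_measure:
  assumes fin: "finite B" "finite \<Omega>" and p: "\<And>x. x \<in> \<Omega> \<Longrightarrow> 0 \<le> p x" "sum p \<Omega> = 1"
  shows "(LINT \<sigma>|PiM B (\<lambda>_. point_measure \<Omega> (\<lambda>x. ennreal (p x))). f \<sigma>) = replica_avg B \<Omega> p f"
proof -
  let ?P = "point_measure \<Omega> (\<lambda>x. ennreal (p x))"
  let ?M = "PiM B (\<lambda>_. ?P)"
  have P1: "prob_space ?P"
    using fin p by (intro prob_spaceI)
      (simp add: emeasure_point_measure_finite space_point_measure sum_ennreal)
  interpret product_sigma_finite "\<lambda>_. ?P"
    using P1 by (auto simp: product_sigma_finite_def intro!: prob_space_imp_sigma_finite)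
  interpret M: prob_space ?M by (intro prob_space_PiM P1)
  have sp: "space ?M = PiE B (\<lambda>_. \<Omega>)" by (simp add: space_PiM space_point_measure)
  have finS: "finite (PiE B (\<lambda>_. \<Omega>))" using fin by (intro finite_PiE)
  have sing: "{\<sigma>} = PiE B (\<lambda>l. {\<sigma> l})" if "\<sigma> \<in> PiE B (\<lambda>_. \<Omega>)" for \<sigma>
    using that by (auto simp: PiE_iff extensional_def fun_eq_iff) metis
  have sets: "{\<sigma>} \<in> sets ?M" if "\<sigma> \<in> PiE B (\<lambda>_. \<Omega>)" for \<sigma>
    unfolding sing[OF that] using that fin
    by (intro sets_PiM_I_finite) (auto simp: sets_point_measure)
  have meas: "measure ?M {\<sigma>} = (\<Prod>l\<in>B. p (\<sigma> l))" if "\<sigma> \<in> PiE B (\<lambda>_. \<Omega>)" for \<sigma>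
  proof -
    have "emeasure ?M {\<sigma>} = (\<Prod>l\<in>B. emeasure ?P {\<sigma> l})"
      unfolding sing[OF that] using that fin
      by (intro emeasure_PiM) (auto simp: sets_point_measure)
    also have "\<dots> = (\<Prod>l\<in>B. ennreal (p (\<sigma> l)))"
      using that fin by (intro prod.cong refl) (subst emeasure_point_measure_finite, auto)
    also have "\<dots> = ennreal (\<Prod>l\<in>B. p (\<sigma> l))"
      using that p by (intro prod_ennreal) auto
    finally show ?thesis
      using that p by (simp add: measure_def prod_nonneg PiE_iff)
  qed
  have "(LINT \<sigma>|?M. f \<sigma>) = (LINT \<sigma>|?M. (\<Sum>\<tau>\<in>PiE B (\<lambda>_. \<Omega>). f \<tau> * indicator {\<tau>} \<sigma>))"
    by (rule Bochner_Integration.integral_cong[OF refl])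
       (use finS in \<open>auto simp: sp indicator_def if_distrib[of "(*) _"] cong: if_cong\<close>)
  also have "\<dots> = (\<Sum>\<tau>\<in>PiE B (\<lambda>_. \<Omega>). f \<tau> * measure ?M {\<tau>})"
    using sets by (subst Bochner_Integration.integral_sum) (auto simp: M.emeasure_eq_measure)
  also have "\<dots> = replica_avg B \<Omega> p f"
    unfolding replica_avg_def by (intro sum.cong refl) (simp add: meas)
  finally show ?thesis .
qed

definition sk_avg ::
    "nat \<Rightarrow> real \<Rightarrow> real \<Rightarrow> nat set \<Rightarrow> ((nat \<Rightarrow> nat \<Rightarrow> real) \<Rightarrow> real) \<Rightarrow> real" where
  "sk_avg N \<beta> h B F = gauss_avg (sk_pairs N) B (sk_configs N) (\<lambda>\<sigma>. \<beta> * h * (\<Sum>j=1..N. \<sigma> j))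
     (\<lambda>(j, k) \<sigma>. \<beta> / sqrt (real N) * \<sigma> j * \<sigma> k) F"

lemma finite_sk_configs: "finite (sk_configs N)"
  unfolding sk_configs_def by (intro finite_PiE) auto

lemma sk_configs_nonempty: "sk_configs N \<noteq> {}"
  unfolding sk_configs_def by (simp add: PiE_eq_empty_iff)

lemma finite_sk_pairs: "finite (sk_pairs N)"
  by (rule finite_subset[of _ "{1..N} \<times> {1..N}"]) (auto simp: sk_pairs_def)

lemma sk_nu_eq_sk_avg: "sk_nu N n \<beta> h f = sk_avg N \<beta> h {1..n} f"
  unfolding sk_nu_def sk_avg_def gauss_avg_def sk_disorder_def
proof (rule Bochner_Integration.integral_cong[OF refl])
  fix g :: "nat \<times> nat \<Rightarrow> real"
  let ?x = "gauss_energy (sk_pairs N) (\<lambda>\<sigma>. \<beta> * h * (\<Sum>j=1..N. \<sigma> j))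
     (\<lambda>(j, k) \<sigma>. \<beta> / sqrt (real N) * \<sigma> j * \<sigma> k) g"
  have H: "\<beta> * sk_H N h g \<sigma> = ?x \<sigma>" for \<sigma>
    unfolding sk_H_def distrib_left sum_distrib_left
    by (simp add: sum_distrib_left case_prod_unfold mult_ac add.commute)
  have "sk_gibbs N \<beta> h g = point_measure (sk_configs N) (\<lambda>\<sigma>. ennreal (boltzmann (sk_configs N) ?x \<sigma>))"
    unfolding sk_gibbs_def boltzmann_def H ..
  then show "(LINT \<sigma>|PiM {1..n} (\<lambda>_. sk_gibbs N \<beta> h g). f \<sigma>)
      = replica_avg {1..n} (sk_configs N) (boltzmann (sk_configs N) ?x) f"
    by (simp add: integral_PiM_point_measure finite_sk_configs boltzmann_nonneg
          sum_boltzmann[OF finite_sk_configs sk_configs_nonempty])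
qed

subsection \<open>Decoupling one site\<close>

definition spin :: "nat set \<Rightarrow> nat \<Rightarrow> (nat \<Rightarrow> nat \<Rightarrow> real) \<Rightarrow> real" where
  "spin S i \<sigma> = (\<Prod>l\<in>S. \<sigma> l i)"

text \<open>Divided by \<open>N\<close> although \<open>N - 1\<close> sites contribute, so that the
  full overlap exceeds it by exactly \<open>spin S i \<sigma> / real N\<close>.\<close>

definition cavity_overlap :: "nat \<Rightarrow> nat \<Rightarrow> nat set \<Rightarrow> (nat \<Rightarrow> nat \<Rightarrow> real) \<Rightarrow> real" where
  "cavity_overlap N i S \<sigma> = 1 / real N * (\<Sum>j\<in>{1..N} - {i}. spin S j \<sigma>)"

lemma sk_overlap_eq: "sk_overlap N S \<sigma> = 1 / real N * (\<Sum>i=1..N. spin S i \<sigma>)"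
  by (simp add: sk_overlap_def spin_def)

lemma sk_overlap_cavity:
  assumes "i \<in> {1..N}"
  shows "sk_overlap N S \<sigma> = cavity_overlap N i S \<sigma> + spin S i \<sigma> / real N"
  unfolding sk_overlap_eq cavity_overlap_def sum.remove[OF finite_atLeastAtMost assms]
  by (simp add: add_divide_distrib)

text \<open>At angle \<open>pi / 2\<close> the site \<open>i\<close> interacts with the others as in the SK model, at angle \<open>0\<close> it
  only feels an independent field of variance \<open>q\<close>, attached to the index \<open>(0, 0)\<close>. Sine and cosine
  play the role of the usual square roots \<open>sqrt t\<close> and \<open>sqrt (1 - t)\<close>, but are smooth.\<close>

definition cavity_rate :: "nat \<Rightarrow> nat \<times> nat \<Rightarrow> real \<Rightarrow> real" where
  "cavity_rate i k \<theta> =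
     (if k = (0, 0) then cos \<theta> else if fst k = i \<or> snd k = i then sin \<theta> else 1)"

text \<open>\<open>(0, 0)\<close> is free as the index of the auxiliary field because the members of
  \<open>sk_pairs\<close> start at 1.\<close>

definition cavity_coeff ::
    "nat \<Rightarrow> nat \<Rightarrow> real \<Rightarrow> real \<Rightarrow> nat \<times> nat \<Rightarrow> (nat \<Rightarrow> real) \<Rightarrow> real" where
  "cavity_coeff N i \<beta> q k \<sigma> = (if k = (0, 0) then \<beta> * sqrt q * \<sigma> i
     else \<beta> / sqrt (real N) * \<sigma> (fst k) * \<sigma> (snd k))"

definition cavity_avg :: "nat \<Rightarrow> nat \<Rightarrow> real \<Rightarrow> real \<Rightarrow> real \<Rightarrow> nat set \<Rightarrow> real
    \<Rightarrow> ((nat \<Rightarrow> nat \<Rightarrow> real) \<Rightarrow> real) \<Rightarrow> real" where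
  "cavity_avg N i \<beta> h q B \<theta> F = gauss_avg (insert (0, 0) (sk_pairs N)) B (sk_configs N)
     (\<lambda>\<sigma>. \<beta> * h * (\<Sum>j=1..N. \<sigma> j)) (\<lambda>k \<sigma>. cavity_rate i k \<theta> * cavity_coeff N i \<beta> q k \<sigma>) F"

text \<open>Up to the factor \<open>sin \<theta> * cos \<theta> * \<beta>\<^sup>2\<close>, half the
  derivative in the angle of the covariance between the energies of two replicas: the couplings of
  site \<open>i\<close> being switched on contribute the overlap of the other sites, the field being
  switched off contributes \<open>q\<close>.\<close>

definition cavity_link :: "nat \<Rightarrow> nat \<Rightarrow> real \<Rightarrow> nat \<Rightarrow> nat \<Rightarrow> (nat \<Rightarrow> nat \<Rightarrow> real) \<Rightarrow> real" where
  "cavity_link N i q l l' \<sigma> = spin {l, l'} i \<sigma> * (cavity_overlap N i {l, l'} \<sigma> - q)"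

text \<open>In \<open>1 - real (card A)\<close> the 1 stems from the replica \<open>e\<close> in the
  second integration by parts and the \<open>- card A\<close> from the first one. For observables
  that see neither fresh replica, exchangeability merges the sums over \<open>e\<close> and
  \<open>e'\<close> into the familiar coefficient \<open>- 2 * card A\<close>. Diagonal pairs are
  absent because they cancel.\<close>

definition cavity_pairs ::
    "nat \<Rightarrow> nat \<Rightarrow> real \<Rightarrow> nat set \<Rightarrow> nat \<Rightarrow> nat \<Rightarrow> (nat \<Rightarrow> nat \<Rightarrow> real) \<Rightarrow> real" where
  "cavity_pairs N i q A e e' \<sigma> =
     (\<Sum>l\<in>A. \<Sum>l'\<in>A - {l}. cavity_link N i q l l' \<sigma>)
     + (1 - real (card A)) * (\<Sum>l\<in>A. cavity_link N i q l e \<sigma>)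
     - (real (card A) + 1) * (\<Sum>l\<in>A. cavity_link N i q l e' \<sigma>)
     + real (card A) * (real (card A) + 1) * cavity_link N i q e e' \<sigma>"

lemma sk_configs_spin_sq: "\<sigma> \<in> sk_configs N \<Longrightarrow> j \<in> {1..N} \<Longrightarrow> \<sigma> j * \<sigma> j = 1"
  unfolding sk_configs_def by (drule (1) PiE_mem) auto

lemma zero_notin_sk_pairs: "(0, 0) \<notin> sk_pairs N"
  by (simp add: sk_pairs_def)

lemma sum_sk_pairs_site:
  assumes i: "i \<in> {1..N}"
  shows "(\<Sum>k\<in>{k \<in> sk_pairs N. fst k = i \<or> snd k = i}. f (fst k) * f (snd k))
    = f i * (\<Sum>j\<in>{1..N} - {i}. f j :: real)"
proof -
  have "(\<Sum>k\<in>{k \<in> sk_pairs N. fst k = i \<or> snd k = i}. f (fst k) * f (snd k))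
      = (\<Sum>j\<in>{1..N} - {i}. f i * f j)"
    \<comment> \<open>A pair containing \<open>i\<close> is recovered from its other member by
      sorting the two.\<close>
    by (rule sum.reindex_bij_witness[where
          i = "\<lambda>j. (min i j, max i j)" and j = "\<lambda>k. if fst k = i then snd k else fst k"])
       (use i in \<open>auto simp: sk_pairs_def min_def max_def mult.commute split: if_splits\<close>)
  then show ?thesis by (simp add: sum_distrib_left)
qed

lemma has_derivative_cavity_avg:
  assumes i: "i \<in> {1..N}" and q: "0 \<le> q" and fin: "finite B"
    and A: "A \<subseteq> B" "e \<in> B - A" "e' \<in> B - insert e A" "depends_on A F"
  shows "((\<lambda>\<theta>. cavity_avg N i \<beta> h q B \<theta> F) has_real_derivative
     sin \<theta> * cos \<theta> * \<beta>\<^sup>2 * cavity_avg N i \<beta> h q B \<theta> (\<lambda>\<sigma>. F \<sigma> * cavity_pairs N i q A e e' \<sigma>)) (at \<theta>)"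
proof -
  let ?K = "insert (0, 0) (sk_pairs N)" and ?\<Omega> = "sk_configs N"
  let ?u = "cavity_coeff N i \<beta> q"
  define \<alpha>' :: "nat \<times> nat \<Rightarrow> real \<Rightarrow> real" where "\<alpha>' k \<theta> =
     (if k = (0, 0) then - sin \<theta> else if fst k = i \<or> snd k = i then cos \<theta> else 0)" for k \<theta>
  define r where "r = sin \<theta> * cos \<theta> * \<beta>\<^sup>2"
  define D where "D \<sigma> \<tau> = r * (\<sigma> i * \<tau> i * (1 / real N * (\<Sum>j\<in>{1..N} - {i}. \<sigma> j * \<tau> j) - q))" for \<sigma> \<tau> :: "nat \<Rightarrow> real"
  have N: "real N > 0" using i by auto
  have d1: "(cavity_rate i k has_real_derivative \<alpha>' k \<theta>) (at \<theta>)" for k \<theta>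
    unfolding cavity_rate_def \<alpha>'_def by (auto intro!: derivative_eq_intros)
  have d2: "\<bar>\<alpha>' k \<theta>\<bar> \<le> 1" for k \<theta> unfolding \<alpha>'_def by auto
  have D: "D \<sigma> \<tau> = (\<Sum>k\<in>?K. \<alpha>' k \<theta> * cavity_rate i k \<theta> * ?u k \<sigma> * ?u k \<tau>)" for \<sigma> \<tau>
  proof -
    let ?f = "\<lambda>j. \<sigma> j * \<tau> j"
    have "(\<Sum>k\<in>sk_pairs N. \<alpha>' k \<theta> * cavity_rate i k \<theta> * ?u k \<sigma> * ?u k \<tau>)
       = (\<Sum>k\<in>sk_pairs N. if fst k = i \<or> snd k = i then r / real N * (?f (fst k) * ?f (snd k)) else 0)"
    proof (rule sum.cong[OF refl])
      fix k assume "k \<in> sk_pairs N"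
      then have k: "k \<noteq> (0, 0)" by (auto simp: sk_pairs_def)
      have "(\<beta> / sqrt (real N)) * (\<beta> / sqrt (real N)) = \<beta>\<^sup>2 / real N"
        by (simp add: power2_eq_square)
      then show "\<alpha>' k \<theta> * cavity_rate i k \<theta> * ?u k \<sigma> * ?u k \<tau>
        = (if fst k = i \<or> snd k = i then r / real N * (?f (fst k) * ?f (snd k)) else 0)"
        using k unfolding \<alpha>'_def cavity_rate_def cavity_coeff_def r_def
        by (auto simp: field_simps power2_eq_square)
    qed
    also have "\<dots> = r / real N * (?f i * (\<Sum>j\<in>{1..N} - {i}. ?f j))"
      unfolding sum_sk_pairs_site[OF i, of ?f, symmetric]
      by (simp add: sum.inter_filter[symmetric] finite_sk_pairs sum_distrib_left)
    finally show ?thesis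
      using q zero_notin_sk_pairs[of N] finite_sk_pairs[of N]
      by (simp add: \<alpha>'_def cavity_rate_def cavity_coeff_def D_def r_def field_simps power2_eq_square)
  qed
  have pairs: "F \<sigma> * ((\<Sum>l\<in>A. \<Sum>l'\<in>A. D (\<sigma> l) (\<sigma> l')) + (\<Sum>l\<in>A. D (\<sigma> l) (\<sigma> e))
        - (real (card A) + 1) * (\<Sum>l\<in>A. D (\<sigma> l) (\<sigma> e')) - real (card A) * (\<Sum>l\<in>A. D (\<sigma> e) (\<sigma> l))
        - real (card A) * D (\<sigma> e) (\<sigma> e) + real (card A) * (real (card A) + 1) * D (\<sigma> e) (\<sigma> e'))
      = r * (F \<sigma> * cavity_pairs N i q A e e' \<sigma>)" if \<sigma>: "\<sigma> \<in> PiE B (\<lambda>_. ?\<Omega>)" for \<sigma>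
  proof -
    have finA: "finite A" using A fin finite_subset by blast
    have link: "D (\<sigma> l) (\<sigma> l') = r * cavity_link N i q l l' \<sigma>" if "l \<noteq> l'" for l l'
      using that by (simp add: D_def cavity_link_def cavity_overlap_def spin_def)
    \<comment> \<open>Spins square to one, so \<open>D\<close> is the same constant on every
      diagonal; its \<open>card A\<close> copies in the double sum cancel the term
      \<open>- card A * D (\<sigma> e) (\<sigma> e)\<close>.\<close>
    have diag: "D (\<sigma> l) (\<sigma> l) = r * (1 / real N * real (N - 1) - q)" if "l \<in> B" for l
    proof -
      have sq: "\<sigma> l j * \<sigma> l j = 1" if "j \<in> {1..N}" for j
        using \<sigma> \<open>l \<in> B\<close> that by (intro sk_configs_spin_sq[of _ N]) auto
      have "(\<Sum>j\<in>{1..N} - {i}. \<sigma> l j * \<sigma> l j) = real (N - 1)"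
        using i by (simp add: sq card_Diff_singleton)
      then show ?thesis using sq[OF i] by (simp add: D_def)
    qed
    have s1: "(\<Sum>l\<in>A. \<Sum>l'\<in>A. D (\<sigma> l) (\<sigma> l')) = r * (\<Sum>l\<in>A. \<Sum>l'\<in>A - {l}. cavity_link N i q l l' \<sigma>)
        + real (card A) * D (\<sigma> e) (\<sigma> e)"
    proof -
      have "(\<Sum>l'\<in>A. D (\<sigma> l) (\<sigma> l')) = D (\<sigma> e) (\<sigma> e) + r * (\<Sum>l'\<in>A - {l}. cavity_link N i q l l' \<sigma>)"
        if "l \<in> A" for l
        using that finA A by (subst sum.remove[of A l]) (auto simp: diag link sum_distrib_left)
      then show ?thesis by (simp add: sum.distrib sum_distrib_left)
    qed
    have "D (\<sigma> l) (\<sigma> e) = r * cavity_link N i q l e \<sigma>" "D (\<sigma> e) (\<sigma> l) = r * cavity_link N i q l e \<sigma>"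
        "D (\<sigma> l) (\<sigma> e') = r * cavity_link N i q l e' \<sigma>" if "l \<in> A" for l
    proof -
      have ne: "l \<noteq> e" "l \<noteq> e'" using that A by auto
      show "D (\<sigma> l) (\<sigma> e) = r * cavity_link N i q l e \<sigma>" "D (\<sigma> l) (\<sigma> e') = r * cavity_link N i q l e' \<sigma>"
        using ne by (simp_all add: link)
      show "D (\<sigma> e) (\<sigma> l) = r * cavity_link N i q l e \<sigma>"
        using link[OF ne(1)] by (simp add: D_def mult_ac)
    qed
    then have s2: "(\<Sum>l\<in>A. D (\<sigma> l) (\<sigma> e)) = r * (\<Sum>l\<in>A. cavity_link N i q l e \<sigma>)"
       "(\<Sum>l\<in>A. D (\<sigma> e) (\<sigma> l)) = r * (\<Sum>l\<in>A. cavity_link N i q l e \<sigma>)"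
       "(\<Sum>l\<in>A. D (\<sigma> l) (\<sigma> e')) = r * (\<Sum>l\<in>A. cavity_link N i q l e' \<sigma>)"
      by (simp_all add: sum_distrib_left)
    have s3: "D (\<sigma> e) (\<sigma> e') = r * cavity_link N i q e e' \<sigma>" using A by (intro link) auto
    show ?thesis unfolding s1 s2 s3 cavity_pairs_def by algebra
  qed
  have "((\<lambda>\<theta>. cavity_avg N i \<beta> h q B \<theta> F) has_real_derivative
    cavity_avg N i \<beta> h q B \<theta> (\<lambda>\<sigma>. F \<sigma> * ((\<Sum>l\<in>A. \<Sum>l'\<in>A. D (\<sigma> l) (\<sigma> l')) + (\<Sum>l\<in>A. D (\<sigma> l) (\<sigma> e))
        - (real (card A) + 1) * (\<Sum>l\<in>A. D (\<sigma> l) (\<sigma> e')) - real (card A) * (\<Sum>l\<in>A. D (\<sigma> e) (\<sigma> l))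
        - real (card A) * D (\<sigma> e) (\<sigma> e) + real (card A) * (real (card A) + 1) * D (\<sigma> e) (\<sigma> e')))) (at \<theta>)"
    unfolding cavity_avg_def
    by (rule has_derivative_gauss_avg[OF finite_sk_configs sk_configs_nonempty fin _ A(1,2,4,3) d1 d2 D])
       (simp add: finite_sk_pairs)
  also have "cavity_avg N i \<beta> h q B \<theta> (\<lambda>\<sigma>. F \<sigma> * ((\<Sum>l\<in>A. \<Sum>l'\<in>A. D (\<sigma> l) (\<sigma> l')) + (\<Sum>l\<in>A. D (\<sigma> l) (\<sigma> e))
        - (real (card A) + 1) * (\<Sum>l\<in>A. D (\<sigma> l) (\<sigma> e')) - real (card A) * (\<Sum>l\<in>A. D (\<sigma> e) (\<sigma> l))
        - real (card A) * D (\<sigma> e) (\<sigma> e) + real (card A) * (real (card A) + 1) * D (\<sigma> e) (\<sigma> e')))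
     = cavity_avg N i \<beta> h q B \<theta> (\<lambda>\<sigma>. r * (F \<sigma> * cavity_pairs N i q A e e' \<sigma>))"
    unfolding cavity_avg_def by (rule gauss_avg_cong) (rule pairs)
  also have "\<dots> = r * cavity_avg N i \<beta> h q B \<theta> (\<lambda>\<sigma>. F \<sigma> * cavity_pairs N i q A e e' \<sigma>)"
    unfolding cavity_avg_def by (rule gauss_avg_cmult[OF finite_sk_configs sk_configs_nonempty])
  finally show ?thesis unfolding r_def by simp
qed

lemma cavity_avg_pi_half:
  assumes "finite B"
  shows "cavity_avg N i \<beta> h q B (pi / 2) F = sk_avg N \<beta> h B F"
proof -
  have "cavity_avg N i \<beta> h q B (pi / 2) F = gauss_avg (sk_pairs N) B (sk_configs N)
     (\<lambda>\<sigma>. \<beta> * h * (\<Sum>j=1..N. \<sigma> j)) (\<lambda>k \<sigma>. cavity_rate i k (pi / 2) * cavity_coeff N i \<beta> q k \<sigma>) F"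
    unfolding cavity_avg_def
    by (rule gauss_avg_null_coord[OF finite_sk_configs sk_configs_nonempty finite_sk_pairs zero_notin_sk_pairs])
       (simp add: cavity_rate_def)
  also have "\<dots> = sk_avg N \<beta> h B F"
  proof -
    have "(\<Sum>k\<in>sk_pairs N. cavity_rate i k (pi / 2) * cavity_coeff N i \<beta> q k \<sigma> * g k)
        = (\<Sum>k\<in>sk_pairs N. (case k of (j, k) \<Rightarrow> \<beta> / sqrt (real N) * \<sigma> j * \<sigma> k) * g k)" for \<sigma> g
      by (rule sum.cong) (use zero_notin_sk_pairs[of N] in
          \<open>auto simp: cavity_rate_def cavity_coeff_def\<close>)
    then show ?thesis by (simp add: sk_avg_def gauss_avg_def case_prod_unfold)
  qed
  finally show ?thesis .
qed

subsection \<open>The decoupled site\<close>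

text \<open>A bijection acting on replica \<open>l\<close> alone reverses the sign of every summand,
  so the sum equals its own negative.\<close>

lemma replica_avg_antisymmetric:
  assumes l: "l \<in> B" "finite B"
    and f: "bij_betw f \<Omega> \<Omega>" and anti: "\<And>\<tau>. \<tau> \<in> \<Omega> \<Longrightarrow> p (f \<tau>) * w (f \<tau>) = - (p \<tau> * w \<tau>)"
    and G: "\<And>\<sigma>. \<sigma> \<in> PiE B (\<lambda>_. \<Omega>) \<Longrightarrow> G (\<sigma>(l := f (\<sigma> l))) = G \<sigma>"
  shows "replica_avg B \<Omega> p (\<lambda>\<sigma>. G \<sigma> * w (\<sigma> l)) = 0"
proof -
  let ?t = "\<lambda>\<sigma>. G \<sigma> * w (\<sigma> l) * (\<Prod>l\<in>B. p (\<sigma> l))"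
  let ?\<phi> = "\<lambda>\<sigma>. \<sigma>(l := f (\<sigma> l))"
  have f\<Omega>: "f x \<in> \<Omega>" "inv_into \<Omega> f x \<in> \<Omega>" if "x \<in> \<Omega>" for x
    using f that bij_betw_inv_into[OF f] by (auto simp: bij_betw_def)
  have finv: "inv_into \<Omega> f (f x) = x" "f (inv_into \<Omega> f x) = x" if "x \<in> \<Omega>" for x
    using f that by (simp_all add: bij_betw_inv_into_left bij_betw_inv_into_right)
  have bij: "bij_betw ?\<phi> (PiE B (\<lambda>_. \<Omega>)) (PiE B (\<lambda>_. \<Omega>))"
    by (rule bij_betwI[where g = "\<lambda>\<sigma>. \<sigma>(l := inv_into \<Omega> f (\<sigma> l))"])
       (use l f\<Omega> finv in \<open>auto simp: PiE_iff extensional_def\<close>)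
  have "?t (?\<phi> \<sigma>) = - ?t \<sigma>" if \<sigma>: "\<sigma> \<in> PiE B (\<lambda>_. \<Omega>)" for \<sigma>
  proof -
    have "\<sigma> l \<in> \<Omega>" using \<sigma> l by auto
    have pr: "(\<Prod>l\<in>B. p (\<tau> l)) = p (\<tau> l) * (\<Prod>k\<in>B - {l}. p (\<tau> k))" for \<tau>
      using l by (simp add: prod.remove)
    have "(\<Prod>k\<in>B - {l}. p (?\<phi> \<sigma> k)) = (\<Prod>k\<in>B - {l}. p (\<sigma> k))"
      by (rule prod.cong) auto
    then have "?t (?\<phi> \<sigma>) = G \<sigma> * (p (f (\<sigma> l)) * w (f (\<sigma> l))) * (\<Prod>k\<in>B - {l}. p (\<sigma> k))"
      using G[OF \<sigma>] by (simp only: pr[of "?\<phi> \<sigma>"]) (simp add: mult_ac)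
    also have "\<dots> = - ?t \<sigma>"
      using anti[OF \<open>\<sigma> l \<in> \<Omega>\<close>] by (simp only: pr[of \<sigma>]) (simp add: mult_ac)
    finally show ?thesis .
  qed
  then have "(\<Sum>\<sigma>\<in>PiE B (\<lambda>_. \<Omega>). ?t \<sigma>) = - (\<Sum>\<sigma>\<in>PiE B (\<lambda>_. \<Omega>). ?t \<sigma>)"
    using sum.reindex_bij_betw[OF bij, of ?t] by (simp add: sum_negf del: fun_upd_apply)
  then have "(\<Sum>\<sigma>\<in>PiE B (\<lambda>_. \<Omega>). ?t \<sigma>) = 0" by linarith
  then show ?thesis unfolding replica_avg_def .
qed

definition flip_site :: "nat \<Rightarrow> (nat \<Rightarrow> real) \<Rightarrow> nat \<Rightarrow> real" where
  "flip_site i \<tau> = \<tau>(i := - \<tau> i)"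

lemma flip_site_simps [simp]:
  "flip_site i \<tau> i = - \<tau> i" "j \<noteq> i \<Longrightarrow> flip_site i \<tau> j = \<tau> j" "flip_site i (flip_site i \<tau>) = \<tau>"
  by (auto simp: flip_site_def)

text \<open>Flipping one replica at a time suffices, since the spins of the decoupled site are
  averaged replica by replica.\<close>

definition site_free :: "nat \<Rightarrow> nat set \<Rightarrow> ((nat \<Rightarrow> nat \<Rightarrow> real) \<Rightarrow> real) \<Rightarrow> bool" where
  "site_free i B G \<longleftrightarrow> (\<forall>l\<in>B. \<forall>\<sigma>. G (\<sigma>(l := flip_site i (\<sigma> l))) = G \<sigma>)"

lemma bij_betw_flip:
  assumes "i \<in> {1..N}"
  shows "bij_betw (flip_site i) (sk_configs N) (sk_configs N)"
proof -
  have "flip_site i \<tau> \<in> sk_configs N" if "\<tau> \<in> sk_configs N" for \<tau> :: "nat \<Rightarrow> real"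
    using that assms unfolding sk_configs_def by (auto simp: PiE_iff extensional_def flip_site_def)
  then show ?thesis
    by (intro bij_betwI[where g = "flip_site i"]) auto
qed

text \<open>\<open>tanh c\<close> is the mean of a spin in the field \<open>c\<close>: the flip
  exchanges the weights \<open>exp c\<close> and \<open>exp (- c)\<close>, and
  \<open>(1 - tanh c) * exp c = (1 + tanh c) * exp (- c)\<close>.\<close>

lemma boltzmann_flip:
  assumes i: "i \<in> {1..N}" and \<tau>: "\<tau> \<in> sk_configs N"
    and x: "\<And>\<tau>. x \<tau> = c * \<tau> i + y \<tau>" and y: "\<And>\<tau>. y (flip_site i \<tau>) = y \<tau>"
  shows "boltzmann \<Omega> x (flip_site i \<tau>) * (- \<tau> i - tanh c)
    = - (boltzmann \<Omega> x \<tau> * (\<tau> i - tanh c))"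
proof -
  have th: "(1 - tanh c) * exp c = (1 + tanh c) * exp (- c)"
  proof -
    have "exp c + exp (- c) > 0" by (simp add: add_pos_pos)
    then show ?thesis by (simp add: tanh_altdef field_simps)
  qed
  have "\<tau> i = 1 \<or> \<tau> i = -1" using PiE_mem[OF \<tau>[unfolded sk_configs_def] i] by auto
  then have "exp (x (flip_site i \<tau>)) * (- \<tau> i - tanh c) = - (exp (x \<tau>) * (\<tau> i - tanh c))"
  proof
    assume "\<tau> i = 1"
    then have "exp (x (flip_site i \<tau>)) = exp (- c) * exp (y \<tau>)" "exp (x \<tau>) = exp c * exp (y \<tau>)"
      by (simp_all add: x y exp_add[symmetric])
    then show ?thesis using th \<open>\<tau> i = 1\<close> by algebra
  next
    assume "\<tau> i = -1"
    then have "exp (x (flip_site i \<tau>)) = exp c * exp (y \<tau>)" "exp (x \<tau>) = exp (- c) * exp (y \<tau>)"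
      by (simp_all add: x y exp_add[symmetric])
    then show ?thesis using th \<open>\<tau> i = -1\<close> by algebra
  qed
  then show ?thesis by (simp add: boltzmann_def)
qed

text \<open>Induction over \<open>V\<close>: by antisymmetry under the flip, each spin of site
  \<open>i\<close> may be replaced by \<open>tanh c\<close>, one replica at a time.\<close>

lemma replica_avg_spin_decoupled:
  fixes G :: "(nat \<Rightarrow> nat \<Rightarrow> real) \<Rightarrow> real"
  assumes i: "i \<in> {1..N}" and x: "\<And>\<tau>. x \<tau> = c * \<tau> i + y \<tau>" and y: "\<And>\<tau>. y (flip_site i \<tau>) = y \<tau>"
    and B: "finite B" "V \<subseteq> B" and G: "site_free i B G"
  shows "replica_avg B (sk_configs N) (boltzmann (sk_configs N) x) (\<lambda>\<sigma>. spin V i \<sigma> * G \<sigma>)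
    = tanh c ^ card V * replica_avg B (sk_configs N) (boltzmann (sk_configs N) x) G"
proof -
  have "finite V" using B finite_subset by blast
  then show ?thesis using B(2)
  proof (induction V rule: finite_induct)
    case empty then show ?case by (simp add: spin_def)
  next
    case (insert l V)
    let ?A = "replica_avg B (sk_configs N) (boltzmann (sk_configs N) x)"
    have "?A (\<lambda>\<sigma>. (spin V i \<sigma> * G \<sigma>) * (\<sigma> l i - tanh c)) = 0"
    proof (rule replica_avg_antisymmetric[where f = "flip_site i" and w = "\<lambda>\<tau>. \<tau> i - tanh c"])
      show "spin V i (\<sigma>(l := flip_site i (\<sigma> l))) * G (\<sigma>(l := flip_site i (\<sigma> l))) = spin V i \<sigma> * G \<sigma>" for \<sigma>
      proof -
        have "spin V i (\<sigma>(l := flip_site i (\<sigma> l))) = spin V i \<sigma>"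
          unfolding spin_def by (rule prod.cong) (use insert in auto)
        moreover have "G (\<sigma>(l := flip_site i (\<sigma> l))) = G \<sigma>"
          using G insert.prems unfolding site_free_def by blast
        ultimately show ?thesis by simp
      qed
      show "boltzmann (sk_configs N) x (flip_site i \<tau>) * (flip_site i \<tau> i - tanh c)
          = - (boltzmann (sk_configs N) x \<tau> * (\<tau> i - tanh c))" if "\<tau> \<in> sk_configs N" for \<tau>
        unfolding flip_site_simps
        by (rule boltzmann_flip[where y = y and N = N]) (use i that x y in auto)
    qed (use insert B bij_betw_flip[OF i] in auto)
    moreover have "(\<lambda>\<sigma>. (spin V i \<sigma> * G \<sigma>) * (\<sigma> l i - tanh c))
       = (\<lambda>\<sigma>. spin (insert l V) i \<sigma> * G \<sigma> - tanh c * (spin V i \<sigma> * G \<sigma>))"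
      using insert.hyps by (auto simp: spin_def algebra_simps)
    ultimately show ?case using insert by (simp add: replica_avg_diff replica_avg_cmult)
  qed
qed

text \<open>The derivative in \<open>c\<close> is a sum of averages of \<open>G\<close> against
  centred spins of site \<open>i\<close>, each of which vanishes; so \<open>c\<close> can be moved
  to 0.\<close>

lemma replica_avg_field_irrelevant:
  fixes G :: "(nat \<Rightarrow> nat \<Rightarrow> real) \<Rightarrow> real"
  assumes i: "i \<in> {1..N}" and y: "\<And>\<tau>. y (flip_site i \<tau>) = y \<tau>"
    and B: "finite B" and G: "site_free i B G"
  shows "replica_avg B (sk_configs N) (boltzmann (sk_configs N) (\<lambda>\<tau>. c * \<tau> i + y \<tau>)) G
    = replica_avg B (sk_configs N) (boltzmann (sk_configs N) y) G"
proof -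
  let ?p = "\<lambda>c. boltzmann (sk_configs N) (\<lambda>\<tau>. c * \<tau> i + y \<tau>)"
  let ?A = "\<lambda>c. replica_avg B (sk_configs N) (?p c)"
  have mean: "(\<Sum>\<tau>\<in>sk_configs N. ?p c \<tau> * \<tau> i) = tanh c" for c
  proof -
    let ?t = "\<lambda>\<tau>. ?p c \<tau> * (\<tau> i - tanh c)"
    have "(\<Sum>\<tau>\<in>sk_configs N. ?t \<tau>) = (\<Sum>\<tau>\<in>sk_configs N. ?t (flip_site i \<tau>))"
      by (rule sum.reindex_bij_betw[OF bij_betw_flip[OF i], of ?t, symmetric])
    also have "\<dots> = - (\<Sum>\<tau>\<in>sk_configs N. ?t \<tau>)"
      unfolding sum_negf[symmetric]
    proof (rule sum.cong[OF refl])
      fix \<tau> assume "\<tau> \<in> sk_configs N"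
      then show "?t (flip_site i \<tau>) = - ?t \<tau>" unfolding flip_site_simps
        by (intro boltzmann_flip[where y = y and N = N]) (use i y in auto)
    qed
    finally have "(\<Sum>\<tau>\<in>sk_configs N. ?t \<tau>) = 0" by linarith
    then show ?thesis
      by (simp add: right_diff_distrib sum_subtractf sum_distrib_right[symmetric]
            sum_boltzmann[OF finite_sk_configs sk_configs_nonempty])
  qed
  have "((\<lambda>c. ?A c G) has_real_derivative 0) (at c)" for c
  proof -
    have "((\<lambda>c. ?A c G) has_real_derivative
       ?A c (\<lambda>\<sigma>. G \<sigma> * (\<Sum>l\<in>B. \<sigma> l i - (\<Sum>\<tau>\<in>sk_configs N. ?p c \<tau> * \<tau> i)))) (at c)"
    proof (rule has_derivative_replica_avg_boltzmann_centered[where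
          x = "\<lambda>c \<tau>. c * \<tau> i + y \<tau>" and v = "\<lambda>\<tau>. \<tau> i"])
      show "((\<lambda>c. c * \<tau> i + y \<tau>) has_real_derivative \<tau> i) (at c)" for \<tau>
        by (rule derivative_eq_intros refl | simp)+
    qed (use finite_sk_configs sk_configs_nonempty B in auto)
    also have "(\<lambda>\<sigma>. G \<sigma> * (\<Sum>l\<in>B. \<sigma> l i - (\<Sum>\<tau>\<in>sk_configs N. ?p c \<tau> * \<tau> i)))
        = (\<lambda>\<sigma>. \<Sum>l\<in>B. spin {l} i \<sigma> * G \<sigma> - tanh c * G \<sigma>)"
      unfolding mean by (simp add: spin_def sum_distrib_left right_diff_distrib mult.commute)
    also have "?A c \<dots> = (\<Sum>l\<in>B. ?A c (\<lambda>\<sigma>. spin {l} i \<sigma> * G \<sigma>) - tanh c * ?A c G)"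
      by (simp only: replica_avg_sum replica_avg_diff replica_avg_cmult)
    also have "\<dots> = 0"
    proof (intro sum.neutral ballI)
      fix l assume "l \<in> B"
      then have "?A c (\<lambda>\<sigma>. spin {l} i \<sigma> * G \<sigma>) = tanh c ^ card {l} * ?A c G"
        by (intro replica_avg_spin_decoupled[where y = y]) (use i y B G in auto)
      then show "?A c (\<lambda>\<sigma>. spin {l} i \<sigma> * G \<sigma>) - tanh c * ?A c G = 0" by simp
    qed
    finally show ?thesis .
  qed
  then have "?A c G = ?A 0 G" for c by (intro DERIV_isconst_all[of "\<lambda>c. ?A c G"]) auto
  then have "?A c G = ?A 0 G" .
  also have "?A 0 G = replica_avg B (sk_configs N) (boltzmann (sk_configs N) y) G" by simp
  finally show ?thesis .
qed

definition tanh_moment :: "real \<Rightarrow> real \<Rightarrow> real \<Rightarrow> nat \<Rightarrow> real" where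
  "tanh_moment \<beta> h q p =
     (LINT y|density lborel std_normal_density. tanh (\<beta> * sqrt q * y + \<beta> * h) ^ p)"

lemma sk_q_eq_tanh_moment: "sk_q \<beta> h p = tanh_moment \<beta> h (sk_q2 \<beta> h) p"
  by (simp add: sk_q_def tanh_moment_def)

lemma abs_tanh_real_le_1: "\<bar>tanh x\<bar> \<le> (1 :: real)"
  using tanh_real_bounds[of x] by auto

lemma measurable_tanh_affine [measurable]:
  "(\<lambda>y :: real. tanh (a * y + b)) \<in> borel_measurable borel"
  by (intro borel_measurable_continuous_onI continuous_intros) (auto simp: cosh_real_nonzero)

lemma integrable_tanh_power:
  "integrable (density lborel std_normal_density) (\<lambda>y. tanh (a * y + b) ^ p)"
  by (rule integrable_std_normal_bounded[where C = 1])
     (auto simp: power_abs intro!: power_le_one abs_tanh_real_le_1)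

text \<open>At angle 0 site \<open>i\<close> feels only the field
  \<open>\<beta> * sqrt q * z + \<beta> * h\<close>. Its spins give a power of the
  \<open>tanh\<close> of this field, integration over \<open>z\<close> gives the moment, and the
  remaining factor does not depend on \<open>z\<close>.\<close>

lemma cavity_avg_zero_factor:
  fixes G :: "(nat \<Rightarrow> nat \<Rightarrow> real) \<Rightarrow> real"
  assumes i: "i \<in> {1..N}" and B: "finite B" "V \<subseteq> B" and G: "site_free i B G"
  shows "cavity_avg N i \<beta> h q B 0 (\<lambda>\<sigma>. spin V i \<sigma> * G \<sigma>)
    = tanh_moment \<beta> h q (card V) * cavity_avg N i \<beta> h q B 0 G"
proof -
  let ?K = "sk_pairs N" and ?\<Omega> = "sk_configs N" and ?z = "(0, 0) :: nat \<times> nat"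
  define y where "y g \<tau> = \<beta> * h * (\<Sum>j\<in>{1..N} - {i}. \<tau> j)
     + (\<Sum>k\<in>?K. cavity_rate i k 0 * cavity_coeff N i \<beta> q k \<tau> * g k)" for g \<tau>
  define R where "R g = replica_avg B ?\<Omega> (boltzmann ?\<Omega> (y g)) G" for g
  let ?c = "\<lambda>z. \<beta> * sqrt q * z + \<beta> * h"
  let ?e = "gauss_energy (insert ?z ?K) (\<lambda>\<sigma>. \<beta> * h * (\<Sum>j=1..N. \<sigma> j))
     (\<lambda>k \<sigma>. cavity_rate i k 0 * cavity_coeff N i \<beta> q k \<sigma>)"
  have yflip: "y g (flip_site i \<tau>) = y g \<tau>" for g \<tau>
  proof -
    have "(\<Sum>j\<in>{1..N} - {i}. (flip_site i \<tau>) j) = (\<Sum>j\<in>{1..N} - {i}. \<tau> j)"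
      by (rule sum.cong) auto
    moreover have "cavity_rate i k 0 * cavity_coeff N i \<beta> q k (flip_site i \<tau>) * g k
      = cavity_rate i k 0 * cavity_coeff N i \<beta> q k \<tau> * g k" if "k \<in> ?K" for k
      using that zero_notin_sk_pairs[of N] by (auto simp: cavity_rate_def cavity_coeff_def)
    then have "(\<Sum>k\<in>?K. cavity_rate i k 0 * cavity_coeff N i \<beta> q k (flip_site i \<tau>) * g k)
      = (\<Sum>k\<in>?K. cavity_rate i k 0 * cavity_coeff N i \<beta> q k \<tau> * g k)"
      by (intro sum.cong refl)
    ultimately show ?thesis unfolding y_def by simp
  qed
  have e: "?e (g(?z := z)) \<tau> = ?c z * \<tau> i + y g \<tau>" for g z \<tau>
  proof -
    have "(\<Sum>k\<in>?K. cavity_rate i k 0 * cavity_coeff N i \<beta> q k \<tau> * (g(?z := z)) k)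
        = (\<Sum>k\<in>?K. cavity_rate i k 0 * cavity_coeff N i \<beta> q k \<tau> * g k)"
      by (rule sum.cong) (use zero_notin_sk_pairs[of N] in auto)
    moreover have "(\<Sum>j=1..N. \<tau> j) = \<tau> i + (\<Sum>j\<in>{1..N} - {i}. \<tau> j)"
      using i by (intro sum.remove) auto
    ultimately show ?thesis unfolding y_def
      using zero_notin_sk_pairs[of N] finite_sk_pairs[of N]
      by (simp add: cavity_rate_def cavity_coeff_def algebra_simps)
  qed
  have bolt: "boltzmann ?\<Omega> (?e (g(?z := z))) = boltzmann ?\<Omega> (\<lambda>\<tau>. ?c z * \<tau> i + y g \<tau>)" for g z
    using e by (simp del: fun_upd_apply)
  have key: "cavity_avg N i \<beta> h q B 0 (\<lambda>\<sigma>. spin W i \<sigma> * G \<sigma>)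
     = tanh_moment \<beta> h q (card W) * (LINT g|gauss_product ?K. R g)" if W: "W \<subseteq> B" for W
  proof -
    have step: "replica_avg B ?\<Omega> (boltzmann ?\<Omega> (\<lambda>\<tau>. ?c z * \<tau> i + y g \<tau>)) (\<lambda>\<sigma>. spin W i \<sigma> * G \<sigma>)
      = tanh (?c z) ^ card W * R g" for g z
    proof -
      have "replica_avg B ?\<Omega> (boltzmann ?\<Omega> (\<lambda>\<tau>. ?c z * \<tau> i + y g \<tau>)) (\<lambda>\<sigma>. spin W i \<sigma> * G \<sigma>)
        = tanh (?c z) ^ card W * replica_avg B ?\<Omega> (boltzmann ?\<Omega> (\<lambda>\<tau>. ?c z * \<tau> i + y g \<tau>)) G"
        by (rule replica_avg_spin_decoupled[where y = "y g"]) (use i yflip B W G in auto)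
      also have "replica_avg B ?\<Omega> (boltzmann ?\<Omega> (\<lambda>\<tau>. ?c z * \<tau> i + y g \<tau>)) G = R g"
        unfolding R_def by (rule replica_avg_field_irrelevant) (use i yflip B G in auto)
      finally show ?thesis .
    qed
    have "cavity_avg N i \<beta> h q B 0 (\<lambda>\<sigma>. spin W i \<sigma> * G \<sigma>)
      = (LINT g|gauss_product ?K. LINT z|density lborel std_normal_density.
         replica_avg B ?\<Omega> (boltzmann ?\<Omega> (?e (g(?z := z)))) (\<lambda>\<sigma>. spin W i \<sigma> * G \<sigma>))"
      unfolding cavity_avg_def gauss_avg_def
      by (rule gauss_product_integral_insert[OF finite_sk_pairs zero_notin_sk_pairs])
         (rule integrable_gauss_product_bounded[OF
            measurable_replica_avg_boltzmann[OF finite_sk_configs sk_configs_nonempty]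
            replica_avg_boltzmann_bound[OF finite_sk_configs]])
    also have "\<dots> = (LINT g|gauss_product ?K. LINT z|density lborel std_normal_density.
         tanh (?c z) ^ card W * R g)"
      unfolding bolt
      by (simp only: step)
    also have "\<dots> = (LINT g|gauss_product ?K. tanh_moment \<beta> h q (card W) * R g)"
      unfolding tanh_moment_def by simp
    finally show ?thesis by simp
  qed
  \<comment> \<open>The empty set identifies the common factor as the average of \<open>G\<close>,
    the zeroth moment being 1.\<close>
  from key[OF B(2)] key[of "{}"] show ?thesis
    using prob_space.prob_space[OF prob_space_std_normal]
    by (simp add: spin_def tanh_moment_def)
qed

subsection \<open>Cavity estimates\<close>

lemma gauss_avg_abs:
  assumes "finite \<Omega>" "\<Omega> \<noteq> {}"
  shows "\<bar>gauss_avg K B \<Omega> a c F\<bar> \<le> gauss_avg K B \<Omega> a c (\<lambda>\<sigma>. \<bar>F \<sigma>\<bar>)"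
  unfolding gauss_avg_eq_sum[OF assms]
  by (rule order_trans[OF sum_abs]) (simp add: abs_mult gauss_weight_nonneg)

lemma cavity_avg_add: "cavity_avg N i \<beta> h q B \<theta> (\<lambda>\<sigma>. F \<sigma> + G \<sigma>) = cavity_avg N i \<beta> h q B \<theta> F + cavity_avg N i \<beta> h q B \<theta> G"
  unfolding cavity_avg_def by (rule gauss_avg_add[OF finite_sk_configs sk_configs_nonempty])

lemma cavity_avg_diff: "cavity_avg N i \<beta> h q B \<theta> (\<lambda>\<sigma>. F \<sigma> - G \<sigma>) = cavity_avg N i \<beta> h q B \<theta> F - cavity_avg N i \<beta> h q B \<theta> G"
  unfolding cavity_avg_def by (rule gauss_avg_diff[OF finite_sk_configs sk_configs_nonempty])

lemma cavity_avg_cmult: "cavity_avg N i \<beta> h q B \<theta> (\<lambda>\<sigma>. r * F \<sigma>) = r * cavity_avg N i \<beta> h q B \<theta> F"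
  unfolding cavity_avg_def by (rule gauss_avg_cmult[OF finite_sk_configs sk_configs_nonempty])

lemma cavity_avg_sum: "cavity_avg N i \<beta> h q B \<theta> (\<lambda>\<sigma>. \<Sum>x\<in>X. F x \<sigma>) = (\<Sum>x\<in>X. cavity_avg N i \<beta> h q B \<theta> (F x))"
  unfolding cavity_avg_def by (rule gauss_avg_sum[OF finite_sk_configs sk_configs_nonempty])

lemma cavity_avg_mono:
  assumes "\<And>\<sigma>. \<sigma> \<in> PiE B (\<lambda>_. sk_configs N) \<Longrightarrow> F \<sigma> \<le> G \<sigma>"
  shows "cavity_avg N i \<beta> h q B \<theta> F \<le> cavity_avg N i \<beta> h q B \<theta> G"
  unfolding cavity_avg_def by (rule gauss_avg_mono[OF finite_sk_configs sk_configs_nonempty assms])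

lemma cavity_avg_cong:
  assumes "\<And>\<sigma>. \<sigma> \<in> PiE B (\<lambda>_. sk_configs N) \<Longrightarrow> F \<sigma> = G \<sigma>"
  shows "cavity_avg N i \<beta> h q B \<theta> F = cavity_avg N i \<beta> h q B \<theta> G"
  unfolding cavity_avg_def by (rule gauss_avg_cong[OF assms])

lemma cavity_avg_abs: "\<bar>cavity_avg N i \<beta> h q B \<theta> F\<bar> \<le> cavity_avg N i \<beta> h q B \<theta> (\<lambda>\<sigma>. \<bar>F \<sigma>\<bar>)"
  unfolding cavity_avg_def by (rule gauss_avg_abs[OF finite_sk_configs sk_configs_nonempty])

lemma cavity_avg_const:
  assumes "finite B"
  shows "cavity_avg N i \<beta> h q B \<theta> (\<lambda>_. r) = r"
  unfolding cavity_avg_def by (rule gauss_avg_const[OF finite_sk_configs sk_configs_nonempty assms])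

lemma cavity_avg_abs_mono:
  assumes "\<And>\<sigma>. \<sigma> \<in> PiE B (\<lambda>_. sk_configs N) \<Longrightarrow> \<bar>F \<sigma>\<bar> \<le> G \<sigma>"
  shows "\<bar>cavity_avg N i \<beta> h q B \<theta> F\<bar> \<le> cavity_avg N i \<beta> h q B \<theta> G"
  by (rule order_trans[OF cavity_avg_abs cavity_avg_mono[OF assms]])

lemma sk_avg_add: "sk_avg N \<beta> h B (\<lambda>\<sigma>. F \<sigma> + G \<sigma>) = sk_avg N \<beta> h B F + sk_avg N \<beta> h B G"
  unfolding sk_avg_def by (rule gauss_avg_add[OF finite_sk_configs sk_configs_nonempty])

lemma sk_avg_diff: "sk_avg N \<beta> h B (\<lambda>\<sigma>. F \<sigma> - G \<sigma>) = sk_avg N \<beta> h B F - sk_avg N \<beta> h B G"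
  unfolding sk_avg_def by (rule gauss_avg_diff[OF finite_sk_configs sk_configs_nonempty])

lemma sk_avg_cmult: "sk_avg N \<beta> h B (\<lambda>\<sigma>. r * F \<sigma>) = r * sk_avg N \<beta> h B F"
  unfolding sk_avg_def by (rule gauss_avg_cmult[OF finite_sk_configs sk_configs_nonempty])

lemma sk_avg_sum: "sk_avg N \<beta> h B (\<lambda>\<sigma>. \<Sum>x\<in>X. F x \<sigma>) = (\<Sum>x\<in>X. sk_avg N \<beta> h B (F x))"
  unfolding sk_avg_def by (rule gauss_avg_sum[OF finite_sk_configs sk_configs_nonempty])

lemma sk_avg_mono:
  assumes "\<And>\<sigma>. \<sigma> \<in> PiE B (\<lambda>_. sk_configs N) \<Longrightarrow> F \<sigma> \<le> G \<sigma>"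
  shows "sk_avg N \<beta> h B F \<le> sk_avg N \<beta> h B G"
  unfolding sk_avg_def by (rule gauss_avg_mono[OF finite_sk_configs sk_configs_nonempty assms])

lemma sk_avg_cong:
  assumes "\<And>\<sigma>. \<sigma> \<in> PiE B (\<lambda>_. sk_configs N) \<Longrightarrow> F \<sigma> = G \<sigma>"
  shows "sk_avg N \<beta> h B F = sk_avg N \<beta> h B G"
  unfolding sk_avg_def by (rule gauss_avg_cong[OF assms])

lemma sk_avg_abs: "\<bar>sk_avg N \<beta> h B F\<bar> \<le> sk_avg N \<beta> h B (\<lambda>\<sigma>. \<bar>F \<sigma>\<bar>)"
  unfolding sk_avg_def by (rule gauss_avg_abs[OF finite_sk_configs sk_configs_nonempty])

lemma sk_avg_const:
  assumes "finite B"
  shows "sk_avg N \<beta> h B (\<lambda>_. r) = r"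
  unfolding sk_avg_def by (rule gauss_avg_const[OF finite_sk_configs sk_configs_nonempty assms])

lemma sk_avg_abs_mono:
  assumes "\<And>\<sigma>. \<sigma> \<in> PiE B (\<lambda>_. sk_configs N) \<Longrightarrow> \<bar>F \<sigma>\<bar> \<le> G \<sigma>"
  shows "\<bar>sk_avg N \<beta> h B F\<bar> \<le> sk_avg N \<beta> h B G"
  by (rule order_trans[OF sk_avg_abs sk_avg_mono[OF assms]])

lemma sk_avg_marginal:
  assumes "finite B" "A \<subseteq> B" "depends_on A F"
  shows "sk_avg N \<beta> h B F = sk_avg N \<beta> h A F"
  unfolding sk_avg_def by (rule gauss_avg_marginal[OF finite_sk_configs sk_configs_nonempty assms])

lemma sk_avg_permute:
  assumes "bij_betw \<pi> B B"
  shows "sk_avg N \<beta> h B (\<lambda>\<sigma>. F (\<lambda>l\<in>B. \<sigma> (\<pi> l))) = sk_avg N \<beta> h B F"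
  unfolding sk_avg_def by (rule gauss_avg_permute[OF assms])

lemma depends_on_spin: "S \<subseteq> A \<Longrightarrow> depends_on A (spin S i)"
  unfolding depends_on_def spin_def by (intro allI impI prod.cong refl) (auto dest: subsetD)

lemma depends_on_cavity_overlap: "S \<subseteq> A \<Longrightarrow> depends_on A (cavity_overlap N i S)"
  unfolding cavity_overlap_def
  by (intro depends_on_compose[where h = "\<lambda>x. 1 / real N * x"] depends_on_sum depends_on_spin)

lemma depends_on_sk_overlap: "S \<subseteq> A \<Longrightarrow> depends_on A (sk_overlap N S)"
  unfolding sk_overlap_eq[abs_def]
  by (intro depends_on_compose[where h = "\<lambda>x. 1 / real N * x"] depends_on_sum depends_on_spin)

lemma abs_spin:
  assumes "\<sigma> \<in> PiE B (\<lambda>_. sk_configs N)" "S \<subseteq> B" "j \<in> {1..N}"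
  shows "\<bar>spin S j \<sigma>\<bar> = 1"
proof -
  have "\<bar>\<sigma> l j\<bar> = 1" if "l \<in> S" for l
  proof -
    have "\<sigma> l \<in> sk_configs N" using assms that by auto
    then have "\<sigma> l j \<in> {-1, 1}" unfolding sk_configs_def using assms(3) PiE_mem by fastforce
    then show ?thesis by auto
  qed
  then show ?thesis unfolding spin_def abs_prod by simp
qed

lemma abs_sum_spin_le:
  assumes "\<sigma> \<in> PiE B (\<lambda>_. sk_configs N)" "S \<subseteq> B" "J \<subseteq> {1..N}"
  shows "\<bar>1 / real N * (\<Sum>j\<in>J. spin S j \<sigma>)\<bar> \<le> 1"
proof -
  have "\<bar>\<Sum>j\<in>J. spin S j \<sigma>\<bar> \<le> (\<Sum>j\<in>J. 1)"
    by (rule order_trans[OF sum_abs sum_mono]) (use abs_spin[OF assms(1,2)] assms(3) in force)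
  also have "\<dots> \<le> real N" using card_mono[OF _ assms(3)] by simp
  finally show ?thesis by (cases "N = 0") (simp_all add: abs_mult field_simps)
qed

lemma abs_cavity_overlap_le:
  assumes "\<sigma> \<in> PiE B (\<lambda>_. sk_configs N)" "S \<subseteq> B"
  shows "\<bar>cavity_overlap N i S \<sigma>\<bar> \<le> 1"
  unfolding cavity_overlap_def by (rule abs_sum_spin_le[OF assms]) auto

text \<open>One majorant for all links among \<open>m\<close> replicas. Its second moment is
  controlled by the two-replica hypothesis, and its absolute values allow it to multiply any
  observable in an estimate.\<close>

definition cavity_dev :: "nat \<Rightarrow> nat \<Rightarrow> real \<Rightarrow> nat \<Rightarrow> (nat \<Rightarrow> nat \<Rightarrow> real) \<Rightarrow> real" where
  "cavity_dev N i q m \<sigma> = (\<Sum>l\<in>{1..m}. \<Sum>l'\<in>{1..m} - {l}. \<bar>cavity_overlap N i {l, l'} \<sigma> - q\<bar>)"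

text \<open>Majorises \<open>4 * (real m)\<^sup>2 + 3 * real m\<close>, a bound for the sum of the
  absolute coefficients of \<open>pairs_form\<close>.\<close>

definition pairs_const :: "nat \<Rightarrow> real" where
  "pairs_const m = 4 * (real m + 1)\<^sup>2"

text \<open>The 2 exceeds \<open>pi / 2\<close>, the length of the angle interval;
  \<open>(real m + 2)\<^sup>2 * (1 + q)\<close> is the deterministic bound on
  \<open>cavity_dev\<close> for \<open>m + 2\<close> replicas.\<close>

definition gronwall_const :: "real \<Rightarrow> real \<Rightarrow> nat \<Rightarrow> real" where
  "gronwall_const \<beta> q m = exp (2 * (\<beta>\<^sup>2 * pairs_const m * ((real m + 2)\<^sup>2 * (1 + q))))"

lemma depends_on_cavity_dev: "depends_on {1..m} (cavity_dev N i q m)"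
  unfolding cavity_dev_def
  by (intro depends_on_sum depends_on_compose[where h = "\<lambda>x. \<bar>x - q\<bar>"] depends_on_cavity_overlap) auto

lemma cavity_dev_nonneg: "0 \<le> cavity_dev N i q m \<sigma>"
  unfolding cavity_dev_def by (intro sum_nonneg) simp

lemma cavity_dev_ge:
  assumes "l \<in> {1..m}" "l' \<in> {1..m}" "l \<noteq> l'"
  shows "\<bar>cavity_overlap N i {l, l'} \<sigma> - q\<bar> \<le> cavity_dev N i q m \<sigma>"
proof -
  have "\<bar>cavity_overlap N i {l, l'} \<sigma> - q\<bar> \<le> (\<Sum>l'\<in>{1..m} - {l}. \<bar>cavity_overlap N i {l, l'} \<sigma> - q\<bar>)"
    by (rule member_le_sum) (use assms in auto)
  also have "\<dots> \<le> cavity_dev N i q m \<sigma>" unfolding cavity_dev_def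
    by (rule member_le_sum[of l _ "\<lambda>l. \<Sum>l'\<in>{1..m} - {l}. \<bar>cavity_overlap N i {l, l'} \<sigma> - q\<bar>"])
       (use assms in \<open>auto intro!: sum_nonneg\<close>)
  finally show ?thesis .
qed

lemma cavity_dev_le:
  assumes "\<sigma> \<in> PiE {1..M} (\<lambda>_. sk_configs N)" "m \<le> M" "0 \<le> q"
  shows "cavity_dev N i q m \<sigma> \<le> (real m)\<^sup>2 * (1 + q)"
proof -
  have "\<bar>cavity_overlap N i {l, l'} \<sigma> - q\<bar> \<le> 1 + q" if "l \<in> {1..m}" "l' \<in> {1..m}" for l l'
    using abs_cavity_overlap_le[OF assms(1), of "{l, l'}" i] that assms by auto
  then have "cavity_dev N i q m \<sigma> \<le> (\<Sum>l\<in>{1..m}. \<Sum>l'\<in>{1..m} - {l}. 1 + q)"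
    unfolding cavity_dev_def by (intro sum_mono) auto
  also have "\<dots> \<le> (\<Sum>l\<in>{1..m}. real m * (1 + q))"
  proof (rule sum_mono)
    fix l assume "l \<in> {1..m}"
    have "card ({1..m} - {l}) \<le> m" using card_mono[of "{1..m}" "{1..m} - {l}"] by simp
    then show "(\<Sum>l'\<in>{1..m} - {l}. 1 + q) \<le> real m * (1 + q)"
      using assms(3) by (simp only: sum_constant) (intro mult_right_mono, auto)
  qed
  finally show ?thesis by (simp add: power2_eq_square)
qed

text \<open>Separates the linear form inside \<open>cavity_pairs\<close> from the links, so that it
  can later be applied to averages indexed by pairs of replicas.\<close>

definition pairs_form :: "nat \<Rightarrow> (nat \<Rightarrow> nat \<Rightarrow> real) \<Rightarrow> real" where
  "pairs_form m Y = (\<Sum>l\<in>{1..m}. \<Sum>l'\<in>{1..m} - {l}. Y l l')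
     + (1 - real m) * (\<Sum>l\<in>{1..m}. Y l (m + 1)) - (real m + 1) * (\<Sum>l\<in>{1..m}. Y l (m + 2))
     + real m * (real m + 1) * Y (m + 1) (m + 2)"

lemma cavity_pairs_eq_pairs_form:
  "cavity_pairs N i q {1..m} (m + 1) (m + 2) \<sigma> = pairs_form m (\<lambda>l l'. cavity_link N i q l l' \<sigma>)"
  by (simp add: cavity_pairs_def pairs_form_def)

lemma abs_pairs_form_le:
  assumes link: "\<And>l l'. l \<in> {1..m + 2} \<Longrightarrow> l' \<in> {1..m + 2} \<Longrightarrow> l \<noteq> l' \<Longrightarrow> \<bar>Y l l'\<bar> \<le> d" and d: "0 \<le> d"
  shows "\<bar>pairs_form m Y\<bar> \<le> pairs_const m * d"
proof -
  have sum1: "\<bar>\<Sum>l\<in>{1..m}. Y l x\<bar> \<le> real m * d" if "x \<in> {m + 1, m + 2}" for x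
  proof -
    have "\<bar>\<Sum>l\<in>{1..m}. Y l x\<bar> \<le> (\<Sum>l\<in>{1..m}. d)"
      by (rule order_trans[OF sum_abs sum_mono], rule link) (use that in auto)
    then show ?thesis by simp
  qed
  have a: "\<bar>\<Sum>l\<in>{1..m}. \<Sum>l'\<in>{1..m} - {l}. Y l l'\<bar> \<le> (real m)\<^sup>2 * d"
  proof -
    have "\<bar>\<Sum>l\<in>{1..m}. \<Sum>l'\<in>{1..m} - {l}. Y l l'\<bar> \<le> (\<Sum>l\<in>{1..m}. real m * d)"
    proof (rule order_trans[OF sum_abs sum_mono])
      fix l assume l: "l \<in> {1..m}"
      have "\<bar>\<Sum>l'\<in>{1..m} - {l}. Y l l'\<bar> \<le> (\<Sum>l'\<in>{1..m} - {l}. d)"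
        by (rule order_trans[OF sum_abs sum_mono], rule link) (use l in auto)
      also have "\<dots> \<le> (\<Sum>l'\<in>{1..m}. d)" by (rule sum_mono2) (use d in auto)
      finally show "\<bar>\<Sum>l'\<in>{1..m} - {l}. Y l l'\<bar> \<le> real m * d" by simp
    qed
    then show ?thesis by (simp add: power2_eq_square)
  qed
  have b: "\<bar>(1 - real m) * (\<Sum>l\<in>{1..m}. Y l (m + 1))\<bar> \<le> (real m + 1) * (real m * d)"
    unfolding abs_mult by (intro mult_mono sum1) auto
  have c: "\<bar>(real m + 1) * (\<Sum>l\<in>{1..m}. Y l (m + 2))\<bar> \<le> (real m + 1) * (real m * d)"
    unfolding abs_mult by (intro mult_mono sum1) auto
  have e: "\<bar>real m * (real m + 1) * Y (m + 1) (m + 2)\<bar> \<le> real m * (real m + 1) * d"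
    unfolding abs_mult by (intro mult_mono link) auto
  have "\<bar>pairs_form m Y\<bar>
      \<le> (real m)\<^sup>2 * d + (real m + 1) * (real m * d) + (real m + 1) * (real m * d) + real m * (real m + 1) * d"
    using a b c e unfolding pairs_form_def by linarith
  also have "\<dots> = (4 * (real m)\<^sup>2 + 3 * real m) * d" by (simp add: algebra_simps power2_eq_square)
  also have "\<dots> \<le> pairs_const m * d"
    using d by (intro mult_right_mono) (auto simp: pairs_const_def power2_eq_square algebra_simps)
  finally show ?thesis .
qed

lemma abs_cavity_pairs_le:
  assumes "\<sigma> \<in> PiE {1..M} (\<lambda>_. sk_configs N)" "m + 2 \<le> M" "i \<in> {1..N}"
  shows "\<bar>cavity_pairs N i q {1..m} (m + 1) (m + 2) \<sigma>\<bar> \<le> pairs_const m * cavity_dev N i q (m + 2) \<sigma>"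
  unfolding cavity_pairs_eq_pairs_form
proof (rule abs_pairs_form_le[OF _ cavity_dev_nonneg])
  fix l l' assume l: "l \<in> {1..m + 2}" "l' \<in> {1..m + 2}" "l \<noteq> l'"
  then show "\<bar>cavity_link N i q l l' \<sigma>\<bar> \<le> cavity_dev N i q (m + 2) \<sigma>"
    using abs_spin[OF assms(1), of "{l, l'}" i] cavity_dev_ge[OF l, of N i \<sigma> q] assms
    by (auto simp: cavity_link_def abs_mult)
qed

lemma pairs_const_nonneg: "0 \<le> pairs_const m"
  by (simp add: pairs_const_def)

lemma gronwall_const_nonneg: "0 \<le> gronwall_const \<beta> q m"
  by (simp add: gronwall_const_def)

lemma depends_on_cavity_pairs:
  "depends_on {1..m + 2} (cavity_pairs N i q {1..m} (m + 1) (m + 2))"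
proof -
  have link: "depends_on {1..m + 2} (cavity_link N i q l l')" if "l \<in> {1..m + 2}" "l' \<in> {1..m + 2}" for l l'
    unfolding cavity_link_def using that
    by (intro depends_on_compose2[where h = "\<lambda>x y. x * (y - q)"] depends_on_spin depends_on_cavity_overlap) auto
  have d: "depends_on {1..m + 2} (\<lambda>\<sigma>. \<Sum>l\<in>{1..m}. \<Sum>l'\<in>{1..m} - {l}. cavity_link N i q l l' \<sigma>)"
    by (rule depends_on_sum, rule depends_on_sum, rule link) auto
  have e: "depends_on {1..m + 2} (\<lambda>\<sigma>. \<Sum>l\<in>{1..m}. cavity_link N i q l x \<sigma>)" if "x \<in> {m + 1, m + 2}" for x
    by (rule depends_on_sum, rule link) (use that in auto)
  have f: "depends_on {1..m + 2} (cavity_link N i q (m + 1) (m + 2))"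
    by (rule link) auto
  show ?thesis unfolding depends_on_def
  proof (intro allI impI)
    fix \<sigma> \<sigma>' :: "nat \<Rightarrow> nat \<Rightarrow> real" assume "\<forall>l\<in>{1..m + 2}. \<sigma> l = \<sigma>' l"
    then have eq: "\<And>l. l \<in> {1..m + 2} \<Longrightarrow> \<sigma> l = \<sigma>' l" by blast
    show "cavity_pairs N i q {1..m} (m + 1) (m + 2) \<sigma> = cavity_pairs N i q {1..m} (m + 1) (m + 2) \<sigma>'"
      unfolding cavity_pairs_def
      by (simp only: depends_onD[OF d eq] depends_onD[OF e[of "m + 1"] eq]
            depends_onD[OF e[of "m + 2"] eq] depends_onD[OF f eq] insert_iff simp_thms)
  qed
qed

section \<open>Expansion of averages in the cavity angle\<close>

locale cavity =
  fixes N i M :: nat and \<beta> h q :: real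
  assumes site: "i \<in> {1..N}" and q_nonneg: "0 \<le> q"
begin

abbreviation E where "E \<theta> F \<equiv> cavity_avg N i \<beta> h q {1..M} \<theta> F"
abbreviation \<nu> where "\<nu> F \<equiv> sk_avg N \<beta> h {1..M} F"
abbreviation dev where "dev m \<equiv> cavity_dev N i q m"
abbreviation pairs where "pairs m \<equiv> cavity_pairs N i q {1..m} (m + 1) (m + 2)"

lemma E_pi_half: "E (pi / 2) F = \<nu> F"
  by (rule cavity_avg_pi_half) simp

lemma E_deriv:
  assumes "depends_on {1..m} F" "m + 2 \<le> M"
  shows "((\<lambda>\<theta>. E \<theta> F) has_real_derivative
     sin \<theta> * cos \<theta> * \<beta>\<^sup>2 * E \<theta> (\<lambda>\<sigma>. F \<sigma> * pairs m \<sigma>)) (at \<theta>)"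
  using assms by (intro has_derivative_cavity_avg[OF site q_nonneg]) auto

lemma abs_sin_cos_le_1: "\<bar>sin \<theta> * cos \<theta> :: real\<bar> \<le> 1"
  unfolding abs_mult by (intro mult_le_one) auto

text \<open>Gronwall: the deviations are bounded, so the derivative is at most a constant times the
  average. Remainders at intermediate angles can thus be estimated at angle \<open>pi / 2\<close>,
  where moment bounds are known.\<close>

lemma E_le:
  assumes F: "depends_on {1..m} F" "m + 2 \<le> M" and nonneg: "\<And>\<sigma>. 0 \<le> F \<sigma>"
    and \<theta>: "0 \<le> \<theta>" "\<theta> \<le> pi / 2"
  shows "E \<theta> F \<le> gronwall_const \<beta> q m * \<nu> F"
proof -
  define c where "c = pairs_const m * ((real m + 2)\<^sup>2 * (1 + q))"
  define k where "k = \<beta>\<^sup>2 * c"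
  have c0: "0 \<le> c" using q_nonneg by (simp add: c_def pairs_const_nonneg)
  have k0: "0 \<le> k" using c0 by (simp add: k_def)
  have E0: "0 \<le> E t F" for t
    using cavity_avg_mono[of "{1..M}" N "\<lambda>_. 0" F i \<beta> h q t] nonneg by (simp add: cavity_avg_const)
  have bd: "\<bar>E t (\<lambda>\<sigma>. F \<sigma> * pairs m \<sigma>)\<bar> \<le> c * E t F" for t
  proof -
    have "\<bar>E t (\<lambda>\<sigma>. F \<sigma> * pairs m \<sigma>)\<bar> \<le> E t (\<lambda>\<sigma>. c * F \<sigma>)"
    proof (rule cavity_avg_abs_mono)
      fix \<sigma> :: "nat \<Rightarrow> nat \<Rightarrow> real" assume \<sigma>: "\<sigma> \<in> PiE {1..M} (\<lambda>_. sk_configs N)"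
      have "\<bar>pairs m \<sigma>\<bar> \<le> pairs_const m * dev (m + 2) \<sigma>"
        by (rule abs_cavity_pairs_le[OF \<sigma> F(2) site])
      also have "\<dots> \<le> c"
        using cavity_dev_le[OF \<sigma> F(2) q_nonneg, of i] unfolding c_def
        by (intro mult_left_mono pairs_const_nonneg) (simp add: add.commute)
      finally show "\<bar>F \<sigma> * pairs m \<sigma>\<bar> \<le> c * F \<sigma>"
        using nonneg[of \<sigma>] mult_left_mono[of "\<bar>pairs m \<sigma>\<bar>" c "F \<sigma>"]
        by (simp add: abs_mult mult.commute)
    qed
    then show ?thesis by (simp add: cavity_avg_cmult)
  qed
  have mono: "exp (k * \<theta>) * E \<theta> F \<le> exp (k * (pi / 2)) * E (pi / 2) F"
  proof (rule DERIV_nonneg_imp_nondecreasing[OF \<theta>(2)])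
    fix t
    have "((\<lambda>t. exp (k * t) * E t F) has_real_derivative
       exp (k * t) * (k * E t F + sin t * cos t * \<beta>\<^sup>2 * E t (\<lambda>\<sigma>. F \<sigma> * pairs m \<sigma>))) (at t)"
    proof -
      have "((\<lambda>t. exp (k * t)) has_real_derivative exp (k * t) * k) (at t)"
        by (rule derivative_eq_intros refl | simp)+
      from DERIV_mult[OF this E_deriv[OF F]] show ?thesis
        by (rule DERIV_cong) (simp add: algebra_simps)
    qed
    moreover have "0 \<le> exp (k * t) * (k * E t F + sin t * cos t * \<beta>\<^sup>2 * E t (\<lambda>\<sigma>. F \<sigma> * pairs m \<sigma>))"
    proof -
      have "\<bar>sin t * cos t * \<beta>\<^sup>2 * E t (\<lambda>\<sigma>. F \<sigma> * pairs m \<sigma>)\<bar> \<le> 1 * \<beta>\<^sup>2 * (c * E t F)"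
        unfolding abs_mult[of _ "E t _"] abs_mult[of _ "\<beta>\<^sup>2"]
        by (intro mult_mono bd abs_sin_cos_le_1) (use c0 E0 in auto)
      then have "0 \<le> k * E t F + sin t * cos t * \<beta>\<^sup>2 * E t (\<lambda>\<sigma>. F \<sigma> * pairs m \<sigma>)"
        unfolding k_def by (simp add: mult.assoc abs_le_iff)
      then show ?thesis by simp
    qed
    ultimately show "\<exists>y. ((\<lambda>t. exp (k * t) * E t F) has_real_derivative y) (at t) \<and> 0 \<le> y" by blast
  qed
  have "E \<theta> F = exp (- k * \<theta>) * (exp (k * \<theta>) * E \<theta> F)" by (simp add: exp_minus)
  also have "\<dots> \<le> 1 * (exp (k * 2) * \<nu> F)"
  proof (rule mult_mono)
    show "exp (- k * \<theta>) \<le> 1" using k0 \<theta> by simp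
    have "exp (k * (pi / 2)) \<le> exp (k * 2)"
      using k0 pi_less_4 mult_left_mono[of "pi / 2" 2 k] by simp
    then show "exp (k * \<theta>) * E \<theta> F \<le> exp (k * 2) * \<nu> F"
      using mono E0[of "pi / 2"] unfolding E_pi_half
      by (meson mult_right_mono order_trans)
  qed (use E0 in auto)
  finally show ?thesis by (simp add: gronwall_const_def k_def c_def mult_ac)
qed

text \<open>Mean value inequality in the angle. Four extra replicas: two come from the derivative,
  two more from applying \<open>E_le\<close> to a function of \<open>m + 2\<close> replicas.\<close>

lemma E_first_order:
  assumes F: "depends_on {1..m} F" "m + 4 \<le> M"
    and \<theta>: "0 \<le> \<theta>" "\<theta> \<le> pi / 2" and \<theta>': "0 \<le> \<theta>'" "\<theta>' \<le> pi / 2"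
  shows "\<bar>E \<theta> F - E \<theta>' F\<bar>
    \<le> 2 * \<beta>\<^sup>2 * pairs_const m * gronwall_const \<beta> q (m + 2) * \<nu> (\<lambda>\<sigma>. \<bar>F \<sigma>\<bar> * dev (m + 2) \<sigma>)"
proof -
  define K where "K = \<beta>\<^sup>2 * (pairs_const m * (gronwall_const \<beta> q (m + 2) * \<nu> (\<lambda>\<sigma>. \<bar>F \<sigma>\<bar> * dev (m + 2) \<sigma>)))"
  have \<nu>0: "0 \<le> \<nu> (\<lambda>\<sigma>. \<bar>F \<sigma>\<bar> * dev (m + 2) \<sigma>)"
    using sk_avg_mono[of "{1..M}" N "\<lambda>_. 0" "\<lambda>\<sigma>. \<bar>F \<sigma>\<bar> * dev (m + 2) \<sigma>" \<beta> h]
    by (simp add: sk_avg_const cavity_dev_nonneg)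
  have K0: "0 \<le> K" using \<nu>0 by (simp add: K_def pairs_const_nonneg gronwall_const_nonneg)
  have "norm ((\<lambda>t. E t F) \<theta> - (\<lambda>t. E t F) \<theta>') \<le> K * norm (\<theta> - \<theta>')"
  proof (rule field_differentiable_bound[where S = "{0..pi / 2}" and f = "\<lambda>t. E t F"
        and f' = "\<lambda>t. sin t * cos t * \<beta>\<^sup>2 * E t (\<lambda>\<sigma>. F \<sigma> * pairs m \<sigma>)"])
    fix t :: real assume t: "t \<in> {0..pi / 2}"
    show "((\<lambda>t. E t F) has_field_derivative
        sin t * cos t * \<beta>\<^sup>2 * E t (\<lambda>\<sigma>. F \<sigma> * pairs m \<sigma>)) (at t within {0..pi / 2})"
      by (rule has_field_derivative_at_within[OF E_deriv[OF F(1)]]) (use F(2) in simp)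
    have "\<bar>E t (\<lambda>\<sigma>. F \<sigma> * pairs m \<sigma>)\<bar> \<le> E t (\<lambda>\<sigma>. pairs_const m * (\<bar>F \<sigma>\<bar> * dev (m + 2) \<sigma>))"
    proof (rule cavity_avg_abs_mono)
      fix \<sigma> :: "nat \<Rightarrow> nat \<Rightarrow> real" assume \<sigma>: "\<sigma> \<in> PiE {1..M} (\<lambda>_. sk_configs N)"
      have "\<bar>pairs m \<sigma>\<bar> \<le> pairs_const m * dev (m + 2) \<sigma>"
        by (rule abs_cavity_pairs_le[OF \<sigma> _ site]) (use F in simp)
      then show "\<bar>F \<sigma> * pairs m \<sigma>\<bar> \<le> pairs_const m * (\<bar>F \<sigma>\<bar> * dev (m + 2) \<sigma>)"
        using mult_left_mono[of "\<bar>pairs m \<sigma>\<bar>" "pairs_const m * dev (m + 2) \<sigma>" "\<bar>F \<sigma>\<bar>"]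
        by (simp add: abs_mult mult_ac)
    qed
    also have "\<dots> = pairs_const m * E t (\<lambda>\<sigma>. \<bar>F \<sigma>\<bar> * dev (m + 2) \<sigma>)" by (rule cavity_avg_cmult)
    also have "\<dots> \<le> pairs_const m * (gronwall_const \<beta> q (m + 2) * \<nu> (\<lambda>\<sigma>. \<bar>F \<sigma>\<bar> * dev (m + 2) \<sigma>))"
    proof (intro mult_left_mono pairs_const_nonneg E_le)
      show "depends_on {1..m + 2} (\<lambda>\<sigma>. \<bar>F \<sigma>\<bar> * dev (m + 2) \<sigma>)"
        by (intro depends_on_compose2[where h = "\<lambda>x y. \<bar>x\<bar> * y"] depends_on_cavity_dev
              depends_on_mono[OF F(1)]) auto
    qed (use F t in \<open>auto simp: cavity_dev_nonneg\<close>)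
    finally have le: "\<bar>E t (\<lambda>\<sigma>. F \<sigma> * pairs m \<sigma>)\<bar>
      \<le> pairs_const m * (gronwall_const \<beta> q (m + 2) * \<nu> (\<lambda>\<sigma>. \<bar>F \<sigma>\<bar> * dev (m + 2) \<sigma>))" .
    have "\<bar>sin t * cos t * \<beta>\<^sup>2 * E t (\<lambda>\<sigma>. F \<sigma> * pairs m \<sigma>)\<bar> \<le> 1 * \<beta>\<^sup>2 *
       (pairs_const m * (gronwall_const \<beta> q (m + 2) * \<nu> (\<lambda>\<sigma>. \<bar>F \<sigma>\<bar> * dev (m + 2) \<sigma>)))"
      unfolding abs_mult[of _ "E t _"] abs_mult[of _ "\<beta>\<^sup>2"]
      by (intro mult_mono le abs_sin_cos_le_1) auto
    then show "norm (sin t * cos t * \<beta>\<^sup>2 * E t (\<lambda>\<sigma>. F \<sigma> * pairs m \<sigma>)) \<le> K"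
      unfolding K_def by simp
  qed (use \<theta> \<theta>' in auto)
  also have "\<dots> \<le> K * 2"
  proof (rule mult_left_mono[OF _ K0])
    have "\<bar>\<theta> - \<theta>'\<bar> \<le> pi / 2" using \<theta> \<theta>' by linarith
    then show "norm (\<theta> - \<theta>') \<le> 2" using pi_less_4 by simp
  qed
  finally show ?thesis by (simp add: K_def mult_ac)
qed

text \<open>For bounded \<open>F\<close> the error is of order \<open>1 / N\<close>, since it
  carries two factors \<open>dev\<close>. The first derivative uses two extra replicas and
  \<open>E_first_order\<close>, applied to it, four more.\<close>

lemma E_second_order:
  assumes F: "depends_on {1..m} F" "m + 6 \<le> M"
  shows "\<bar>\<nu> F - E 0 F - \<beta>\<^sup>2 / 2 * E 0 (\<lambda>\<sigma>. F \<sigma> * pairs m \<sigma>)\<bar>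
    \<le> 4 * \<beta>\<^sup>2 * \<beta>\<^sup>2 * pairs_const (m + 2) * gronwall_const \<beta> q (m + 4) * pairs_const m
      * \<nu> (\<lambda>\<sigma>. \<bar>F \<sigma>\<bar> * dev (m + 2) \<sigma> * dev (m + 4) \<sigma>)"
proof -
  define \<psi> where "\<psi> t = E t (\<lambda>\<sigma>. F \<sigma> * pairs m \<sigma>)" for t
  define K where "K = 2 * \<beta>\<^sup>2 * pairs_const (m + 2) * gronwall_const \<beta> q (m + 4) *
      (pairs_const m * \<nu> (\<lambda>\<sigma>. \<bar>F \<sigma>\<bar> * dev (m + 2) \<sigma> * dev (m + 4) \<sigma>))"
  have le: "\<nu> (\<lambda>\<sigma>. \<bar>F \<sigma> * pairs m \<sigma>\<bar> * dev (m + 4) \<sigma>)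
      \<le> pairs_const m * \<nu> (\<lambda>\<sigma>. \<bar>F \<sigma>\<bar> * dev (m + 2) \<sigma> * dev (m + 4) \<sigma>)"
    unfolding sk_avg_cmult[symmetric]
  proof (rule sk_avg_mono)
    fix \<sigma> :: "nat \<Rightarrow> nat \<Rightarrow> real" assume \<sigma>: "\<sigma> \<in> PiE {1..M} (\<lambda>_. sk_configs N)"
    have "\<bar>pairs m \<sigma>\<bar> \<le> pairs_const m * dev (m + 2) \<sigma>"
      by (rule abs_cavity_pairs_le[OF \<sigma> _ site]) (use F in simp)
    then have "\<bar>F \<sigma>\<bar> * \<bar>pairs m \<sigma>\<bar> * dev (m + 4) \<sigma> \<le> \<bar>F \<sigma>\<bar> * (pairs_const m * dev (m + 2) \<sigma>) * dev (m + 4) \<sigma>"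
      by (intro mult_right_mono mult_left_mono cavity_dev_nonneg) auto
    then show "\<bar>F \<sigma> * pairs m \<sigma>\<bar> * dev (m + 4) \<sigma> \<le> pairs_const m * (\<bar>F \<sigma>\<bar> * dev (m + 2) \<sigma> * dev (m + 4) \<sigma>)"
      by (simp add: abs_mult mult_ac)
  qed
  have \<psi>: "\<bar>\<psi> t - \<psi> 0\<bar> \<le> K" if t: "t \<in> {0..pi / 2}" for t
  proof -
    have "\<bar>\<psi> t - \<psi> 0\<bar> \<le> 2 * \<beta>\<^sup>2 * pairs_const (m + 2) * gronwall_const \<beta> q (m + 2 + 2)
         * \<nu> (\<lambda>\<sigma>. \<bar>F \<sigma> * pairs m \<sigma>\<bar> * dev (m + 2 + 2) \<sigma>)"
      unfolding \<psi>_def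
    proof (rule E_first_order)
      show "depends_on {1..m + 2} (\<lambda>\<sigma>. F \<sigma> * pairs m \<sigma>)"
        by (intro depends_on_compose2[where h = "(*)"] depends_on_cavity_pairs depends_on_mono[OF F(1)]) auto
    qed (use F t in auto)
    also have "m + 2 + 2 = m + 4" by simp
    also have "2 * \<beta>\<^sup>2 * pairs_const (m + 2) * gronwall_const \<beta> q (m + 4)
         * \<nu> (\<lambda>\<sigma>. \<bar>F \<sigma> * pairs m \<sigma>\<bar> * dev (m + 4) \<sigma>) \<le> K"
      unfolding K_def by (rule mult_left_mono[OF le]) (simp add: pairs_const_nonneg gronwall_const_nonneg)
    finally show ?thesis .
  qed
  \<comment> \<open>The subtracted multiple of \<open>(sin t)\<^sup>2\<close> has the derivative of
    \<open>E t F\<close> with \<open>\<psi>\<close> frozen at 0, which leaves the increment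
    \<open>\<psi> t - \<psi> 0\<close>. At \<open>pi / 2\<close> it equals
    \<open>\<beta>\<^sup>2 / 2 * \<psi> 0\<close>.\<close>
  define f where "f t = E t F - \<beta>\<^sup>2 / 2 * \<psi> 0 * (sin t)\<^sup>2" for t
  have "norm (f (pi / 2) - f 0) \<le> \<beta>\<^sup>2 * K * norm (pi / 2 - 0 :: real)"
  proof (rule field_differentiable_bound[where S = "{0..pi / 2}" and f = f
        and f' = "\<lambda>t. sin t * cos t * \<beta>\<^sup>2 * (\<psi> t - \<psi> 0)"])
    fix t :: real assume t: "t \<in> {0..pi / 2}"
    have "(f has_real_derivative sin t * cos t * \<beta>\<^sup>2 * (\<psi> t - \<psi> 0)) (at t)"
    proof -
      have "((\<lambda>t. \<beta>\<^sup>2 / 2 * \<psi> 0 * (sin t)\<^sup>2) has_real_derivative \<beta>\<^sup>2 * \<psi> 0 * (sin t * cos t)) (at t)"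
        by (rule derivative_eq_intros refl | simp)+
      moreover have "m + 2 \<le> M" using F by simp
      ultimately show ?thesis unfolding f_def
        by (intro DERIV_cong[OF DERIV_diff[OF E_deriv[OF F(1)]]]) (auto simp: \<psi>_def algebra_simps)
    qed
    then show "(f has_field_derivative sin t * cos t * \<beta>\<^sup>2 * (\<psi> t - \<psi> 0)) (at t within {0..pi / 2})"
      by (rule has_field_derivative_at_within)
    have "\<bar>sin t * cos t * \<beta>\<^sup>2 * (\<psi> t - \<psi> 0)\<bar> \<le> 1 * \<beta>\<^sup>2 * K"
      unfolding abs_mult[of _ "\<psi> t - \<psi> 0"] abs_mult[of _ "\<beta>\<^sup>2"]
      by (intro mult_mono \<psi>[OF t] abs_sin_cos_le_1) auto
    then show "norm (sin t * cos t * \<beta>\<^sup>2 * (\<psi> t - \<psi> 0)) \<le> \<beta>\<^sup>2 * K" by simp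
  qed auto
  also have "\<dots> \<le> \<beta>\<^sup>2 * K * 2"
    using \<psi>[of 0] pi_less_4 by (intro mult_left_mono) auto
  finally have le: "\<bar>f (pi / 2) - f 0\<bar> \<le> \<beta>\<^sup>2 * K * 2" by simp
  have "f (pi / 2) - f 0 = \<nu> F - E 0 F - \<beta>\<^sup>2 / 2 * E 0 (\<lambda>\<sigma>. F \<sigma> * pairs m \<sigma>)"
    unfolding f_def E_pi_half \<psi>_def by simp
  moreover have "\<beta>\<^sup>2 * K * 2 = 4 * \<beta>\<^sup>2 * \<beta>\<^sup>2 * pairs_const (m + 2) * gronwall_const \<beta> q (m + 4) * pairs_const m
      * \<nu> (\<lambda>\<sigma>. \<bar>F \<sigma>\<bar> * dev (m + 2) \<sigma> * dev (m + 4) \<sigma>)"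
    unfolding K_def by (simp only: mult_ac)
  ultimately show ?thesis using le by (simp only:)
qed

end

subsection \<open>Second moments of multi-overlaps\<close>

lemma sk_overlap_permute:
  assumes "bij_betw \<pi> B B" "S \<subseteq> B"
  shows "sk_overlap N S (\<lambda>l\<in>B. \<sigma> (\<pi> l)) = sk_overlap N (\<pi> ` S) \<sigma>"
proof -
  have inj: "inj_on \<pi> S" using assms by (auto simp: bij_betw_def inj_on_subset)
  have "spin S j (\<lambda>l\<in>B. \<sigma> (\<pi> l)) = spin (\<pi> ` S) j \<sigma>" for j
    unfolding spin_def prod.reindex[OF inj] comp_def
    by (rule prod.cong) (use assms in auto)
  then show ?thesis by (simp add: sk_overlap_eq)
qed

lemma sk_avg_permute_replicas:
  assumes "bij_betw \<pi> B B" "\<And>\<sigma>. F' (\<lambda>l\<in>B. \<sigma> (\<pi> l)) = F \<sigma>"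
  shows "sk_avg N \<beta> h B F = sk_avg N \<beta> h B F'"
  using sk_avg_permute[OF assms(1), of N \<beta> h F'] assms(2) by simp

lemma ex_bij_betw_pair:
  assumes "l \<in> {1..M}" "l' \<in> {1..M}" "l \<noteq> (l' :: nat)"
  shows "\<exists>\<pi>. bij_betw \<pi> {1..M} {1..M} \<and> \<pi> 1 = l \<and> \<pi> 2 = l'"
proof -
  have M: "M \<ge> 2" using assms by auto
  define \<tau> where "\<tau> = Transposition.transpose 1 l"
  define \<rho> where "\<rho> = Transposition.transpose (\<tau> 2) l' \<circ> \<tau>"
  have b1: "bij_betw \<tau> {1..M} {1..M}"
    unfolding \<tau>_def by (rule permutes_imp_bij[OF permutes_swap_id]) (use assms M in auto)
  have t2: "\<tau> 2 \<in> {1..M}" using b1 M by (auto simp: bij_betw_def)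
  have b2: "bij_betw (Transposition.transpose (\<tau> 2) l') {1..M} {1..M}"
    by (rule permutes_imp_bij[OF permutes_swap_id[OF t2 assms(2)]])
  have "bij_betw \<rho> {1..M} {1..M}" unfolding \<rho>_def by (rule bij_betw_trans[OF b1 b2])
  moreover have "\<tau> 1 = l" by (simp add: \<tau>_def)
  \<comment> \<open>Hence the second transposition leaves \<open>l\<close>, the image of 1, in
    place.\<close>
  moreover have "\<tau> 2 \<noteq> l" unfolding \<tau>_def by (auto simp: Transposition.transpose_def)
  ultimately have "bij_betw \<rho> {1..M} {1..M} \<and> \<rho> 1 = l \<and> \<rho> 2 = l'"
    using assms(3) by (simp add: \<rho>_def Transposition.transpose_def)
  then show ?thesis by blast
qed

lemma tanh_moment_0 [simp]: "tanh_moment \<beta> h q 0 = 1"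
  using prob_space.prob_space[OF prob_space_std_normal] by (simp add: tanh_moment_def)

lemma abs_tanh_moment_le: "\<bar>tanh_moment \<beta> h q p\<bar> \<le> 1"
proof -
  interpret prob_space "density lborel std_normal_density" by (rule prob_space_std_normal)
  have "\<bar>tanh_moment \<beta> h q p\<bar> \<le> (LINT y|density lborel std_normal_density. 1)"
    unfolding tanh_moment_def
  proof (rule order_trans[OF integral_abs_bound integral_mono])
    show "\<bar>tanh (\<beta> * sqrt q * y + \<beta> * h) ^ p\<bar> \<le> 1" for y
      unfolding power_abs by (intro power_le_one abs_tanh_real_le_1) simp
  qed (auto intro!: integrable_abs integrable_tanh_power)
  then show ?thesis using prob_space by simp
qed

text \<open>The exponential hypothesis acts through this second-moment bound. Here \<open>q\<close>
  is any nonnegative number for which it holds; that \<open>q\<close> is the second tanh moment is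
  derived in \<open>q_eq_moment\<close>.\<close>

locale high_temperature =
  fixes \<beta> h q L :: real
  assumes q_nonneg: "0 \<le> q"
    and pair: "\<And>N. N \<ge> 1 \<Longrightarrow> sk_avg N \<beta> h {1..2} (\<lambda>\<sigma>. (sk_overlap N {1, 2} \<sigma> - q)\<^sup>2) \<le> L / real N"
begin

abbreviation qq where "qq \<equiv> tanh_moment \<beta> h q"
abbreviation \<nu> where "\<nu> N M F \<equiv> sk_avg N \<beta> h {1..M} F"

lemma \<nu>_nonneg:
  assumes "\<And>\<sigma>. \<sigma> \<in> PiE {1..M} (\<lambda>_. sk_configs N) \<Longrightarrow> 0 \<le> F \<sigma>"
  shows "0 \<le> \<nu> N M F"
  using sk_avg_mono[of "{1..M}" N "\<lambda>_. 0" F \<beta> h] assms by (simp add: sk_avg_const)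

lemma L_nonneg: "0 \<le> L"
proof -
  have "0 \<le> sk_avg 1 \<beta> h {1..2} (\<lambda>\<sigma>. (sk_overlap 1 {1, 2} \<sigma> - q)\<^sup>2)" by (rule \<nu>_nonneg) simp
  also have "\<dots> \<le> L / real 1" by (rule pair) simp
  finally show ?thesis by simp
qed

lemma overlap_moment:
  assumes "l \<in> {1..M}" "l' \<in> {1..M}" "l \<noteq> l'" "N \<ge> 1"
  shows "\<nu> N M (\<lambda>\<sigma>. (sk_overlap N {l, l'} \<sigma> - q)\<^sup>2) \<le> L / real N"
proof -
  obtain \<pi> where \<pi>: "bij_betw \<pi> {1..M} {1..M}" "\<pi> 1 = l" "\<pi> 2 = l'"
    using ex_bij_betw_pair[OF assms(1-3)] by blast
  have M: "2 \<le> M" using assms by auto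
  have "\<nu> N M (\<lambda>\<sigma>. (sk_overlap N {l, l'} \<sigma> - q)\<^sup>2) = \<nu> N M (\<lambda>\<sigma>. (sk_overlap N {1, 2} \<sigma> - q)\<^sup>2)"
    by (rule sk_avg_permute_replicas[OF \<pi>(1)]) (use \<pi> M in \<open>simp add: sk_overlap_permute\<close>)
  also have "\<dots> = \<nu> N 2 (\<lambda>\<sigma>. (sk_overlap N {1, 2} \<sigma> - q)\<^sup>2)"
    by (rule sk_avg_marginal)
       (use M in \<open>auto intro!: depends_on_compose[where h = "\<lambda>x. (x - q)\<^sup>2"] depends_on_sk_overlap\<close>)
  also have "\<dots> \<le> L / real N" by (rule pair[OF assms(4)])
  finally show ?thesis .
qed

lemma cavity_overlap_moment:
  assumes "l \<in> {1..M}" "l' \<in> {1..M}" "l \<noteq> l'" "i \<in> {1..N}"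
  shows "\<nu> N M (\<lambda>\<sigma>. (cavity_overlap N i {l, l'} \<sigma> - q)\<^sup>2) \<le> (2 * L + 2) / real N"
proof -
  have N: "real N \<ge> 1" using assms by auto
  have "\<nu> N M (\<lambda>\<sigma>. (cavity_overlap N i {l, l'} \<sigma> - q)\<^sup>2)
     \<le> \<nu> N M (\<lambda>\<sigma>. 2 * (sk_overlap N {l, l'} \<sigma> - q)\<^sup>2 + 2 / real N)"
  proof (rule sk_avg_mono)
    fix \<sigma> :: "nat \<Rightarrow> nat \<Rightarrow> real" assume \<sigma>: "\<sigma> \<in> PiE {1..M} (\<lambda>_. sk_configs N)"
    let ?x = "sk_overlap N {l, l'} \<sigma> - q" and ?s = "spin {l, l'} i \<sigma> / real N"
    have "(?s)\<^sup>2 = 1 / (real N)\<^sup>2"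
      using abs_spin[OF \<sigma>, of "{l, l'}" i] assms by (simp add: power_divide abs_square_eq_1)
    also have "\<dots> \<le> 1 / real N" using N by (simp add: power2_eq_square field_simps)
    finally have s: "(?s)\<^sup>2 \<le> 1 / real N" .
    have "cavity_overlap N i {l, l'} \<sigma> - q = ?x - ?s"
      using sk_overlap_cavity[OF assms(4), of "{l, l'}" \<sigma>] by simp
    moreover have "(?x - ?s)\<^sup>2 \<le> 2 * ?x\<^sup>2 + 2 * (?s)\<^sup>2"
      using zero_le_power2[of "?x + ?s"] by (simp add: power2_eq_square algebra_simps)
    ultimately show "(cavity_overlap N i {l, l'} \<sigma> - q)\<^sup>2 \<le> 2 * ?x\<^sup>2 + 2 / real N"
      using s by (simp only: power2_eq_square)
  qed
  also have "\<dots> = 2 * \<nu> N M (\<lambda>\<sigma>. (sk_overlap N {l, l'} \<sigma> - q)\<^sup>2) + 2 / real N"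
    by (simp add: sk_avg_add sk_avg_cmult sk_avg_const)
  also have "\<dots> \<le> 2 * (L / real N) + 2 / real N"
    using overlap_moment[OF assms(1-3), of N] N by simp
  finally show ?thesis by (simp add: add_divide_distrib)
qed

lemma dev_moment:
  assumes "m \<le> M" "i \<in> {1..N}"
  shows "\<nu> N M (\<lambda>\<sigma>. (cavity_dev N i q m \<sigma>)\<^sup>2) \<le> (real m)^4 * (2 * L + 2) / real N"
proof -
  let ?X = "SIGMA l:{1..m}. {1..m} - {l}"
  let ?f = "\<lambda>\<sigma> x. \<bar>cavity_overlap N i {fst x, snd x} \<sigma> - q\<bar>"
  have dev: "cavity_dev N i q m \<sigma> = (\<Sum>x\<in>?X. ?f \<sigma> x)" for \<sigma>
    unfolding cavity_dev_def by (subst sum.Sigma) (auto simp: case_prod_unfold)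
  have card: "real (card ?X) \<le> (real m)\<^sup>2"
  proof -
    have "card ?X \<le> card ({1..m} \<times> {1..m})" by (rule card_mono) auto
    then have "card ?X \<le> m * m" by simp
    then show ?thesis unfolding power2_eq_square by (metis of_nat_le_iff of_nat_mult)
  qed
  have t0: "0 \<le> (2 * L + 2) / real N" using L_nonneg by simp
  have "\<nu> N M (\<lambda>\<sigma>. (cavity_dev N i q m \<sigma>)\<^sup>2)
     \<le> \<nu> N M (\<lambda>\<sigma>. (real m)\<^sup>2 * (\<Sum>x\<in>?X. (cavity_overlap N i {fst x, snd x} \<sigma> - q)\<^sup>2))"
  proof (rule sk_avg_mono)
    fix \<sigma> :: "nat \<Rightarrow> nat \<Rightarrow> real"
    have "(cavity_dev N i q m \<sigma>)\<^sup>2 \<le> (\<Sum>x\<in>?X. (?f \<sigma> x)\<^sup>2) * real (card ?X)"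
      unfolding dev by (rule sum_squared_le_sum_of_squares)
    also have "\<dots> \<le> (\<Sum>x\<in>?X. (?f \<sigma> x)\<^sup>2) * (real m)\<^sup>2"
      by (intro mult_left_mono card sum_nonneg) auto
    finally show "(cavity_dev N i q m \<sigma>)\<^sup>2
        \<le> (real m)\<^sup>2 * (\<Sum>x\<in>?X. (cavity_overlap N i {fst x, snd x} \<sigma> - q)\<^sup>2)"
      by (simp add: mult.commute)
  qed
  also have "\<dots> = (real m)\<^sup>2 * (\<Sum>x\<in>?X. \<nu> N M (\<lambda>\<sigma>. (cavity_overlap N i {fst x, snd x} \<sigma> - q)\<^sup>2))"
    by (simp only: sk_avg_cmult sk_avg_sum)
  also have "\<dots> \<le> (real m)\<^sup>2 * (\<Sum>x\<in>?X. (2 * L + 2) / real N)"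
    by (intro mult_left_mono sum_mono cavity_overlap_moment) (use assms in auto)
  also have "\<dots> \<le> (real m)\<^sup>2 * ((real m)\<^sup>2 * ((2 * L + 2) / real N))"
    using card t0 by (simp only: sum_constant) (intro mult_left_mono mult_right_mono, auto)
  finally show ?thesis by (simp add: power4_eq_xxxx power2_eq_square mult_ac)
qed

lemma dev_prod_moment:
  assumes "m \<le> M" "m' \<le> M" "m \<le> k" "m' \<le> k" "i \<in> {1..N}"
  shows "\<nu> N M (\<lambda>\<sigma>. cavity_dev N i q m \<sigma> * cavity_dev N i q m' \<sigma>) \<le> (real k)^4 * (2 * L + 2) / real N"
proof -
  let ?x = "cavity_dev N i q m" and ?y = "cavity_dev N i q m'"
  have k: "(real j)^4 * (2 * L + 2) / real N \<le> (real k)^4 * (2 * L + 2) / real N" if "j \<le> k" for j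
    using that L_nonneg by (intro divide_right_mono mult_right_mono power_mono) auto
  have "\<nu> N M (\<lambda>\<sigma>. ?x \<sigma> * ?y \<sigma>) \<le> \<nu> N M (\<lambda>\<sigma>. 1/2 * (?x \<sigma>)\<^sup>2 + 1/2 * (?y \<sigma>)\<^sup>2)"
  proof (rule sk_avg_mono)
    fix \<sigma>
    show "?x \<sigma> * ?y \<sigma> \<le> 1/2 * (?x \<sigma>)\<^sup>2 + 1/2 * (?y \<sigma>)\<^sup>2"
      using zero_le_power2[of "?x \<sigma> - ?y \<sigma>"] by (simp add: power2_eq_square algebra_simps)
  qed
  also have "\<dots> = 1/2 * \<nu> N M (\<lambda>\<sigma>. (?x \<sigma>)\<^sup>2) + 1/2 * \<nu> N M (\<lambda>\<sigma>. (?y \<sigma>)\<^sup>2)"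
    by (simp only: sk_avg_add sk_avg_cmult)
  also have "\<dots> \<le> (real k)^4 * (2 * L + 2) / real N"
  proof -
    have avg: "x \<le> r \<Longrightarrow> y \<le> r \<Longrightarrow> 1/2 * x + 1/2 * y \<le> r" for x y r :: real by simp
    show ?thesis
      by (rule avg[OF order_trans[OF dev_moment[OF assms(1,5)] k[OF assms(3)]]
            order_trans[OF dev_moment[OF assms(2,5)] k[OF assms(4)]]])
  qed
  finally show ?thesis .
qed

text \<open>Arithmetic-geometric mean with weight \<open>sqrt N\<close>, chosen so that a second
  moment of order \<open>1 / N\<close> yields a first absolute moment of order
  \<open>1 / sqrt N\<close>.\<close>

lemma abs_le_scaled_square:
  assumes "N \<ge> 1"
  shows "\<bar>x\<bar> \<le> sqrt (real N) / 2 * x\<^sup>2 + 1 / (2 * sqrt (real N))"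
proof -
  have s: "sqrt (real N) > 0" using assms by simp
  have "0 \<le> (sqrt (real N) * \<bar>x\<bar> - 1)\<^sup>2 / (2 * sqrt (real N))" using s by simp
  also have "\<dots> = sqrt (real N) / 2 * x\<^sup>2 + 1 / (2 * sqrt (real N)) - \<bar>x\<bar>"
    using s by (simp add: field_simps power2_eq_square)
  finally show ?thesis by simp
qed

lemma first_moment_le:
  assumes "N \<ge> 1" "\<nu> N M (\<lambda>\<sigma>. (F \<sigma>)\<^sup>2) \<le> c / real N"
  shows "\<nu> N M (\<lambda>\<sigma>. \<bar>F \<sigma>\<bar>) \<le> (c + 1) / sqrt (real N)"
proof -
  have s: "sqrt (real N) > 0" using assms by simp
  have "\<nu> N M (\<lambda>\<sigma>. \<bar>F \<sigma>\<bar>) \<le> \<nu> N M (\<lambda>\<sigma>. sqrt (real N) / 2 * (F \<sigma>)\<^sup>2 + 1 / (2 * sqrt (real N)))"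
    by (rule sk_avg_mono) (rule abs_le_scaled_square[OF assms(1)])
  also have "\<dots> = sqrt (real N) / 2 * \<nu> N M (\<lambda>\<sigma>. (F \<sigma>)\<^sup>2) + 1 / (2 * sqrt (real N))"
    by (simp only: sk_avg_add sk_avg_cmult sk_avg_const[OF finite_atLeastAtMost])
  also have "\<dots> \<le> sqrt (real N) / 2 * (c / real N) + 1 / (2 * sqrt (real N))"
    using assms(2) s by (intro add_mono mult_left_mono) auto
  also have "sqrt (real N) / 2 * (c / real N) = c / (2 * sqrt (real N))"
    using s assms(1) by (simp add: field_simps)
  also have "c / (2 * sqrt (real N)) + 1 / (2 * sqrt (real N)) = (c + 1) / sqrt (real N) / 2"
    by (simp add: add_divide_distrib)
  also have "\<dots> \<le> (c + 1) / sqrt (real N)"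
  proof -
    have "0 \<le> \<nu> N M (\<lambda>\<sigma>. (F \<sigma>)\<^sup>2)" by (rule \<nu>_nonneg) simp
    then have "0 \<le> c / real N" using assms(2) by linarith
    then have "0 \<le> c" using assms(1) by (simp add: zero_le_divide_iff)
    then have "0 \<le> (c + 1) / sqrt (real N)" using s by simp
    moreover have "0 \<le> x \<Longrightarrow> x / 2 \<le> x" for x :: real by simp
    ultimately show ?thesis by blast
  qed
  finally show ?thesis .
qed

lemma site_free_cavity_overlap: "site_free i B (cavity_overlap N i S)"
  unfolding site_free_def cavity_overlap_def spin_def
  by (intro ballI allI arg_cong[where f = "\<lambda>x. 1 / real N * x"] sum.cong prod.cong refl) auto

lemma site_free_compose: "site_free i B G \<Longrightarrow> site_free i B (\<lambda>\<sigma>. f (G \<sigma>))"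
  by (simp add: site_free_def)

lemma site_free_compose2: "site_free i B G \<Longrightarrow> site_free i B H \<Longrightarrow> site_free i B (\<lambda>\<sigma>. f (G \<sigma>) (H \<sigma>))"
  by (simp add: site_free_def)

lemma site_free_sum: "(\<And>x. x \<in> X \<Longrightarrow> site_free i B (G x)) \<Longrightarrow> site_free i B (\<lambda>\<sigma>. \<Sum>x\<in>X. G x \<sigma>)"
  by (simp add: site_free_def)

text \<open>The average over the decoupled site is exact, so the leading term of the cavity expansion of
  \<open>\<nu> ((R_S - q_s)^2)\<close> vanishes; the remainder is absorbed by the arithmetic-geometric mean
  inequality.\<close>

lemma multi_overlap_moment:
  assumes S: "S \<subseteq> {1..m}"
  shows "\<exists>C\<ge>0. \<forall>N\<ge>1. \<forall>M\<ge>m. \<nu> N M (\<lambda>\<sigma>. (sk_overlap N S \<sigma> - qq (card S))\<^sup>2) \<le> C / real N"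
proof -
  define M where "M = m + 4"
  define K where "K = 2 * \<beta>\<^sup>2 * pairs_const m * gronwall_const \<beta> q (m + 2)"
  define D where "D = (real (m + 2))^4 * (2 * L + 2)"
  \<comment> \<open>Twice the error in the estimate \<open>site\<close> below; the factor 2 comes
    from absorbing \<open>y / 2\<close>.\<close>
  define C where "C = 4 + 4 * K\<^sup>2 * D + 4 * K * (1 + D)"
  let ?q = "qq (card S)"
  have K0: "0 \<le> K" by (simp add: K_def pairs_const_nonneg gronwall_const_nonneg)
  have D0: "0 \<le> D" using L_nonneg by (simp add: D_def)
  have C0: "0 \<le> C" using K0 D0 by (simp add: C_def)
  have main: "\<nu> N M (\<lambda>\<sigma>. (sk_overlap N S \<sigma> - ?q)\<^sup>2) \<le> C / real N" if N: "N \<ge> 1" for N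
  proof -
    let ?R = "\<lambda>\<sigma>. sk_overlap N S \<sigma> - ?q"
    define y where "y = \<nu> N M (\<lambda>\<sigma>. (?R \<sigma>)\<^sup>2)"
    have SM: "S \<subseteq> {1..M}" using S by (auto simp: M_def)
    have site: "\<nu> N M (\<lambda>\<sigma>. (spin S i \<sigma> - ?q) * ?R \<sigma>)
        \<le> 2 / real N + y / 2 + (2 * K\<^sup>2 * D + 2 * K * (1 + D)) / real N" if i: "i \<in> {1..N}" for i
    proof -
      interpret cav: cavity N i M \<beta> h q by standard (use i q_nonneg in auto)
      let ?c = "\<lambda>\<sigma>. cavity_overlap N i S \<sigma> - ?q" and ?d = "cavity_dev N i q (m + 2)"
      define F where "F \<sigma> = (spin S i \<sigma> - ?q) * ?c \<sigma>" for \<sigma>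
      have d2: "\<nu> N M (\<lambda>\<sigma>. (?d \<sigma>)\<^sup>2) \<le> D / real N"
        unfolding D_def by (rule dev_moment) (use i in \<open>auto simp: M_def\<close>)
      have sp: "\<bar>spin S i \<sigma> - ?q\<bar> \<le> 2" "\<bar>spin S i \<sigma>\<bar> = 1" if "\<sigma> \<in> PiE {1..M} (\<lambda>_. sk_configs N)" for \<sigma>
        using abs_spin[OF that SM i] abs_tanh_moment_le[of \<beta> h q "card S"] by linarith+
      have "\<nu> N M (\<lambda>\<sigma>. (spin S i \<sigma> - ?q) * ?R \<sigma>) \<le> \<nu> N M (\<lambda>\<sigma>. F \<sigma> + 2 / real N)"
      proof (rule sk_avg_mono)
        fix \<sigma> :: "nat \<Rightarrow> nat \<Rightarrow> real" assume \<sigma>: "\<sigma> \<in> PiE {1..M} (\<lambda>_. sk_configs N)"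
        have "(spin S i \<sigma> - ?q) * ?R \<sigma> = F \<sigma> + (spin S i \<sigma> - ?q) * spin S i \<sigma> / real N"
          unfolding F_def sk_overlap_cavity[OF i]
          by (simp add: algebra_simps add_divide_distrib diff_divide_distrib)
        moreover have "(spin S i \<sigma> - ?q) * spin S i \<sigma> \<le> 2"
          using sp[OF \<sigma>] abs_ge_self[of "(spin S i \<sigma> - ?q) * spin S i \<sigma>"] by (simp add: abs_mult)
        then have "(spin S i \<sigma> - ?q) * spin S i \<sigma> / real N \<le> 2 / real N"
          by (intro divide_right_mono) auto
        ultimately show "(spin S i \<sigma> - ?q) * ?R \<sigma> \<le> F \<sigma> + 2 / real N" by simp
      qed
      also have "\<dots> = \<nu> N M F + 2 / real N" by (simp add: sk_avg_add sk_avg_const)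
      also have "\<nu> N M F \<le> K * \<nu> N M (\<lambda>\<sigma>. \<bar>F \<sigma>\<bar> * ?d \<sigma>)"
      proof -
        have sf: "site_free i {1..M} ?c"
          by (rule site_free_compose[OF site_free_cavity_overlap])
        have "cav.E 0 F = cav.E 0 (\<lambda>\<sigma>. spin S i \<sigma> * ?c \<sigma> - ?q * ?c \<sigma>)"
          by (rule cavity_avg_cong) (simp add: F_def algebra_simps)
        also have "\<dots> = 0"
          by (simp only: cavity_avg_diff cavity_avg_cmult cavity_avg_zero_factor[OF i finite_atLeastAtMost SM sf] diff_self)
        finally have E0: "cav.E 0 F = 0" .
        have "depends_on {1..m} F" unfolding F_def using S
          by (intro depends_on_compose2[where h = "\<lambda>x y. (x - ?q) * (y - ?q)"] depends_on_spin depends_on_cavity_overlap)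
        from cav.E_first_order[OF this, of "pi / 2" 0] E0
        show ?thesis unfolding K_def cav.E_pi_half by (simp add: M_def)
      qed
      also have "K * \<nu> N M (\<lambda>\<sigma>. \<bar>F \<sigma>\<bar> * ?d \<sigma>)
          \<le> \<nu> N M (\<lambda>\<sigma>. 1/2 * (?R \<sigma>)\<^sup>2 + ((2 * K\<^sup>2 + 2 * K / real N) * (?d \<sigma>)\<^sup>2 + 2 * K / real N))"
        unfolding sk_avg_cmult[symmetric]
      proof (rule sk_avg_mono)
        fix \<sigma> :: "nat \<Rightarrow> nat \<Rightarrow> real" assume \<sigma>: "\<sigma> \<in> PiE {1..M} (\<lambda>_. sk_configs N)"
        let ?r = "\<bar>?R \<sigma>\<bar>" and ?e = "?d \<sigma>"
        have e0: "0 \<le> ?e" by (rule cavity_dev_nonneg)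
        have "\<bar>?c \<sigma>\<bar> \<le> ?r + 1 / real N"
        proof -
          have "\<bar>spin S i \<sigma> / real N\<bar> = 1 / real N" using sp(2)[OF \<sigma>] by simp
          moreover have "\<bar>a\<bar> \<le> \<bar>b\<bar> + x" if "b = a + s" "\<bar>s\<bar> = x" for a b s x :: real
            using that by linarith
          ultimately show ?thesis unfolding sk_overlap_cavity[OF i] by (metis add.commute add_diff_eq)
        qed
        then have "\<bar>F \<sigma>\<bar> \<le> 2 * (?r + 1 / real N)"
          unfolding F_def abs_mult by (intro mult_mono sp \<sigma>) auto
        then have "K * (\<bar>F \<sigma>\<bar> * ?e) \<le> K * (2 * (?r + 1 / real N) * ?e)"
          using K0 e0 by (intro mult_left_mono mult_right_mono) auto
        also have "\<dots> = 2 * K * ?r * ?e + 2 * K / real N * ?e" by (simp add: algebra_simps)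
        \<comment> \<open>The weight 1/2 on \<open>?r\<^sup>2\<close> is what makes the average of
          this term absorbable into \<open>y\<close>.\<close>
        also have "2 * K * ?r * ?e \<le> 1/2 * ?r\<^sup>2 + 2 * K\<^sup>2 * ?e\<^sup>2"
          using zero_le_power2[of "?r - 2 * K * ?e"] by (simp add: power2_eq_square algebra_simps)
        also have "2 * K / real N * ?e \<le> 2 * K / real N * (1 + ?e\<^sup>2)"
        proof (rule mult_left_mono)
          show "?e \<le> 1 + ?e\<^sup>2" using zero_le_power2[of "?e - 1"] e0
            by (simp add: power2_eq_square algebra_simps)
        qed (use K0 in simp)
        finally show "K * (\<bar>F \<sigma>\<bar> * ?e) \<le> 1/2 * (?R \<sigma>)\<^sup>2 + ((2 * K\<^sup>2 + 2 * K / real N) * ?e\<^sup>2 + 2 * K / real N)"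
          by (simp add: algebra_simps)
      qed
      also have "\<dots> = y / 2 + ((2 * K\<^sup>2 + 2 * K / real N) * \<nu> N M (\<lambda>\<sigma>. (?d \<sigma>)\<^sup>2) + 2 * K / real N)"
        unfolding sk_avg_add sk_avg_cmult y_def by (simp add: sk_avg_const)
      also have "\<dots> \<le> y / 2 + ((2 * K\<^sup>2 + 2 * K) * (D / real N) + 2 * K / real N)"
      proof -
        have "2 * K / real N \<le> 2 * K" using N K0 mult_left_mono[of 1 "real N" K] by (simp add: field_simps)
        moreover have "0 \<le> \<nu> N M (\<lambda>\<sigma>. (?d \<sigma>)\<^sup>2)" by (rule \<nu>_nonneg) simp
        ultimately show ?thesis using d2 K0 D0
          by (intro add_mono mult_mono order_refl) auto
      qed
      finally show ?thesis by (simp add: add_divide_distrib algebra_simps)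
    qed
    \<comment> \<open>One of the two factors of the square is spread over the sites, so that each
      site can be decoupled against the other factor.\<close>
    have "y = \<nu> N M (\<lambda>\<sigma>. 1 / real N * (\<Sum>i\<in>{1..N}. (spin S i \<sigma> - ?q) * ?R \<sigma>))"
      unfolding y_def
    proof (rule sk_avg_cong)
      fix \<sigma> :: "nat \<Rightarrow> nat \<Rightarrow> real"
      have "1 / real N * (\<Sum>i\<in>{1..N}. spin S i \<sigma> - ?q) = ?R \<sigma>"
        using N by (simp add: sk_overlap_eq sum_subtractf diff_divide_distrib)
      then show "(?R \<sigma>)\<^sup>2 = 1 / real N * (\<Sum>i\<in>{1..N}. (spin S i \<sigma> - ?q) * ?R \<sigma>)"
        unfolding sum_distrib_right[symmetric] power2_eq_square mult.assoc[symmetric] by simp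
    qed
    also have "\<dots> = 1 / real N * (\<Sum>i\<in>{1..N}. \<nu> N M (\<lambda>\<sigma>. (spin S i \<sigma> - ?q) * ?R \<sigma>))"
      by (simp only: sk_avg_cmult sk_avg_sum)
    also have "\<dots> \<le> 1 / real N * (\<Sum>i\<in>{1..N}. 2 / real N + y / 2 + (2 * K\<^sup>2 * D + 2 * K * (1 + D)) / real N)"
      by (intro mult_left_mono sum_mono site) auto
    also have "\<dots> = 2 / real N + y / 2 + (2 * K\<^sup>2 * D + 2 * K * (1 + D)) / real N"
      using N by simp
    finally have "y \<le> 2 / real N + y / 2 + (2 * K\<^sup>2 * D + 2 * K * (1 + D)) / real N" .
    moreover have "y \<le> 2 * (a + b)" if "y \<le> a + y / 2 + b" for a b using that by simp
    ultimately have "y \<le> 2 * (2 / real N + (2 * K\<^sup>2 * D + 2 * K * (1 + D)) / real N)" by blast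
    also have "\<dots> = (4 + 4 * K\<^sup>2 * D + 4 * K * (1 + D)) / real N"
      unfolding add_divide_distrib[symmetric] times_divide_eq_right by (simp add: algebra_simps)
    finally have "y \<le> (4 + 4 * K\<^sup>2 * D + 4 * K * (1 + D)) / real N" .
    then show ?thesis unfolding y_def C_def .
  qed
  have "\<nu> N M' (\<lambda>\<sigma>. (sk_overlap N S \<sigma> - ?q)\<^sup>2) \<le> C / real N" if "N \<ge> 1" "M' \<ge> m" for N M'
  proof -
    have dep: "depends_on {1..m} (\<lambda>\<sigma>. (sk_overlap N S \<sigma> - ?q)\<^sup>2)"
      by (rule depends_on_compose[where h = "\<lambda>x. (x - ?q)\<^sup>2"]) (rule depends_on_sk_overlap[OF S])
    have "\<nu> N M' (\<lambda>\<sigma>. (sk_overlap N S \<sigma> - ?q)\<^sup>2) = \<nu> N M (\<lambda>\<sigma>. (sk_overlap N S \<sigma> - ?q)\<^sup>2)"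
      using sk_avg_marginal[OF _ _ dep, of "{1..M'}" N \<beta> h] sk_avg_marginal[OF _ _ dep, of "{1..M}" N \<beta> h] that
      by (simp add: M_def)
    then show ?thesis using main that by simp
  qed
  with C0 show ?thesis by blast
qed

text \<open>The overlap of two replicas concentrates at \<open>q\<close> by hypothesis and at
  \<open>qq 2\<close> by \<open>multi_overlap_moment\<close>, so the two agree. This is the
  fixed-point equation for \<open>q\<close>.\<close>

lemma q_eq_moment: "qq 2 = q"
proof (rule ccontr)
  assume ne: "qq 2 \<noteq> q"
  have "{1, 2 :: nat} \<subseteq> {1..2}" "card {1, 2 :: nat} = 2" by auto
  with multi_overlap_moment[of "{1, 2}" 2] obtain C where
    C: "0 \<le> C" "\<And>N. N \<ge> 1 \<Longrightarrow> \<nu> N 2 (\<lambda>\<sigma>. (sk_overlap N {1, 2} \<sigma> - qq 2)\<^sup>2) \<le> C / real N"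
    by (metis order_refl)
  have bound: "(qq 2 - q)\<^sup>2 \<le> (2 * C + 2 * L) / real N" if N: "N \<ge> 1" for N
  proof -
    let ?R = "sk_overlap N {1, 2}"
    have "(qq 2 - q)\<^sup>2 = \<nu> N 2 (\<lambda>_. (qq 2 - q)\<^sup>2)" by (simp add: sk_avg_const)
    also have "\<dots> \<le> \<nu> N 2 (\<lambda>\<sigma>. 2 * (?R \<sigma> - qq 2)\<^sup>2 + 2 * (?R \<sigma> - q)\<^sup>2)"
    proof (rule sk_avg_mono)
      fix \<sigma>
      show "(qq 2 - q)\<^sup>2 \<le> 2 * (?R \<sigma> - qq 2)\<^sup>2 + 2 * (?R \<sigma> - q)\<^sup>2"
        using zero_le_power2[of "(?R \<sigma> - qq 2) + (?R \<sigma> - q)"] by (simp add: power2_eq_square algebra_simps)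
    qed
    also have "\<dots> \<le> 2 * (C / real N) + 2 * (L / real N)"
      unfolding sk_avg_add sk_avg_cmult using C(2)[OF N] pair[OF N] by simp
    finally show ?thesis by (simp add: add_divide_distrib)
  qed
  have "(\<lambda>N. (2 * C + 2 * L) / real N) \<longlonglongrightarrow> 0" by (rule lim_const_over_n)
  then have "(qq 2 - q)\<^sup>2 \<le> 0"
    by (rule LIMSEQ_le_const) (use bound in blast)
  then show False using ne by simp
qed

end

subsection \<open>The cavity equation for test functions of the fluctuations\<close>

text \<open>The Taylor bounds carry explicit constants, so that all later errors are uniform over
  such pairs.\<close>

definition smooth_pair :: "(real \<Rightarrow> real) \<Rightarrow> (real \<Rightarrow> real) \<Rightarrow> bool" where
  "smooth_pair \<eta> \<eta>' \<longleftrightarrow> (\<forall>x. \<bar>\<eta> x\<bar> \<le> 1) \<and> (\<forall>x. \<bar>\<eta>' x\<bar> \<le> 1)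
     \<and> (\<forall>x y. \<bar>\<eta> y - \<eta> x\<bar> \<le> \<bar>y - x\<bar>) \<and> (\<forall>x y. \<bar>\<eta>' y - \<eta>' x\<bar> \<le> \<bar>y - x\<bar>)
     \<and> (\<forall>x y. \<bar>\<eta> y - \<eta> x - \<eta>' x * (y - x)\<bar> \<le> (y - x)\<^sup>2)"

lemma smooth_pairI:
  assumes deriv: "\<And>x. (\<eta> has_real_derivative \<eta>' x) (at x)" "\<And>x. (\<eta>' has_real_derivative \<eta>'' x) (at x)"
    and bound: "\<And>x. \<bar>\<eta> x\<bar> \<le> 1" "\<And>x. \<bar>\<eta>' x\<bar> \<le> 1" "\<And>x. \<bar>\<eta>'' x\<bar> \<le> 1"
  shows "smooth_pair \<eta> \<eta>'"
proof -
  have l1: "\<bar>\<eta> y - \<eta> x\<bar> \<le> \<bar>y - x\<bar>" for x y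
    using field_differentiable_bound[where S = UNIV and f = \<eta> and f' = \<eta>' and B = 1 and x = y and y = x] deriv bound by auto
  have l2: "\<bar>\<eta>' y - \<eta>' x\<bar> \<le> \<bar>y - x\<bar>" for x y
    using field_differentiable_bound[where S = UNIV and f = \<eta>' and f' = \<eta>'' and B = 1 and x = y and y = x] deriv bound by auto
  have l3: "\<bar>\<eta> y - \<eta> x - \<eta>' x * (y - x)\<bar> \<le> (y - x)\<^sup>2" for x y
  proof -
    define f where "f z = \<eta> z - \<eta>' x * z" for z
    have "norm (f y - f x) \<le> \<bar>y - x\<bar> * norm (y - x)"
    proof (rule field_differentiable_bound[where S = "closed_segment x y" and f = f and f' = "\<lambda>z. \<eta>' z - \<eta>' x"])
      fix z assume z: "z \<in> closed_segment x y"
      show "(f has_field_derivative \<eta>' z - \<eta>' x) (at z within closed_segment x y)"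
        unfolding f_def
        by (rule has_field_derivative_at_within) (auto intro!: derivative_eq_intros deriv)
      have "\<bar>z - x\<bar> \<le> \<bar>y - x\<bar>" using z by (auto simp: closed_segment_eq_real_ivl split: if_splits)
      then show "norm (\<eta>' z - \<eta>' x) \<le> \<bar>y - x\<bar>" using l2[of z x] by simp
    qed auto
    then show ?thesis by (simp add: f_def power2_eq_square algebra_simps)
  qed
  show ?thesis unfolding smooth_pair_def using bound l1 l2 l3 by blast
qed

lemma smooth_pair_cos: "smooth_pair cos (\<lambda>x. - sin x)"
  by (rule smooth_pairI[where \<eta>'' = "\<lambda>x. - cos x"]) (auto intro!: derivative_eq_intros)

lemma smooth_pair_sin: "smooth_pair sin cos"
  by (rule smooth_pairI[where \<eta>'' = "\<lambda>x. - sin x"]) (auto intro!: derivative_eq_intros)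

text \<open>Spins square to one, so replicas common to both sets drop out.\<close>

lemma spin_mult:
  assumes "\<sigma> \<in> PiE B (\<lambda>_. sk_configs N)" "V \<subseteq> B" "W \<subseteq> B" "finite B" "i \<in> {1..N}"
  shows "spin W i \<sigma> * spin V i \<sigma> = spin (sym_diff W V) i \<sigma>"
proof -
  have fin: "finite V" "finite W" using assms finite_subset by blast+
  have sq: "spin (W \<inter> V) i \<sigma> * spin (W \<inter> V) i \<sigma> = 1"
    using abs_spin[OF assms(1), of "W \<inter> V" i] assms by (metis abs_mult_self_eq mult_1 Int_lower1 order_trans)
  have "spin W i \<sigma> = spin (W - V) i \<sigma> * spin (W \<inter> V) i \<sigma>"
    unfolding spin_def using fin
    by (subst prod.union_disjoint[symmetric]) (auto intro!: prod.cong)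
  moreover have "spin V i \<sigma> = spin (V - W) i \<sigma> * spin (W \<inter> V) i \<sigma>"
    unfolding spin_def using fin
    by (subst prod.union_disjoint[symmetric]) (auto intro!: prod.cong)
  moreover have "spin (sym_diff W V) i \<sigma> = spin (W - V) i \<sigma> * spin (V - W) i \<sigma>"
    unfolding spin_def using fin by (subst prod.union_disjoint[symmetric]) auto
  ultimately show ?thesis using sq by (simp add: mult_ac)
qed

lemma pairs_form_cmult: "pairs_form m (\<lambda>l l'. c * Y l l') = c * pairs_form m Y"
  by (simp add: pairs_form_def sum_distrib_left algebra_simps)

lemma pairs_form_diff: "pairs_form m (\<lambda>l l'. Y l l' - Z l l') = pairs_form m Y - pairs_form m Z"
  by (simp add: pairs_form_def sum_subtractf algebra_simps)

text \<open>The bound \<open>abs_pairs_form_le\<close> with \<open>d = 0\<close>, applied to the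
  difference; the form contains only pairs of distinct replicas.\<close>

lemma pairs_form_cong:
  assumes "\<And>l l'. l \<in> {1..m + 2} \<Longrightarrow> l' \<in> {1..m + 2} \<Longrightarrow> l \<noteq> l' \<Longrightarrow> Y l l' = Z l l'"
  shows "pairs_form m Y = pairs_form m Z"
proof -
  have "\<bar>pairs_form m (\<lambda>l l'. Y l l' - Z l l')\<bar> \<le> pairs_const m * 0"
    by (rule abs_pairs_form_le) (simp_all add: assms)
  then show ?thesis by (simp add: pairs_form_diff)
qed

lemma cavity_avg_pairs_form:
  "cavity_avg N i \<beta> h q B \<theta> (\<lambda>\<sigma>. pairs_form m (\<lambda>l l'. Y l l' \<sigma>))
    = pairs_form m (\<lambda>l l'. cavity_avg N i \<beta> h q B \<theta> (Y l l'))"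
  unfolding pairs_form_def
  by (simp only: cavity_avg_add cavity_avg_diff cavity_avg_cmult cavity_avg_sum)

context high_temperature
begin

definition fluct :: "nat \<Rightarrow> nat \<Rightarrow> (nat set \<Rightarrow> real) \<Rightarrow> (nat \<Rightarrow> nat \<Rightarrow> real) \<Rightarrow> real" where
  "fluct N n t \<sigma> = (\<Sum>S\<in>Pow {1..n}. t S * (sqrt (real N) * (sk_overlap N S \<sigma> - qq (card S))))"

text \<open>Covariance, at the decoupled site, of the spin product over \<open>W\<close> with the
  contribution of that site to the fluctuation. \<open>link_coeff\<close> is the same covariance for
  a single pair of distinct replicas.\<close>

definition source :: "nat \<Rightarrow> (nat set \<Rightarrow> real) \<Rightarrow> nat set \<Rightarrow> real" where
  "source n t W = (\<Sum>S\<in>Pow {1..n}. t S * (qq (card (sym_diff W S)) - qq (card W) * qq (card S)))"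

definition link_coeff :: "nat set \<Rightarrow> nat \<Rightarrow> nat \<Rightarrow> real" where
  "link_coeff W l l' = qq (card (sym_diff W {l, l'})) - qq (card W) * qq 2"

definition dev_const :: "nat \<Rightarrow> real" where
  "dev_const m = (real (m + 4))^4 * (2 * L + 2)"

definition first_const :: "nat \<Rightarrow> real" where
  "first_const m = 2 * \<beta>\<^sup>2 * pairs_const m * gronwall_const \<beta> q (m + 2)"

definition second_const :: "nat \<Rightarrow> real" where
  "second_const m = 4 * \<beta>\<^sup>2 * \<beta>\<^sup>2 * pairs_const (m + 2) * gronwall_const \<beta> q (m + 4) * pairs_const m"

text \<open>The errors of \<open>step_taylor\<close>, \<open>step_source\<close> and
  \<open>step_pairs\<close>, in this order.\<close>

definition stein_const :: "nat \<Rightarrow> real \<Rightarrow> real" where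
  "stein_const m T = 2 * T\<^sup>2 + (2 * T * (first_const m * (dev_const m + 1))
     + 2 * T * (first_const m * (dev_const m + 1) + T))
     + (2 * second_const m * dev_const m
     + \<beta>\<^sup>2 / 2 * (pairs_const m * (2 * (first_const (m + 2) * dev_const m + (1 + T * (L + 1))))))"

lemma const_nonneg: "0 \<le> dev_const m" "0 \<le> first_const m" "0 \<le> second_const m"
  using L_nonneg
  by (simp_all add: dev_const_def first_const_def second_const_def pairs_const_nonneg gronwall_const_nonneg)

end

section \<open>The cavity equation at a single site\<close>

locale stein_site = high_temperature +
  fixes N i n m :: nat and T :: real and t :: "nat set \<Rightarrow> real" and \<eta> \<eta>' :: "real \<Rightarrow> real" and W :: "nat set"
  assumes site: "i \<in> {1..N}" and nm: "n \<le> m" and W: "W \<subseteq> {1..m}"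
    and T: "(\<Sum>S\<in>Pow {1..n}. \<bar>t S\<bar>) \<le> T" and smooth: "smooth_pair \<eta> \<eta>'"
begin

abbreviation M where "M \<equiv> m + 6"

sublocale cav: cavity N i M \<beta> h q
  by standard (use site q_nonneg in auto)

text \<open>The share of site \<open>i\<close> in the fluctuation, on scale one:
  \<open>\<Theta>\<close> is \<open>\<Theta>c\<close> plus \<open>\<delta> / sqrt N\<close>, and
  \<open>\<Theta>c\<close> factors out at angle 0 because it does not involve site
  \<open>i\<close>.\<close>

definition \<delta> where "\<delta> \<sigma> = (\<Sum>S\<in>Pow {1..n}. t S * spin S i \<sigma>)"
definition \<Theta>c where
  "\<Theta>c \<sigma> = (\<Sum>S\<in>Pow {1..n}. t S * (sqrt (real N) * (cavity_overlap N i S \<sigma> - qq (card S))))"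
abbreviation \<Theta> where "\<Theta> \<equiv> fluct N n t"
abbreviation sw where "sw \<sigma> \<equiv> spin W i \<sigma> - qq (card W)"
abbreviation cfg where "cfg \<equiv> PiE {1..M} (\<lambda>_. sk_configs N)"

lemma N1: "N \<ge> 1" using site by auto
lemma sqrtN: "sqrt (real N) > 0" "sqrt (real N) * sqrt (real N) = real N" "real N > 0" using N1 by auto
lemma T0: "0 \<le> T"
  by (rule order_trans[OF _ T]) (simp add: sum_nonneg)

lemma \<eta>_bounds: "\<bar>\<eta> x\<bar> \<le> 1" "\<bar>\<eta>' x\<bar> \<le> 1" "\<bar>\<eta> y - \<eta> x\<bar> \<le> \<bar>y - x\<bar>" "\<bar>\<eta>' y - \<eta>' x\<bar> \<le> \<bar>y - x\<bar>"
    "\<bar>\<eta> y - \<eta> x - \<eta>' x * (y - x)\<bar> \<le> (y - x)\<^sup>2"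
  using smooth unfolding smooth_pair_def by blast+

lemma \<Theta>_eq: "\<Theta> \<sigma> = \<Theta>c \<sigma> + \<delta> \<sigma> / sqrt (real N)"
proof -
  have *: "sqrt (real N) * (x / real N) = x / sqrt (real N)" for x :: real
    using sqrtN by (simp add: field_simps)
  show ?thesis unfolding fluct_def \<Theta>c_def \<delta>_def sum_divide_distrib sum.distrib[symmetric]
  proof (intro sum.cong refl)
    fix S
    have "t S * (sqrt (real N) * (sk_overlap N S \<sigma> - qq (card S)))
      = t S * (sqrt (real N) * (cavity_overlap N i S \<sigma> - qq (card S)))
        + t S * (sqrt (real N) * (spin S i \<sigma> / real N))"
      unfolding sk_overlap_cavity[OF site] by (simp add: algebra_simps)
    then show "t S * (sqrt (real N) * (sk_overlap N S \<sigma> - qq (card S)))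
      = t S * (sqrt (real N) * (cavity_overlap N i S \<sigma> - qq (card S)))
        + t S * spin S i \<sigma> / sqrt (real N)"
      by (simp only: *) simp
  qed
qed

lemma SM: "S \<in> Pow {1..n} \<Longrightarrow> S \<subseteq> {1..M}" "W \<subseteq> {1..M}"
  using nm W by auto

lemma \<delta>_le: "\<sigma> \<in> cfg \<Longrightarrow> \<bar>\<delta> \<sigma>\<bar> \<le> T"
proof -
  assume \<sigma>: "\<sigma> \<in> cfg"
  have "\<bar>\<delta> \<sigma>\<bar> \<le> (\<Sum>S\<in>Pow {1..n}. \<bar>t S\<bar>)"
    unfolding \<delta>_def
    by (rule order_trans[OF sum_abs sum_mono])
       (simp only: abs_mult abs_spin[OF \<sigma> SM(1) site] mult_1_right order_refl)
  then show ?thesis using T by simp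
qed

lemma \<Theta>_diff_le: "\<sigma> \<in> cfg \<Longrightarrow> \<bar>\<Theta> \<sigma> - \<Theta>c \<sigma>\<bar> \<le> T / sqrt (real N)"
  using \<delta>_le[of \<sigma>] sqrtN by (simp add: \<Theta>_eq divide_right_mono)

lemma sw_le: "\<sigma> \<in> cfg \<Longrightarrow> \<bar>sw \<sigma>\<bar> \<le> 2"
  using abs_spin[OF _ SM(2) site, of \<sigma>] abs_tanh_moment_le[of \<beta> h q "card W"] by linarith

lemma depends_\<Theta>c: "depends_on {1..m} \<Theta>c"
  unfolding \<Theta>c_def[abs_def] using nm
  by (intro depends_on_sum depends_on_compose[where h = "\<lambda>x. t S * (sqrt (real N) * (x - qq (card S)))" for S]
        depends_on_cavity_overlap) auto

lemma depends_\<delta>: "depends_on {1..m} \<delta>"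
  unfolding \<delta>_def[abs_def] using nm
  by (intro depends_on_sum depends_on_compose[where h = "\<lambda>x. t S * x" for S] depends_on_spin) auto

lemma site_free_\<Theta>c: "site_free i B \<Theta>c"
  unfolding \<Theta>c_def[abs_def]
  by (intro site_free_sum site_free_compose[where f = "\<lambda>x. t S * (sqrt (real N) * (x - qq (card S)))" for S]
        site_free_cavity_overlap)

lemma dev_first: "\<nu> N M (cav.dev (m + 2)) \<le> (dev_const m + 1) / sqrt (real N)"
proof -
  have "\<nu> N M (\<lambda>\<sigma>. (cav.dev (m + 2) \<sigma>)\<^sup>2) \<le> dev_const m / real N"
    using dev_prod_moment[of "m + 2" M "m + 2" "m + 4" i N] site
    by (simp add: dev_const_def power2_eq_square)
  from first_moment_le[OF N1 this] show ?thesis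
    by (simp add: cavity_dev_nonneg)
qed

lemma dev_second: "\<nu> N M (\<lambda>\<sigma>. cav.dev (m + 2) \<sigma> * cav.dev (m + 4) \<sigma>) \<le> dev_const m / real N"
    "\<nu> N M (\<lambda>\<sigma>. cav.dev (m + 4) \<sigma> * cav.dev (m + 4) \<sigma>) \<le> dev_const m / real N"
  unfolding dev_const_def by (rule dev_prod_moment; use site in auto)+

lemma link_coeff_le: "\<bar>link_coeff V l l'\<bar> \<le> 2"
  unfolding link_coeff_def
  using abs_tanh_moment_le[of \<beta> h q "card (sym_diff V {l, l'})"]
    mult_mono[OF abs_tanh_moment_le[of \<beta> h q "card V"] abs_tanh_moment_le[of \<beta> h q 2]]
  by (simp add: abs_mult[symmetric])

lemma source_le: "\<bar>source n t W\<bar> \<le> 2 * T"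
proof -
  have "\<bar>source n t W\<bar> \<le> (\<Sum>S\<in>Pow {1..n}. \<bar>t S\<bar> * 2)"
    unfolding source_def
  proof (rule order_trans[OF sum_abs sum_mono])
    fix S
    have "\<bar>qq (card (sym_diff W S)) - qq (card W) * qq (card S)\<bar> \<le> 2"
      using abs_tanh_moment_le[of \<beta> h q "card (sym_diff W S)"]
        mult_mono[OF abs_tanh_moment_le[of \<beta> h q "card W"] abs_tanh_moment_le[of \<beta> h q "card S"]]
      by (simp add: abs_mult[symmetric])
    then show "\<bar>t S * (qq (card (sym_diff W S)) - qq (card W) * qq (card S))\<bar> \<le> \<bar>t S\<bar> * 2"
      unfolding abs_mult by (intro mult_left_mono) auto
  qed
  then show ?thesis using T by (simp add: sum_distrib_right[symmetric])
qed

text \<open>Takes site \<open>i\<close> out of the argument of \<open>\<eta>\<close>. The increment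
  is \<open>\<delta> / sqrt N\<close>, so the linear term survives the factor \<open>sqrt N\<close>
  and the quadratic remainder is of order \<open>1 / sqrt N\<close>.\<close>

lemma step_taylor:
  "\<bar>sqrt (real N) * \<nu> N M (\<lambda>\<sigma>. sw \<sigma> * \<eta> (\<Theta> \<sigma>)) - sqrt (real N) * \<nu> N M (\<lambda>\<sigma>. sw \<sigma> * \<eta> (\<Theta>c \<sigma>))
     - \<nu> N M (\<lambda>\<sigma>. sw \<sigma> * \<delta> \<sigma> * \<eta>' (\<Theta>c \<sigma>))\<bar> \<le> 2 * T\<^sup>2 / sqrt (real N)"
proof -
  have "\<bar>\<nu> N M (\<lambda>\<sigma>. sqrt (real N) * (sw \<sigma> * \<eta> (\<Theta> \<sigma>)) - sqrt (real N) * (sw \<sigma> * \<eta> (\<Theta>c \<sigma>))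
     - sw \<sigma> * \<delta> \<sigma> * \<eta>' (\<Theta>c \<sigma>))\<bar> \<le> \<nu> N M (\<lambda>_. 2 * T\<^sup>2 / sqrt (real N))"
  proof (rule sk_avg_abs_mono)
    fix \<sigma> assume \<sigma>: "\<sigma> \<in> cfg"
    let ?x = "\<Theta>c \<sigma>" and ?y = "\<Theta> \<sigma>"
    have d: "\<delta> \<sigma> = sqrt (real N) * (?y - ?x)" using sqrtN by (simp add: \<Theta>_eq)
    have "sqrt (real N) * (sw \<sigma> * \<eta> ?y) - sqrt (real N) * (sw \<sigma> * \<eta> ?x) - sw \<sigma> * \<delta> \<sigma> * \<eta>' ?x
       = sqrt (real N) * (sw \<sigma> * (\<eta> ?y - \<eta> ?x - \<eta>' ?x * (?y - ?x)))"
      unfolding d by (simp add: algebra_simps)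
    also have "\<bar>\<dots>\<bar> \<le> sqrt (real N) * (2 * (T\<^sup>2 / real N))"
    proof -
      have "\<bar>?y - ?x\<bar>\<^sup>2 \<le> (T / sqrt (real N))\<^sup>2"
        by (rule power_mono[OF \<Theta>_diff_le[OF \<sigma>]]) simp
      then have "\<bar>\<eta> ?y - \<eta> ?x - \<eta>' ?x * (?y - ?x)\<bar> \<le> T\<^sup>2 / real N"
        using \<eta>_bounds(5)[of ?y ?x] by (simp add: power_divide)
      then show ?thesis unfolding abs_mult using sw_le[OF \<sigma>]
        by (intro mult_mono) auto
    qed
    also have "\<dots> = 2 * T\<^sup>2 / sqrt (real N)" using sqrtN by (simp add: field_simps)
    finally show "\<bar>sqrt (real N) * (sw \<sigma> * \<eta> ?y) - sqrt (real N) * (sw \<sigma> * \<eta> ?x) - sw \<sigma> * \<delta> \<sigma> * \<eta>' ?x\<bar>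
       \<le> 2 * T\<^sup>2 / sqrt (real N)" .
  qed
  then show ?thesis by (simp add: sk_avg_diff sk_avg_cmult sk_avg_const)
qed

lemma E_zero_spin:
  assumes "V \<subseteq> {1..M}" "site_free i {1..M} G"
  shows "cav.E 0 (\<lambda>\<sigma>. sw \<sigma> * spin V i \<sigma> * G \<sigma>)
    = (qq (card (sym_diff W V)) - qq (card W) * qq (card V)) * cav.E 0 G"
proof -
  have "cav.E 0 (\<lambda>\<sigma>. sw \<sigma> * spin V i \<sigma> * G \<sigma>)
     = cav.E 0 (\<lambda>\<sigma>. spin (sym_diff W V) i \<sigma> * G \<sigma> - qq (card W) * (spin V i \<sigma> * G \<sigma>))"
    by (rule cavity_avg_cong)
       (simp add: spin_mult[OF _ assms(1) SM(2) _ site, symmetric] algebra_simps)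
  also have "\<dots> = qq (card (sym_diff W V)) * cav.E 0 G - qq (card W) * (qq (card V) * cav.E 0 G)"
  proof -
    have "sym_diff W V \<subseteq> {1..M}" using assms(1) SM(2) by blast
    note * = cavity_avg_zero_factor[OF site finite_atLeastAtMost this assms(2)]
      cavity_avg_zero_factor[OF site finite_atLeastAtMost assms(1,2)]
    show ?thesis by (simp only: cavity_avg_diff cavity_avg_cmult *)
  qed
  finally show ?thesis by (simp add: algebra_simps)
qed

text \<open>No factor \<open>sqrt N\<close> is left, so the first-order expansion suffices. At angle
  0 the spins of the site factor out and produce \<open>source\<close>.\<close>

lemma step_source:
  "\<bar>\<nu> N M (\<lambda>\<sigma>. sw \<sigma> * \<delta> \<sigma> * \<eta>' (\<Theta>c \<sigma>)) - source n t W * \<nu> N M (\<lambda>\<sigma>. \<eta>' (\<Theta> \<sigma>))\<bar>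
    \<le> (2 * T * (first_const m * (dev_const m + 1)) + 2 * T * (first_const m * (dev_const m + 1) + T)) / sqrt (real N)"
proof -
  let ?H = "\<lambda>\<sigma>. sw \<sigma> * \<delta> \<sigma> * \<eta>' (\<Theta>c \<sigma>)" and ?G = "\<lambda>\<sigma>. \<eta>' (\<Theta>c \<sigma>)"
  let ?K = "first_const m" and ?d = "cav.dev (m + 2)" and ?D = "(dev_const m + 1) / sqrt (real N)"
  have K: "0 \<le> ?K" by (rule const_nonneg)
  have E0: "cav.E 0 ?H = source n t W * cav.E 0 ?G"
  proof -
    have "?H = (\<lambda>\<sigma>. \<Sum>S\<in>Pow {1..n}. t S * (sw \<sigma> * spin S i \<sigma> * ?G \<sigma>))"
      by (auto simp: \<delta>_def sum_distrib_left sum_distrib_right mult_ac)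
    then have "cav.E 0 ?H = (\<Sum>S\<in>Pow {1..n}. t S * cav.E 0 (\<lambda>\<sigma>. sw \<sigma> * spin S i \<sigma> * ?G \<sigma>))"
      by (simp only: cavity_avg_sum cavity_avg_cmult)
    also have "\<dots> = (\<Sum>S\<in>Pow {1..n}. t S * ((qq (card (sym_diff W S)) - qq (card W) * qq (card S)) * cav.E 0 ?G))"
      by (intro sum.cong refl arg_cong2[where f = "(*)"] E_zero_spin SM site_free_compose[OF site_free_\<Theta>c])
    finally show ?thesis unfolding source_def sum_distrib_right mult.assoc .
  qed
  have bd: "\<nu> N M (\<lambda>\<sigma>. \<bar>F \<sigma>\<bar> * ?d \<sigma>) \<le> c * ?D" if "\<And>\<sigma>. \<sigma> \<in> cfg \<Longrightarrow> \<bar>F \<sigma>\<bar> \<le> c" "0 \<le> c" for F c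
  proof -
    have "\<nu> N M (\<lambda>\<sigma>. \<bar>F \<sigma>\<bar> * ?d \<sigma>) \<le> \<nu> N M (\<lambda>\<sigma>. c * ?d \<sigma>)"
      by (intro sk_avg_mono mult_right_mono that cavity_dev_nonneg)
    also have "\<dots> \<le> c * ?D" unfolding sk_avg_cmult by (intro mult_left_mono dev_first that)
    finally show ?thesis .
  qed
  have fo: "\<bar>\<nu> N M F - cav.E 0 F\<bar> \<le> ?K * (c * ?D)"
    if "depends_on {1..m} F" "\<And>\<sigma>. \<sigma> \<in> cfg \<Longrightarrow> \<bar>F \<sigma>\<bar> \<le> c" "0 \<le> c" for F c
  proof -
    have "\<bar>cav.E (pi / 2) F - cav.E 0 F\<bar> \<le> ?K * \<nu> N M (\<lambda>\<sigma>. \<bar>F \<sigma>\<bar> * ?d \<sigma>)"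
      unfolding first_const_def by (rule cav.E_first_order[OF that(1)]) auto
    also have "\<dots> \<le> ?K * (c * ?D)" by (intro mult_left_mono bd that K)
    finally show ?thesis unfolding cav.E_pi_half .
  qed
  have h: "\<bar>\<nu> N M ?H - source n t W * cav.E 0 ?G\<bar> \<le> ?K * (2 * T * ?D)"
    unfolding E0[symmetric]
  proof (rule fo)
    show "depends_on {1..m} ?H"
      by (rule depends_on_compose2[where h = "\<lambda>x y. x * \<eta>' y"], rule depends_on_compose2[where h = "\<lambda>x y. (x - qq (card W)) * y"])
         (rule depends_on_spin[OF W] depends_\<delta> depends_\<Theta>c)+
    fix \<sigma> assume \<sigma>: "\<sigma> \<in> cfg"
    have "\<bar>?H \<sigma>\<bar> \<le> 2 * T * 1" unfolding abs_mult
      by (intro mult_mono sw_le \<sigma> \<delta>_le \<eta>_bounds) (use T0 in auto)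
    then show "\<bar>?H \<sigma>\<bar> \<le> 2 * T" by simp
  qed (use T0 in simp)
  have g: "\<bar>\<nu> N M ?G - cav.E 0 ?G\<bar> \<le> ?K * (1 * ?D)"
    by (rule fo[OF depends_on_compose[OF depends_\<Theta>c]]) (auto intro: \<eta>_bounds)
  have g2: "\<bar>\<nu> N M (\<lambda>\<sigma>. ?G \<sigma> - \<eta>' (\<Theta> \<sigma>))\<bar> \<le> \<nu> N M (\<lambda>_. T / sqrt (real N))"
  proof (rule sk_avg_abs_mono)
    fix \<sigma> assume "\<sigma> \<in> cfg"
    then show "\<bar>?G \<sigma> - \<eta>' (\<Theta> \<sigma>)\<bar> \<le> T / sqrt (real N)"
      using \<eta>_bounds(4)[of "\<Theta>c \<sigma>" "\<Theta> \<sigma>"] \<Theta>_diff_le[of \<sigma>] by linarith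
  qed
  then have g2: "\<bar>\<nu> N M ?G - \<nu> N M (\<lambda>\<sigma>. \<eta>' (\<Theta> \<sigma>))\<bar> \<le> T / sqrt (real N)"
    by (simp add: sk_avg_diff sk_avg_const)
  have "\<bar>source n t W * cav.E 0 ?G - source n t W * \<nu> N M (\<lambda>\<sigma>. \<eta>' (\<Theta> \<sigma>))\<bar>
      \<le> 2 * T * (?K * ?D + T / sqrt (real N))"
    unfolding right_diff_distrib[symmetric] abs_mult
    by (intro mult_mono source_le) (use g g2 T0 in auto)
  with h have "\<bar>\<nu> N M ?H - source n t W * \<nu> N M (\<lambda>\<sigma>. \<eta>' (\<Theta> \<sigma>))\<bar>
     \<le> ?K * (2 * T * ?D) + 2 * T * (?K * ?D + T / sqrt (real N))" by linarith
  also have "\<dots> = (2 * T * (?K * (dev_const m + 1)) + 2 * T * (?K * (dev_const m + 1) + T)) / sqrt (real N)"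
    by (simp add: add_divide_distrib distrib_left mult_ac)
  finally show ?thesis .
qed

text \<open>The factor \<open>sqrt N\<close> forces a second-order expansion. The term at angle 0
  vanishes because \<open>sw\<close> is centred there, and the derivative term produces the links
  with coefficients \<open>link_coeff\<close>.\<close>

lemma step_pairs:
  "\<bar>sqrt (real N) * \<nu> N M (\<lambda>\<sigma>. sw \<sigma> * \<eta> (\<Theta>c \<sigma>))
     - \<beta>\<^sup>2 / 2 * pairs_form m (\<lambda>l l'. link_coeff W l l' *
        (sqrt (real N) * \<nu> N M (\<lambda>\<sigma>. (sk_overlap N {l, l'} \<sigma> - q) * \<eta> (\<Theta> \<sigma>))))\<bar>
   \<le> (2 * second_const m * dev_const m
     + \<beta>\<^sup>2 / 2 * (pairs_const m * (2 * (first_const (m + 2) * dev_const m + (1 + T * (L + 1)))))) / sqrt (real N)"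
proof -
  let ?F = "\<lambda>\<sigma>. sw \<sigma> * \<eta> (\<Theta>c \<sigma>)" and ?s = "sqrt (real N)"
  let ?g = "\<lambda>l l' \<sigma>. (cavity_overlap N i {l, l'} \<sigma> - q) * \<eta> (\<Theta>c \<sigma>)"
  let ?r = "\<lambda>l l' \<sigma>. (sk_overlap N {l, l'} \<sigma> - q) * \<eta> (\<Theta> \<sigma>)"
  define c4 where "c4 = first_const (m + 2) * dev_const m + (1 + T * (L + 1))"
  have sf: "site_free i {1..M} (\<lambda>\<sigma>. \<eta> (\<Theta>c \<sigma>))" by (rule site_free_compose[OF site_free_\<Theta>c])
  have depF: "depends_on {1..m} ?F"
    by (rule depends_on_compose2[where h = "\<lambda>x y. (x - qq (card W)) * \<eta> y"])
       (rule depends_on_spin[OF W] depends_\<Theta>c)+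
  have E0: "cav.E 0 ?F = 0"
    using E_zero_spin[OF empty_subsetI sf] by (simp add: spin_def)
  have pf: "cav.E 0 (\<lambda>\<sigma>. ?F \<sigma> * cav.pairs m \<sigma>) = pairs_form m (\<lambda>l l'. link_coeff W l l' * cav.E 0 (?g l l'))"
  proof -
    have "cav.E 0 (\<lambda>\<sigma>. ?F \<sigma> * cav.pairs m \<sigma>) = pairs_form m (\<lambda>l l'. cav.E 0 (\<lambda>\<sigma>. ?F \<sigma> * cavity_link N i q l l' \<sigma>))"
      unfolding cavity_pairs_eq_pairs_form pairs_form_cmult[symmetric] cavity_avg_pairs_form ..
    also have "\<dots> = pairs_form m (\<lambda>l l'. link_coeff W l l' * cav.E 0 (?g l l'))"
    proof (rule pairs_form_cong)
      fix l l' :: nat assume l: "l \<in> {1..m + 2}" "l' \<in> {1..m + 2}" "l \<noteq> l'"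
      have "cav.E 0 (\<lambda>\<sigma>. ?F \<sigma> * cavity_link N i q l l' \<sigma>) = cav.E 0 (\<lambda>\<sigma>. sw \<sigma> * spin {l, l'} i \<sigma> * ?g l l' \<sigma>)"
        by (rule cavity_avg_cong) (simp add: cavity_link_def mult_ac)
      also have "\<dots> = (qq (card (sym_diff W {l, l'})) - qq (card W) * qq (card {l, l'})) * cav.E 0 (?g l l')"
        by (rule E_zero_spin[OF _ site_free_compose2[where f = "\<lambda>x y. (x - q) * y", OF site_free_cavity_overlap sf]])
           (use l in auto)
      finally show "cav.E 0 (\<lambda>\<sigma>. ?F \<sigma> * cavity_link N i q l l' \<sigma>) = link_coeff W l l' * cav.E 0 (?g l l')"
        using l by (simp add: link_coeff_def numeral_2_eq_2)
    qed
    finally show ?thesis .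
  qed
  have so: "\<bar>\<nu> N M ?F - \<beta>\<^sup>2 / 2 * pairs_form m (\<lambda>l l'. link_coeff W l l' * cav.E 0 (?g l l'))\<bar>
     \<le> second_const m * (2 * (dev_const m / real N))"
  proof -
    have "\<bar>\<nu> N M ?F - cav.E 0 ?F - \<beta>\<^sup>2 / 2 * cav.E 0 (\<lambda>\<sigma>. ?F \<sigma> * cav.pairs m \<sigma>)\<bar>
      \<le> second_const m * \<nu> N M (\<lambda>\<sigma>. \<bar>?F \<sigma>\<bar> * cav.dev (m + 2) \<sigma> * cav.dev (m + 4) \<sigma>)"
      unfolding second_const_def by (rule cav.E_second_order[OF depF]) simp
    also have "\<dots> \<le> second_const m * (2 * (dev_const m / real N))"
    proof (rule mult_left_mono[OF _ const_nonneg(3)])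
      have "\<nu> N M (\<lambda>\<sigma>. \<bar>?F \<sigma>\<bar> * cav.dev (m + 2) \<sigma> * cav.dev (m + 4) \<sigma>)
         \<le> \<nu> N M (\<lambda>\<sigma>. 2 * (cav.dev (m + 2) \<sigma> * cav.dev (m + 4) \<sigma>))"
      proof (rule sk_avg_mono)
        fix \<sigma> assume \<sigma>: "\<sigma> \<in> cfg"
        have "\<bar>?F \<sigma>\<bar> \<le> 2 * 1" unfolding abs_mult
          by (intro mult_mono sw_le \<sigma> \<eta>_bounds) auto
        then show "\<bar>?F \<sigma>\<bar> * cav.dev (m + 2) \<sigma> * cav.dev (m + 4) \<sigma> \<le> 2 * (cav.dev (m + 2) \<sigma> * cav.dev (m + 4) \<sigma>)"
          unfolding mult.assoc by (intro mult_right_mono mult_nonneg_nonneg cavity_dev_nonneg) simp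
      qed
      also have "\<dots> \<le> 2 * (dev_const m / real N)"
        unfolding sk_avg_cmult by (intro mult_left_mono dev_second) simp
      finally show "\<nu> N M (\<lambda>\<sigma>. \<bar>?F \<sigma>\<bar> * cav.dev (m + 2) \<sigma> * cav.dev (m + 4) \<sigma>) \<le> 2 * (dev_const m / real N)" .
    qed
    finally show ?thesis unfolding E0 pf by simp
  qed
  \<comment> \<open>The overlap deviation is itself of order \<open>1 / sqrt N\<close>, so passing
    from angle 0 to the model and restoring site \<open>i\<close> costs only a multiple of
    \<open>1 / N\<close>.\<close>
  have link: "\<bar>cav.E 0 (?g l l') - \<nu> N M (?r l l')\<bar> \<le> c4 / real N"
    if l: "l \<in> {1..m + 2}" "l' \<in> {1..m + 2}" "l \<noteq> l'" for l l'
  proof -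
    have "\<bar>cav.E (pi / 2) (?g l l') - cav.E 0 (?g l l')\<bar>
       \<le> first_const (m + 2) * \<nu> N M (\<lambda>\<sigma>. \<bar>?g l l' \<sigma>\<bar> * cav.dev (m + 2 + 2) \<sigma>)"
      unfolding first_const_def
    proof (rule cav.E_first_order)
      show "depends_on {1..m + 2} (?g l l')"
        by (rule depends_on_compose2[where h = "\<lambda>x y. (x - q) * \<eta> y"])
           (use l in \<open>auto intro!: depends_on_cavity_overlap depends_on_mono[OF depends_\<Theta>c]\<close>)
    qed auto
    also have "m + 2 + 2 = m + 4" by simp
    also have "first_const (m + 2) * \<nu> N M (\<lambda>\<sigma>. \<bar>?g l l' \<sigma>\<bar> * cav.dev (m + 4) \<sigma>)
       \<le> first_const (m + 2) * (dev_const m / real N)"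
    proof (rule mult_left_mono[OF _ const_nonneg(2)])
      have "\<nu> N M (\<lambda>\<sigma>. \<bar>?g l l' \<sigma>\<bar> * cav.dev (m + 4) \<sigma>) \<le> \<nu> N M (\<lambda>\<sigma>. cav.dev (m + 4) \<sigma> * cav.dev (m + 4) \<sigma>)"
      proof (intro sk_avg_mono mult_right_mono cavity_dev_nonneg)
        fix \<sigma> :: "nat \<Rightarrow> nat \<Rightarrow> real"
        have "\<bar>?g l l' \<sigma>\<bar> \<le> \<bar>cavity_overlap N i {l, l'} \<sigma> - q\<bar> * 1"
          unfolding abs_mult by (intro mult_left_mono \<eta>_bounds) simp
        also have "\<dots> \<le> cav.dev (m + 4) \<sigma>" using cavity_dev_ge[of l "m + 4" l' N i \<sigma> q] l by simp
        finally show "\<bar>?g l l' \<sigma>\<bar> \<le> cav.dev (m + 4) \<sigma>" .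
      qed
      also note dev_second(2)
      finally show "\<nu> N M (\<lambda>\<sigma>. \<bar>?g l l' \<sigma>\<bar> * cav.dev (m + 4) \<sigma>) \<le> dev_const m / real N" .
    qed
    finally have a: "\<bar>\<nu> N M (?g l l') - cav.E 0 (?g l l')\<bar> \<le> first_const (m + 2) * (dev_const m / real N)"
      unfolding cav.E_pi_half .
    have "\<bar>\<nu> N M (\<lambda>\<sigma>. ?g l l' \<sigma> - ?r l l' \<sigma>)\<bar>
      \<le> \<nu> N M (\<lambda>\<sigma>. 1 / real N + T / ?s * \<bar>sk_overlap N {l, l'} \<sigma> - q\<bar>)"
    proof (rule sk_avg_abs_mono)
      fix \<sigma> assume \<sigma>: "\<sigma> \<in> cfg"
      let ?R = "sk_overlap N {l, l'} \<sigma> - q" and ?e = "spin {l, l'} i \<sigma> / real N"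
      have e: "\<bar>?e\<bar> = 1 / real N" using abs_spin[OF \<sigma>, of "{l, l'}" i] site l by simp
      have "?g l l' \<sigma> - ?r l l' \<sigma> = - ?e * \<eta> (\<Theta>c \<sigma>) + ?R * (\<eta> (\<Theta>c \<sigma>) - \<eta> (\<Theta> \<sigma>))"
        unfolding sk_overlap_cavity[OF site] by (simp add: algebra_simps)
      also have "\<bar>\<dots>\<bar> \<le> \<bar>?e\<bar> * \<bar>\<eta> (\<Theta>c \<sigma>)\<bar> + \<bar>?R\<bar> * \<bar>\<eta> (\<Theta>c \<sigma>) - \<eta> (\<Theta> \<sigma>)\<bar>"
        by (rule order_trans[OF abs_triangle_ineq]) (simp add: abs_mult)
      also have "\<dots> \<le> 1 / real N * 1 + \<bar>?R\<bar> * (T / ?s)"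
      proof (intro add_mono mult_mono)
        show "\<bar>\<eta> (\<Theta>c \<sigma>) - \<eta> (\<Theta> \<sigma>)\<bar> \<le> T / ?s"
          using \<eta>_bounds(3)[of "\<Theta>c \<sigma>" "\<Theta> \<sigma>"] \<Theta>_diff_le[OF \<sigma>] by linarith
      qed (use e \<eta>_bounds in auto)
      finally show "\<bar>?g l l' \<sigma> - ?r l l' \<sigma>\<bar> \<le> 1 / real N + T / ?s * \<bar>?R\<bar>" by (simp add: mult.commute)
    qed
    also have "\<dots> = 1 / real N + T / ?s * \<nu> N M (\<lambda>\<sigma>. \<bar>sk_overlap N {l, l'} \<sigma> - q\<bar>)"
      by (simp only: sk_avg_add sk_avg_cmult sk_avg_const[OF finite_atLeastAtMost])
    also have "\<dots> \<le> 1 / real N + T / ?s * ((L + 1) / ?s)"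
      using T0 sqrtN l
      by (intro add_left_mono mult_left_mono first_moment_le N1 overlap_moment) auto
    also have "T / ?s * ((L + 1) / ?s) = T * (L + 1) / real N" by (simp add: sqrtN)
    finally have b: "\<bar>\<nu> N M (?g l l') - \<nu> N M (?r l l')\<bar> \<le> 1 / real N + T * (L + 1) / real N"
      by (simp only: sk_avg_diff)
    have tri: "\<bar>x - z\<bar> \<le> c + d" if "\<bar>y - x\<bar> \<le> c" "\<bar>y - z\<bar> \<le> d" for x y z c d :: real
      using that by linarith
    have "c4 / real N = first_const (m + 2) * (dev_const m / real N) + (1 / real N + T * (L + 1) / real N)"
      unfolding c4_def by (simp add: add_divide_distrib)
    with tri[OF a b] show ?thesis by (simp only:)
  qed
  have c4: "0 \<le> c4" using const_nonneg T0 L_nonneg by (simp add: c4_def)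
  have pfd: "\<bar>pairs_form m (\<lambda>l l'. link_coeff W l l' * cav.E 0 (?g l l') - link_coeff W l l' * \<nu> N M (?r l l'))\<bar>
     \<le> pairs_const m * (2 * (c4 / real N))"
  proof (rule abs_pairs_form_le)
    fix l l' :: nat assume l: "l \<in> {1..m + 2}" "l' \<in> {1..m + 2}" "l \<noteq> l'"
    show "\<bar>link_coeff W l l' * cav.E 0 (?g l l') - link_coeff W l l' * \<nu> N M (?r l l')\<bar> \<le> 2 * (c4 / real N)"
      unfolding right_diff_distrib[symmetric] abs_mult
      by (intro mult_mono link_coeff_le link l) auto
  qed (use c4 in simp)
  define A where "A = pairs_form m (\<lambda>l l'. link_coeff W l l' * cav.E 0 (?g l l'))"
  define B where "B = pairs_form m (\<lambda>l l'. link_coeff W l l' * \<nu> N M (?r l l'))"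
  have AB: "\<bar>A - B\<bar> \<le> pairs_const m * (2 * (c4 / real N))"
    using pfd unfolding pairs_form_diff A_def B_def .
  have "\<bar>\<nu> N M ?F - \<beta>\<^sup>2 / 2 * B\<bar> \<le> \<bar>\<nu> N M ?F - \<beta>\<^sup>2 / 2 * A\<bar> + \<bar>\<beta>\<^sup>2 / 2 * (A - B)\<bar>"
    unfolding right_diff_distrib by linarith
  also have "\<bar>\<beta>\<^sup>2 / 2 * (A - B)\<bar> = \<beta>\<^sup>2 / 2 * \<bar>A - B\<bar>" by (simp add: abs_mult)
  also have "\<bar>\<nu> N M ?F - \<beta>\<^sup>2 / 2 * A\<bar> + \<beta>\<^sup>2 / 2 * \<bar>A - B\<bar>
     \<le> second_const m * (2 * (dev_const m / real N)) + \<beta>\<^sup>2 / 2 * (pairs_const m * (2 * (c4 / real N)))"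
    by (intro add_mono mult_left_mono AB so[folded A_def]) simp
  also have "\<dots> = (2 * second_const m * dev_const m + \<beta>\<^sup>2 / 2 * (pairs_const m * (2 * c4))) / real N"
    by (simp add: add_divide_distrib)
  finally have le: "\<bar>\<nu> N M ?F - \<beta>\<^sup>2 / 2 * B\<bar>
     \<le> (2 * second_const m * dev_const m + \<beta>\<^sup>2 / 2 * (pairs_const m * (2 * c4))) / real N" .
  have "pairs_form m (\<lambda>l l'. link_coeff W l l' * (?s * \<nu> N M (?r l l'))) = ?s * B"
    unfolding B_def pairs_form_cmult[symmetric] by (simp add: mult_ac)
  then have "\<bar>?s * \<nu> N M ?F - \<beta>\<^sup>2 / 2 * pairs_form m (\<lambda>l l'. link_coeff W l l' * (?s * \<nu> N M (?r l l')))\<bar>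
      = ?s * \<bar>\<nu> N M ?F - \<beta>\<^sup>2 / 2 * B\<bar>"
  proof -
    have "?s * \<nu> N M ?F - \<beta>\<^sup>2 / 2 * (?s * B) = ?s * (\<nu> N M ?F - \<beta>\<^sup>2 / 2 * B)" by (simp add: algebra_simps)
    then have "\<bar>?s * \<nu> N M ?F - \<beta>\<^sup>2 / 2 * (?s * B)\<bar> = ?s * \<bar>\<nu> N M ?F - \<beta>\<^sup>2 / 2 * B\<bar>"
      using sqrtN(1) by (simp add: abs_mult)
    then show ?thesis by (simp only: \<open>pairs_form m _ = ?s * B\<close>)
  qed
  also have "\<dots> \<le> ?s * ((2 * second_const m * dev_const m + \<beta>\<^sup>2 / 2 * (pairs_const m * (2 * c4))) / real N)"
    by (intro mult_left_mono le) simp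
  also have "\<dots> = (2 * second_const m * dev_const m + \<beta>\<^sup>2 / 2 * (pairs_const m * (2 * c4))) / ?s"
  proof -
    have "?s * (x / real N) = x / ?s" for x using sqrtN by (simp add: field_simps)
    then show ?thesis .
  qed
  finally show ?thesis unfolding c4_def .
qed

lemma stein_site:
  "\<bar>sqrt (real N) * \<nu> N M (\<lambda>\<sigma>. sw \<sigma> * \<eta> (\<Theta> \<sigma>)) - (source n t W * \<nu> N M (\<lambda>\<sigma>. \<eta>' (\<Theta> \<sigma>))
     + \<beta>\<^sup>2 / 2 * pairs_form m (\<lambda>l l'. link_coeff W l l' *
        (sqrt (real N) * \<nu> N M (\<lambda>\<sigma>. (sk_overlap N {l, l'} \<sigma> - q) * \<eta> (\<Theta> \<sigma>)))))\<bar>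
   \<le> stein_const m T / sqrt (real N)"
proof -
  have tri: "\<bar>x - (s + p)\<bar> \<le> c1 + c2 + c3"
    if "\<bar>x - y - z\<bar> \<le> c1" "\<bar>z - s\<bar> \<le> c2" "\<bar>y - p\<bar> \<le> c3" for x y z s p c1 c2 c3 :: real
    using that by linarith
  show ?thesis
    using tri[OF step_taylor step_source step_pairs] unfolding stein_const_def add_divide_distrib .
qed

end

subsection \<open>Reduction to a closed linear system\<close>

lemma card_sym_diff_pair:
  assumes "finite W" "l \<noteq> l'"
  shows "card (sym_diff W {l, l'}) =
    (if l \<in> W then if l' \<in> W then card W - 2 else card W else if l' \<in> W then card W else card W + 2)"
proof -
  have a: "card (sym_diff W {l, l'}) = card (W - {l, l'}) + card ({l, l'} - W)"
    using assms by (intro card_Un_disjoint) auto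
  have "W - {l, l'} = W - {l} - {l'}" by blast
  then have b: "card (W - {l, l'}) = card W - (if l \<in> W then 1 else 0) - (if l' \<in> W then 1 else 0)"
    using assms by (simp only: card_Diff_singleton_if) simp
  have c: "card ({l, l'} - W) = (if l \<in> W then 0 else 1) + (if l' \<in> W then 0 else 1)"
    using assms(2) by (simp add: insert_Diff_if)
  have d: "0 < card W" if "x \<in> W" for x
    using that assms(1) by (metis card_gt_0_iff empty_iff)
  show ?thesis unfolding a b c using d[of l] d[of l'] by (simp add: numeral_2_eq_2)
qed

lemma average_const: "N \<ge> 1 \<Longrightarrow> 1 / real N * (\<Sum>i\<in>{1..N}. c) = (c :: real)"
  by simp

context high_temperature
begin

text \<open>Coupling of \<open>W\<close> to one old replica once the fresh replicas are eliminated;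
  \<open>sum_link_coeff\<close> shows the origin. For \<open>l\<close> outside \<open>W\<close> it
  is \<open>sk_kappa\<close> without the factor coming from its second argument.\<close>

definition kappa1 :: "nat set \<Rightarrow> nat \<Rightarrow> real" where
  "kappa1 W l = (let w = card W in
     if l \<in> W then (real w - 1) * qq (w - 2) - real w * qq w + qq w * qq 2
     else real w * qq w - (real w + 1) * qq (w + 2) + qq w * qq 2)"

text \<open>\<open>sk_lambda\<close> in shorter form: its products with \<open>q 2\<close> cancel
  because the two binomial coefficients add up to the square of the argument.\<close>

definition lambda0 :: "nat \<Rightarrow> real" where
  "lambda0 w = real (w choose 2) * qq (w - 2) + real ((w + 1) choose 2) * qq (w + 2) - (real w)\<^sup>2 * qq w"

lemma two_choose_two: "2 * real (w choose 2) = real w * (real w - 1)"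
proof (induction w)
  case (Suc w) then show ?case by (simp add: numeral_2_eq_2 algebra_simps)
qed simp

text \<open>A count, since the coefficient is constant on \<open>W - {l}\<close> and on the rest.
  Outside \<open>W\<close> it equals the coefficient with the fresh replica \<open>e\<close>, which
  is why \<open>m\<close> disappears.\<close>

lemma sum_link_coeff:
  assumes W: "W \<subseteq> {1..m}" and l: "l \<in> {1..m}" and e: "e \<notin> {1..m}"
  shows "(\<Sum>l'\<in>{1..m} - {l}. link_coeff W l l') - real m * link_coeff W l e = kappa1 W l"
proof -
  have fin: "finite W" using W finite_subset by blast
  have cW: "card W \<le> m" using card_mono[OF _ W] by simp
  have le: "l \<noteq> e" "e \<notin> W" using l e W by auto
  have "(\<Sum>l'\<in>{1..m} - {l}. link_coeff W l l')
     = (\<Sum>l'\<in>W - {l}. link_coeff W l l') + (\<Sum>l'\<in>{1..m} - {l} - W. link_coeff W l l')"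
    using W by (subst sum.union_disjoint[symmetric]) (auto intro!: sum.cong simp: fin)
  also have "(\<Sum>l'\<in>W - {l}. link_coeff W l l')
     = (\<Sum>l'\<in>W - {l}. (if l \<in> W then qq (card W - 2) else qq (card W)) - qq (card W) * qq 2)"
    by (rule sum.cong) (auto simp: link_coeff_def card_sym_diff_pair[OF fin])
  also have "(\<Sum>l'\<in>{1..m} - {l} - W. link_coeff W l l')
     = (\<Sum>l'\<in>{1..m} - {l} - W. (if l \<in> W then qq (card W) else qq (card W + 2)) - qq (card W) * qq 2)"
    by (rule sum.cong) (auto simp: link_coeff_def card_sym_diff_pair[OF fin])
  finally have S: "(\<Sum>l'\<in>{1..m} - {l}. link_coeff W l l')
     = real (card (W - {l})) * ((if l \<in> W then qq (card W - 2) else qq (card W)) - qq (card W) * qq 2)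
     + real (card ({1..m} - {l} - W)) * ((if l \<in> W then qq (card W) else qq (card W + 2)) - qq (card W) * qq 2)"
    by simp
  have be: "link_coeff W l e = (if l \<in> W then qq (card W) else qq (card W + 2)) - qq (card W) * qq 2"
    using le by (simp add: link_coeff_def card_sym_diff_pair[OF fin])
  show ?thesis
  proof (cases "l \<in> W")
    case True
    then have "card W \<ge> 1" using fin by (metis One_nat_def Suc_leI card_gt_0_iff empty_iff)
    then have c1: "real (card (W - {l})) = real (card W) - 1" using True fin by (simp add: of_nat_diff)
    have "{1..m} - {l} - W = {1..m} - W" using True by auto
    then have c2: "real (card ({1..m} - {l} - W)) = real m - real (card W)"
      using W fin cW by (simp add: card_Diff_subset of_nat_diff)
    have c3: "link_coeff W l e = qq (card W) - qq (card W) * qq 2" using True be by simp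
    show ?thesis using True unfolding S c1 c2 c3 kappa1_def Let_def
      by (simp add: algebra_simps)
  next
    case False
    then have "W - {l} = W" by auto
    moreover have "{1..m} - {l} - W = {1..m} - insert l W" using l by auto
    then have "card ({1..m} - {l} - W) = m - (card W + 1)"
      using W l False fin by (simp add: card_Diff_subset)
    moreover have "card (insert l W) \<le> card {1..m}" using W l by (intro card_mono) auto
    then have "card W + 1 \<le> m" using False fin by simp
    ultimately have c: "real (card ({1..m} - {l} - W)) = real m - real (card W) - 1" "W - {l} = W"
      by (simp_all add: of_nat_diff)
    have c3: "link_coeff W l e = qq (card W + 2) - qq (card W) * qq 2" using False be by simp
    show ?thesis using False unfolding S c c3 kappa1_def Let_def
      by (simp add: algebra_simps)
  qed
qed

lemma link_coeff_sym: "link_coeff W l l' = link_coeff W l' l"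
  by (simp add: link_coeff_def insert_commute)

text \<open>\<open>sum_link_coeff\<close> is summed over \<open>l\<close>; everything that depends
  on \<open>m\<close> cancels once more.\<close>

lemma pairs_form_link_const:
  assumes W: "W \<subseteq> {1..m}"
  shows "pairs_form m (\<lambda>l l'. link_coeff W l l') = 2 * lambda0 (card W)"
proof -
  let ?w = "card W" and ?e = "m + 1" and ?e' = "m + 2" and ?Q = "qq (card W) * qq 2"
  have fin: "finite W" using W finite_subset by blast
  have cW: "?w \<le> m" using card_mono[OF _ W] by simp
  have e: "?e \<notin> W" "?e' \<notin> W" using W by auto
  have be: "link_coeff W l ?e' = link_coeff W l ?e"
    "link_coeff W l ?e = (if l \<in> W then qq ?w else qq (?w + 2)) - ?Q" if "l \<in> {1..m}" for l
    using that e by (auto simp: link_coeff_def card_sym_diff_pair[OF fin])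
  have bee: "link_coeff W ?e ?e' = qq (?w + 2) - ?Q"
    unfolding link_coeff_def by (subst card_sym_diff_pair[OF fin]) (use e in auto)
  have split: "(\<Sum>l\<in>{1..m}. if l \<in> W then a else b) = real ?w * a + (real m - real ?w) * b" for a b :: real
  proof -
    have "(\<Sum>l\<in>{1..m}. if l \<in> W then a else b) = (\<Sum>l\<in>W. a) + (\<Sum>l\<in>{1..m} - W. b)"
      using W by (subst sum.If_cases) (auto simp: Int_absorb1 Int_absorb2 Diff_eq)
    moreover have "real (card ({1..m} - W)) = real m - real ?w"
      using W fin cW by (simp add: card_Diff_subset of_nat_diff)
    ultimately show ?thesis by simp
  qed
  have s1: "(\<Sum>l\<in>{1..m}. \<Sum>l'\<in>{1..m} - {l}. link_coeff W l l')
      = (\<Sum>l\<in>{1..m}. kappa1 W l + real m * link_coeff W l ?e)"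
    using sum_link_coeff[OF W, of _ ?e] by (intro sum.cong refl) (simp add: algebra_simps)
  have s2: "(\<Sum>l\<in>{1..m}. link_coeff W l ?e') = (\<Sum>l\<in>{1..m}. link_coeff W l ?e)"
    by (intro sum.cong refl be)
  have s3: "(\<Sum>l\<in>{1..m}. link_coeff W l ?e)
      = real ?w * (qq ?w - ?Q) + (real m - real ?w) * (qq (?w + 2) - ?Q)"
    unfolding split[symmetric]
  proof (rule sum.cong[OF refl])
    fix l assume "l \<in> {1..m}"
    from be(2)[OF this] show "link_coeff W l ?e = (if l \<in> W then qq ?w - ?Q else qq (?w + 2) - ?Q)" by simp
  qed
  have s4: "(\<Sum>l\<in>{1..m}. kappa1 W l)
      = real ?w * ((real ?w - 1) * qq (?w - 2) - real ?w * qq ?w + ?Q)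
      + (real m - real ?w) * (real ?w * qq ?w - (real ?w + 1) * qq (?w + 2) + ?Q)"
    unfolding split[symmetric] by (intro sum.cong refl) (auto simp: kappa1_def Let_def)
  have ch: "2 * lambda0 ?w = real ?w * (real ?w - 1) * qq (?w - 2) + (real ?w + 1) * real ?w * qq (?w + 2)
     - 2 * (real ?w)\<^sup>2 * qq ?w"
  proof -
    have "2 * lambda0 ?w = (2 * real (?w choose 2)) * qq (?w - 2)
        + (2 * real ((?w + 1) choose 2)) * qq (?w + 2) - 2 * (real ?w)\<^sup>2 * qq ?w"
      by (simp add: lambda0_def)
    then show ?thesis unfolding two_choose_two by simp
  qed
  show ?thesis unfolding pairs_form_def s1 s2 bee ch sum.distrib s4 sum_distrib_left[symmetric] s3
    by (simp add: algebra_simps power2_eq_square)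
qed

lemma sum_off_diagonal_swap:
  "(\<Sum>l\<in>{1..m :: nat}. \<Sum>l'\<in>{1..m} - {l}. f l l') = (\<Sum>l\<in>{1..m}. \<Sum>l'\<in>{1..m} - {l}. f l' l :: real)"
proof -
  have "(\<Sum>l\<in>{1..m}. \<Sum>l'\<in>{1..m} - {l}. g l l') = (\<Sum>l\<in>{1..m}. \<Sum>l'\<in>{1..m}. g l l') - (\<Sum>l\<in>{1..m}. g l l)"
    for g :: "nat \<Rightarrow> nat \<Rightarrow> real"
    unfolding sum_subtractf[symmetric] by (intro sum.cong refl) (simp add: sum_diff1)
  then show ?thesis by (simp only: sum.swap[of "\<lambda>l l'. f l l'"])
qed

text \<open>The two fresh columns carry equal coefficients, so their weights \<open>1 - m\<close>
  and \<open>- (m + 1)\<close> add up to \<open>- 2 * m\<close>, which is what two applications of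
  \<open>sum_link_coeff\<close> consume.\<close>

lemma pairs_form_link_site:
  assumes W: "W \<subseteq> {1..m}" and nm: "n \<le> m" and x: "\<And>l. l > n \<Longrightarrow> x l = 0"
  shows "pairs_form m (\<lambda>l l'. link_coeff W l l' * (x l + x l')) = 2 * (\<Sum>l\<in>{1..n}. kappa1 W l * x l)"
proof -
  let ?e = "m + 1" and ?e' = "m + 2" and ?c = "link_coeff W"
  have fin: "finite W" using W finite_subset by blast
  have x0: "x ?e = 0" "x ?e' = 0" using nm by (auto intro: x)
  have be: "?c l ?e' = ?c l ?e" if "l \<in> {1..m}" for l
    using that W by (auto simp: link_coeff_def card_sym_diff_pair[OF fin])
  have "(\<Sum>l\<in>{1..m}. \<Sum>l'\<in>{1..m} - {l}. ?c l l' * (x l + x l'))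
    = (\<Sum>l\<in>{1..m}. \<Sum>l'\<in>{1..m} - {l}. ?c l l' * x l) + (\<Sum>l\<in>{1..m}. \<Sum>l'\<in>{1..m} - {l}. ?c l l' * x l')"
    by (simp add: distrib_left sum.distrib)
  also have "(\<Sum>l\<in>{1..m}. \<Sum>l'\<in>{1..m} - {l}. ?c l l' * x l')
    = (\<Sum>l\<in>{1..m}. \<Sum>l'\<in>{1..m} - {l}. ?c l l' * x l)"
    by (subst sum_off_diagonal_swap) (simp add: link_coeff_sym)
  finally have s1: "(\<Sum>l\<in>{1..m}. \<Sum>l'\<in>{1..m} - {l}. ?c l l' * (x l + x l'))
    = 2 * (\<Sum>l\<in>{1..m}. (\<Sum>l'\<in>{1..m} - {l}. ?c l l') * x l)"
    by (simp add: sum_distrib_right)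
  have s2: "(\<Sum>l\<in>{1..m}. ?c l ?e' * (x l + x ?e')) = (\<Sum>l\<in>{1..m}. ?c l ?e * x l)"
  proof (rule sum.cong[OF refl])
    fix l assume "l \<in> {1..m}"
    from be[OF this] show "?c l ?e' * (x l + x ?e') = ?c l ?e * x l" unfolding x0 by simp
  qed
  have "pairs_form m (\<lambda>l l'. ?c l l' * (x l + x l'))
     = 2 * (\<Sum>l\<in>{1..m}. (\<Sum>l'\<in>{1..m} - {l}. ?c l l') * x l) - 2 * real m * (\<Sum>l\<in>{1..m}. ?c l ?e * x l)"
    unfolding pairs_form_def s1 s2 by (simp only: x0 add_0_right mult_zero_right) (simp add: algebra_simps)
  also have "\<dots> = 2 * (\<Sum>l\<in>{1..m}. ((\<Sum>l'\<in>{1..m} - {l}. ?c l l') - real m * ?c l ?e) * x l)"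
    by (simp add: left_diff_distrib sum_subtractf sum_distrib_left right_diff_distrib mult_ac)
  also have "(\<Sum>l\<in>{1..m}. ((\<Sum>l'\<in>{1..m} - {l}. ?c l l') - real m * ?c l ?e) * x l)
     = (\<Sum>l\<in>{1..m}. kappa1 W l * x l)"
    by (intro sum.cong refl arg_cong2[where f = "(*)"] sum_link_coeff W) auto
  also have "\<dots> = (\<Sum>l\<in>{1..n}. kappa1 W l * x l)"
    by (rule sum.mono_neutral_right) (use nm x in auto)
  finally show ?thesis .
qed

lemma pairs_form_link_pair:
  assumes nm: "n \<le> m" and x: "\<And>l l'. l > n \<or> l' > n \<Longrightarrow> x l l' = 0"
  shows "pairs_form m (\<lambda>l l'. link_coeff W l l' * x l l')
    = (\<Sum>l\<in>{1..n}. \<Sum>l'\<in>{1..n} - {l}. link_coeff W l l' * x l l')"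
proof -
  have "x l (m + 1) = 0" "x l (m + 2) = 0" for l using nm by (auto intro: x)
  then have "pairs_form m (\<lambda>l l'. link_coeff W l l' * x l l')
    = (\<Sum>l\<in>{1..m}. \<Sum>l'\<in>{1..m} - {l}. link_coeff W l l' * x l l')"
    by (simp add: pairs_form_def)
  also have "\<dots> = (\<Sum>l\<in>{1..n}. \<Sum>l'\<in>{1..m} - {l}. link_coeff W l l' * x l l')"
    by (rule sum.mono_neutral_right) (use nm x in \<open>auto intro!: sum.neutral\<close>)
  also have "\<dots> = (\<Sum>l\<in>{1..n}. \<Sum>l'\<in>{1..n} - {l}. link_coeff W l l' * x l l')"
  proof (rule sum.cong[OF refl])
    fix l
    show "(\<Sum>l'\<in>{1..m} - {l}. link_coeff W l l' * x l l') = (\<Sum>l'\<in>{1..n} - {l}. link_coeff W l l' * x l l')"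
    proof (rule sum.mono_neutral_right)
      show "\<forall>l'\<in>{1..m} - {l} - ({1..n} - {l}). link_coeff W l l' * x l l' = 0"
      proof
        fix l' assume "l' \<in> {1..m} - {l} - ({1..n} - {l})"
        then have "l' > n" by auto
        then show "link_coeff W l l' * x l l' = 0" by (simp add: x)
      qed
    qed (use nm in auto)
  qed
  finally show ?thesis .
qed

text \<open>\<open>obs\<close> pairs the rescaled multi-overlap of \<open>W\<close> with a test function of the fluctuations of the
  replicas \<open>1, \<dots>, n\<close>; the replicas \<open>n + 1, n + 2, \<dots>\<close> are fresh.\<close>

definition mean :: "nat \<Rightarrow> nat \<Rightarrow> (nat set \<Rightarrow> real) \<Rightarrow> (real \<Rightarrow> real) \<Rightarrow> real" where
  "mean N n t \<eta> = \<nu> N (n + 8) (\<lambda>\<sigma>. \<eta> (fluct N n t \<sigma>))"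

definition obs :: "nat \<Rightarrow> nat \<Rightarrow> (nat set \<Rightarrow> real) \<Rightarrow> (real \<Rightarrow> real) \<Rightarrow> nat set \<Rightarrow> real" where
  "obs N n t \<eta> W = sqrt (real N) * \<nu> N (n + 8)
     (\<lambda>\<sigma>. (sk_overlap N W \<sigma> - qq (card W)) * \<eta> (fluct N n t \<sigma>))"

text \<open>Each site satisfies \<open>stein_site\<close> with the same right-hand side and the same
  error, and \<open>obs\<close> is the average over the sites.\<close>

lemma stein:
  assumes N: "N \<ge> 1" and W: "W \<subseteq> {1..n + 2}" and T: "(\<Sum>S\<in>Pow {1..n}. \<bar>t S\<bar>) \<le> T"
    and smooth: "smooth_pair \<eta> \<eta>'"
  shows "\<bar>obs N n t \<eta> W - (source n t W * mean N n t \<eta>'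
      + \<beta>\<^sup>2 / 2 * pairs_form (n + 2) (\<lambda>l l'. link_coeff W l l' * obs N n t \<eta> {l, l'}))\<bar>
    \<le> stein_const (n + 2) T / sqrt (real N)"
proof -
  \<comment> \<open>\<open>W\<close> may contain two fresh replicas, so \<open>m\<close> is
    \<open>n + 2\<close>, and the expansion needs six more: hence the \<open>n + 8\<close> in
    \<open>mean\<close> and \<open>obs\<close>.\<close>
  let ?M = "n + 2 + 6" and ?\<eta> = "\<lambda>\<sigma>. \<eta> (fluct N n t \<sigma>)"
  let ?rhs = "source n t W * mean N n t \<eta>'
      + \<beta>\<^sup>2 / 2 * pairs_form (n + 2) (\<lambda>l l'. link_coeff W l l' * obs N n t \<eta> {l, l'})"
  let ?X = "\<lambda>i. sqrt (real N) * \<nu> N ?M (\<lambda>\<sigma>. (spin W i \<sigma> - qq (card W)) * ?\<eta> \<sigma>)"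
  have M: "?M = n + 8" by simp
  have pf: "pairs_form (n + 2) (\<lambda>l l'. link_coeff W l l' *
        (sqrt (real N) * \<nu> N ?M (\<lambda>\<sigma>. (sk_overlap N {l, l'} \<sigma> - q) * ?\<eta> \<sigma>)))
     = pairs_form (n + 2) (\<lambda>l l'. link_coeff W l l' * obs N n t \<eta> {l, l'})"
    by (rule pairs_form_cong) (simp add: obs_def q_eq_moment[unfolded numeral_2_eq_2] add.commute)
  have site: "\<bar>?X i - ?rhs\<bar> \<le> stein_const (n + 2) T / sqrt (real N)" if i: "i \<in> {1..N}" for i
  proof -
    have "stein_site \<beta> h q L N i n (n + 2) T t \<eta> \<eta>' W"
      by (intro stein_site.intro stein_site_axioms.intro high_temperature_axioms i W T smooth) simp
    from stein_site.stein_site[OF this, unfolded pf] show ?thesis unfolding mean_def M .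
  qed
  have "obs N n t \<eta> W = 1 / real N * (\<Sum>i\<in>{1..N}. ?X i)"
  proof -
    have "\<nu> N ?M (\<lambda>\<sigma>. (sk_overlap N W \<sigma> - qq (card W)) * ?\<eta> \<sigma>)
       = \<nu> N ?M (\<lambda>\<sigma>. 1 / real N * (\<Sum>i\<in>{1..N}. (spin W i \<sigma> - qq (card W)) * ?\<eta> \<sigma>))"
    proof (rule sk_avg_cong)
      fix \<sigma> :: "nat \<Rightarrow> nat \<Rightarrow> real"
      have "1 / real N * (\<Sum>i\<in>{1..N}. spin W i \<sigma> - qq (card W)) = sk_overlap N W \<sigma> - qq (card W)"
        using N by (simp add: sk_overlap_eq sum_subtractf diff_divide_distrib)
      then show "(sk_overlap N W \<sigma> - qq (card W)) * ?\<eta> \<sigma>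
          = 1 / real N * (\<Sum>i\<in>{1..N}. (spin W i \<sigma> - qq (card W)) * ?\<eta> \<sigma>)"
        unfolding sum_distrib_right[symmetric] mult.assoc[symmetric] by simp
    qed
    also have "\<dots> = 1 / real N * (\<Sum>i\<in>{1..N}. \<nu> N ?M (\<lambda>\<sigma>. (spin W i \<sigma> - qq (card W)) * ?\<eta> \<sigma>))"
      by (simp only: sk_avg_cmult sk_avg_sum)
    finally show ?thesis unfolding obs_def by (simp add: sum_distrib_left add.commute)
  qed
  then have eq: "obs N n t \<eta> W - ?rhs = 1 / real N * (\<Sum>i\<in>{1..N}. ?X i - ?rhs)"
    unfolding sum_subtractf right_diff_distrib average_const[OF N] by simp
  have "\<bar>1 / real N * (\<Sum>i\<in>{1..N}. ?X i - ?rhs)\<bar> \<le> 1 / real N * (\<Sum>i\<in>{1..N}. stein_const (n + 2) T / sqrt (real N))"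
    unfolding abs_mult
    by (rule mult_mono[OF _ order_trans[OF sum_abs sum_mono[OF site]]]) auto
  also have "\<dots> = stein_const (n + 2) T / sqrt (real N)"
    by (rule average_const[OF N])
  finally show ?thesis unfolding eq .
qed

text \<open>Permutations fixing the replicas \<open>1, ..., n\<close> do not change the
  fluctuation.\<close>

lemma obs_permute:
  assumes \<pi>: "bij_betw \<pi> {1..n + 8} {1..n + 8}" "\<And>l. l \<in> {1..n} \<Longrightarrow> \<pi> l = l" and W: "W \<subseteq> {1..n + 8}"
  shows "obs N n t \<eta> (\<pi> ` W) = obs N n t \<eta> W"
proof -
  have card: "card (\<pi> ` W) = card W"
    using \<pi>(1) W by (intro card_image) (auto simp: bij_betw_def inj_on_subset)
  have *: "fluct N n t (\<lambda>l\<in>{1..n + 8}. \<sigma> (\<pi> l)) = fluct N n t \<sigma>" for \<sigma>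
    unfolding fluct_def
  proof (rule sum.cong[OF refl])
    fix S assume S: "S \<in> Pow {1..n}"
    have "\<pi> ` S = (\<lambda>l. l) ` S" by (rule image_cong) (use S \<pi> in auto)
    moreover have "S \<subseteq> {1..n + 8}" using S by auto
    ultimately show "t S * (sqrt (real N) * (sk_overlap N S (\<lambda>l\<in>{1..n + 8}. \<sigma> (\<pi> l)) - qq (card S)))
      = t S * (sqrt (real N) * (sk_overlap N S \<sigma> - qq (card S)))"
      by (simp only: sk_overlap_permute[OF \<pi>(1)] image_ident)
  qed
  show ?thesis unfolding obs_def card
  proof (rule arg_cong2[where f = "(*)", OF refl], rule sk_avg_permute_replicas[OF \<pi>(1)])
    fix \<sigma> :: "nat \<Rightarrow> nat \<Rightarrow> real"
    show "(sk_overlap N W (\<lambda>l\<in>{1..n + 8}. \<sigma> (\<pi> l)) - qq (card W)) * \<eta> (fluct N n t (\<lambda>l\<in>{1..n + 8}. \<sigma> (\<pi> l)))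
      = (sk_overlap N (\<pi> ` W) \<sigma> - qq (card W)) * \<eta> (fluct N n t \<sigma>)"
      by (simp only: sk_overlap_permute[OF \<pi>(1) W, of N \<sigma>] *[of \<sigma>])
  qed
qed

lemma obs_fresh_one:
  assumes "l \<in> {1..n}" "k \<in> {n + 1..n + 8}"
  shows "obs N n t \<eta> {l, k} = obs N n t \<eta> {l, n + 1}"
proof -
  let ?\<pi> = "Transposition.transpose (n + 1) k"
  have "bij_betw ?\<pi> {1..n + 8} {1..n + 8}"
    by (rule permutes_imp_bij[OF permutes_swap_id]) (use assms in auto)
  moreover have "?\<pi> j = j" if "j \<in> {1..n}" for j
    using that assms by (auto simp: Transposition.transpose_def)
  moreover have "?\<pi> ` {l, n + 1} = {l, k}" using assms by (auto simp: Transposition.transpose_def)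
  ultimately show ?thesis using obs_permute[of ?\<pi> n "{l, n + 1}" N t \<eta>] assms by simp
qed

lemma obs_fresh_two:
  assumes "k \<in> {n + 1..n + 8}" "k' \<in> {n + 1..n + 8}" "k \<noteq> k'"
  shows "obs N n t \<eta> {k, k'} = obs N n t \<eta> {n + 1, n + 2}"
proof -
  define \<tau> where "\<tau> = Transposition.transpose (n + 1) k"
  define \<pi> where "\<pi> = Transposition.transpose (\<tau> (n + 2)) k' \<circ> \<tau>"
  have \<tau>: "\<tau> permutes {n + 1..n + 8}"
    unfolding \<tau>_def by (rule permutes_swap_id) (use assms in auto)
  have t2: "\<tau> (n + 2) \<in> {n + 1..n + 8}" using permutes_in_image[OF \<tau>] by simp
  have \<pi>: "\<pi> permutes {n + 1..n + 8}" unfolding \<pi>_def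
    by (rule permutes_compose[OF \<tau> permutes_swap_id[OF t2 assms(2)]])
  have "\<pi> permutes {1..n + 8}" by (rule permutes_subset[OF \<pi>]) auto
  then have b: "bij_betw \<pi> {1..n + 8} {1..n + 8}" by (rule permutes_imp_bij)
  have fx: "\<pi> j = j" if "j \<in> {1..n}" for j
    using that by (intro permutes_not_in[OF \<pi>]) auto
  have "\<tau> (n + 1) = k" "\<tau> (n + 2) \<noteq> k" unfolding \<tau>_def by (auto simp: Transposition.transpose_def)
  then have "\<pi> ` {n + 1, n + 2} = {k, k'}" using assms(3)
    by (auto simp: \<pi>_def Transposition.transpose_def)
  then show ?thesis using obs_permute[OF b fx, of "{n + 1, n + 2}" N t \<eta>] by simp
qed

text \<open>\<open>x0\<close>, \<open>x1\<close> and \<open>x2\<close> split \<open>obs\<close> on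
  pairs into a constant, a one-replica and a two-replica part, as in an analysis of variance with
  the fresh replicas as reference level: \<open>x1\<close> and \<open>x2\<close> vanish as soon as
  an argument is fresh.\<close>

definition x0 :: "nat \<Rightarrow> nat \<Rightarrow> (nat set \<Rightarrow> real) \<Rightarrow> (real \<Rightarrow> real) \<Rightarrow> real" where
  "x0 N n t \<eta> = obs N n t \<eta> {n + 1, n + 2}"

definition x1 :: "nat \<Rightarrow> nat \<Rightarrow> (nat set \<Rightarrow> real) \<Rightarrow> (real \<Rightarrow> real) \<Rightarrow> nat \<Rightarrow> real" where
  "x1 N n t \<eta> l = (if l \<le> n then obs N n t \<eta> {l, n + 1} - x0 N n t \<eta> else 0)"

definition x2 :: "nat \<Rightarrow> nat \<Rightarrow> (nat set \<Rightarrow> real) \<Rightarrow> (real \<Rightarrow> real) \<Rightarrow> nat \<Rightarrow> nat \<Rightarrow> real" where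
  "x2 N n t \<eta> l l' = (if l \<le> n \<and> l' \<le> n
     then obs N n t \<eta> {l, l'} - x1 N n t \<eta> l - x1 N n t \<eta> l' - x0 N n t \<eta> else 0)"

lemma obs_pair_decomp:
  assumes "l \<in> {1..n + 8}" "l' \<in> {1..n + 8}" "l \<noteq> l'"
  shows "obs N n t \<eta> {l, l'} = x2 N n t \<eta> l l' + (x1 N n t \<eta> l + x1 N n t \<eta> l') + x0 N n t \<eta>"
proof (cases "l \<le> n"; cases "l' \<le> n")
  assume "l \<le> n" "\<not> l' \<le> n"
  then show ?thesis using obs_fresh_one[of l n l' N t \<eta>] assms by (simp add: x1_def x2_def)
next
  assume "\<not> l \<le> n" "l' \<le> n"
  then show ?thesis using obs_fresh_one[of l' n l N t \<eta>] assms by (simp add: x1_def x2_def insert_commute)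
next
  assume "\<not> l \<le> n" "\<not> l' \<le> n"
  then show ?thesis using obs_fresh_two[of l n l' N t \<eta>] assms by (simp add: x0_def x1_def x2_def)
qed (simp add: x2_def)

text \<open>Half of \<open>pairs_form\<close> on the links after eliminating the fresh replicas;
  each part of the splitting meets its own coefficient.\<close>

definition reduced :: "nat \<Rightarrow> nat set \<Rightarrow> (nat \<Rightarrow> nat \<Rightarrow> real) \<Rightarrow> (nat \<Rightarrow> real) \<Rightarrow> real \<Rightarrow> real" where
  "reduced n W X2 X1 X0 = 1 / 2 * (\<Sum>l\<in>{1..n}. \<Sum>l'\<in>{1..n} - {l}. link_coeff W l l' * X2 l l')
     + (\<Sum>l\<in>{1..n}. kappa1 W l * X1 l) + lambda0 (card W) * X0"

lemma stein_reduced: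
  assumes N: "N \<ge> 1" and W: "W \<subseteq> {1..n + 2}" and T: "(\<Sum>S\<in>Pow {1..n}. \<bar>t S\<bar>) \<le> T"
    and smooth: "smooth_pair \<eta> \<eta>'"
  shows "\<bar>obs N n t \<eta> W - (source n t W * mean N n t \<eta>'
      + \<beta>\<^sup>2 * reduced n W (x2 N n t \<eta>) (x1 N n t \<eta>) (x0 N n t \<eta>))\<bar>
    \<le> stein_const (n + 2) T / sqrt (real N)"
proof -
  let ?x2 = "x2 N n t \<eta>" and ?x1 = "x1 N n t \<eta>" and ?x0 = "x0 N n t \<eta>" and ?c = "link_coeff W"
  have "pairs_form (n + 2) (\<lambda>l l'. ?c l l' * obs N n t \<eta> {l, l'})
     = pairs_form (n + 2) (\<lambda>l l'. ?c l l' * ?x2 l l' - (- 1 * (?c l l' * (?x1 l + ?x1 l')) - ?x0 * ?c l l'))"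
    by (rule pairs_form_cong) (simp add: obs_pair_decomp algebra_simps)
  also have "\<dots> = pairs_form (n + 2) (\<lambda>l l'. ?c l l' * ?x2 l l')
     + pairs_form (n + 2) (\<lambda>l l'. ?c l l' * (?x1 l + ?x1 l')) + ?x0 * pairs_form (n + 2) ?c"
    unfolding pairs_form_diff pairs_form_cmult by simp
  also have "\<dots> = 2 * reduced n W ?x2 ?x1 ?x0"
  proof -
    have "pairs_form (n + 2) (\<lambda>l l'. ?c l l' * ?x2 l l') = (\<Sum>l\<in>{1..n}. \<Sum>l'\<in>{1..n} - {l}. ?c l l' * ?x2 l l')"
      by (rule pairs_form_link_pair) (auto simp: x2_def)
    moreover have "pairs_form (n + 2) (\<lambda>l l'. ?c l l' * (?x1 l + ?x1 l')) = 2 * (\<Sum>l\<in>{1..n}. kappa1 W l * ?x1 l)"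
      by (rule pairs_form_link_site[OF W]) (auto simp: x1_def)
    moreover have "pairs_form (n + 2) ?c = 2 * lambda0 (card W)" by (rule pairs_form_link_const[OF W])
    ultimately show ?thesis by (simp add: reduced_def)
  qed
  finally have pf: "pairs_form (n + 2) (\<lambda>l l'. ?c l l' * obs N n t \<eta> {l, l'}) = 2 * reduced n W ?x2 ?x1 ?x0" .
  show ?thesis using stein[OF N W T smooth] unfolding pf by simp
qed

end

subsection \<open>Solving the linear system\<close>

lemma card_sym_diff_pair':
  assumes "finite W" "l \<noteq> l'"
  shows "card (sym_diff {l, l'} W) =
    (if l \<in> W then if l' \<in> W then card W - 2 else card W else if l' \<in> W then card W else card W + 2)"
  using card_sym_diff_pair[OF assms] by (simp only: Un_commute)

context high_temperature
begin

text \<open>An error of order \<open>1 / sqrt N\<close>, uniform over the smooth pairs and over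
  weights of bounded total size. The uniformity in \<open>t\<close> is what allows integration along
  rays in \<open>mean_ode\<close>.\<close>

definition small :: "nat \<Rightarrow> real \<Rightarrow>
    (nat \<Rightarrow> (nat set \<Rightarrow> real) \<Rightarrow> (real \<Rightarrow> real) \<Rightarrow> (real \<Rightarrow> real) \<Rightarrow> real) \<Rightarrow> bool" where
  "small n T f \<longleftrightarrow> (\<exists>C. \<forall>N\<ge>1. \<forall>t \<eta> \<eta>'. (\<Sum>S\<in>Pow {1..n}. \<bar>t S\<bar>) \<le> T \<longrightarrow> smooth_pair \<eta> \<eta>' \<longrightarrow>
     \<bar>f N t \<eta> \<eta>'\<bar> \<le> C / sqrt (real N))"

lemma smallD:
  assumes "small n T f"
  obtains C where "\<And>N t \<eta> \<eta>'. N \<ge> 1 \<Longrightarrow> (\<Sum>S\<in>Pow {1..n}. \<bar>t S\<bar>) \<le> T \<Longrightarrow> smooth_pair \<eta> \<eta>' \<Longrightarrow>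
     \<bar>f N t \<eta> \<eta>'\<bar> \<le> C / sqrt (real N)"
proof -
  from assms obtain C where "\<forall>N\<ge>1. \<forall>t \<eta> \<eta>'. (\<Sum>S\<in>Pow {1..n}. \<bar>t S\<bar>) \<le> T \<longrightarrow> smooth_pair \<eta> \<eta>' \<longrightarrow>
     \<bar>f N t \<eta> \<eta>'\<bar> \<le> C / sqrt (real N)" unfolding small_def ..
  then show ?thesis by (intro that[of C]) blast
qed

lemma small_add:
  assumes "small n T f" "small n T g"
  shows "small n T (\<lambda>N t \<eta> \<eta>'. f N t \<eta> \<eta>' + g N t \<eta> \<eta>')"
proof -
  obtain C where C: "\<And>N t \<eta> \<eta>'. N \<ge> 1 \<Longrightarrow> (\<Sum>S\<in>Pow {1..n}. \<bar>t S\<bar>) \<le> T \<Longrightarrow> smooth_pair \<eta> \<eta>' \<Longrightarrow>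
     \<bar>f N t \<eta> \<eta>'\<bar> \<le> C / sqrt (real N)" using smallD[OF assms(1)] by blast
  obtain D where D: "\<And>N t \<eta> \<eta>'. N \<ge> 1 \<Longrightarrow> (\<Sum>S\<in>Pow {1..n}. \<bar>t S\<bar>) \<le> T \<Longrightarrow> smooth_pair \<eta> \<eta>' \<Longrightarrow>
     \<bar>g N t \<eta> \<eta>'\<bar> \<le> D / sqrt (real N)" using smallD[OF assms(2)] by blast
  show ?thesis unfolding small_def add_divide_distrib
  proof (intro exI[of _ "C + D"] allI impI)
    fix N :: nat and t \<eta> \<eta>'
    assume "N \<ge> 1" "(\<Sum>S\<in>Pow {1..n}. \<bar>t S\<bar>) \<le> T" "smooth_pair \<eta> \<eta>'"
    from C[OF this] D[OF this] show "\<bar>f N t \<eta> \<eta>' + g N t \<eta> \<eta>'\<bar> \<le> (C + D) / sqrt (real N)"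
      unfolding add_divide_distrib by (rule order_trans[OF abs_triangle_ineq add_mono])
  qed
qed

lemma small_cmult:
  assumes "small n T f"
  shows "small n T (\<lambda>N t \<eta> \<eta>'. c * f N t \<eta> \<eta>')"
proof -
  obtain C where C: "\<And>N t \<eta> \<eta>'. N \<ge> 1 \<Longrightarrow> (\<Sum>S\<in>Pow {1..n}. \<bar>t S\<bar>) \<le> T \<Longrightarrow> smooth_pair \<eta> \<eta>' \<Longrightarrow>
     \<bar>f N t \<eta> \<eta>'\<bar> \<le> C / sqrt (real N)" using smallD[OF assms(1)] by blast
  show ?thesis unfolding small_def
  proof (intro exI[of _ "\<bar>c\<bar> * C"] allI impI)
    fix N :: nat and t \<eta> \<eta>'
    assume "N \<ge> 1" "(\<Sum>S\<in>Pow {1..n}. \<bar>t S\<bar>) \<le> T" "smooth_pair \<eta> \<eta>'"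
    from mult_left_mono[OF C[OF this] abs_ge_zero[of c]]
    show "\<bar>c * f N t \<eta> \<eta>'\<bar> \<le> \<bar>c\<bar> * C / sqrt (real N)" by (simp only: abs_mult times_divide_eq_right)
  qed
qed

lemma small_diff:
  assumes "small n T f" "small n T g"
  shows "small n T (\<lambda>N t \<eta> \<eta>'. f N t \<eta> \<eta>' - g N t \<eta> \<eta>')"
  using small_add[OF assms(1) small_cmult[OF assms(2), of "- 1"]] by simp

lemma small_zero: "small n T (\<lambda>N t \<eta> \<eta>'. 0)"
  unfolding small_def by (intro exI[of _ 0]) simp

lemma small_sum:
  assumes "\<And>x. x \<in> X \<Longrightarrow> small n T (f x)"
  shows "small n T (\<lambda>N t \<eta> \<eta>'. \<Sum>x\<in>X. f x N t \<eta> \<eta>')"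
proof (cases "finite X")
  case True
  then show ?thesis using assms
    by (induction X rule: finite_induct) (simp_all add: small_zero small_add)
qed (simp add: small_zero)

lemma small_cong:
  assumes "small n T f" "\<And>N t \<eta> \<eta>'. g N t \<eta> \<eta>' = f N t \<eta> \<eta>'"
  shows "small n T g"
proof -
  have "g = f" by (intro ext) (rule assms(2))
  with assms(1) show ?thesis by simp
qed

text \<open>The quantities of the statement, written with the moments at the \<open>q\<close> of the
  locale. \<open>pi1 s\<close> is \<open>sk_pi\<close> at \<open>s - 1\<close>; \<open>om2\<close>
  and \<open>kap2\<close> are what \<open>sk_omega\<close>, and \<open>sk_kappa\<close> at 2,
  contain besides the factor from their second argument.\<close>

definition rho :: "nat \<Rightarrow> real" where "rho p = qq p - 2 * qq (p + 2) + qq (p + 4)"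
definition phi1 :: real where "phi1 = 1 - 4 * qq 2 + 3 * qq 4"
definition pi1 :: "nat \<Rightarrow> real" where "pi1 s = qq s - qq (s + 2)"
definition om2 :: "nat \<Rightarrow> real" where "om2 s = qq (s + 2) - qq s * qq 2"
definition kap2 :: real where "kap2 = 2 * qq 2 - 3 * qq 4 + qq 2 * qq 2"

abbreviation err where
  "err n W N t \<eta> \<eta>' \<equiv> obs N n t \<eta> W - (source n t W * mean N n t \<eta>'
     + \<beta>\<^sup>2 * reduced n W (x2 N n t \<eta>) (x1 N n t \<eta>) (x0 N n t \<eta>))"

lemma small_err: "W \<subseteq> {1..n + 2} \<Longrightarrow> small n T (err n W)"
  unfolding small_def
  by (intro exI[of _ "stein_const (n + 2) T"] allI impI) (rule stein_reduced)

lemma x2_sym: "x2 N n t \<eta> l l' = x2 N n t \<eta> l' l"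
  by (simp add: x2_def insert_commute)

text \<open>The alternating combination of \<open>{a, b}\<close> with its fresh counterparts is a
  mixed difference, which kills every \<open>S\<close> not containing both \<open>a\<close> and
  \<open>b\<close>.\<close>

lemma source_pair:
  assumes a: "a \<in> {1..n}" "b \<in> {1..n}" "a \<noteq> b"
  shows "source n t {a, b} - source n t {a, n + 1} - source n t {b, n + 1} + source n t {n + 1, n + 2}
     = (\<Sum>S\<in>Pow {1..n}. t S * (if a \<in> S \<and> b \<in> S then rho (card S - 2) else 0))"
  unfolding source_def sum_subtractf[symmetric] sum.distrib[symmetric]
proof (rule sum.cong[OF refl])
  fix S assume S: "S \<in> Pow {1..n}"
  then have fin: "finite S" using finite_subset by auto
  have nS: "n + 1 \<notin> S" "n + 2 \<notin> S" using S by auto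
  have two: "card S \<ge> 2" if "a \<in> S" "b \<in> S"
    using card_mono[OF fin, of "{a, b}"] that a by simp
  have ne: "a \<noteq> n + 1" "b \<noteq> n + 1" "n + 1 \<noteq> n + 2" using a by auto
  have r: "rho (card S - 2) = qq (card S - 2) - 2 * qq (card S) + qq (card S + 2)" if "a \<in> S" "b \<in> S"
  proof -
    have "card S - 2 + 2 = card S" "card S - 2 + 4 = card S + 2" using two[OF that] by auto
    then show ?thesis by (simp only: rho_def)
  qed
  have cd: "card {a, b} = 2" "card {a, n + 1} = 2" "card {b, n + 1} = 2" "card {n + 1, n + 2} = 2"
    using a ne by auto
  show "t S * (qq (card (sym_diff {a, b} S)) - qq (card {a, b}) * qq (card S))
     - t S * (qq (card (sym_diff {a, n + 1} S)) - qq (card {a, n + 1}) * qq (card S))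
     - t S * (qq (card (sym_diff {b, n + 1} S)) - qq (card {b, n + 1}) * qq (card S))
     + t S * (qq (card (sym_diff {n + 1, n + 2} S)) - qq (card {n + 1, n + 2}) * qq (card S))
     = t S * (if a \<in> S \<and> b \<in> S then rho (card S - 2) else 0)"
    unfolding cd card_sym_diff_pair'[OF fin a(3)] card_sym_diff_pair'[OF fin ne(1)]
      card_sym_diff_pair'[OF fin ne(2)] card_sym_diff_pair'[OF fin ne(3)]
    using nS by (cases "a \<in> S"; cases "b \<in> S") (simp_all add: r algebra_simps)
qed

lemma source_one:
  assumes a: "a \<in> {1..n}"
  shows "source n t {a, n + 1} - source n t {n + 1, n + 2}
     = (\<Sum>S\<in>Pow {1..n}. t S * (if a \<in> S then pi1 (card S) else 0))"
  unfolding source_def sum_subtractf[symmetric]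
proof (rule sum.cong[OF refl])
  fix S assume S: "S \<in> Pow {1..n}"
  then have fin: "finite S" using finite_subset by auto
  have nS: "n + 1 \<notin> S" "n + 2 \<notin> S" using S by auto
  have ne: "a \<noteq> n + 1" "n + 1 \<noteq> n + 2" using a by auto
  have cd: "card {a, n + 1} = 2" "card {n + 1, n + 2} = 2"
    using ne by auto
  show "t S * (qq (card (sym_diff {a, n + 1} S)) - qq (card {a, n + 1}) * qq (card S))
     - t S * (qq (card (sym_diff {n + 1, n + 2} S)) - qq (card {n + 1, n + 2}) * qq (card S))
     = t S * (if a \<in> S then pi1 (card S) else 0)"
    unfolding cd card_sym_diff_pair'[OF fin ne(1)] card_sym_diff_pair'[OF fin ne(2)]
    using nS by (cases "a \<in> S") (simp_all add: algebra_simps pi1_def)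
qed

lemma source_zero:
  "source n t {n + 1, n + 2} = (\<Sum>S\<in>Pow {1..n}. t S * om2 (card S))"
  unfolding source_def
proof (rule sum.cong[OF refl])
  fix S assume S: "S \<in> Pow {1..n}"
  then have fin: "finite S" using finite_subset by auto
  have nS: "n + 1 \<notin> S" "n + 2 \<notin> S" using S by auto
  have ne: "n + 1 \<noteq> n + 2" by simp
  have cd: "card {n + 1, n + 2} = 2" by simp
  show "t S * (qq (card (sym_diff {n + 1, n + 2} S)) - qq (card {n + 1, n + 2}) * qq (card S)) = t S * om2 (card S)"
    unfolding cd card_sym_diff_pair'[OF fin ne] using nS by (simp add: om2_def)
qed

lemma qq_Suc_numeral: "qq (Suc (Suc 0)) = qq 2" "qq (Suc (Suc (Suc (Suc 0)))) = qq 4"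
  by (simp_all add: eval_nat_numeral)

lemma link_coeff_pair:
  assumes "a \<noteq> b" "l \<noteq> l'"
  shows "link_coeff {a, b} l l' = (let k = (if a \<in> {l, l'} then 1 else 0) + (if b \<in> {l, l'} then 1 else (0 :: nat)) in
    (if k = 0 then qq 4 else if k = 1 then qq 2 else 1) - qq 2 * qq 2)"
  using assms by (simp add: link_coeff_def card_sym_diff_pair Let_def qq_Suc_numeral)

lemma kappa1_pair:
  assumes "a \<noteq> b"
  shows "kappa1 {a, b} l = (if l = a \<or> l = b then 1 - 2 * qq 2 + qq 2 * qq 2 else kap2)"
  using assms by (auto simp: kappa1_def Let_def kap2_def qq_Suc_numeral)

lemma lambda0_two: "lambda0 2 = phi1"
proof -
  have "(3 :: nat) choose 2 = 3" by (simp add: numeral_2_eq_2 numeral_3_eq_3)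
  then show ?thesis by (simp add: lambda0_def phi1_def)
qed

lemma reduced_zero:
  "reduced n {n + 1, n + 2} X2 X1 X0
    = 1 / 2 * om2 2 * (\<Sum>l\<in>{1..n}. \<Sum>l'\<in>{1..n} - {l}. X2 l l') + kap2 * (\<Sum>l\<in>{1..n}. X1 l) + phi1 * X0"
proof -
  have "(\<Sum>l\<in>{1..n}. \<Sum>l'\<in>{1..n} - {l}. link_coeff {n + 1, n + 2} l l' * X2 l l')
     = (\<Sum>l\<in>{1..n}. \<Sum>l'\<in>{1..n} - {l}. om2 2 * X2 l l')"
    by (intro sum.cong refl) (auto simp: link_coeff_pair om2_def)
  moreover have "(\<Sum>l\<in>{1..n}. kappa1 {n + 1, n + 2} l * X1 l) = (\<Sum>l\<in>{1..n}. kap2 * X1 l)"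
    by (intro sum.cong refl) (simp add: kappa1_pair)
  moreover have "card {n + 1, n + 2} = 2" by simp
  ultimately show ?thesis unfolding reduced_def by (simp only: lambda0_two sum_distrib_left mult.assoc)
qed

text \<open>Replacing \<open>a\<close> by a fresh replica changes only the coefficients at
  \<open>a\<close>, so the difference involves \<open>X1 a\<close> and the row of \<open>X2\<close>
  at \<open>a\<close> alone.\<close>

lemma reduced_one:
  assumes a: "a \<in> {1..n}" and sym: "\<And>l l'. X2 l l' = X2 l' l"
  shows "reduced n {a, n + 1} X2 X1 X0 - reduced n {n + 1, n + 2} X2 X1 X0
    = pi1 2 * (\<Sum>l'\<in>{1..n} - {a}. X2 a l') + phi1 * X1 a"
proof -
  have ne: "a \<noteq> n + 1" "n + 1 \<noteq> n + 2" using a by auto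
  have card: "card {a, n + 1} = card {n + 1, n + 2}" using ne by simp
  let ?D = "\<lambda>l l'. link_coeff {a, n + 1} l l' - link_coeff {n + 1, n + 2} l l'"
  have D: "?D l l' = (if l = a then pi1 2 else 0) + (if l' = a then pi1 2 else 0)"
    if "l \<in> {1..n}" "l' \<in> {1..n} - {l}" for l l'
  proof -
    have ll: "l \<noteq> l'" using that by auto
    show ?thesis
      unfolding link_coeff_pair[OF ne(1) ll] link_coeff_pair[OF ne(2) ll] Let_def pi1_def
      using that by (auto simp: qq_Suc_numeral)
  qed
  have "(\<Sum>l\<in>{1..n}. \<Sum>l'\<in>{1..n} - {l}. ?D l l' * X2 l l')
     = (\<Sum>l\<in>{1..n}. \<Sum>l'\<in>{1..n} - {l}. (if l = a then pi1 2 else 0) * X2 l l' + (if l' = a then pi1 2 else 0) * X2 l l')"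
    by (intro sum.cong refl) (simp only: D distrib_right)
  also have "\<dots> = (\<Sum>l\<in>{1..n}. \<Sum>l'\<in>{1..n} - {l}. (if l = a then pi1 2 else 0) * X2 l l')
     + (\<Sum>l\<in>{1..n}. \<Sum>l'\<in>{1..n} - {l}. (if l' = a then pi1 2 else 0) * X2 l l')"
    by (simp only: sum.distrib)
  also have "(\<Sum>l\<in>{1..n}. \<Sum>l'\<in>{1..n} - {l}. (if l' = a then pi1 2 else 0) * X2 l l')
     = (\<Sum>l\<in>{1..n}. \<Sum>l'\<in>{1..n} - {l}. (if l = a then pi1 2 else 0) * X2 l l')"
    by (subst sum_off_diagonal_swap) (simp only: sym)
  also have "(\<Sum>l\<in>{1..n}. \<Sum>l'\<in>{1..n} - {l}. (if l = a then pi1 2 else 0) * X2 l l')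
     = (\<Sum>l\<in>{1..n}. if l = a then pi1 2 * (\<Sum>l'\<in>{1..n} - {a}. X2 a l') else 0)"
    by (intro sum.cong refl) (auto simp: sum_distrib_left)
  also have "\<dots> = pi1 2 * (\<Sum>l'\<in>{1..n} - {a}. X2 a l')"
    using a by (subst sum.delta) auto
  finally have s1: "(\<Sum>l\<in>{1..n}. \<Sum>l'\<in>{1..n} - {l}. ?D l l' * X2 l l') = 2 * (pi1 2 * (\<Sum>l'\<in>{1..n} - {a}. X2 a l'))"
    by simp
  have "(\<Sum>l\<in>{1..n}. (kappa1 {a, n + 1} l - kappa1 {n + 1, n + 2} l) * X1 l)
     = (\<Sum>l\<in>{1..n}. if l = a then phi1 * X1 a else 0)"
    by (intro sum.cong refl) (use ne in \<open>auto simp: kappa1_pair kap2_def phi1_def algebra_simps\<close>)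
  also have "\<dots> = phi1 * X1 a" using a by (subst sum.delta) auto
  finally have s2: "(\<Sum>l\<in>{1..n}. (kappa1 {a, n + 1} l - kappa1 {n + 1, n + 2} l) * X1 l) = phi1 * X1 a" .
  have "reduced n {a, n + 1} X2 X1 X0 - reduced n {n + 1, n + 2} X2 X1 X0
    = 1 / 2 * (\<Sum>l\<in>{1..n}. \<Sum>l'\<in>{1..n} - {l}. ?D l l' * X2 l l')
      + (\<Sum>l\<in>{1..n}. (kappa1 {a, n + 1} l - kappa1 {n + 1, n + 2} l) * X1 l)"
    unfolding reduced_def card left_diff_distrib sum_subtractf by simp
  then show ?thesis unfolding s1 s2 by simp
qed

text \<open>The mixed difference leaves only the link between \<open>a\<close> and \<open>b\<close>:
  the system is diagonal in the two-replica part and hence triangular overall.\<close>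

lemma reduced_two:
  assumes a: "a \<in> {1..n}" "b \<in> {1..n}" "a \<noteq> b" and sym: "\<And>l l'. X2 l l' = X2 l' l"
  shows "reduced n {a, b} X2 X1 X0 - reduced n {a, n + 1} X2 X1 X0 - reduced n {b, n + 1} X2 X1 X0
    + reduced n {n + 1, n + 2} X2 X1 X0 = rho 0 * X2 a b"
proof -
  have ne: "a \<noteq> n + 1" "b \<noteq> n + 1" "n + 1 \<noteq> n + 2" using a by auto
  have card: "card {a, b} = 2" "card {a, n + 1} = 2" "card {b, n + 1} = 2" "card {n + 1, n + 2} = 2"
    using ne a by auto
  let ?D = "\<lambda>l l'. link_coeff {a, b} l l' - link_coeff {a, n + 1} l l' - link_coeff {b, n + 1} l l'
     + link_coeff {n + 1, n + 2} l l'"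
  have D: "?D l l' = (if l = a then if l' = b then rho 0 else 0 else 0) + (if l = b then if l' = a then rho 0 else 0 else 0)"
    if l: "l \<in> {1..n}" "l' \<in> {1..n} - {l}" for l l'
  proof -
    have ll: "l \<noteq> l'" using l by auto
    show ?thesis
      unfolding link_coeff_pair[OF ne(1) ll] link_coeff_pair[OF ne(2) ll] link_coeff_pair[OF ne(3) ll]
        link_coeff_pair[OF a(3) ll] Let_def rho_def
      using l a(3) by (auto simp: qq_Suc_numeral)
  qed
  have "(\<Sum>l\<in>{1..n}. \<Sum>l'\<in>{1..n} - {l}. ?D l l' * X2 l l')
     = (\<Sum>l\<in>{1..n}. \<Sum>l'\<in>{1..n} - {l}. (if l = a then if l' = b then rho 0 * X2 a b else 0 else 0)
         + (if l = b then if l' = a then rho 0 * X2 a b else 0 else 0))"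
  proof (intro sum.cong refl)
    fix l l' assume l: "l \<in> {1..n}" "l' \<in> {1..n} - {l}"
    show "?D l l' * X2 l l' = (if l = a then if l' = b then rho 0 * X2 a b else 0 else 0)
         + (if l = b then if l' = a then rho 0 * X2 a b else 0 else 0)"
      unfolding D[OF l] using a(3) sym by auto
  qed
  also have "\<dots> = (\<Sum>l\<in>{1..n}. (if l = a then rho 0 * X2 a b else 0) + (if l = b then rho 0 * X2 a b else 0))"
    using a by (intro sum.cong refl) (auto simp: sum.distrib)
  also have "\<dots> = 2 * (rho 0 * X2 a b)" using a by (simp add: sum.distrib)
  finally have s1: "(\<Sum>l\<in>{1..n}. \<Sum>l'\<in>{1..n} - {l}. ?D l l' * X2 l l') = 2 * (rho 0 * X2 a b)" .
  have "kappa1 {a, b} l - kappa1 {a, n + 1} l - kappa1 {b, n + 1} l + kappa1 {n + 1, n + 2} l = 0"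
    if "l \<in> {1..n}" for l
    using that a ne by (auto simp: kappa1_pair kap2_def)
  then have s2: "(\<Sum>l\<in>{1..n}. (kappa1 {a, b} l - kappa1 {a, n + 1} l - kappa1 {b, n + 1} l
     + kappa1 {n + 1, n + 2} l) * X1 l) = 0"
    by (intro sum.neutral) simp
  have "reduced n {a, b} X2 X1 X0 - reduced n {a, n + 1} X2 X1 X0 - reduced n {b, n + 1} X2 X1 X0
    + reduced n {n + 1, n + 2} X2 X1 X0 = 1 / 2 * (\<Sum>l\<in>{1..n}. \<Sum>l'\<in>{1..n} - {l}. ?D l l' * X2 l l')
      + (\<Sum>l\<in>{1..n}. (kappa1 {a, b} l - kappa1 {a, n + 1} l - kappa1 {b, n + 1} l
     + kappa1 {n + 1, n + 2} l) * X1 l)"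
    unfolding reduced_def card left_diff_distrib distrib_right sum_subtractf sum.distrib by simp
  then show ?thesis unfolding s1 s2 by simp
qed

lemma small_x2:
  assumes a: "a \<in> {1..n}" "b \<in> {1..n}" "a \<noteq> b"
  shows "small n T (\<lambda>N t \<eta> \<eta>'. (1 - \<beta>\<^sup>2 * rho 0) * x2 N n t \<eta> a b
     - (\<Sum>S\<in>Pow {1..n}. t S * (if a \<in> S \<and> b \<in> S then rho (card S - 2) else 0)) * mean N n t \<eta>')"
proof (rule small_cong)
  show "small n T (\<lambda>N t \<eta> \<eta>'. err n {a, b} N t \<eta> \<eta>' - err n {a, n + 1} N t \<eta> \<eta>'
     - err n {b, n + 1} N t \<eta> \<eta>' + err n {n + 1, n + 2} N t \<eta> \<eta>')"
    by (intro small_add small_diff small_err) (use a in auto)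
  fix N t \<eta> \<eta>'
  have "x2 N n t \<eta> a b = obs N n t \<eta> {a, b} - obs N n t \<eta> {a, n + 1} - obs N n t \<eta> {b, n + 1} + obs N n t \<eta> {n + 1, n + 2}"
    using a by (simp add: x2_def x1_def x0_def)
  then show "(1 - \<beta>\<^sup>2 * rho 0) * x2 N n t \<eta> a b
     - (\<Sum>S\<in>Pow {1..n}. t S * (if a \<in> S \<and> b \<in> S then rho (card S - 2) else 0)) * mean N n t \<eta>'
     = err n {a, b} N t \<eta> \<eta>' - err n {a, n + 1} N t \<eta> \<eta>'
     - err n {b, n + 1} N t \<eta> \<eta>' + err n {n + 1, n + 2} N t \<eta> \<eta>'"
    using reduced_two[OF a, of "x2 N n t \<eta>" "x1 N n t \<eta>" "x0 N n t \<eta>", OF x2_sym]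
      source_pair[OF a, of t] by algebra
qed

lemma small_x1:
  assumes a: "a \<in> {1..n}"
  shows "small n T (\<lambda>N t \<eta> \<eta>'. (1 - \<beta>\<^sup>2 * phi1) * x1 N n t \<eta> a
     - (\<Sum>S\<in>Pow {1..n}. t S * (if a \<in> S then pi1 (card S) else 0)) * mean N n t \<eta>'
     - \<beta>\<^sup>2 * pi1 2 * (\<Sum>l'\<in>{1..n} - {a}. x2 N n t \<eta> a l'))"
proof (rule small_cong)
  show "small n T (\<lambda>N t \<eta> \<eta>'. err n {a, n + 1} N t \<eta> \<eta>' - err n {n + 1, n + 2} N t \<eta> \<eta>')"
    by (intro small_add small_diff small_err) (use a in auto)
  fix N t \<eta> \<eta>'
  have "x1 N n t \<eta> a = obs N n t \<eta> {a, n + 1} - obs N n t \<eta> {n + 1, n + 2}"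
    using a by (simp add: x1_def x0_def)
  then show "(1 - \<beta>\<^sup>2 * phi1) * x1 N n t \<eta> a
     - (\<Sum>S\<in>Pow {1..n}. t S * (if a \<in> S then pi1 (card S) else 0)) * mean N n t \<eta>'
     - \<beta>\<^sup>2 * pi1 2 * (\<Sum>l'\<in>{1..n} - {a}. x2 N n t \<eta> a l')
     = err n {a, n + 1} N t \<eta> \<eta>' - err n {n + 1, n + 2} N t \<eta> \<eta>'"
    using reduced_one[OF a, of "x2 N n t \<eta>" "x1 N n t \<eta>" "x0 N n t \<eta>", OF x2_sym]
      source_one[OF a, of t] by algebra
qed

lemma small_x0:
  "small n T (\<lambda>N t \<eta> \<eta>'. (1 - \<beta>\<^sup>2 * phi1) * x0 N n t \<eta>
     - (\<Sum>S\<in>Pow {1..n}. t S * om2 (card S)) * mean N n t \<eta>'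
     - \<beta>\<^sup>2 * (1 / 2 * om2 2 * (\<Sum>l\<in>{1..n}. \<Sum>l'\<in>{1..n} - {l}. x2 N n t \<eta> l l')
       + kap2 * (\<Sum>l\<in>{1..n}. x1 N n t \<eta> l)))"
proof (rule small_cong)
  show "small n T (\<lambda>N t \<eta> \<eta>'. err n {n + 1, n + 2} N t \<eta> \<eta>')"
    by (intro small_err) auto
  fix N t \<eta> \<eta>'
  show "(1 - \<beta>\<^sup>2 * phi1) * x0 N n t \<eta>
     - (\<Sum>S\<in>Pow {1..n}. t S * om2 (card S)) * mean N n t \<eta>'
     - \<beta>\<^sup>2 * (1 / 2 * om2 2 * (\<Sum>l\<in>{1..n}. \<Sum>l'\<in>{1..n} - {l}. x2 N n t \<eta> l l')
       + kap2 * (\<Sum>l\<in>{1..n}. x1 N n t \<eta> l)) = err n {n + 1, n + 2} N t \<eta> \<eta>'"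
    using reduced_zero[of n "x2 N n t \<eta>" "x1 N n t \<eta>" "x0 N n t \<eta>"] source_zero[of n t]
      x0_def[of N n t \<eta>] by algebra
qed

end

context high_temperature
begin

subsection \<open>Non-degeneracy of the linear system\<close>

text \<open>A nonnegative function has integral zero only if it vanishes almost everywhere, and the
  exceptional point is a null set.\<close>

lemma integral_std_normal_pos:
  assumes g: "g \<in> borel_measurable borel" "\<And>y. 0 \<le> g y" "\<And>y. g y \<le> C"
    and null: "\<And>y. y \<noteq> z \<Longrightarrow> g y \<noteq> 0"
  shows "(LINT y|density lborel std_normal_density. g y) > (0 :: real)"
proof -
  interpret prob_space "density lborel std_normal_density" by (rule prob_space_std_normal)
  have int: "integrable (density lborel std_normal_density) g"
    by (rule integrable_std_normal_bounded[OF g(1), of C]) (use g in \<open>simp add: abs_of_nonneg\<close>)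
  have "(LINT y|density lborel std_normal_density. g y) \<noteq> 0"
  proof
    assume "(LINT y|density lborel std_normal_density. g y) = 0"
    then have "AE y in density lborel std_normal_density. g y = 0"
      using integral_nonneg_eq_0_iff_AE[OF int] g(2) by simp
    then have "AE y in lborel. g y = 0"
      by (subst (asm) AE_density) (auto elim!: eventually_mono simp: normal_density_pos)
    moreover have "AE y in lborel. y \<noteq> z" by (rule AE_lborel_singleton)
    ultimately have "AE y in (lborel :: real measure). False"
      by eventually_elim (use null in blast)
    then show False using AE_iff_null[of lborel "\<lambda>_. False"] by (auto simp: eventually_False ae_filter_eq_bot_iff)
  qed
  moreover have "(LINT y|density lborel std_normal_density. g y) \<ge> 0" using g by simp
  ultimately show ?thesis by simp
qed

lemma tanh_sq_lt_1: "tanh x ^ 2 < (1 :: real)"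
  using tanh_real_abs[of x] abs_square_less_1[of "tanh x"] tanh_real_bounds[of x] by (auto simp: abs_less_iff)

lemma rho_zero_pos: "0 < rho 0"
proof -
  let ?f = "\<lambda>y. tanh (\<beta> * sqrt q * y + \<beta> * h)"
  have "(LINT y|density lborel std_normal_density. (1 - ?f y ^ 2)\<^sup>2) > 0"
  proof (rule integral_std_normal_pos)
    show "(1 - ?f y ^ 2)\<^sup>2 \<le> 1" for y
      using tanh_sq_lt_1[of "\<beta> * sqrt q * y + \<beta> * h"] by (intro power_le_one) auto
    show "(1 - ?f y ^ 2)\<^sup>2 \<noteq> 0" for y
      using tanh_sq_lt_1[of "\<beta> * sqrt q * y + \<beta> * h"] by simp
  qed auto
  also have "(LINT y|density lborel std_normal_density. (1 - ?f y ^ 2)\<^sup>2)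
     = (LINT y|density lborel std_normal_density. ?f y ^ 0 - 2 * ?f y ^ 2 + ?f y ^ 4)"
    by (intro Bochner_Integration.integral_cong refl) (simp add: power2_eq_square power4_eq_xxxx algebra_simps)
  also have "\<dots> = (LINT y|density lborel std_normal_density. ?f y ^ 0 - 2 * ?f y ^ 2)
     + (LINT y|density lborel std_normal_density. ?f y ^ 4)"
    by (intro Bochner_Integration.integral_add Bochner_Integration.integrable_diff integrable_mult_right
          integrable_tanh_power)
  also have "(LINT y|density lborel std_normal_density. ?f y ^ 0 - 2 * ?f y ^ 2)
     = (LINT y|density lborel std_normal_density. ?f y ^ 0) - (LINT y|density lborel std_normal_density. 2 * ?f y ^ 2)"
    by (intro Bochner_Integration.integral_diff integrable_mult_right integrable_tanh_power)
  also have "(LINT y|density lborel std_normal_density. 2 * ?f y ^ 2)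
     = 2 * (LINT y|density lborel std_normal_density. ?f y ^ 2)" by simp
  finally have "0 < qq 0 - 2 * qq 2 + qq 4" unfolding tanh_moment_def .
  then have "0 < rho 0" by (simp add: rho_def qq_Suc_numeral)
  then show ?thesis .
qed

lemma pi1_two_pos:
  assumes "\<beta> * h \<noteq> 0"
  shows "0 < pi1 2"
proof -
  let ?a = "\<beta> * sqrt q" and ?b = "\<beta> * h"
  let ?f = "\<lambda>y. tanh (?a * y + ?b)"
  have "(LINT y|density lborel std_normal_density. ?f y ^ 2 * (1 - ?f y ^ 2)) > 0"
  \<comment> \<open>The only possible zero of the argument of \<open>tanh\<close>. If
    \<open>\<beta> * sqrt q = 0\<close>, the quotient is 0 by convention and the argument is the
    nonzero constant \<open>\<beta> * h\<close>.\<close>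
  proof (rule integral_std_normal_pos[where z = "- ?b / ?a"])
    fix y
    have lt: "?f y ^ 2 < 1" by (rule tanh_sq_lt_1)
    show "0 \<le> ?f y ^ 2 * (1 - ?f y ^ 2)" using lt by (intro mult_nonneg_nonneg) auto
    show "?f y ^ 2 * (1 - ?f y ^ 2) \<le> 1" using lt by (intro mult_le_one) auto
    show "?f y ^ 2 * (1 - ?f y ^ 2) \<noteq> 0" if "y \<noteq> - ?b / ?a"
    proof -
      have "?a * y + ?b \<noteq> 0"
      proof
        assume eq: "?a * y + ?b = 0"
        have "?a \<noteq> 0" using assms eq by auto
        moreover have "?a * y = - ?b" using eq by linarith
        ultimately have "y = - ?b / ?a" by (metis nonzero_mult_div_cancel_left)
        with that show False by simp
      qed
      then show ?thesis using lt by simp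
    qed
  qed auto
  also have "(LINT y|density lborel std_normal_density. ?f y ^ 2 * (1 - ?f y ^ 2))
     = (LINT y|density lborel std_normal_density. ?f y ^ 2 - ?f y ^ 4)"
    by (intro Bochner_Integration.integral_cong refl) (simp add: power2_eq_square power4_eq_xxxx algebra_simps)
  also have "\<dots> = pi1 2"
    unfolding pi1_def tanh_moment_def
    using integrable_tanh_power[of "\<beta> * sqrt q" "\<beta> * h"] by (simp add: Bochner_Integration.integral_diff)
  finally show ?thesis .
qed

lemma cos_ge: "cos x \<ge> 1 - x\<^sup>2 / (2 :: real)"
  using cos_squared_eq[of "x / 2"] sin_x_le_x abs_sin_x_le_abs_x[of "x / 2"] cos_double_sin[of "x / 2"]
    power_mono[OF abs_sin_x_le_abs_x[of "x / 2"], of 2]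
  by (simp add: power_divide)

text \<open>If a factor \<open>1 - \<beta>\<^sup>2 rho_0\<close> or \<open>1 - \<beta>\<^sup>2 phi_1\<close> vanished, the characteristic function of the
  rescaled overlap of two replicas would tend to \<open>0\<close> at every small argument, contradicting
  tightness.\<close>

definition only12 :: "(nat set \<Rightarrow> real) \<Rightarrow> nat set \<Rightarrow> real" where
  "only12 t S = (if S = {1, 2} then t {1, 2} else 0)"

lemma small_only12:
  assumes "small 2 \<tau> f"
  shows "small 2 \<tau> (\<lambda>N t \<eta> \<eta>'. f N (only12 t) \<eta> \<eta>')"
proof -
  obtain C where C: "\<And>N t \<eta> \<eta>'. N \<ge> 1 \<Longrightarrow> (\<Sum>S\<in>Pow {1..2}. \<bar>t S\<bar>) \<le> \<tau> \<Longrightarrow> smooth_pair \<eta> \<eta>' \<Longrightarrow>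
     \<bar>f N t \<eta> \<eta>'\<bar> \<le> C / sqrt (real N)" using smallD[OF assms] by blast
  show ?thesis unfolding small_def
  proof (intro exI[of _ C] allI impI)
    fix N :: nat and t :: "nat set \<Rightarrow> real" and \<eta> \<eta>'
    assume N: "1 \<le> N" and t: "(\<Sum>S\<in>Pow {1..2}. \<bar>t S\<bar>) \<le> \<tau>" and sm: "smooth_pair \<eta> \<eta>'"
    have "(\<Sum>S\<in>Pow {1..2}. \<bar>only12 t S\<bar>) \<le> (\<Sum>S\<in>Pow {1..2}. \<bar>t S\<bar>)"
      by (intro sum_mono) (auto simp: only12_def)
    with t have "(\<Sum>S\<in>Pow {1..2}. \<bar>only12 t S\<bar>) \<le> \<tau>" by linarith
    then show "\<bar>f N (only12 t) \<eta> \<eta>'\<bar> \<le> C / sqrt (real N)" by (rule C[OF N _ sm])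
  qed
qed

lemma sum_only12:
  fixes f :: "nat set \<Rightarrow> real"
  shows "(\<Sum>S\<in>Pow {1..2}. only12 t S * f S) = t {1, 2} * f {1, 2}"
proof -
  have P: "{1, 2 :: nat} \<in> Pow {1..2}" by auto
  have "(\<Sum>S\<in>Pow {1..2}. only12 t S * f S) = (\<Sum>S\<in>Pow {1..2 :: nat}. if S = {1, 2} then t {1, 2} * f {1, 2} else 0)"
    by (intro sum.cong refl) (simp add: only12_def)
  then show ?thesis using P by (subst (asm) sum.delta) auto
qed

lemma card12: "card {1, 2 :: nat} = 2"
  by simp

text \<open>Tightness: for small \<open>\<tau>\<close> the average of \<open>cos\<close> stays above
  1/2, by \<open>cos_ge\<close> and the second-moment bound, so no nonzero multiple of it is an
  error of order \<open>1 / sqrt N\<close>.\<close>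

lemma not_small_mean:
  "\<exists>\<tau>>0. \<forall>c. small 2 \<tau> (\<lambda>N t \<eta> \<eta>'. c * t {1, 2} * mean N 2 (only12 t) \<eta>') \<longrightarrow> c = 0"
proof -
  \<comment> \<open>Chosen so that \<open>\<tau>\<^sup>2 * L \<le> 1\<close>, which gives the lower
    bound 1/2.\<close>
  define \<tau> where "\<tau> = 1 / sqrt (L + 1)"
  define t where "t = only12 (\<lambda>_. \<tau>)"
  have t12: "t {1, 2} = \<tau>" "only12 t = t" by (auto simp: t_def only12_def)
  have L1: "L + 1 > 0" using L_nonneg by simp
  have \<tau>: "\<tau> > 0" "\<tau>\<^sup>2 = 1 / (L + 1)" using L1 by (simp_all add: \<tau>_def power_divide)
  have T: "(\<Sum>S\<in>Pow {1..2}. \<bar>t S\<bar>) \<le> \<tau>"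
  proof -
    have "(\<Sum>S\<in>Pow {1..2}. \<bar>t S\<bar>) = (\<Sum>S\<in>Pow {1..2}. only12 (\<lambda>_. \<tau>) S * 1)"
      using \<tau> by (intro sum.cong refl) (simp add: t_def only12_def)
    then show ?thesis by (simp only: sum_only12)
  qed
  have half: "1 / 2 \<le> mean N 2 t cos" if N: "N \<ge> 1" for N
  proof -
    have fl: "fluct N 2 t \<sigma> = \<tau> * (sqrt (real N) * (sk_overlap N {1, 2} \<sigma> - q))" for \<sigma>
      unfolding fluct_def t_def sum_only12 by (simp add: q_eq_moment[unfolded numeral_2_eq_2])
    have "1 / 2 \<le> 1 - \<tau>\<^sup>2 / 2 * (real N * (L / real N))"
    proof -
      have "L \<le> 1 * (L + 1)" by simp
      then have "\<tau>\<^sup>2 * L \<le> 1" unfolding \<tau> using L1 by (simp add: field_simps)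
      then show ?thesis using N by simp
    qed
    also have "\<dots> \<le> 1 - \<tau>\<^sup>2 / 2 * (real N * \<nu> N (2 + 8) (\<lambda>\<sigma>. (sk_overlap N {1, 2} \<sigma> - q)\<^sup>2))"
      using overlap_moment[of 1 "2 + 8" 2 N] N by (intro diff_left_mono mult_left_mono) auto
    also have "\<dots> = \<nu> N (2 + 8) (\<lambda>\<sigma>. 1 - \<tau>\<^sup>2 / 2 * (real N * (sk_overlap N {1, 2} \<sigma> - q)\<^sup>2))"
      by (simp only: sk_avg_diff sk_avg_cmult sk_avg_const[OF finite_atLeastAtMost])
    also have "\<dots> \<le> mean N 2 t cos"
      unfolding mean_def
    proof (rule sk_avg_mono)
      fix \<sigma>
      show "1 - \<tau>\<^sup>2 / 2 * (real N * (sk_overlap N {1, 2} \<sigma> - q)\<^sup>2) \<le> cos (fluct N 2 t \<sigma>)"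
        using cos_ge[of "fluct N 2 t \<sigma>"] by (simp add: fl power_mult_distrib)
    qed
    finally show ?thesis .
  qed
  have "c = 0" if sm: "small 2 \<tau> (\<lambda>N t \<eta> \<eta>'. c * t {1, 2} * mean N 2 (only12 t) \<eta>')" for c
  proof -
    obtain C where C: "\<And>N t \<eta> \<eta>'. N \<ge> 1 \<Longrightarrow> (\<Sum>S\<in>Pow {1..2}. \<bar>t S\<bar>) \<le> \<tau> \<Longrightarrow> smooth_pair \<eta> \<eta>' \<Longrightarrow>
       \<bar>c * t {1, 2} * mean N 2 (only12 t) \<eta>'\<bar> \<le> C / sqrt (real N)" using smallD[OF sm] by blast
    have bd: "\<bar>c\<bar> * \<tau> / 2 \<le> C / sqrt (real N)" if N: "N \<ge> 1" for N
    proof -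
      have "\<bar>c\<bar> * \<tau> / 2 = \<bar>c\<bar> * \<tau> * (1 / 2)" by simp
      also have "\<dots> \<le> \<bar>c\<bar> * \<tau> * mean N 2 t cos" using half[OF N] \<tau> by (intro mult_left_mono) auto
      also have "\<dots> = \<bar>c * t {1, 2} * mean N 2 (only12 t) cos\<bar>"
        using half[OF N] \<tau> by (simp add: abs_mult t12 del: One_nat_def)
      also have "\<dots> \<le> C / sqrt (real N)" by (rule C[OF N T smooth_pair_sin])
      finally show ?thesis .
    qed
    have "(\<lambda>N. C / sqrt (real N)) \<longlonglongrightarrow> 0" by real_asymp
    then have "\<bar>c\<bar> * \<tau> / 2 \<le> 0"
      by (rule LIMSEQ_le_const) (use bd in blast)
    then show "c = 0" using \<tau> by (simp add: mult_le_0_iff)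
  qed
  with \<tau> show ?thesis by blast
qed

lemma small_x2_only12:
  "small 2 \<tau> (\<lambda>N t \<eta> \<eta>'. (1 - \<beta>\<^sup>2 * rho 0) * x2 N 2 (only12 t) \<eta> 1 2 - t {1, 2} * rho 0 * mean N 2 (only12 t) \<eta>')"
proof (rule small_cong)
  show "small 2 \<tau> (\<lambda>N t \<eta> \<eta>'. (1 - \<beta>\<^sup>2 * rho 0) * x2 N 2 (only12 t) \<eta> 1 2
     - (\<Sum>S\<in>Pow {1..2}. only12 t S * (if 1 \<in> S \<and> 2 \<in> S then rho (card S - 2) else 0)) * mean N 2 (only12 t) \<eta>')"
    by (rule small_only12[OF small_x2]) auto
qed (simp add: sum_only12 card12 del: One_nat_def)

lemma small_x1_only12:
  "small 2 \<tau> (\<lambda>N t \<eta> \<eta>'. (1 - \<beta>\<^sup>2 * phi1) * x1 N 2 (only12 t) \<eta> 1 - t {1, 2} * pi1 2 * mean N 2 (only12 t) \<eta>'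
     - \<beta>\<^sup>2 * pi1 2 * x2 N 2 (only12 t) \<eta> 1 2)"
proof (rule small_cong)
  show "small 2 \<tau> (\<lambda>N t \<eta> \<eta>'. (1 - \<beta>\<^sup>2 * phi1) * x1 N 2 (only12 t) \<eta> 1
     - (\<Sum>S\<in>Pow {1..2}. only12 t S * (if 1 \<in> S then pi1 (card S) else 0)) * mean N 2 (only12 t) \<eta>'
     - \<beta>\<^sup>2 * pi1 2 * (\<Sum>l'\<in>{1..2} - {1}. x2 N 2 (only12 t) \<eta> 1 l'))"
    by (rule small_only12[OF small_x1]) auto
  have "{1..2 :: nat} - {1} = {2}" by auto
  then show "(1 - \<beta>\<^sup>2 * phi1) * x1 N 2 (only12 t) \<eta> 1 - t {1, 2} * pi1 2 * mean N 2 (only12 t) \<eta>'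
     - \<beta>\<^sup>2 * pi1 2 * x2 N 2 (only12 t) \<eta> 1 2 = (1 - \<beta>\<^sup>2 * phi1) * x1 N 2 (only12 t) \<eta> 1
     - (\<Sum>S\<in>Pow {1..2}. only12 t S * (if 1 \<in> S then pi1 (card S) else 0)) * mean N 2 (only12 t) \<eta>'
     - \<beta>\<^sup>2 * pi1 2 * (\<Sum>l'\<in>{1..2} - {1}. x2 N 2 (only12 t) \<eta> 1 l')" for N t \<eta> and \<eta>' :: "real \<Rightarrow> real"
    by (simp add: sum_only12 card12 del: One_nat_def)
qed

lemma rho_nondegenerate: "1 - \<beta>\<^sup>2 * rho 0 \<noteq> 0"
proof
  assume eq: "1 - \<beta>\<^sup>2 * rho 0 = 0"
  obtain \<tau> where \<tau>: "\<forall>c. small 2 \<tau> (\<lambda>N t \<eta> \<eta>'. c * t {1, 2} * mean N 2 (only12 t) \<eta>') \<longrightarrow> c = 0"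
    using not_small_mean by blast
  have "small 2 \<tau> (\<lambda>N t \<eta> \<eta>'. rho 0 * t {1, 2} * mean N 2 (only12 t) \<eta>')"
    by (rule small_cong[OF small_cmult[OF small_x2_only12, of _ "-1"]]) (simp add: eq)
  then have "rho 0 = 0" using \<tau> by blast
  with rho_zero_pos show False by simp
qed

lemma phi_nondegenerate:
  assumes "\<beta> * h \<noteq> 0"
  shows "1 - \<beta>\<^sup>2 * phi1 \<noteq> 0"
proof
  assume eq: "1 - \<beta>\<^sup>2 * phi1 = 0"
  define x where "x = 1 - \<beta>\<^sup>2 * rho 0"
  obtain \<tau> where \<tau>: "\<forall>c. small 2 \<tau> (\<lambda>N t \<eta> \<eta>'. c * t {1, 2} * mean N 2 (only12 t) \<eta>') \<longrightarrow> c = 0"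
    using not_small_mean by blast
  have "small 2 \<tau> (\<lambda>N t \<eta> \<eta>'. pi1 2 * t {1, 2} * mean N 2 (only12 t) \<eta>')"
  \<comment> \<open>As the factor of \<open>x1\<close> is zero, this combination eliminates both
    \<open>x1\<close> and \<open>x2\<close>. What is left has the coefficient
    \<open>pi1 2 * (x + \<beta>\<^sup>2 * rho 0) = pi1 2\<close>.\<close>
  proof (rule small_cong[OF small_diff[OF
        small_cmult[OF small_x1_only12, of \<tau> "- x"] small_cmult[OF small_x2_only12, of \<tau> "\<beta>\<^sup>2 * pi1 2"]]])
    fix N :: nat and t :: "nat set \<Rightarrow> real" and \<eta> \<eta>' :: "real \<Rightarrow> real"
    show "pi1 2 * t {1, 2} * mean N 2 (only12 t) \<eta>' = - x * ((1 - \<beta>\<^sup>2 * phi1) * x1 N 2 (only12 t) \<eta> 1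
        - t {1, 2} * pi1 2 * mean N 2 (only12 t) \<eta>' - \<beta>\<^sup>2 * pi1 2 * x2 N 2 (only12 t) \<eta> 1 2)
        - \<beta>\<^sup>2 * pi1 2 * ((1 - \<beta>\<^sup>2 * rho 0) * x2 N 2 (only12 t) \<eta> 1 2 - t {1, 2} * rho 0 * mean N 2 (only12 t) \<eta>')"
      unfolding eq x_def by algebra
  qed
  then have "pi1 2 = 0" using \<tau> by blast
  with pi1_two_pos[OF assms] show False by simp
qed

subsection \<open>The limiting covariance in closed form\<close>

text \<open>Solution of the triangular system for weights concentrated on one set of size
  \<open>s\<close>: \<open>a2\<close> for a pair inside the set, then \<open>a1\<close> for an
  element, then \<open>a0\<close>. The factors \<open>real s - 1\<close> and
  \<open>real s * (real s - 1)\<close> count a row and all ordered pairs.\<close>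

definition a2 :: "nat \<Rightarrow> real" where "a2 s = rho (s - 2) / (1 - \<beta>\<^sup>2 * rho 0)"
definition a1 :: "nat \<Rightarrow> real" where
  "a1 s = (pi1 s + \<beta>\<^sup>2 * pi1 2 * ((real s - 1) * a2 s)) / (1 - \<beta>\<^sup>2 * phi1)"
definition a0 :: "nat \<Rightarrow> real" where
  "a0 s = (om2 s + \<beta>\<^sup>2 * (1 / 2 * om2 2 * (real s * (real s - 1) * a2 s) + kap2 * (real s * a1 s))) / (1 - \<beta>\<^sup>2 * phi1)"

definition ind2 :: "nat set \<Rightarrow> nat \<Rightarrow> nat \<Rightarrow> real" where
  "ind2 S l l' = (if l \<in> S \<and> l' \<in> S then a2 (card S) else 0)"
definition ind1 :: "nat set \<Rightarrow> nat \<Rightarrow> real" where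
  "ind1 S l = (if l \<in> S then a1 (card S) else 0)"

text \<open>The covariance as the cavity equation delivers it, with the solved system inserted;
  \<open>cov_eq\<close> identifies it with the sum over common subsets.\<close>

definition cov :: "nat \<Rightarrow> nat set \<Rightarrow> nat set \<Rightarrow> real" where
  "cov n W S = (qq (card (sym_diff W S)) - qq (card W) * qq (card S))
     + \<beta>\<^sup>2 * reduced n W (ind2 S) (ind1 S) (a0 (card S))"

lemma sum_ind2_row:
  assumes "S \<subseteq> {1..n}" "a \<in> {1..n}"
  shows "(\<Sum>l'\<in>{1..n} - {a}. ind2 S a l') = (if a \<in> S then (real (card S) - 1) * a2 (card S) else 0)"
proof -
  have fin: "finite S" using finite_subset[OF assms(1)] by simp
  have "(\<Sum>l'\<in>{1..n} - {a}. ind2 S a l') = (\<Sum>l'\<in>S - {a}. ind2 S a l')"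
    by (rule sum.mono_neutral_right) (use assms in \<open>auto simp: ind2_def\<close>)
  also have "\<dots> = (\<Sum>l'\<in>S - {a}. if a \<in> S then a2 (card S) else 0)"
    by (intro sum.cong refl) (simp add: ind2_def)
  also have "\<dots> = (if a \<in> S then (real (card S) - 1) * a2 (card S) else 0)"
  proof (cases "a \<in> S")
    case True
    then have "card S \<ge> 1" using fin by (metis One_nat_def Suc_leI card_gt_0_iff empty_iff)
    then show ?thesis using True fin by (simp add: of_nat_diff)
  qed simp
  finally show ?thesis .
qed

lemma sum_ind:
  assumes "S \<subseteq> {1..n :: nat}"
  shows "(\<Sum>l\<in>{1..n}. if l \<in> S then c else 0) = real (card S) * (c :: real)"
proof -
  have "(\<Sum>l\<in>{1..n}. if l \<in> S then c else 0) = (\<Sum>l\<in>S. c)"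
    using assms by (intro sum.mono_neutral_cong_right) auto
  then show ?thesis by simp
qed

lemma reduced_add:
  "reduced n W (\<lambda>l l'. f l l' + f' l l') (\<lambda>l. g l + g' l) (k + k') = reduced n W f g k + reduced n W f' g' k'"
  by (simp add: reduced_def distrib_left sum.distrib algebra_simps)

lemma reduced_cmult: "reduced n W (\<lambda>l l'. c * f l l') (\<lambda>l. c * g l) (c * k) = c * reduced n W f g k"
  by (simp add: reduced_def sum_distrib_left algebra_simps)

lemma reduced_diff:
  "reduced n W (\<lambda>l l'. f l l' - f' l l') (\<lambda>l. g l - g' l) (k - k') = reduced n W f g k - reduced n W f' g' k'"
  using reduced_add[of n W f "\<lambda>l l'. - 1 * f' l l'" g "\<lambda>l. - 1 * g' l" k "- 1 * k'"]
  unfolding reduced_cmult by simp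

lemma reduced_sum:
  assumes "finite F"
  shows "reduced n W (\<lambda>l l'. \<Sum>S\<in>F. t S * f S l l') (\<lambda>l. \<Sum>S\<in>F. t S * g S l) (\<Sum>S\<in>F. t S * k S)
    = (\<Sum>S\<in>F. t S * reduced n W (f S) (g S) (k S))"
  using assms
proof (induction F rule: finite_induct)
  case empty then show ?case by (simp add: reduced_def)
next
  case (insert S F)
  then show ?case by (simp add: reduced_add reduced_cmult)
qed

abbreviation X2 where "X2 n t l l' \<equiv> \<Sum>S\<in>Pow {1..n}. t S * ind2 S l l'"
abbreviation X1 where "X1 n t l \<equiv> \<Sum>S\<in>Pow {1..n}. t S * ind1 S l"
abbreviation X0 where "X0 n t \<equiv> \<Sum>S\<in>Pow {1..n}. t S * a0 (card S)"

lemma small_x2_solved: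
  assumes "a \<in> {1..n}" "b \<in> {1..n}" "a \<noteq> b"
  shows "small n T (\<lambda>N t \<eta> \<eta>'. x2 N n t \<eta> a b - mean N n t \<eta>' * X2 n t a b)"
proof (rule small_cong[OF small_cmult[OF small_x2[OF assms], of T "1 / (1 - \<beta>\<^sup>2 * rho 0)"]])
  fix N t \<eta> \<eta>'
  let ?x = "1 - \<beta>\<^sup>2 * rho 0"
  have "X2 n t a b = 1 / ?x * (\<Sum>S\<in>Pow {1..n}. t S * (if a \<in> S \<and> b \<in> S then rho (card S - 2) else 0))"
    unfolding sum_distrib_left by (intro sum.cong refl) (simp add: ind2_def a2_def)
  then show "x2 N n t \<eta> a b - mean N n t \<eta>' * X2 n t a b = 1 / ?x * (?x * x2 N n t \<eta> a b
     - (\<Sum>S\<in>Pow {1..n}. t S * (if a \<in> S \<and> b \<in> S then rho (card S - 2) else 0)) * mean N n t \<eta>')"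
    using rho_nondegenerate by (simp add: right_diff_distrib)
qed

lemma small_x1_solved:
  assumes a: "a \<in> {1..n}" and bh: "\<beta> * h \<noteq> 0"
  shows "small n T (\<lambda>N t \<eta> \<eta>'. x1 N n t \<eta> a - mean N n t \<eta>' * X1 n t a)"
proof -
  let ?y = "1 - \<beta>\<^sup>2 * phi1"
  let ?D2 = "\<lambda>N t \<eta> \<eta>'. \<Sum>l'\<in>{1..n} - {a}. x2 N n t \<eta> a l' - mean N n t \<eta>' * X2 n t a l'"
  let ?s = "\<lambda>t. \<Sum>S\<in>Pow {1..n}. t S * (if a \<in> S then pi1 (card S) else 0)"
  have D2: "small n T ?D2" by (rule small_sum, rule small_x2_solved[OF a]) auto
  have y: "?y \<noteq> 0" by (rule phi_nondegenerate[OF bh])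
  \<comment> \<open>The candidate \<open>X1\<close> solves the limiting equation exactly, so the
    difference satisfies an equation with nothing but errors on its right-hand side.\<close>
  have X: "?y * X1 n t a = ?s t + \<beta>\<^sup>2 * pi1 2 * (\<Sum>l'\<in>{1..n} - {a}. X2 n t a l')" for t
  proof -
    have "(\<Sum>l'\<in>{1..n} - {a}. X2 n t a l') = (\<Sum>S\<in>Pow {1..n}. t S * (\<Sum>l'\<in>{1..n} - {a}. ind2 S a l'))"
      by (subst sum.swap) (simp add: sum_distrib_left)
    also have "\<dots> = (\<Sum>S\<in>Pow {1..n}. t S * (if a \<in> S then (real (card S) - 1) * a2 (card S) else 0))"
      by (intro sum.cong refl arg_cong2[where f = "(*)"] sum_ind2_row a) auto
    finally have "?s t + \<beta>\<^sup>2 * pi1 2 * (\<Sum>l'\<in>{1..n} - {a}. X2 n t a l')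
       = (\<Sum>S\<in>Pow {1..n}. t S * (if a \<in> S then pi1 (card S) + \<beta>\<^sup>2 * pi1 2 * ((real (card S) - 1) * a2 (card S)) else 0))"
      by (simp only: sum_distrib_left sum.distrib[symmetric]) (intro sum.cong refl, simp add: algebra_simps)
    also have "\<dots> = (\<Sum>S\<in>Pow {1..n}. ?y * (t S * ind1 S a))"
      using y by (intro sum.cong refl) (simp add: ind1_def a1_def)
    finally show ?thesis by (simp only: sum_distrib_left)
  qed
  have "small n T (\<lambda>N t \<eta> \<eta>'. 1 / ?y * ((?y * x1 N n t \<eta> a - ?s t * mean N n t \<eta>'
     - \<beta>\<^sup>2 * pi1 2 * (\<Sum>l'\<in>{1..n} - {a}. x2 N n t \<eta> a l')) + \<beta>\<^sup>2 * pi1 2 * ?D2 N t \<eta> \<eta>'))"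
    by (intro small_cmult small_add small_x1 a D2)
  then show ?thesis
  proof (rule small_cong)
    fix N t \<eta> \<eta>'
    have "?D2 N t \<eta> \<eta>' = (\<Sum>l'\<in>{1..n} - {a}. x2 N n t \<eta> a l') - mean N n t \<eta>' * (\<Sum>l'\<in>{1..n} - {a}. X2 n t a l')"
      unfolding sum_subtractf sum_distrib_left[of "mean N n t \<eta>'"] ..
    then have "(?y * x1 N n t \<eta> a - ?s t * mean N n t \<eta>'
     - \<beta>\<^sup>2 * pi1 2 * (\<Sum>l'\<in>{1..n} - {a}. x2 N n t \<eta> a l')) + \<beta>\<^sup>2 * pi1 2 * ?D2 N t \<eta> \<eta>'
      = ?y * (x1 N n t \<eta> a - mean N n t \<eta>' * X1 n t a)"
      using X[of t] by algebra
    then show "x1 N n t \<eta> a - mean N n t \<eta>' * X1 n t a = 1 / ?y * ((?y * x1 N n t \<eta> a - ?s t * mean N n t \<eta>'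
     - \<beta>\<^sup>2 * pi1 2 * (\<Sum>l'\<in>{1..n} - {a}. x2 N n t \<eta> a l')) + \<beta>\<^sup>2 * pi1 2 * ?D2 N t \<eta> \<eta>')"
      using y by simp
  qed
qed

lemma small_x0_solved:
  assumes bh: "\<beta> * h \<noteq> 0"
  shows "small n T (\<lambda>N t \<eta> \<eta>'. x0 N n t \<eta> - mean N n t \<eta>' * X0 n t)"
proof -
  let ?y = "1 - \<beta>\<^sup>2 * phi1"
  let ?D2 = "\<lambda>N t \<eta> \<eta>'. \<Sum>l\<in>{1..n}. \<Sum>l'\<in>{1..n} - {l}. x2 N n t \<eta> l l' - mean N n t \<eta>' * X2 n t l l'"
  let ?D1 = "\<lambda>N t \<eta> \<eta>'. \<Sum>l\<in>{1..n}. x1 N n t \<eta> l - mean N n t \<eta>' * X1 n t l"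
  let ?s = "\<lambda>t. \<Sum>S\<in>Pow {1..n}. t S * om2 (card S)"
  have D: "small n T ?D2" "small n T ?D1"
  proof -
    show "small n T ?D2" by (rule small_sum, rule small_sum, rule small_x2_solved) auto
    show "small n T ?D1" by (rule small_sum, rule small_x1_solved[OF _ bh])
  qed
  have y: "?y \<noteq> 0" by (rule phi_nondegenerate[OF bh])
  have X: "?y * X0 n t = ?s t + \<beta>\<^sup>2 * (1 / 2 * om2 2 * (\<Sum>l\<in>{1..n}. \<Sum>l'\<in>{1..n} - {l}. X2 n t l l')
       + kap2 * (\<Sum>l\<in>{1..n}. X1 n t l))" for t
  proof -
    have "(\<Sum>l\<in>{1..n}. \<Sum>l'\<in>{1..n} - {l}. X2 n t l l') = (\<Sum>l\<in>{1..n}. \<Sum>S\<in>Pow {1..n}. t S * (\<Sum>l'\<in>{1..n} - {l}. ind2 S l l'))"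
      by (intro sum.cong refl, subst sum.swap) (simp add: sum_distrib_left)
    also have "\<dots> = (\<Sum>S\<in>Pow {1..n}. t S * (\<Sum>l\<in>{1..n}. \<Sum>l'\<in>{1..n} - {l}. ind2 S l l'))"
      by (subst sum.swap) (simp add: sum_distrib_left)
    also have "\<dots> = (\<Sum>S\<in>Pow {1..n}. t S * (real (card S) * ((real (card S) - 1) * a2 (card S))))"
    proof (intro sum.cong refl arg_cong2[where f = "(*)"])
      fix S assume S: "S \<in> Pow {1..n}"
      have "(\<Sum>l\<in>{1..n}. \<Sum>l'\<in>{1..n} - {l}. ind2 S l l')
         = (\<Sum>l\<in>{1..n}. if l \<in> S then (real (card S) - 1) * a2 (card S) else 0)"
        using S by (intro sum.cong refl sum_ind2_row) auto
      then show "(\<Sum>l\<in>{1..n}. \<Sum>l'\<in>{1..n} - {l}. ind2 S l l') = real (card S) * ((real (card S) - 1) * a2 (card S))"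
        using S by (simp only: sum_ind Pow_iff)
    qed
    finally have e2: "(\<Sum>l\<in>{1..n}. \<Sum>l'\<in>{1..n} - {l}. X2 n t l l')
       = (\<Sum>S\<in>Pow {1..n}. t S * (real (card S) * ((real (card S) - 1) * a2 (card S))))" .
    have "(\<Sum>l\<in>{1..n}. X1 n t l) = (\<Sum>S\<in>Pow {1..n}. t S * (\<Sum>l\<in>{1..n}. ind1 S l))"
      by (subst sum.swap) (simp add: sum_distrib_left)
    also have "\<dots> = (\<Sum>S\<in>Pow {1..n}. t S * (real (card S) * a1 (card S)))"
      unfolding ind1_def by (intro sum.cong refl arg_cong2[where f = "(*)"] sum_ind) auto
    finally have e1: "(\<Sum>l\<in>{1..n}. X1 n t l) = (\<Sum>S\<in>Pow {1..n}. t S * (real (card S) * a1 (card S)))" .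
    have "?s t + \<beta>\<^sup>2 * (1 / 2 * om2 2 * (\<Sum>l\<in>{1..n}. \<Sum>l'\<in>{1..n} - {l}. X2 n t l l')
       + kap2 * (\<Sum>l\<in>{1..n}. X1 n t l)) = (\<Sum>S\<in>Pow {1..n}. t S * (om2 (card S) + \<beta>\<^sup>2 *
         (1 / 2 * om2 2 * (real (card S) * (real (card S) - 1) * a2 (card S)) + kap2 * (real (card S) * a1 (card S)))))"
      unfolding e1 e2
      by (simp only: sum_distrib_left sum.distrib[symmetric]) (intro sum.cong refl, simp add: algebra_simps)
    also have "\<dots> = (\<Sum>S\<in>Pow {1..n}. ?y * (t S * a0 (card S)))"
      using y by (intro sum.cong refl) (simp add: a0_def)
    finally show ?thesis by (simp only: sum_distrib_left)
  qed
  have "small n T (\<lambda>N t \<eta> \<eta>'. 1 / ?y * ((?y * x0 N n t \<eta> - ?s t * mean N n t \<eta>'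
     - \<beta>\<^sup>2 * (1 / 2 * om2 2 * (\<Sum>l\<in>{1..n}. \<Sum>l'\<in>{1..n} - {l}. x2 N n t \<eta> l l')
       + kap2 * (\<Sum>l\<in>{1..n}. x1 N n t \<eta> l)))
     + (\<beta>\<^sup>2 * (1 / 2 * om2 2) * ?D2 N t \<eta> \<eta>' + \<beta>\<^sup>2 * kap2 * ?D1 N t \<eta> \<eta>')))"
    by (intro small_cmult small_add small_x0 D)
  then show ?thesis
  proof (rule small_cong)
    fix N t \<eta> \<eta>'
    have d2: "?D2 N t \<eta> \<eta>' = (\<Sum>l\<in>{1..n}. \<Sum>l'\<in>{1..n} - {l}. x2 N n t \<eta> l l')
      - mean N n t \<eta>' * (\<Sum>l\<in>{1..n}. \<Sum>l'\<in>{1..n} - {l}. X2 n t l l')"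
      unfolding sum_subtractf sum_distrib_left[of "mean N n t \<eta>'"] ..
    have d1: "?D1 N t \<eta> \<eta>' = (\<Sum>l\<in>{1..n}. x1 N n t \<eta> l) - mean N n t \<eta>' * (\<Sum>l\<in>{1..n}. X1 n t l)"
      unfolding sum_subtractf sum_distrib_left[of "mean N n t \<eta>'"] ..
    have "(?y * x0 N n t \<eta> - ?s t * mean N n t \<eta>'
     - \<beta>\<^sup>2 * (1 / 2 * om2 2 * (\<Sum>l\<in>{1..n}. \<Sum>l'\<in>{1..n} - {l}. x2 N n t \<eta> l l')
       + kap2 * (\<Sum>l\<in>{1..n}. x1 N n t \<eta> l)))
     + (\<beta>\<^sup>2 * (1 / 2 * om2 2) * ?D2 N t \<eta> \<eta>' + \<beta>\<^sup>2 * kap2 * ?D1 N t \<eta> \<eta>')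
     = ?y * (x0 N n t \<eta> - mean N n t \<eta>' * X0 n t)"
      using X[of t] d1 d2 by algebra
    then show "x0 N n t \<eta> - mean N n t \<eta>' * X0 n t = 1 / ?y * ((?y * x0 N n t \<eta> - ?s t * mean N n t \<eta>'
     - \<beta>\<^sup>2 * (1 / 2 * om2 2 * (\<Sum>l\<in>{1..n}. \<Sum>l'\<in>{1..n} - {l}. x2 N n t \<eta> l l')
       + kap2 * (\<Sum>l\<in>{1..n}. x1 N n t \<eta> l)))
     + (\<beta>\<^sup>2 * (1 / 2 * om2 2) * ?D2 N t \<eta> \<eta>' + \<beta>\<^sup>2 * kap2 * ?D1 N t \<eta> \<eta>'))"
      using y by simp
  qed
qed

text \<open>The cavity equation for \<open>W\<close>, with \<open>x2\<close>, \<open>x1\<close> and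
  \<open>x0\<close> replaced by their limits; linearity of \<open>reduced\<close> collects the
  coefficients into \<open>cov\<close>.\<close>

theorem small_obs:
  assumes bh: "\<beta> * h \<noteq> 0" and W: "W \<subseteq> {1..n}"
  shows "small n T (\<lambda>N t \<eta> \<eta>'. obs N n t \<eta> W - (\<Sum>S\<in>Pow {1..n}. t S * cov n W S) * mean N n t \<eta>')"
proof -
  let ?d2 = "\<lambda>N t \<eta> \<eta>' l l'. x2 N n t \<eta> l l' - mean N n t \<eta>' * X2 n t l l'"
  let ?d1 = "\<lambda>N t \<eta> \<eta>' l. x1 N n t \<eta> l - mean N n t \<eta>' * X1 n t l"
  let ?d0 = "\<lambda>N t \<eta> \<eta>'. x0 N n t \<eta> - mean N n t \<eta>' * X0 n t"
  have "small n T (\<lambda>N t \<eta> \<eta>'. err n W N t \<eta> \<eta>' + \<beta>\<^sup>2 * (1 / 2 * (\<Sum>l\<in>{1..n}. \<Sum>l'\<in>{1..n} - {l}. link_coeff W l l' * ?d2 N t \<eta> \<eta>' l l')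
     + (\<Sum>l\<in>{1..n}. kappa1 W l * ?d1 N t \<eta> \<eta>' l) + lambda0 (card W) * ?d0 N t \<eta> \<eta>'))"
    by (intro small_add small_cmult small_sum small_err small_x2_solved small_x1_solved small_x0_solved bh)
       (use W in auto)
  then show ?thesis
  proof (rule small_cong)
    fix N t \<eta> \<eta>'
    let ?m = "mean N n t \<eta>'"
    have r: "1 / 2 * (\<Sum>l\<in>{1..n}. \<Sum>l'\<in>{1..n} - {l}. link_coeff W l l' * ?d2 N t \<eta> \<eta>' l l')
     + (\<Sum>l\<in>{1..n}. kappa1 W l * ?d1 N t \<eta> \<eta>' l) + lambda0 (card W) * ?d0 N t \<eta> \<eta>'
     = reduced n W (x2 N n t \<eta>) (x1 N n t \<eta>) (x0 N n t \<eta>)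
       - ?m * (\<Sum>S\<in>Pow {1..n}. t S * reduced n W (ind2 S) (ind1 S) (a0 (card S)))"
    proof -
      have "1 / 2 * (\<Sum>l\<in>{1..n}. \<Sum>l'\<in>{1..n} - {l}. link_coeff W l l' * ?d2 N t \<eta> \<eta>' l l')
     + (\<Sum>l\<in>{1..n}. kappa1 W l * ?d1 N t \<eta> \<eta>' l) + lambda0 (card W) * ?d0 N t \<eta> \<eta>'
        = reduced n W (?d2 N t \<eta> \<eta>') (?d1 N t \<eta> \<eta>') (?d0 N t \<eta> \<eta>')" by (simp only: reduced_def)
      also have "\<dots> = reduced n W (x2 N n t \<eta>) (x1 N n t \<eta>) (x0 N n t \<eta>)
         - ?m * reduced n W (X2 n t) (X1 n t) (X0 n t)"
        unfolding reduced_diff reduced_cmult ..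
      finally show ?thesis by (simp only: reduced_sum[OF finite_Pow_iff[THEN iffD2, OF finite_atLeastAtMost]])
    qed
    have c: "(\<Sum>S\<in>Pow {1..n}. t S * cov n W S) = source n t W
       + \<beta>\<^sup>2 * (\<Sum>S\<in>Pow {1..n}. t S * reduced n W (ind2 S) (ind1 S) (a0 (card S)))"
      unfolding cov_def source_def sum_distrib_left sum.distrib[symmetric]
      by (intro sum.cong refl) (simp add: algebra_simps)
    show "obs N n t \<eta> W - (\<Sum>S\<in>Pow {1..n}. t S * cov n W S) * ?m = err n W N t \<eta> \<eta>'
      + \<beta>\<^sup>2 * (1 / 2 * (\<Sum>l\<in>{1..n}. \<Sum>l'\<in>{1..n} - {l}. link_coeff W l l' * ?d2 N t \<eta> \<eta>' l l')
     + (\<Sum>l\<in>{1..n}. kappa1 W l * ?d1 N t \<eta> \<eta>' l) + lambda0 (card W) * ?d0 N t \<eta> \<eta>')"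
      unfolding r c by algebra
  qed
qed

end

subsection \<open>The recursion for the limiting covariance\<close>

lemma two_choose_two_real: "2 * real (p choose 2) = real p * (real p - 1)"
proof (induction p)
  case (Suc p) then show ?case by (simp add: numeral_2_eq_2 algebra_simps)
qed simp

lemma sk_q_0: "sk_q \<beta> h 0 = 1"
  by (simp add: sk_q_eq_tanh_moment)

lemma sk_pi_nat: "sk_pi \<beta> h (int p) = sk_q \<beta> h (p + 1) - sk_q \<beta> h (p + 3)"
proof -
  have "nat (int p + 1) = p + 1" "nat (int p + 3) = p + 3" by simp_all
  then show ?thesis unfolding sk_pi_def by simp
qed

lemma sk_pi_sum: "sk_pi \<beta> h (int p + int p' - 1) = sk_q \<beta> h (p + p') - sk_q \<beta> h (p + p' + 2)"
proof -
  have "nat (int p + int p' - 1 + 1) = p + p'" "nat (int p + int p' - 1 + 3) = p + p' + 2" by simp_all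
  then show ?thesis unfolding sk_pi_def by simp
qed

lemma sk_pi_pred: "sk_pi \<beta> h (int (Suc p) - 2) = sk_q \<beta> h p - sk_q \<beta> h (p + 2)"
  using sk_pi_sum[of \<beta> h p 0] by (simp add: add.commute)

section \<open>Solution, uniqueness and symmetry of the covariance system\<close>

locale sk_algebra =
  fixes \<beta> h :: real
  assumes x_ne: "1 - \<beta>\<^sup>2 * sk_rho \<beta> h 0 \<noteq> 0" and y_ne: "1 - \<beta>\<^sup>2 * sk_phi \<beta> h 1 \<noteq> 0"
begin

abbreviation "Q \<equiv> sk_q \<beta> h"
abbreviation "\<rho> \<equiv> sk_rho \<beta> h"
abbreviation "\<pi> p \<equiv> sk_pi \<beta> h (int p)"
abbreviation "\<phi> \<equiv> sk_phi \<beta> h"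
abbreviation "lam \<equiv> sk_lambda \<beta> h"
abbreviation "kap \<equiv> sk_kappa \<beta> h"
abbreviation "om \<equiv> sk_omega \<beta> h"
abbreviation "x \<equiv> 1 - \<beta>\<^sup>2 * \<rho> 0"
abbreviation "y \<equiv> 1 - \<beta>\<^sup>2 * \<phi> 1"

text \<open>In terms of \<open>K\<close>, \<open>om1\<close> and \<open>lam\<close> the recursion for \<open>s = 0\<close> becomes a bilinear form, whose symmetry
  is then visible.\<close>

definition K :: "nat \<Rightarrow> real" where "K p = real p * Q p - (real p + 1) * Q (p + 2) + Q p * Q 2"
definition om1 :: "nat \<Rightarrow> real" where "om1 p = Q (p + 2) - Q p * Q 2"

lemma lam_eq: "lam p = real (p choose 2) * Q (p - 2) + real ((p + 1) choose 2) * Q (p + 2) - (real p)\<^sup>2 * Q p"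
proof -
  have "real (p choose 2) + real ((p + 1) choose 2) = (real p)\<^sup>2"
    using two_choose_two_real[of p] two_choose_two_real[of "p + 1"] by (simp add: power2_eq_square algebra_simps)
  then have e: "real ((p + 1) choose 2) = (real p)\<^sup>2 - real (p choose 2)" by simp
  show ?thesis unfolding sk_lambda_def Let_def e by (simp add: algebra_simps)
qed

lemma kap_eq: "kap p p' = real p' * K p"
  by (simp add: sk_kappa_def K_def Let_def algebra_simps)

lemma om_eq: "om p p' = real (p' choose 2) * om1 p"
  by (simp add: sk_omega_def om1_def Let_def)

text \<open>Multiplied by the coefficients with which they occur in the recursion, the shifted
  quantities become combinations of \<open>lam\<close>, \<open>K\<close> and \<open>om1\<close>.
  This also disposes of truncated subtraction, since the coefficient is 0 whenever it truncates. The
  same holds for \<open>pi_pred\<close> and \<open>phi_pred\<close>.\<close>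

lemma rho_choose: "real (p choose 2) * \<rho> (p - 2) = lam p + K p + om1 p"
proof (cases "p < 2")
  case True
  then consider "p = 0" | "p = 1" by linarith
  then show ?thesis
    by cases (simp_all add: lam_eq K_def om1_def sk_q_0 numeral_2_eq_2 numeral_3_eq_3)
next
  case False
  then obtain k where p: "p = k + 2" by (metis add.commute le_Suc_ex not_less)
  have c: "real ((k + 2) choose 2) = (real k + 2) * (real k + 1) / 2" "real ((k + 2 + 1) choose 2) = (real k + 3) * (real k + 2) / 2"
    using two_choose_two_real[of "k + 2"] two_choose_two_real[of "k + 2 + 1"] by (simp_all add: algebra_simps)
  have n: "k + 2 + 2 = k + 4" "k + 2 - 2 = k" by simp_all
  show ?thesis unfolding p lam_eq K_def om1_def sk_rho_def c n
    by (simp add: field_simps power2_eq_square)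
qed

lemma pi_pred: "real p * \<pi> (p - 1) = K p + om1 p"
  by (cases p) (simp_all add: K_def om1_def sk_q_0 sk_pi_nat algebra_simps numeral_2_eq_2 numeral_3_eq_3)

lemma phi_pred: "real p * \<phi> (p - 1) = 2 * lam p"
proof (cases p)
  case 0 then show ?thesis by (simp add: lam_eq numeral_2_eq_2)
next
  case (Suc k)
  have c: "2 * real (Suc k choose 2) = (real k + 1) * real k" "2 * real ((Suc k + 1) choose 2) = (real k + 2) * (real k + 1)"
    using two_choose_two_real[of "Suc k"] two_choose_two_real[of "Suc k + 1"] by (simp_all add: algebra_simps)
  have "2 * lam (Suc k) = (2 * real (Suc k choose 2)) * Q (Suc k - 2)
      + (2 * real ((Suc k + 1) choose 2)) * Q (Suc k + 2) - 2 * (real (Suc k))\<^sup>2 * Q (Suc k)"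
    by (simp add: lam_eq)
  also have "\<dots> = (real k + 1) * real k * Q (k - 1) + (real k + 2) * (real k + 1) * Q (k + 3)
      - 2 * (real k + 1)\<^sup>2 * Q (k + 1)"
    unfolding c by (simp add: numeral_3_eq_3 numeral_2_eq_2) (simp add: algebra_simps)
  also have "\<dots> = (real k + 1) * \<phi> k"
  proof (cases k)
    case 0 then show ?thesis using sk_pi_nat[of \<beta> h 0] by (simp add: sk_phi_def)
  next
    case (Suc j)
    have *: "sk_pi \<beta> h (int k - 2) = Q (k - 1) - Q (k + 1)"
      unfolding Suc using sk_pi_pred[of \<beta> h j] by simp
    show ?thesis unfolding sk_phi_def * sk_pi_nat
      by (simp add: power2_eq_square algebra_simps)
  qed
  finally show ?thesis using Suc by simp
qed

lemma rho_pred: "real p * \<rho> (p - 1) = \<phi> p + 2 * \<pi> p"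
proof (cases p)
  case (Suc j)
  have "sk_pi \<beta> h (int p - 2) = Q j - Q (j + 2)"
    unfolding Suc by (rule sk_pi_pred)
  moreover have "\<pi> p = Q (j + 2) - Q (j + 4)" unfolding sk_pi_nat Suc by (simp add: eval_nat_numeral)
  moreover have "p - 1 = j" "j + 2 + 2 = j + 4" using Suc by simp_all
  ultimately show ?thesis
    unfolding sk_phi_def sk_rho_def by (simp add: Suc right_diff_distrib distrib_right distrib_left)
qed (simp add: sk_phi_def)

lemma phi_one: "\<phi> 1 = lam 2"
  using phi_pred[of 2] by simp

text \<open>The relation between the two denominators on which the symmetry of \<open>A0\<close>
  rests.\<close>

lemma x_eq: "x = y - \<beta>\<^sup>2 * (K 2 + om1 2)"
  using rho_choose[of 2] phi_one by (simp add: algebra_simps)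

definition A2 :: "nat \<Rightarrow> nat \<Rightarrow> real" where
  "A2 p p' = \<rho> (p + p') + \<beta>^2 * \<rho> p * \<rho> p' + \<beta>^4 * \<rho> p * \<rho> p' * (\<rho> 0 / (1 - \<beta>^2 * \<rho> 0))"

text \<open>\<open>a11\<close>, \<open>A1one p\<close> and \<open>A0two p'\<close> are the values at
  \<open>(1, 1)\<close> and \<open>(p, 1)\<close> for \<open>s = 1\<close> and at
  \<open>(2, p')\<close> for \<open>s = 0\<close>, solved in the order in which the system
  determines them.\<close>

definition a11 :: real where "a11 = (\<pi> 1 + \<beta>^2 * \<pi> 1 * A2 0 0) / y"

definition A1one :: "nat \<Rightarrow> real" where
  "A1one p = \<pi> p + \<beta>^2 * \<phi> p * a11 + \<beta>^2 * \<pi> p * A2 0 0"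

definition A1 :: "nat \<Rightarrow> nat \<Rightarrow> real" where
  "A1 p p' = sk_pi \<beta> h (int p + int p' - 1) + \<beta>^2 * \<phi> p * A1one p' + \<beta>^2 * real p' * \<pi> p * A2 (p' - 1) 0"

definition A0two :: "nat \<Rightarrow> real" where
  "A0two p' = ((Q (2 + p') - Q 2 * Q p') + \<beta>^2 * kap 2 p' * A1 1 (p' - 1) + \<beta>^2 * om 2 p' * A2 0 (p' - 2))
     / (1 - \<beta>^2 * lam 2)"

definition A0 :: "nat \<Rightarrow> nat \<Rightarrow> real" where
  "A0 p p' = (Q (p + p') - Q p * Q p') + \<beta>^2 * lam p * A0two p' + \<beta>^2 * kap p p' * A1 1 (p' - 1)
     + \<beta>^2 * om p p' * A2 0 (p' - 2)"

text \<open>The formula for \<open>s \<ge> 3\<close>, taken for every \<open>s\<close>: the moment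
  of \<open>z ^ (p + p') * (1 - z\<^sup>2) ^ s\<close> for the random hyperbolic tangent
  \<open>z\<close>. For \<open>s = 1\<close> and \<open>s = 2\<close> it is the part of
  \<open>A s\<close> outside the corrections with \<open>\<beta>\<close>.\<close>

definition D :: "nat \<Rightarrow> nat \<Rightarrow> nat \<Rightarrow> real" where
  "D s p p' = (\<Sum>l=0..s. real (s choose l) * (-1) ^ l * Q (p + p' + 2 * l))"

definition A :: "nat \<Rightarrow> nat \<Rightarrow> nat \<Rightarrow> real" where
  "A s p p' = (if s = 0 then A0 p p' else if s = 1 then A1 p p' else if s = 2 then A2 p p' else D s p p')"

text \<open>The corrections form a geometric series:
  \<open>1 + \<beta>\<^sup>2 * (\<rho> 0 / x) = 1 / x\<close>.\<close>

lemma A2_zero: "A2 0 p = \<rho> p / x" "A2 p 0 = \<rho> p / x"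
proof -
  show "A2 0 p = \<rho> p / x" unfolding A2_def using x_ne by (simp add: field_simps power2_eq_square power4_eq_xxxx)
  then show "A2 p 0 = \<rho> p / x" unfolding A2_def by (simp add: mult_ac)
qed

lemma a11_eq: "a11 = \<pi> 1 / (x * y)"
proof -
  have "1 + \<beta>\<^sup>2 * (\<rho> 0 / x) = 1 / x" using x_ne by (simp add: field_simps)
  moreover have "\<pi> 1 + \<beta>\<^sup>2 * \<pi> 1 * (\<rho> 0 / x) = \<pi> 1 * (1 + \<beta>\<^sup>2 * (\<rho> 0 / x))" by (simp add: algebra_simps)
  ultimately show ?thesis unfolding a11_def A2_zero(1) by simp
qed

lemma A1one_eq: "A1one p = \<pi> p / x + \<beta>\<^sup>2 * \<phi> p * a11"
proof -
  have "1 + \<beta>\<^sup>2 * (\<rho> 0 / x) = 1 / x" using x_ne by (simp add: field_simps)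
  then have "\<pi> p * (1 + \<beta>\<^sup>2 * (\<rho> 0 / x)) = \<pi> p * (1 / x)" by simp
  then show ?thesis unfolding A1one_def A2_zero(1) by (simp add: algebra_simps)
qed

text \<open>Eliminating \<open>A2\<close> by \<open>rho_pred\<close> makes the symmetry in
  \<open>p\<close> and \<open>p'\<close> visible, which the recursion hides.\<close>

lemma A1_eq: "A1 p p' = (Q (p + p') - Q (p + p' + 2)) + \<beta>\<^sup>2 * (\<phi> p * \<pi> p' + \<phi> p' * \<pi> p + 2 * \<pi> p * \<pi> p') / x
     + \<beta>\<^sup>2 * \<beta>\<^sup>2 * \<phi> p * \<phi> p' * a11"
proof -
  have "real p' * A2 (p' - 1) 0 = (\<phi> p' + 2 * \<pi> p') / x" unfolding A2_zero(2) using rho_pred[of p'] by simp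
  moreover have "\<beta>\<^sup>2 * real p' * \<pi> p * A2 (p' - 1) 0 = \<beta>\<^sup>2 * \<pi> p * (real p' * A2 (p' - 1) 0)" by simp
  ultimately have "\<beta>\<^sup>2 * real p' * \<pi> p * A2 (p' - 1) 0 = \<beta>\<^sup>2 * \<pi> p * ((\<phi> p' + 2 * \<pi> p') / x)" by (simp only:)
  then show ?thesis unfolding A1_def A1one_eq sk_pi_sum
    by (simp add: distrib_left add_divide_distrib mult_ac)
qed

lemma A1_sym: "A1 p p' = A1 p' p"
  unfolding A1_eq by (simp add: add.commute mult_ac)

lemma A1_one_right: "A1 p 1 = A1one p"
proof -
  have a: "a11 = \<pi> 1 + \<beta>^2 * \<phi> 1 * a11 + \<beta>^2 * \<pi> 1 * A2 0 0"
    using y_ne by (simp add: a11_def field_simps)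
  then have "A1one 1 = a11" by (simp add: A1one_def)
  then show ?thesis unfolding A1_def A1one_def[of p] by simp
qed

lemma A1_one_left: "A1 1 p = A1one p"
  using A1_one_right A1_sym by simp

lemma A0two_eq: "A0two p = (om1 p + \<beta>\<^sup>2 * (K 2 * ((K p + om1 p) / x + 2 * \<beta>\<^sup>2 * lam p * a11)
     + om1 2 * ((lam p + K p + om1 p) / x))) / y"
proof -
  have "real p * A1 1 (p - 1) = (K p + om1 p) / x + 2 * \<beta>\<^sup>2 * lam p * a11"
  proof -
    have "real p * A1 1 (p - 1) = (real p * \<pi> (p - 1)) / x + \<beta>\<^sup>2 * (real p * \<phi> (p - 1)) * a11"
      unfolding A1_one_left A1one_eq by (simp add: distrib_left mult_ac)
    then show ?thesis unfolding pi_pred phi_pred by simp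
  qed
  moreover have "\<beta>^2 * kap 2 p * A1 1 (p - 1) = \<beta>\<^sup>2 * K 2 * (real p * A1 1 (p - 1))"
    unfolding kap_eq by simp
  ultimately have 1: "\<beta>^2 * kap 2 p * A1 1 (p - 1) = \<beta>\<^sup>2 * K 2 * ((K p + om1 p) / x + 2 * \<beta>\<^sup>2 * lam p * a11)"
    by (simp only:)
  have "real (p choose 2) * A2 0 (p - 2) = (lam p + K p + om1 p) / x"
    unfolding A2_zero using rho_choose[of p] by simp
  moreover have "\<beta>^2 * om 2 p * A2 0 (p - 2) = \<beta>\<^sup>2 * om1 2 * (real (p choose 2) * A2 0 (p - 2))"
    unfolding om_eq by simp
  ultimately have 2: "\<beta>^2 * om 2 p * A2 0 (p - 2) = \<beta>\<^sup>2 * om1 2 * ((lam p + K p + om1 p) / x)"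
    by (simp only:)
  show ?thesis unfolding A0two_def 1 2 phi_one[symmetric] om1_def[of p]
    by (simp add: algebra_simps)
qed

lemma A0_eq: "A0 p p' = (Q (p + p') - Q p * Q p') + \<beta>\<^sup>2 * (lam p * A0two p'
     + K p * ((K p' + om1 p') / x + 2 * \<beta>\<^sup>2 * lam p' * a11) + om1 p * ((lam p' + K p' + om1 p') / x))"
proof -
  have "real p' * A1 1 (p' - 1) = (K p' + om1 p') / x + 2 * \<beta>\<^sup>2 * lam p' * a11"
  proof -
    have "real p' * A1 1 (p' - 1) = (real p' * \<pi> (p' - 1)) / x + \<beta>\<^sup>2 * (real p' * \<phi> (p' - 1)) * a11"
      unfolding A1_one_left A1one_eq by (simp add: distrib_left mult_ac)
    then show ?thesis unfolding pi_pred phi_pred by simp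
  qed
  moreover have "\<beta>^2 * kap p p' * A1 1 (p' - 1) = \<beta>\<^sup>2 * K p * (real p' * A1 1 (p' - 1))"
    unfolding kap_eq by simp
  ultimately have 1: "\<beta>^2 * kap p p' * A1 1 (p' - 1) = \<beta>\<^sup>2 * K p * ((K p' + om1 p') / x + 2 * \<beta>\<^sup>2 * lam p' * a11)"
    by (simp only:)
  have "real (p' choose 2) * A2 0 (p' - 2) = (lam p' + K p' + om1 p') / x"
    unfolding A2_zero using rho_choose[of p'] by simp
  moreover have "\<beta>^2 * om p p' * A2 0 (p' - 2) = \<beta>\<^sup>2 * om1 p * (real (p' choose 2) * A2 0 (p' - 2))"
    unfolding om_eq by simp
  ultimately have 2: "\<beta>^2 * om p p' * A2 0 (p' - 2) = \<beta>\<^sup>2 * om1 p * ((lam p' + K p' + om1 p') / x)"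
    by (simp only:)
  show ?thesis unfolding A0_def 1 2 by (simp add: algebra_simps)
qed

lemma A0_sym: "A0 p p' = A0 p' p"
proof -
  \<comment> \<open>With this \<open>a11\<close> becomes rational in the same quantities as
    everything else, and symmetry turns into a polynomial identity modulo the relation
    \<open>XY\<close> below.\<close>
  have pi1: "\<pi> 1 = (K 2 + om1 2) / 2" using pi_pred[of 2] by simp
  define X Y b k2 o2 where "X = x" "Y = y" "b = \<beta>\<^sup>2" "k2 = K 2" "o2 = om1 2"
  have ne: "X \<noteq> 0" "Y \<noteq> 0" using x_ne y_ne unfolding X_Y_b_k2_o2_def by auto
  have XY: "X = Y - b * (k2 + o2)" using x_eq unfolding X_Y_b_k2_o2_def .
  have a: "2 * a11 = (k2 + o2) / (X * Y)" 
  proof -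
    have "2 * (v / 2 / d) = v / d" for v d :: real by simp
    then show ?thesis unfolding a11_eq pi1 X_Y_b_k2_o2_def .
  qed
  let ?f = "\<lambda>l k o' l' k' o''. l * ((o'' + b * (k2 * ((k' + o'') / X + b * l' * ((k2 + o2) / (X * Y)))
       + o2 * ((l' + k' + o'') / X))) / Y)
     + k * ((k' + o'') / X + b * l' * ((k2 + o2) / (X * Y))) + o' * ((l' + k' + o'') / X)"
  have sym: "?f l k o' l' k' o'' = ?f l' k' o'' l k o'" for l k o' l' k' o'' :: real
  proof -
    have "X * Y * ?f l k o' l' k' o'' = X * Y * ?f l' k' o'' l k o'"
      using ne XY by (simp add: field_simps) algebra
    then show ?thesis using ne by simp
  qed
  have f: "A0 p p' = (Q (p + p') - Q p * Q p') + b * ?f (lam p) (K p) (om1 p) (lam p') (K p') (om1 p')" for p p'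
  proof -
    have "2 * \<beta>\<^sup>2 * lam p' * a11 = b * lam p' * ((k2 + o2) / (X * Y))"
      unfolding a[symmetric] X_Y_b_k2_o2_def(3) by simp
    then show ?thesis unfolding A0_eq A0two_eq X_Y_b_k2_o2_def by (simp only:)
  qed
  have "Q (p' + p) - Q p' * Q p = Q (p + p') - Q p * Q p'" by (simp add: add.commute mult.commute)
  then show ?thesis unfolding f[of p p'] f[of p' p] using sym[where l = "lam p" and k = "K p" and o' = "om1 p" and l' = "lam p'" and k' = "K p'" and o'' = "om1 p'"]
    by (simp only:)
qed

lemma A_sym: "A s p p' = A s p' p"
  unfolding A_def using A0_sym[of p p'] A1_sym[of p p']
  by (simp add: A2_def D_def add.commute mult_ac)

lemma A_system: "sk_A_system \<beta> h A"
  unfolding sk_A_system_def Let_def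
proof (intro conjI allI impI)
  fix s p p' :: nat assume "s \<ge> 3"
  then show "A s p p' = (\<Sum>l=0..s. real (s choose l) * (-1) ^ l * Q (p + p' + 2 * l))"
    by (simp add: A_def D_def)
next
  fix p p' :: nat
  show "A 2 p p' = \<rho> (p + p') + \<beta>\<^sup>2 * \<rho> p * \<rho> p' + \<beta> ^ 4 * \<rho> p * \<rho> p' * (\<rho> 0 / (1 - \<beta>\<^sup>2 * \<rho> 0))"
    by (simp add: A_def A2_def)
  show "A 1 p p' = sk_pi \<beta> h (int p + int p' - 1) + \<beta>\<^sup>2 * \<phi> p * A 1 p' 1
      + \<beta>\<^sup>2 * real p' * \<pi> p * A 2 (p' - 1) 0"
  proof -
    have "A 1 p' 1 = A1one p'" using A1_one_right[of p'] by (simp add: A_def)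
    then show ?thesis by (simp add: A_def A1_def)
  qed
  show "A 0 p p' = Q (p + p') - Q p * Q p' + \<beta>\<^sup>2 * lam p * A 0 2 p' + \<beta>\<^sup>2 * kap p p' * A 1 1 (p' - 1)
      + \<beta>\<^sup>2 * om p p' * A 2 0 (p' - 2)"
  proof -
    have "A0two p' * (1 - \<beta>^2 * lam 2) = (Q (2 + p') - Q 2 * Q p') + \<beta>^2 * kap 2 p' * A1 1 (p' - 1) + \<beta>^2 * om 2 p' * A2 0 (p' - 2)"
      unfolding A0two_def using y_ne phi_one by simp
    then have "A 0 2 p' = A0two p'"
      unfolding A_def A0_def[of 2] by (simp add: algebra_simps)
    then show ?thesis by (simp add: A_def A0_def)
  qed
qed

text \<open>\<open>A' 1 1 1\<close> and \<open>A' 0 2 p'\<close> occur on both sides of their own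
  equations, with coefficient \<open>\<beta>\<^sup>2 * \<phi> 1\<close> on the right, so
  \<open>y_ne\<close> determines them; all other values follow by substitution.\<close>

lemma A_unique:
  assumes "sk_A_system \<beta> h A'"
  shows "A' = A"
proof -
  note sys = assms[unfolded sk_A_system_def Let_def]
  have s3: "A' s p p' = D s p p'" if "s \<ge> 3" for s p p' using sys that unfolding D_def by blast
  have s2: "A' 2 p p' = A2 p p'" for p p' using sys unfolding A2_def by blast
  have s1: "A' 1 p p' = sk_pi \<beta> h (int p + int p' - 1) + \<beta>\<^sup>2 * \<phi> p * A' 1 p' 1
      + \<beta>\<^sup>2 * real p' * \<pi> p * A2 (p' - 1) 0" for p p' using sys s2 by metis
  have s0: "A' 0 p p' = Q (p + p') - Q p * Q p' + \<beta>\<^sup>2 * lam p * A' 0 2 p' + \<beta>\<^sup>2 * kap p p' * A' 1 1 (p' - 1)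
      + \<beta>\<^sup>2 * om p p' * A2 0 (p' - 2)" for p p' using sys s2 by metis
  have "A' 1 1 1 * y = \<pi> 1 + \<beta>^2 * \<pi> 1 * A2 0 0"
    using s1[of 1 1] by (simp add: algebra_simps)
  then have a11: "A' 1 1 1 = a11" unfolding a11_def using y_ne by (simp add: eq_divide_eq)
  have p1: "A' 1 p 1 = A1one p" for p
    using s1[of p 1] a11 by (simp add: A1one_def)
  have A1: "A' 1 p p' = A1 p p'" for p p'
    using s1[of p p'] p1[of p'] by (simp add: A1_def)
  have p2: "A' 0 2 p' = A0two p'" for p'
  proof -
    have "A' 0 2 p' * (1 - \<beta>^2 * lam 2) = (Q (2 + p') - Q 2 * Q p') + \<beta>^2 * kap 2 p' * A1 1 (p' - 1) + \<beta>^2 * om 2 p' * A2 0 (p' - 2)"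
      using s0[of 2 p'] A1[of 1 "p' - 1"] by (simp add: algebra_simps)
    then show ?thesis unfolding A0two_def using y_ne phi_one by (simp add: eq_divide_eq)
  qed
  have A0: "A' 0 p p' = A0 p p'" for p p'
    using s0[of p p'] p2[of p'] A1[of 1 "p' - 1"] by (simp add: A0_def)
  show ?thesis
  proof (intro ext)
    fix s p p' :: nat
    consider "s = 0" | "s = 1" | "s = 2" | "s \<ge> 3" by linarith
    then show "A' s p p' = A s p p'"
      by cases (use A0 A1 s2 s3 in \<open>simp_all add: A_def\<close>)
  qed
qed

lemma sk_A_eq: "sk_A \<beta> h = A"
  unfolding sk_A_def using A_system A_unique by (rule the_equality)

lemma D_0: "D 0 p p' = Q (p + p')"
  by (simp add: D_def)

lemma D_1: "D 1 p p' = Q (p + p') - Q (p + p' + 2)"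
  by (simp add: D_def)

lemma D_2: "D 2 p p' = \<rho> (p + p')"
proof -
  have "{0..2 :: nat} = {0, 1, 2}" by auto
  then show ?thesis by (simp add: D_def sk_rho_def)
qed

text \<open>The inner sum is a power of \<open>z\<close> times \<open>(1 - z\<^sup>2) ^ j\<close>,
  and the outer sum then expands \<open>((1 - z\<^sup>2) + z\<^sup>2) ^ r = 1\<close>.\<close>

lemma binomial_power_identity:
  fixes z :: real
  assumes "r \<le> w" "r \<le> s"
  shows "(\<Sum>j\<le>r. real (r choose j) * (\<Sum>l=0..j. real (j choose l) * (-1) ^ l * z ^ ((w - j) + (s - j) + 2 * l)))
    = z ^ (w + s - 2 * r)"
proof -
  have inner: "(\<Sum>l=0..j. real (j choose l) * (-1) ^ l * z ^ (m + 2 * l)) = z ^ m * (1 - z\<^sup>2) ^ j" for j m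
  proof -
    have "(1 - z\<^sup>2) ^ j = (- (z\<^sup>2) + 1) ^ j" by simp
    also have "\<dots> = (\<Sum>l\<le>j. real (j choose l) * (- (z\<^sup>2)) ^ l * 1 ^ (j - l))" by (rule binomial_ring)
    also have "\<dots> = (\<Sum>l\<le>j. real (j choose l) * (-1) ^ l * z ^ (2 * l))"
      by (intro sum.cong refl) (simp add: power_mult power_minus[of "z\<^sup>2"])
    finally show ?thesis
      by (simp add: sum_distrib_left power_add mult_ac atLeast0AtMost)
  qed
  have "(\<Sum>j\<le>r. real (r choose j) * (\<Sum>l=0..j. real (j choose l) * (-1) ^ l * z ^ ((w - j) + (s - j) + 2 * l)))
    = (\<Sum>j\<le>r. z ^ (w + s - 2 * r) * (real (r choose j) * (1 - z\<^sup>2) ^ j * (z\<^sup>2) ^ (r - j)))"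
  proof (rule sum.cong[OF refl])
    fix j assume j: "j \<in> {..r}"
    have "(w - j) + (s - j) = (w + s - 2 * r) + 2 * (r - j)" using j assms by auto
    then have "z ^ ((w - j) + (s - j)) = z ^ (w + s - 2 * r) * (z\<^sup>2) ^ (r - j)"
      by (simp only: power_add power_mult)
    then show "real (r choose j) * (\<Sum>l=0..j. real (j choose l) * (-1) ^ l * z ^ ((w - j) + (s - j) + 2 * l))
       = z ^ (w + s - 2 * r) * (real (r choose j) * (1 - z\<^sup>2) ^ j * (z\<^sup>2) ^ (r - j))"
      unfolding inner by simp
  qed
  also have "\<dots> = z ^ (w + s - 2 * r) * ((1 - z\<^sup>2) + z\<^sup>2) ^ r"
    unfolding sum_distrib_left[symmetric] binomial_ring ..
  finally show ?thesis by simp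
qed

text \<open>The integrated identity: for sets of sizes \<open>w\<close> and \<open>s\<close> meeting
  in \<open>r\<close> elements, summing \<open>D\<close> over the common subsets gives the moment
  belonging to the symmetric difference.\<close>

lemma sum_D:
  assumes "r \<le> w" "r \<le> s"
  shows "(\<Sum>j\<le>r. real (r choose j) * D j (w - j) (s - j)) = Q (w + s - 2 * r)"
proof -
  let ?M = "density lborel std_normal_density"
  let ?z = "\<lambda>t. tanh (\<beta> * sqrt (sk_q2 \<beta> h) * t + \<beta> * h)"
  have "(\<Sum>j\<le>r. real (r choose j) * D j (w - j) (s - j))
    = (\<Sum>j\<le>r. real (r choose j) * (\<Sum>l=0..j. real (j choose l) * (-1) ^ l * (LINT t|?M. ?z t ^ ((w - j) + (s - j) + 2 * l))))"
    by (simp only: D_def sk_q_def)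
  also have "\<dots> = (LINT t|?M. (\<Sum>j\<le>r. real (r choose j) * (\<Sum>l=0..j. real (j choose l) * (-1) ^ l * ?z t ^ ((w - j) + (s - j) + 2 * l))))"
    by (simp add: Bochner_Integration.integral_sum integrable_tanh_power integrable_mult_right
          Bochner_Integration.integrable_sum)
  also have "\<dots> = Q (w + s - 2 * r)"
    unfolding binomial_power_identity[OF assms] sk_q_def ..
  finally show ?thesis .
qed

lemma sum_choose_first_three:
  assumes "\<And>j. j \<ge> 3 \<Longrightarrow> f j = (0 :: real)"
  shows "(\<Sum>j\<le>r. real (r choose j) * f j) = f 0 + real r * f 1 + real (r choose 2) * f 2"
proof -
  \<comment> \<open>The added binomial coefficients are 0; the larger range contains 0, 1 and 2 even
    for small \<open>r\<close>.\<close>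
  have "(\<Sum>j\<le>r. real (r choose j) * f j) = (\<Sum>j\<le>r + 2. real (r choose j) * f j)"
    by (rule sum.mono_neutral_left) (auto simp: binomial_eq_0)
  also have "\<dots> = (\<Sum>j\<in>{0, 1, 2}. real (r choose j) * f j)"
    by (rule sum.mono_neutral_right) (use assms in \<open>auto simp: not_less_eq_eq numeral_3_eq_3\<close>)
  finally show ?thesis by simp
qed

text \<open>\<open>A j\<close> differs from \<open>D j\<close> only for \<open>j \<le> 2\<close>, so
  three corrections are added to \<open>sum_D\<close>. They are grouped by \<open>A2\<close>,
  \<open>A1\<close> and \<open>A0two\<close>, the form in which the cavity equation produces
  them.\<close>

lemma sum_A_closed:
  assumes r: "r \<le> w" "r \<le> s"
  shows "(\<Sum>j\<le>r. real (r choose j) * A j (w - j) (s - j)) = Q (w + s - 2 * r) - Q w * Q s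
    + \<beta>\<^sup>2 * ((real (s choose 2) * om1 w + real r * (real s - 1) * (Q w - Q (w + 2))
         + real (r choose 2) * (Q (w - 2) - 2 * Q w + Q (w + 2))) * A2 0 (s - 2)
       + (real s * K w + real r * (((real w - 1) * Q (w - 2) - real w * Q w + Q w * Q 2) - K w)) * A1 1 (s - 1)
       + lam w * A0two s)"
proof -
  define f where "f j = A j (w - j) (s - j) - D j (w - j) (s - j)" for j
  have f3: "f j = 0" if "j \<ge> 3" for j using that by (simp add: f_def A_def)
  have f0: "f 0 = - (Q w * Q s) + \<beta>\<^sup>2 * (lam w * A0two s + real s * K w * A1 1 (s - 1)
      + real (s choose 2) * om1 w * A2 0 (s - 2))"
    by (simp add: f_def A_def A0_def D_0 kap_eq om_eq algebra_simps)
  have f1: "real r * f 1 = real r * (\<beta>\<^sup>2 * ((((real w - 1) * Q (w - 2) - real w * Q w + Q w * Q 2) - K w) * A1 1 (s - 1)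
     + (real s - 1) * (Q w - Q (w + 2)) * A2 0 (s - 2)))"
  proof (cases "r = 0")
    case False
    then obtain v u where w: "w = Suc v" and s: "s = Suc u" using r by (metis le_zero_eq not0_implies_Suc)
    have "f 1 = \<beta>\<^sup>2 * (\<phi> v * A1one u + real u * \<pi> v * A2 (u - 1) 0)"
      unfolding f_def w s D_1 A_def by (simp add: A1_def sk_pi_sum algebra_simps)
    also have "\<phi> v = ((real w - 1) * Q (w - 2) - real w * Q w + Q w * Q 2) - K w"
    proof (cases v)
      case 0 then show ?thesis unfolding w K_def
        using sk_pi_nat[of \<beta> h 0] by (simp add: sk_phi_def numeral_3_eq_3 algebra_simps)
    next
      case (Suc j)
      have *: "sk_pi \<beta> h (int v - 2) = Q j - Q (j + 2)" unfolding Suc by (rule sk_pi_pred)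
      show ?thesis unfolding sk_phi_def * sk_pi_nat K_def w unfolding Suc
        by (simp add: numeral_3_eq_3 algebra_simps)
    qed
    also have "\<pi> v = Q w - Q (w + 2)" unfolding sk_pi_nat w by (simp add: numeral_3_eq_3)
    also have "A2 (u - 1) 0 = A2 0 (s - 2)" unfolding A2_zero s by simp
    also have "A1one u = A1 1 (s - 1)" unfolding A1_one_left s by simp
    finally show ?thesis unfolding s by simp
  qed simp
  have f2: "real (r choose 2) * f 2 = real (r choose 2) * (\<beta>\<^sup>2 * ((Q (w - 2) - 2 * Q w + Q (w + 2)) * A2 0 (s - 2)))"
  proof (cases "r < 2")
    case False
    then obtain v u where w: "w = v + 2" and s: "s = u + 2"
      using r by (metis add.commute le_Suc_ex not_less order_trans)
    have "f 2 = A2 v u - \<rho> (v + u)" unfolding f_def w s D_2 A_def by simp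
    also have "\<dots> = \<beta>\<^sup>2 * \<rho> v * (\<rho> u / x)"
      unfolding A2_def using x_ne by (simp add: field_simps power2_eq_square power4_eq_xxxx)
    also have "\<rho> v = Q (w - 2) - 2 * Q w + Q (w + 2)" unfolding sk_rho_def w by (simp add: eval_nat_numeral)
    also have "\<rho> u / x = A2 0 (s - 2)" unfolding A2_zero s by simp
    finally show ?thesis by simp
  qed (simp add: binomial_eq_0)
  have "(\<Sum>j\<le>r. real (r choose j) * A j (w - j) (s - j))
     = (\<Sum>j\<le>r. real (r choose j) * D j (w - j) (s - j)) + (\<Sum>j\<le>r. real (r choose j) * f j)"
    unfolding sum.distrib[symmetric] by (intro sum.cong refl) (simp add: f_def algebra_simps)
  also have "\<dots> = Q (w + s - 2 * r) + (f 0 + real r * f 1 + real (r choose 2) * f 2)"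
  proof -
    have "(\<Sum>j\<le>r. real (r choose j) * f j) = f 0 + real r * f 1 + real (r choose 2) * f 2"
      by (rule sum_choose_first_three) (rule f3)
    then show ?thesis by (simp only: sum_D[OF r])
  qed
  also have "\<dots> = Q (w + s - 2 * r) - Q w * Q s
    + \<beta>\<^sup>2 * ((real (s choose 2) * om1 w + real r * (real s - 1) * (Q w - Q (w + 2))
         + real (r choose 2) * (Q (w - 2) - 2 * Q w + Q (w + 2))) * A2 0 (s - 2)
       + (real s * K w + real r * (((real w - 1) * Q (w - 2) - real w * Q w + Q w * Q 2) - K w)) * A1 1 (s - 1)
       + lam w * A0two s)"
    unfolding f0 f1 f2 by algebra
  finally show ?thesis .
qed

end

lemma sum_Pow_card:
  assumes "finite U"
  shows "(\<Sum>T\<in>Pow U. f (card T)) = (\<Sum>j\<le>card U. real (card U choose j) * (f j :: real))"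
proof -
  have "(\<Sum>T\<in>Pow U. f (card T)) = (\<Sum>j\<le>card U. \<Sum>T\<in>{T \<in> Pow U. card T = j}. f (card T))"
    by (rule sum.group[symmetric]) (use assms in \<open>auto intro: card_mono\<close>)
  also have "\<dots> = (\<Sum>j\<le>card U. real (card U choose j) * f j)"
  proof (rule sum.cong[OF refl])
    fix j
    have "(\<Sum>T\<in>{T \<in> Pow U. card T = j}. f (card T)) = (\<Sum>T\<in>{T \<in> Pow U. card T = j}. f j)"
      by (intro sum.cong refl) auto
    then show "(\<Sum>T\<in>{T \<in> Pow U. card T = j}. f (card T)) = real (card U choose j) * f j"
      using n_subsets[OF assms, of j] by simp
  qed
  finally show ?thesis .
qed

section \<open>Identification of the cavity covariance with the stated one\<close>

locale sk_limit = high_temperature \<beta> h "sk_q2 \<beta> h" L for \<beta> h L +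
  assumes bh: "\<beta> * h \<noteq> 0"
begin

lemma qq_eq: "qq = sk_q \<beta> h"
  by (rule ext) (simp add: sk_q_eq_tanh_moment)

lemma rho_eq: "rho = sk_rho \<beta> h"
  by (rule ext) (simp add: rho_def sk_rho_def qq_eq)

lemma phi1_eq: "phi1 = sk_phi \<beta> h 1"
  using sk_pi_nat[of \<beta> h 1] sk_pi_pred[of \<beta> h 0]
  by (simp add: phi1_def sk_phi_def qq_eq sk_q_0 eval_nat_numeral)

sublocale sk_algebra \<beta> h
  using rho_nondegenerate phi_nondegenerate[OF bh] by unfold_locales (simp_all add: rho_eq phi1_eq)

lemma om2_eq: "om2 = om1"
  by (rule ext) (simp add: om2_def om1_def qq_eq)

lemma kap2_eq: "kap2 = K 2"
  by (simp add: kap2_def K_def qq_eq)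

lemma a2_eq: "a2 s = A2 0 (s - 2)"
  by (simp add: a2_def A2_zero rho_eq)

text \<open>The row \<open>p = 1\<close> of the recursion, with symmetry, is an equation for
  \<open>A1one u\<close> with factor \<open>y\<close>, and its right-hand side is the numerator of
  \<open>a1\<close>.\<close>

lemma a1_eq: "a1 (Suc u) = A1 1 u"
proof -
  have pi: "pi1 (Suc u) = \<pi> u" "pi1 2 = \<pi> 1"
    using sk_pi_nat[of \<beta> h u] sk_pi_nat[of \<beta> h 1]
    by (simp_all add: pi1_def qq_eq eval_nat_numeral)
  have y: "y * A1one u = \<pi> u + \<beta>\<^sup>2 * \<pi> 1 * (real u * A2 0 (u - 1))"
  proof -
    have "A1 1 u = \<pi> u + \<beta>^2 * \<phi> 1 * A1one u + \<beta>^2 * real u * \<pi> 1 * A2 (u - 1) 0"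
      unfolding A1_def by simp
    then show ?thesis unfolding A1_one_left A2_zero by (simp add: algebra_simps)
  qed
  have "real (Suc u) - 1 = real u" "Suc u - 2 = u - 1" by simp_all
  then have "a1 (Suc u) = (\<pi> u + \<beta>\<^sup>2 * \<pi> 1 * (real u * A2 0 (u - 1))) / y"
    unfolding a1_def a2_eq pi phi1_eq by (simp only:)
  also have "\<dots> = A1one u" unfolding y[symmetric] using y_ne by simp
  finally show ?thesis unfolding A1_one_left .
qed

lemma a0_eq: "a0 s = A0two s"
proof -
  have a: "real s * a1 s = real s * A1 1 (s - 1)" by (cases s) (simp_all add: a1_eq)
  have b: "1 / 2 * om2 2 * (real s * (real s - 1) * a2 s) = om 2 s * A2 0 (s - 2)"
    using two_choose_two_real[of s] unfolding a2_eq om_eq om2_eq by simp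
  have c: "kap2 * (real s * a1 s) = kap 2 s * A1 1 (s - 1)" unfolding a kap2_eq kap_eq by simp
  have d: "om2 s = Q (2 + s) - Q 2 * Q s" by (simp add: om2_eq om1_def)
  show ?thesis unfolding a0_def A0two_def b c d phi1_eq phi_one by (simp add: algebra_simps)
qed

lemma lambda0_eq: "lambda0 = lam"
  by (rule ext) (simp add: lambda0_def lam_eq qq_eq)

definition B :: "nat set \<Rightarrow> nat set \<Rightarrow> real" where
  "B W S = (\<Sum>T\<in>Pow (W \<inter> S). A (card T) (card W - card T) (card S - card T))"

text \<open>Counting: a coefficient depends only on which of \<open>l\<close> and \<open>l'\<close>
  lie in \<open>W\<close>, and \<open>S\<close> has \<open>r\<close> elements inside
  \<open>W\<close> and \<open>s - r\<close> outside.\<close>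

lemma sum_link_coeff_overlap:
  fixes W S :: "nat set"
  assumes fin: "finite W" "finite S"
  defines "w \<equiv> card W" and "s \<equiv> real (card S)" and "r \<equiv> real (card (W \<inter> S))"
  shows "(\<Sum>l\<in>S. \<Sum>l'\<in>S - {l}. link_coeff W l l')
    = r * ((r - 1) * Q (w - 2) + (s - r) * Q w - (s - 1) * (Q w * Q 2))
     + (s - r) * (r * Q w + (s - r - 1) * Q (w + 2) - (s - 1) * (Q w * Q 2))"
proof -
  have row: "(\<Sum>l'\<in>S - {l}. link_coeff W l l') = (if l \<in> W
      then (r - 1) * Q (w - 2) + (s - r) * Q w - (s - 1) * (Q w * Q 2)
      else r * Q w + (s - r - 1) * Q (w + 2) - (s - 1) * (Q w * Q 2))" if l: "l \<in> S" for l
  proof -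
    have "(\<Sum>l'\<in>S - {l}. link_coeff W l l')
       = (\<Sum>l'\<in>S \<inter> W - {l}. link_coeff W l l') + (\<Sum>l'\<in>S - W - {l}. link_coeff W l l')"
      using fin by (subst sum.union_disjoint[symmetric]) (auto intro!: sum.cong)
    also have "(\<Sum>l'\<in>S \<inter> W - {l}. link_coeff W l l')
       = (\<Sum>l'\<in>S \<inter> W - {l}. (if l \<in> W then Q (w - 2) else Q w) - Q w * Q 2)"
      by (rule sum.cong) (auto simp: link_coeff_def card_sym_diff_pair[OF fin(1)] qq_eq w_def)
    also have "(\<Sum>l'\<in>S - W - {l}. link_coeff W l l')
       = (\<Sum>l'\<in>S - W - {l}. (if l \<in> W then Q w else Q (w + 2)) - Q w * Q 2)"
      by (rule sum.cong) (auto simp: link_coeff_def card_sym_diff_pair[OF fin(1)] qq_eq w_def)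
    finally have e: "(\<Sum>l'\<in>S - {l}. link_coeff W l l')
       = real (card (S \<inter> W - {l})) * ((if l \<in> W then Q (w - 2) else Q w) - Q w * Q 2)
        + real (card (S - W - {l})) * ((if l \<in> W then Q w else Q (w + 2)) - Q w * Q 2)" by simp
    have SW: "real (card (S - W)) = s - r"
      using fin card_Diff_subset_Int[of S W] card_mono[of S "S \<inter> W"] unfolding s_def r_def
      by (simp add: of_nat_diff Int_commute)
    show ?thesis
    proof (cases "l \<in> W")
      case True
      then have "card (S \<inter> W) \<ge> 1" using l fin by (metis IntI One_nat_def Suc_leI card_gt_0_iff empty_iff finite_Int)
      then have c1: "real (card (S \<inter> W - {l})) = r - 1"
        using True l unfolding r_def by (simp add: of_nat_diff Int_commute)
      have c2: "S - W - {l} = S - W" using True by auto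
      show ?thesis unfolding e c1 c2 SW using True by (simp add: algebra_simps)
    next
      case False
      then have "card (S - W) \<ge> 1" using l fin by (metis DiffI One_nat_def Suc_leI card_gt_0_iff empty_iff finite_Diff)
      then have c1: "real (card (S - W - {l})) = s - r - 1"
        using False l SW by (simp add: of_nat_diff)
      have c2: "S \<inter> W - {l} = S \<inter> W" using False by auto
      have c3: "real (card (S \<inter> W)) = r" unfolding r_def by (simp add: Int_commute)
      show ?thesis unfolding e c1 c2 c3 using False by (simp add: algebra_simps)
    qed
  qed
  have SW: "real (card (S - W)) = s - r"
    using fin card_Diff_subset_Int[of S W] card_mono[of S "S \<inter> W"] unfolding s_def r_def
    by (simp add: of_nat_diff Int_commute)
  have split: "(\<Sum>l\<in>S. if l \<in> W then a else b) = r * a + (s - r) * b" for a b :: real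
  proof -
    have "(\<Sum>l\<in>S. if l \<in> W then a else b) = (\<Sum>l\<in>S \<inter> W. a) + (\<Sum>l\<in>S - W. b)"
      using fin by (subst sum.If_cases) (auto simp: Diff_eq)
    then show ?thesis using SW by (simp add: r_def Int_commute)
  qed
  show ?thesis unfolding split[symmetric] by (rule sum.cong[OF refl row])
qed

lemma sum_kappa1_overlap:
  fixes W S :: "nat set"
  assumes fin: "finite W" "finite S"
  defines "w \<equiv> card W" and "s \<equiv> real (card S)" and "r \<equiv> real (card (W \<inter> S))"
  shows "(\<Sum>l\<in>S. kappa1 W l) = r * ((real w - 1) * Q (w - 2) - real w * Q w + Q w * Q 2) + (s - r) * K w"
proof -
  have SW: "real (card (S - W)) = s - r"
    using fin card_Diff_subset_Int[of S W] card_mono[of S "S \<inter> W"] unfolding s_def r_def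
    by (simp add: of_nat_diff Int_commute)
  have "(\<Sum>l\<in>S. kappa1 W l)
    = (\<Sum>l\<in>S. if l \<in> W then (real w - 1) * Q (w - 2) - real w * Q w + Q w * Q 2 else K w)"
    by (intro sum.cong refl) (simp add: kappa1_def Let_def w_def qq_eq K_def)
  also have "\<dots> = (\<Sum>l\<in>S \<inter> W. (real w - 1) * Q (w - 2) - real w * Q w + Q w * Q 2) + (\<Sum>l\<in>S - W. K w)"
    using fin by (subst sum.If_cases) (auto simp: Diff_eq)
  finally show ?thesis using SW by (simp add: r_def Int_commute)
qed

text \<open>Both sides depend on the sizes \<open>w\<close>, \<open>s\<close> and \<open>r\<close>
  only. The counting lemmas expand the cavity side, and \<open>sum_A_closed\<close> is the same
  expression reached from the other side.\<close>

lemma cov_eq: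
  assumes W: "W \<subseteq> {1..n}" and S: "S \<subseteq> {1..n}"
  shows "cov n W S = B W S"
proof -
  define w s r where "w = card W" "s = card S" "r = card (W \<inter> S)"
  have fin: "finite W" "finite S" using W S finite_subset by auto
  have r: "r \<le> w" "r \<le> s" unfolding w_s_r_def using fin by (auto intro: card_mono)
  have "(\<Sum>l\<in>{1..n}. \<Sum>l'\<in>{1..n} - {l}. link_coeff W l l' * ind2 S l l')
     = (\<Sum>l\<in>S. \<Sum>l'\<in>{1..n} - {l}. link_coeff W l l' * ind2 S l l')"
    by (rule sum.mono_neutral_right) (use S in \<open>auto simp: ind2_def\<close>)
  also have "\<dots> = (\<Sum>l\<in>S. \<Sum>l'\<in>S - {l}. link_coeff W l l' * ind2 S l l')"
  proof (rule sum.cong[OF refl])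
    fix l
    show "(\<Sum>l'\<in>{1..n} - {l}. link_coeff W l l' * ind2 S l l') = (\<Sum>l'\<in>S - {l}. link_coeff W l l' * ind2 S l l')"
      by (rule sum.mono_neutral_right) (use S in \<open>auto simp: ind2_def\<close>)
  qed
  also have "\<dots> = (\<Sum>l\<in>S. \<Sum>l'\<in>S - {l}. link_coeff W l l') * a2 s"
    unfolding sum_distrib_right by (intro sum.cong refl) (simp add: ind2_def w_s_r_def)
  finally have e2: "(\<Sum>l\<in>{1..n}. \<Sum>l'\<in>{1..n} - {l}. link_coeff W l l' * ind2 S l l')
     = (\<Sum>l\<in>S. \<Sum>l'\<in>S - {l}. link_coeff W l l') * a2 s" .
  have "(\<Sum>l\<in>{1..n}. kappa1 W l * ind1 S l) = (\<Sum>l\<in>S. kappa1 W l * ind1 S l)"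
    by (rule sum.mono_neutral_right) (use S in \<open>auto simp: ind1_def\<close>)
  also have "\<dots> = (\<Sum>l\<in>S. kappa1 W l) * a1 s"
    unfolding sum_distrib_right by (intro sum.cong refl) (simp add: ind1_def w_s_r_def)
  finally have e1: "(\<Sum>l\<in>{1..n}. kappa1 W l * ind1 S l) = (\<Sum>l\<in>S. kappa1 W l) * a1 s" .
  have card: "card (sym_diff W S) = w + s - 2 * r"
  proof -
    have "card (sym_diff W S) = card (W - S) + card (S - W)"
      using fin by (intro card_Un_disjoint) auto
    moreover have "card (W - S) = w - r" "card (S - W) = s - r"
      unfolding w_s_r_def using fin by (simp_all add: card_Diff_subset_Int Int_commute)
    ultimately show ?thesis using r by simp
  qed
  \<comment> \<open>At \<open>s = 0\<close>, where \<open>s - 1\<close> truncates, \<open>r\<close>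
    is 0 as well and both sides vanish.\<close>
  have k: "(real r * k1 + (real s - real r) * K w) * a1 s = (real s * K w + real r * (k1 - K w)) * A1 1 (s - 1)" for k1
  proof (cases s)
    case 0 then show ?thesis using r by simp
  next
    case (Suc u) then show ?thesis by (simp add: a1_eq algebra_simps)
  qed
  have l: "1 / 2 * (real r * ((real r - 1) * Q (w - 2) + (real s - real r) * Q w - (real s - 1) * (Q w * Q 2))
     + (real s - real r) * (real r * Q w + (real s - real r - 1) * Q (w + 2) - (real s - 1) * (Q w * Q 2)))
    = real (s choose 2) * om1 w + real r * (real s - 1) * (Q w - Q (w + 2))
         + real (r choose 2) * (Q (w - 2) - 2 * Q w + Q (w + 2))"
  proof -
    have c: "real (s choose 2) = real s * (real s - 1) / 2" "real (r choose 2) = real r * (real r - 1) / 2"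
      using two_choose_two_real[of s] two_choose_two_real[of r] by simp_all
    show ?thesis unfolding c om1_def by (simp add: field_simps)
  qed
  have "cov n W S = Q (w + s - 2 * r) - Q w * Q s + \<beta>\<^sup>2 * (
     (1 / 2 * (real r * ((real r - 1) * Q (w - 2) + (real s - real r) * Q w - (real s - 1) * (Q w * Q 2))
     + (real s - real r) * (real r * Q w + (real s - real r - 1) * Q (w + 2) - (real s - 1) * (Q w * Q 2)))) * a2 s
     + (real r * ((real w - 1) * Q (w - 2) - real w * Q w + Q w * Q 2) + (real s - real r) * K w) * a1 s
     + lam w * a0 s)"
    unfolding cov_def reduced_def e2 e1 card lambda0_eq
      sum_link_coeff_overlap[OF fin] sum_kappa1_overlap[OF fin] qq_eq w_s_r_def[symmetric]
    by (simp add: algebra_simps)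
  also have "\<dots> = (\<Sum>j\<le>r. real (r choose j) * A j (w - j) (s - j))"
    unfolding l k a2_eq a0_eq sum_A_closed[OF r] ..
  also have "\<dots> = B W S"
    unfolding B_def w_s_r_def using fin by (subst sum_Pow_card) simp_all
  finally show ?thesis .
qed

subsection \<open>Characteristic functions\<close>

lemma has_derivative_sk_avg:
  assumes "\<And>\<sigma> u. ((\<lambda>u. F u \<sigma>) has_real_derivative F' u \<sigma>) (at u)"
  shows "((\<lambda>u. sk_avg N \<beta> h C (F u)) has_real_derivative sk_avg N \<beta> h C (F' u)) (at u)"
  unfolding sk_avg_def gauss_avg_eq_sum[OF finite_sk_configs sk_configs_nonempty]
  by (intro DERIV_sum DERIV_cmult_right assms)

lemma fluct_scale: "fluct N n (\<lambda>S. u * t S) \<sigma> = u * fluct N n t \<sigma>"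
  by (simp add: fluct_def sum_distrib_left mult.assoc)

text \<open>Summing \<open>obs\<close> against \<open>t\<close> restores the fluctuation as a
  factor, which is what differentiation along a ray brings down.\<close>

lemma sum_obs: "(\<Sum>W\<in>Pow {1..n}. t W * obs N n t' \<eta> W)
    = \<nu> N (n + 8) (\<lambda>\<sigma>. fluct N n t \<sigma> * \<eta> (fluct N n t' \<sigma>))"
proof -
  have "(\<lambda>\<sigma>. fluct N n t \<sigma> * \<eta> (fluct N n t' \<sigma>)) = (\<lambda>\<sigma>. \<Sum>W\<in>Pow {1..n}. (t W * sqrt (real N)) *
      ((sk_overlap N W \<sigma> - qq (card W)) * \<eta> (fluct N n t' \<sigma>)))"
    by (rule ext) (simp add: fluct_def sum_distrib_right mult_ac)
  then show ?thesis by (simp only: sk_avg_sum sk_avg_cmult obs_def mult.assoc)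
qed

definition V :: "nat \<Rightarrow> (nat set \<Rightarrow> real) \<Rightarrow> real" where
  "V n t = (\<Sum>W\<in>Pow {1..n}. \<Sum>S\<in>Pow {1..n}. t W * t S * B W S)"

text \<open>The cavity equation turns into the differential equation \<open>\<phi>' u = - u V \<phi> u\<close> for the
  characteristic function along rays, up to \<open>O(1/sqrt N)\<close>.\<close>

lemma mean_ode:
  assumes smooth: "smooth_pair \<eta> \<eta>'" and d: "\<And>x. (\<eta>' has_real_derivative - \<eta> x) (at x)"
  shows "\<exists>C. \<forall>N\<ge>1. \<bar>mean N n t \<eta>' * exp (V n t / 2) - \<eta>' 0\<bar> \<le> C / sqrt (real N)"
proof -
  \<comment> \<open>The same bound serves every multiple \<open>u * t\<close> with
    \<open>0 \<le> u \<le> 1\<close>, so one constant \<open>C\<close> works along the whole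
    ray.\<close>
  define T where "T = (\<Sum>S\<in>Pow {1..n}. \<bar>t S\<bar>)"
  let ?u = "\<lambda>u S. u * t S"
  have "small n T (\<lambda>N t' \<eta> \<eta>'. \<Sum>W\<in>Pow {1..n}. t W * (obs N n t' \<eta> W - (\<Sum>S\<in>Pow {1..n}. t' S * cov n W S) * mean N n t' \<eta>'))"
    by (intro small_sum small_cmult small_obs bh) auto
  then obtain C where C: "\<And>N t' \<eta> \<eta>'. N \<ge> 1 \<Longrightarrow> (\<Sum>S\<in>Pow {1..n}. \<bar>t' S\<bar>) \<le> T \<Longrightarrow> smooth_pair \<eta> \<eta>' \<Longrightarrow>
     \<bar>\<Sum>W\<in>Pow {1..n}. t W * (obs N n t' \<eta> W - (\<Sum>S\<in>Pow {1..n}. t' S * cov n W S) * mean N n t' \<eta>')\<bar> \<le> C / sqrt (real N)"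
    by (rule smallD) blast
  have VB: "(\<Sum>W\<in>Pow {1..n}. t W * (\<Sum>S\<in>Pow {1..n}. ?u u S * cov n W S)) = u * V n t" for u
  proof -
    have "(\<Sum>W\<in>Pow {1..n}. t W * (\<Sum>S\<in>Pow {1..n}. ?u u S * cov n W S))
       = (\<Sum>W\<in>Pow {1..n}. \<Sum>S\<in>Pow {1..n}. u * (t W * t S * B W S))"
      unfolding sum_distrib_left by (intro sum.cong refl) (simp add: cov_eq mult_ac)
    then show ?thesis by (simp only: V_def sum_distrib_left)
  qed
  define C' where "C' = exp (\<bar>V n t\<bar> / 2) * C"
  have "\<bar>mean N n t \<eta>' * exp (V n t / 2) - \<eta>' 0\<bar> \<le> C' / sqrt (real N)" if N: "N \<ge> 1" for N
  proof -
    define g where "g u = mean N n (?u u) \<eta>'" for u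
    \<comment> \<open>The exponential is the integrating factor of the equation: \<open>f\<close>
      has a derivative of order \<open>1 / sqrt N\<close>, and \<open>f 0\<close> is
      explicit.\<close>
    define f where "f u = g u * exp (u\<^sup>2 * V n t / 2)" for u
    define g' where "g' u = - (\<Sum>W\<in>Pow {1..n}. t W * obs N n (?u u) \<eta> W)" for u
    have dg: "(g has_real_derivative g' u) (at u)" for u
    proof -
      have "((\<lambda>u. \<nu> N (n + 8) (\<lambda>\<sigma>. \<eta>' (u * fluct N n t \<sigma>))) has_real_derivative
         \<nu> N (n + 8) (\<lambda>\<sigma>. - \<eta> (u * fluct N n t \<sigma>) * fluct N n t \<sigma>)) (at u)"
      proof (rule has_derivative_sk_avg)
        fix \<sigma> :: "nat \<Rightarrow> nat \<Rightarrow> real" and u :: real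
        have "((\<lambda>u. u * fluct N n t \<sigma>) has_real_derivative fluct N n t \<sigma>) (at u)"
          by (auto intro!: derivative_eq_intros)
        from DERIV_chain2[OF d this]
        show "((\<lambda>u. \<eta>' (u * fluct N n t \<sigma>)) has_real_derivative - \<eta> (u * fluct N n t \<sigma>) * fluct N n t \<sigma>) (at u)" .
      qed
      also have "\<nu> N (n + 8) (\<lambda>\<sigma>. - \<eta> (u * fluct N n t \<sigma>) * fluct N n t \<sigma>)
         = - \<nu> N (n + 8) (\<lambda>\<sigma>. fluct N n t \<sigma> * \<eta> (u * fluct N n t \<sigma>))"
        using sk_avg_cmult[of N \<beta> h "{1..n + 8}" "-1" "\<lambda>\<sigma>. fluct N n t \<sigma> * \<eta> (u * fluct N n t \<sigma>)"]
        by (simp add: mult.commute)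
      also have "\<dots> = g' u" unfolding g'_def sum_obs fluct_scale ..
      finally show ?thesis unfolding g_def mean_def fluct_scale .
    qed
    have dev: "\<bar>g' u + u * V n t * g u\<bar> \<le> C / sqrt (real N)" if u: "0 \<le> u" "u \<le> 1" for u
    proof -
      have T: "(\<Sum>S\<in>Pow {1..n}. \<bar>?u u S\<bar>) \<le> T"
        unfolding T_def using u by (intro sum_mono) (simp add: abs_mult mult_left_le_one_le)
      have "(\<Sum>W\<in>Pow {1..n}. t W * (obs N n (?u u) \<eta> W - (\<Sum>S\<in>Pow {1..n}. ?u u S * cov n W S) * mean N n (?u u) \<eta>'))
         = - g' u - u * V n t * g u"
      proof -
        define s where "s W = (\<Sum>S\<in>Pow {1..n}. ?u u S * cov n W S)" for W
        have "(\<Sum>W\<in>Pow {1..n}. t W * (obs N n (?u u) \<eta> W - s W * g u))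
          = (\<Sum>W\<in>Pow {1..n}. t W * obs N n (?u u) \<eta> W) - (\<Sum>W\<in>Pow {1..n}. t W * s W) * g u"
          unfolding sum_distrib_right[of _ _ "g u"] sum_subtractf[symmetric]
          by (intro sum.cong refl) (simp only: right_diff_distrib mult.assoc)
        then show ?thesis unfolding s_def VB g'_def g_def by simp
      qed
      then show ?thesis using C[OF N T smooth] by (simp add: abs_minus_commute)
    qed
    have "norm (f 1 - f 0) \<le> C' / sqrt (real N) * norm (1 - 0 :: real)"
    proof (rule field_differentiable_bound[where S = "{0..1}" and f = f
          and f' = "\<lambda>u. (g' u + u * V n t * g u) * exp (u\<^sup>2 * V n t / 2)"])
      fix u :: real assume u: "u \<in> {0..1}"
      have "((\<lambda>u. exp (u\<^sup>2 * V n t / 2)) has_real_derivative exp (u\<^sup>2 * V n t / 2) * (u * V n t)) (at u)"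
        by (rule derivative_eq_intros refl | simp)+
      from DERIV_mult[OF dg this]
      have "(f has_real_derivative (g' u + u * V n t * g u) * exp (u\<^sup>2 * V n t / 2)) (at u)"
        unfolding f_def by (rule DERIV_cong) (simp add: algebra_simps)
      then show "(f has_field_derivative (g' u + u * V n t * g u) * exp (u\<^sup>2 * V n t / 2)) (at u within {0..1})"
        by (rule has_field_derivative_at_within)
      have u2: "u\<^sup>2 \<le> 1" using u by (simp add: power_le_one)
      have "u\<^sup>2 * V n t \<le> u\<^sup>2 * \<bar>V n t\<bar>" by (rule mult_left_mono) simp_all
      also have "u\<^sup>2 * \<bar>V n t\<bar> \<le> 1 * \<bar>V n t\<bar>" by (rule mult_right_mono[OF u2]) simp
      finally have E: "exp (u\<^sup>2 * V n t / 2) \<le> exp (\<bar>V n t\<bar> / 2)" by simp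
      have D: "\<bar>g' u + u * V n t * g u\<bar> \<le> C / sqrt (real N)" using dev[of u] u by simp
      have "\<bar>g' u + u * V n t * g u\<bar> * exp (u\<^sup>2 * V n t / 2) \<le> C / sqrt (real N) * exp (\<bar>V n t\<bar> / 2)"
        by (rule mult_mono[OF D E]) (use order_trans[OF abs_ge_zero D] in simp_all)
      then show "norm ((g' u + u * V n t * g u) * exp (u\<^sup>2 * V n t / 2)) \<le> C' / sqrt (real N)"
        by (simp add: abs_mult C'_def mult.commute)
    qed auto
    moreover have "f 1 = mean N n t \<eta>' * exp (V n t / 2)" by (simp add: f_def g_def)
    moreover have "f 0 = \<eta>' 0" by (simp add: f_def g_def mean_def fluct_def sk_avg_const)
    ultimately show ?thesis by simp
  qed
  then show ?thesis by blast
qed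

lemma mean_tendsto:
  assumes "smooth_pair \<eta> \<eta>'" "\<And>x. (\<eta>' has_real_derivative - \<eta> x) (at x)"
  shows "(\<lambda>N. mean N n t \<eta>') \<longlonglongrightarrow> \<eta>' 0 * exp (- V n t / 2)"
proof -
  obtain C where C: "\<And>N. N \<ge> 1 \<Longrightarrow> \<bar>mean N n t \<eta>' * exp (V n t / 2) - \<eta>' 0\<bar> \<le> C / sqrt (real N)"
    using mean_ode[OF assms, of n t] by blast
  have "(\<lambda>N. mean N n t \<eta>' * exp (V n t / 2) - \<eta>' 0) \<longlonglongrightarrow> 0"
  proof (rule Lim_null_comparison)
    show "\<forall>\<^sub>F N in sequentially. norm (mean N n t \<eta>' * exp (V n t / 2) - \<eta>' 0) \<le> C / sqrt (real N)"
      using C by (intro eventually_sequentiallyI[of 1]) simp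
    show "(\<lambda>N. C / sqrt (real N)) \<longlonglongrightarrow> 0" by real_asymp
  qed
  then have "(\<lambda>N. (mean N n t \<eta>' * exp (V n t / 2) - \<eta>' 0 + \<eta>' 0) * exp (- V n t / 2)) \<longlonglongrightarrow> (0 + \<eta>' 0) * exp (- V n t / 2)"
    by (intro tendsto_intros)
  then show ?thesis by (simp add: mult.assoc exp_add[symmetric])
qed

lemma sk_nu_fluct: "sk_nu N n \<beta> h (\<lambda>\<sigma>. \<eta> (fluct N n t \<sigma>)) = mean N n t \<eta>"
proof -
  have "depends_on {1..n} (\<lambda>\<sigma>. \<eta> (fluct N n t \<sigma>))"
    unfolding fluct_def
    by (intro depends_on_compose[where h = \<eta>] depends_on_sum
          depends_on_compose[where h = "\<lambda>x. t S * (sqrt (real N) * (x - qq (card S)))" for S] depends_on_sk_overlap) auto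
  then show ?thesis unfolding sk_nu_eq_sk_avg mean_def
    by (intro sk_avg_marginal[symmetric]) auto
qed

lemma cos_tendsto: "(\<lambda>N. sk_nu N n \<beta> h (\<lambda>\<sigma>. cos (fluct N n t \<sigma>))) \<longlonglongrightarrow> exp (- V n t / 2)"
  using mean_tendsto[OF smooth_pair_sin, of n t] unfolding sk_nu_fluct
  by (simp add: DERIV_cos)

lemma sin_tendsto: "(\<lambda>N. sk_nu N n \<beta> h (\<lambda>\<sigma>. sin (fluct N n t \<sigma>))) \<longlonglongrightarrow> 0"
proof -
  have "((\<lambda>x. - sin x) has_real_derivative - cos x) (at x)" for x :: real
    by (auto intro!: derivative_eq_intros)
  from mean_tendsto[OF smooth_pair_cos this, of n t]
  have "(\<lambda>N. mean N n t (\<lambda>x. - sin x)) \<longlonglongrightarrow> 0" by simp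
  moreover have "mean N n t (\<lambda>x. - sin x) = - mean N n t sin" for N
    using sk_avg_cmult[of N \<beta> h "{1..n + 8}" "-1" "\<lambda>\<sigma>. sin (fluct N n t \<sigma>)"] by (simp add: mean_def)
  ultimately show ?thesis unfolding sk_nu_fluct using tendsto_minus_cancel_left[of "\<lambda>N. mean N n t sin" 0 sequentially]
    by simp
qed

lemma V_nonneg: "0 \<le> V n t"
proof -
  have "mean N n t cos \<le> 1" for N
    using sk_avg_mono[of "{1..n + 8}" N "\<lambda>\<sigma>. cos (fluct N n t \<sigma>)" "\<lambda>_. 1" \<beta> h]
    by (simp add: mean_def sk_avg_const)
  then have "exp (- V n t / 2) \<le> 1"
    using cos_tendsto[of n t] unfolding sk_nu_fluct by (intro LIMSEQ_le_const2) auto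
  then show ?thesis by simp
qed

end

subsection \<open>Convergence in distribution from characteristic functions\<close>

lemma open_coordinate_preimage:
  fixes f g :: "'a \<Rightarrow> 'b::topological_space"
  assumes "open U" shows "open {x. x i \<in> U}"
  using open_vimage[OF assms continuous_on_product_coordinates, of i] by (simp add: vimage_def)

text \<open>Stone-Weierstrass is applied on a function type with the product topology and asks for a
  Hausdorff type. Distinct functions are separated through a coordinate at which they
  differ.\<close>

instance "fun" :: (type, t0_space) t0_space
proof
  fix f g :: "'a \<Rightarrow> 'b"
  assume "f \<noteq> g"
  then obtain i where "f i \<noteq> g i" unfolding fun_eq_iff by blast
  then obtain U where "open U" "\<not> (f i \<in> U \<longleftrightarrow> g i \<in> U)" using t0_space_class.t0_space[of "f i" "g i"] by blast
  then show "\<exists>U. open U \<and> \<not> (f \<in> U \<longleftrightarrow> g \<in> U)"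
    using open_coordinate_preimage[of U i] by (intro exI[of _ "{x. x i \<in> U}"]) auto
qed

instance "fun" :: (type, t1_space) t1_space
proof
  fix f g :: "'a \<Rightarrow> 'b"
  assume "f \<noteq> g"
  then obtain i where "f i \<noteq> g i" unfolding fun_eq_iff by blast
  then obtain U where "open U" "f i \<in> U" "g i \<notin> U" using t1_space_class.t1_space[of "f i" "g i"] by blast
  then show "\<exists>U. open U \<and> f \<in> U \<and> g \<notin> U"
    using open_coordinate_preimage[of U i] by (intro exI[of _ "{x. x i \<in> U}"]) auto
qed

instance "fun" :: (type, t2_space) t2_space
proof
  fix f g :: "'a \<Rightarrow> 'b"
  assume "f \<noteq> g"
  then obtain i where "f i \<noteq> g i" unfolding fun_eq_iff by blast
  then obtain U V where "open U" "open V" "f i \<in> U" "g i \<in> V" "U \<inter> V = {}"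
    using hausdorff[of "f i" "g i"] by blast
  then show "\<exists>U V. open U \<and> open V \<and> f \<in> U \<and> g \<in> V \<and> U \<inter> V = {}"
    using open_coordinate_preimage[of U i] open_coordinate_preimage[of V i]
    by (intro exI[of _ "{x. x i \<in> U}"] exI[of _ "{x. x i \<in> V}"]) auto
qed

text \<open>The amplitude \<open>a\<close> sits in the base cases, so that sums already give the
  linear span; the product-to-sum formulas make it an algebra in
  \<open>trig_poly_mult\<close>.\<close>

inductive trig_poly :: "'i set \<Rightarrow> (('i \<Rightarrow> real) \<Rightarrow> real) \<Rightarrow> bool" for I where
  cos: "trig_poly I (\<lambda>x. a * cos (\<Sum>i\<in>I. t i * x i))"
| sin: "trig_poly I (\<lambda>x. a * sin (\<Sum>i\<in>I. t i * x i))"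
| add: "trig_poly I P \<Longrightarrow> trig_poly I Q \<Longrightarrow> trig_poly I (\<lambda>x. P x + Q x)"

lemma trig_poly_const: "trig_poly I (\<lambda>_. a)"
  using trig_poly.cos[of I a "\<lambda>_. 0"] by simp

lemma trig_poly_sin_coord:
  assumes "finite I" "i \<in> I"
  shows "trig_poly I (\<lambda>x. sin (c * x i))"
proof -
  have "(\<Sum>j\<in>I. (if j = i then c else 0) * x j) = c * x i" for x
  proof -
    have "(\<Sum>j\<in>I. (if j = i then c else 0) * x j) = (\<Sum>j\<in>I. if j = i then c * x j else 0)"
      by (intro sum.cong) auto
    then show ?thesis using assms by simp
  qed
  then show ?thesis using trig_poly.sin[of I 1 "\<lambda>j. if j = i then c else 0"] by simp
qed

lemma trig_poly_mult:
  assumes "trig_poly I P" "trig_poly I Q"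
  shows "trig_poly I (\<lambda>x. P x * Q x)"
  using assms
proof (induction arbitrary: Q)
  case (cos a t)
  from cos show ?case
  proof (induction)
    case (cos b u)
    have eq: "a * cos (\<Sum>i\<in>I. t i * x i) * (b * cos (\<Sum>i\<in>I. u i * x i))
      = a * b / 2 * cos (\<Sum>i\<in>I. (t i - u i) * x i) + a * b / 2 * cos (\<Sum>i\<in>I. (t i + u i) * x i)" for x
      unfolding distrib_right left_diff_distrib sum.distrib sum_subtractf cos_add cos_diff by (simp add: algebra_simps)
    show ?case unfolding eq by (rule trig_poly.add[OF trig_poly.cos trig_poly.cos])
  next
    case (sin b u)
    have eq: "a * cos (\<Sum>i\<in>I. t i * x i) * (b * sin (\<Sum>i\<in>I. u i * x i))
      = a * b / 2 * sin (\<Sum>i\<in>I. (u i - t i) * x i) + a * b / 2 * sin (\<Sum>i\<in>I. (t i + u i) * x i)" for x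
      unfolding distrib_right left_diff_distrib sum.distrib sum_subtractf sin_add sin_diff by (simp add: algebra_simps)
    show ?case unfolding eq by (rule trig_poly.add[OF trig_poly.sin trig_poly.sin])
  next
    case (add P Q)
    from add.IH show ?case unfolding distrib_left by (rule trig_poly.add)
  qed
next
  case (sin a t)
  from sin show ?case
  proof (induction)
    case (cos b u)
    have eq: "a * sin (\<Sum>i\<in>I. t i * x i) * (b * cos (\<Sum>i\<in>I. u i * x i))
      = a * b / 2 * sin (\<Sum>i\<in>I. (t i - u i) * x i) + a * b / 2 * sin (\<Sum>i\<in>I. (t i + u i) * x i)" for x
      unfolding distrib_right left_diff_distrib sum.distrib sum_subtractf sin_add sin_diff by (simp add: algebra_simps)
    show ?case unfolding eq by (rule trig_poly.add[OF trig_poly.sin trig_poly.sin])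
  next
    case (sin b u)
    have eq: "a * sin (\<Sum>i\<in>I. t i * x i) * (b * sin (\<Sum>i\<in>I. u i * x i))
      = a * b / 2 * cos (\<Sum>i\<in>I. (t i - u i) * x i) + (- a * b / 2) * cos (\<Sum>i\<in>I. (t i + u i) * x i)" for x
      unfolding distrib_right left_diff_distrib sum.distrib sum_subtractf cos_add cos_diff by (simp add: algebra_simps)
    show ?case unfolding eq by (rule trig_poly.add[OF trig_poly.cos trig_poly.cos])
  next
    case (add P Q)
    from add.IH show ?case unfolding distrib_left by (rule trig_poly.add)
  qed
next
  case (add P1 P2)
  show ?case unfolding distrib_right by (rule trig_poly.add[OF add.IH(1)[OF add.prems] add.IH(2)[OF add.prems]])
qed

text \<open>Stone--Weierstrass is applied in the variables \<open>sin (c * x i)\<close>, which take values in \<open>[-1, 1]\<close> for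
  all \<open>x\<close>, so that the approximation is also bounded outside the cube.\<close>

lemma trig_poly_approximation:
  fixes F :: "('i \<Rightarrow> real) \<Rightarrow> real"
  assumes I: "finite I" and F: "continuous_on UNIV F" and b: "\<And>x. \<bar>F x\<bar> \<le> b"
    and "0 < K" "0 < e"
  shows "\<exists>P. trig_poly I P \<and> (\<forall>x\<in>extensional I. \<bar>P x\<bar> \<le> b + e \<and>
           ((\<forall>i\<in>I. \<bar>x i\<bar> \<le> K) \<longrightarrow> \<bar>F x - P x\<bar> \<le> e))"
proof -
  \<comment> \<open>Maps the cube \<open>\<bar>x i\<bar> \<le> K\<close> into
    \<open>\<bar>c * x i\<bar> \<le> pi / 2\<close>, where \<open>arcsin\<close> inverts
    \<open>sin\<close>.\<close>
  define c where "c = pi / (2 * K)"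
  have c: "c > 0" using \<open>0 < K\<close> by (simp add: c_def)
  let ?s = "\<lambda>x. \<lambda>i\<in>I. sin (c * x i)"
  let ?r = "\<lambda>s. \<lambda>i\<in>I. arcsin (s i) / c"
  define C where "C = PiE I (\<lambda>_. {-1..1::real})"
  define R where "R = {f. continuous_on C f \<and> trig_poly I (\<lambda>x. f (?s x))}"
  \<comment> \<open>Coordinates outside \<open>I\<close> are pinned to \<open>undefined\<close>, so
    \<open>C\<close> is a product of compact sets over the whole index type.\<close>
  have "C = PiE UNIV (\<lambda>i. if i \<in> I then {-1..1} else {undefined})"
    unfolding C_def by (auto simp: PiE_def Pi_def extensional_def split: if_splits)
  then have "compactin (product_topology (\<lambda>_. euclidean) UNIV) C"
    by (auto simp: compactin_PiE)
  then have compact: "compact C" by (simp add: euclidean_product_topology)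
  have coord: "continuous_on X (\<lambda>s. s i)" for X :: "('i \<Rightarrow> real) set" and i
    by (rule continuous_on_subset[OF continuous_on_product_coordinates subset_UNIV])
  interpret function_ring_on R C
  proof
    show "compact C" by (rule compact)
  next
    fix f g assume "f \<in> R" "g \<in> R"
    then have c: "continuous_on C f" "continuous_on C g"
      and t: "trig_poly I (\<lambda>x. f (?s x))" "trig_poly I (\<lambda>x. g (?s x))" unfolding R_def by blast+
    show "continuous_on C f" by (rule c)
    show "(\<lambda>x. f x + g x) \<in> R" unfolding R_def mem_Collect_eq
      by (rule conjI[OF continuous_on_add[OF c] trig_poly.add[OF t]])
    show "(\<lambda>x. f x * g x) \<in> R" unfolding R_def mem_Collect_eq
      by (rule conjI[OF continuous_on_mult[OF c] trig_poly_mult[OF t]])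
  next
    show "(\<lambda>_. a) \<in> R" for a unfolding R_def mem_Collect_eq
      by (rule conjI[OF continuous_on_const trig_poly_const])
    show "\<exists>f\<in>R. f x \<noteq> f y" if "x \<in> C" "y \<in> C" "x \<noteq> y" for x y
    proof -
      have "\<exists>i\<in>I. x i \<noteq> y i" using that PiE_ext[of x I "\<lambda>_. {-1..1}" y] unfolding C_def by blast
      then obtain i where i: "i \<in> I" "x i \<noteq> y i" by blast
      have t: "trig_poly I (\<lambda>x. ?s x i)" using trig_poly_sin_coord[OF I i(1), of c] i(1) by simp
      have r: "(\<lambda>s. s i) \<in> R" unfolding R_def mem_Collect_eq by (rule conjI[OF coord t])
      show ?thesis unfolding Bex_def by (rule exI[of _ "\<lambda>s. s i"], rule conjI[OF r i(2)])
    qed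
  qed
  have "continuous_on C (\<lambda>s. F (?r s))"
  proof (rule continuous_on_compose2[OF F])
    show "continuous_on C ?r"
    proof (rule continuous_on_coordinatewise_then_product)
      fix i show "continuous_on C (\<lambda>s. ?r s i)"
      proof (cases "i \<in> I")
        case True
        have "continuous_on C (\<lambda>s. arcsin (s i) / c)"
          by (intro continuous_intros continuous_on_arcsin coord) (use c True in \<open>auto simp: C_def PiE_def Pi_def\<close>)
        then show ?thesis using True by simp
      qed simp
    qed
  qed simp
  from Stone_Weierstrass_basic[OF this \<open>0 < e\<close>] obtain g where
    g: "g \<in> R" and gF': "\<forall>s\<in>C. \<bar>F (?r s) - g s\<bar> < e" by (rule bexE)
  note gF = gF'[rule_format]
  have sC: "?s x \<in> C" for x by (auto simp: C_def)
  show ?thesis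
  proof (intro exI[of _ "\<lambda>x. g (?s x)"] conjI ballI impI)
    show "trig_poly I (\<lambda>x. g (?s x))" using g by (simp add: R_def)
    fix x :: "'i \<Rightarrow> real" assume x: "x \<in> extensional I"
    show "\<bar>g (?s x)\<bar> \<le> b + e" using gF[OF sC[of x]] b[of "?r (?s x)"] by linarith
    assume K: "\<forall>i\<in>I. \<bar>x i\<bar> \<le> K"
    have "?r (?s x) = x"
    proof (rule extensionalityI[where A = I])
      fix i assume i: "i \<in> I"
      have "\<bar>c * x i\<bar> \<le> pi / 2"
      proof -
        have "\<bar>c * x i\<bar> \<le> c * K" using K i c by (simp add: abs_mult)
        also have "c * K = pi / 2" using \<open>0 < K\<close> by (simp add: c_def)
        finally show ?thesis .
      qed
      then have "arcsin (sin (c * x i)) = c * x i" by (intro arcsin_sin) linarith+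
      then show "?r (?s x) i = x i" using i c by simp
    qed (use x in auto)
    then show "\<bar>F x - g (?s x)\<bar> \<le> e" using gF[OF sC[of x]] by simp
  qed
qed

lemma trig_poly_integral_tendsto:
  assumes "trig_poly I P" and M: "prob_space M" and Z: "\<And>i. i \<in> I \<Longrightarrow> Z i \<in> borel_measurable M"
    and add: "\<And>N f g. E N (\<lambda>x. f x + g x) = E N f + E N g"
    and cmult: "\<And>N a f. E N (\<lambda>x. a * f x) = a * E N f"
    and cos: "\<And>t. (\<lambda>N. E N (\<lambda>x. cos (\<Sum>i\<in>I. t i * X N i x))) \<longlonglongrightarrow> (LINT w|M. cos (\<Sum>i\<in>I. t i * Z i w))"
    and sin: "\<And>t. (\<lambda>N. E N (\<lambda>x. sin (\<Sum>i\<in>I. t i * X N i x))) \<longlonglongrightarrow> (LINT w|M. sin (\<Sum>i\<in>I. t i * Z i w))"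
  shows "integrable M (\<lambda>w. P (\<lambda>i\<in>I. Z i w)) \<and>
    (\<lambda>N. E N (\<lambda>x. P (\<lambda>i\<in>I. X N i x))) \<longlonglongrightarrow> (LINT w|M. P (\<lambda>i\<in>I. Z i w))"
  using assms(1)
proof induction
  interpret prob_space M by (rule M)
  case (cos a t)
  have [measurable]: "(\<lambda>w. \<Sum>i\<in>I. t i * Z i w) \<in> borel_measurable M"
    using Z by (intro borel_measurable_sum borel_measurable_times) auto
  have "integrable M (\<lambda>w. cos (\<Sum>i\<in>I. t i * Z i w))"
    by (rule integrable_const_bound[where B = 1]) auto
  moreover have "(\<lambda>N. E N (\<lambda>x. a * cos (\<Sum>i\<in>I. t i * X N i x))) \<longlonglongrightarrow> a * (LINT w|M. cos (\<Sum>i\<in>I. t i * Z i w))"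
    unfolding cmult by (intro tendsto_mult_left assms(6))
  ultimately show ?case by simp
next
  interpret prob_space M by (rule M)
  case (sin a t)
  have [measurable]: "(\<lambda>w. \<Sum>i\<in>I. t i * Z i w) \<in> borel_measurable M"
    using Z by (intro borel_measurable_sum borel_measurable_times) auto
  have "integrable M (\<lambda>w. sin (\<Sum>i\<in>I. t i * Z i w))"
    by (rule integrable_const_bound[where B = 1]) auto
  moreover have "(\<lambda>N. E N (\<lambda>x. a * sin (\<Sum>i\<in>I. t i * X N i x))) \<longlonglongrightarrow> a * (LINT w|M. sin (\<Sum>i\<in>I. t i * Z i w))"
    unfolding cmult by (intro tendsto_mult_left assms(7))
  ultimately show ?case by simp
next
  case (add P Q)
  have eq: "(\<lambda>N. E N (\<lambda>x. P (\<lambda>i\<in>I. X N i x) + Q (\<lambda>i\<in>I. X N i x)))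
      = (\<lambda>N. E N (\<lambda>x. P (\<lambda>i\<in>I. X N i x)) + E N (\<lambda>x. Q (\<lambda>i\<in>I. X N i x)))"
    by (rule ext) (rule assms(4))
  note P = conjunct1[OF add.IH(1)] conjunct2[OF add.IH(1)] and Q = conjunct1[OF add.IH(2)] conjunct2[OF add.IH(2)]
  show ?case unfolding eq Bochner_Integration.integral_add[OF P(1) Q(1)]
    by (rule conjI[OF Bochner_Integration.integrable_add[OF P(1) Q(1)] tendsto_add[OF P(2) Q(2)]])
qed

text \<open>On the cube \<open>\<bar>x i\<bar> \<le> K\<close> the error is \<open>1 / K\<close>.
  Off the cube it is at most \<open>2 * b + 1\<close>, while the sum of squares is at least
  \<open>K\<close>. One quadratic bound covers both, and integrated it turns bounded second moments
  into a uniform error.\<close>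

lemma trig_poly_approximation_quadratic:
  fixes F :: "('i \<Rightarrow> real) \<Rightarrow> real"
  assumes I: "finite I" and F: "continuous_on UNIV F" and b: "\<And>x. \<bar>F x\<bar> \<le> b"
  shows "\<exists>P. trig_poly I P \<and>
    (\<forall>x\<in>extensional I. \<bar>F x - P x\<bar> \<le> (1 + (2 * b + 1) * (\<Sum>i\<in>I. (x i)\<^sup>2)) / real (Suc k))"
proof -
  define K where "K = real (Suc k)"
  have K: "1 \<le> K" by (simp add: K_def)
  have b0: "0 \<le> b" using b[of undefined] by linarith
  obtain P where P: "trig_poly I P" and
    ap: "\<forall>x\<in>extensional I. \<bar>P x\<bar> \<le> b + 1 / K \<and> ((\<forall>i\<in>I. \<bar>x i\<bar> \<le> K) \<longrightarrow> \<bar>F x - P x\<bar> \<le> 1 / K)"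
    using trig_poly_approximation[OF I F b, of K "1 / K"] K by auto
  have "\<bar>F x - P x\<bar> \<le> (1 + (2 * b + 1) * (\<Sum>i\<in>I. (x i)\<^sup>2)) / K" if x: "x \<in> extensional I" for x
  proof (cases "\<forall>i\<in>I. \<bar>x i\<bar> \<le> K")
    case True
    then have "\<bar>F x - P x\<bar> \<le> 1 / K" using ap x by blast
    also have "1 / K \<le> (1 + (2 * b + 1) * (\<Sum>i\<in>I. (x i)\<^sup>2)) / K"
      using K b0 by (intro divide_right_mono) (auto intro!: mult_nonneg_nonneg sum_nonneg)
    finally show ?thesis .
  next
    case False
    then obtain i where i: "i \<in> I" "K \<le> \<bar>x i\<bar>" by (meson not_le_imp_less less_imp_le)
    have "K * K \<le> \<bar>x i\<bar> * \<bar>x i\<bar>" using i K by (intro mult_mono) auto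
    also have "\<bar>x i\<bar> * \<bar>x i\<bar> = (x i)\<^sup>2" by (simp add: power2_eq_square abs_mult_self_eq)
    also have "(x i)\<^sup>2 \<le> (\<Sum>i\<in>I. (x i)\<^sup>2)" using I i(1) by (intro member_le_sum) auto
    finally have S: "K * K \<le> (\<Sum>i\<in>I. (x i)\<^sup>2)" .
    have "K * 1 \<le> K * K" using K by (intro mult_left_mono) auto
    then have S1: "K \<le> (\<Sum>i\<in>I. (x i)\<^sup>2)" using S by simp
    have "1 / K \<le> 1" using K by simp
    then have "\<bar>F x - P x\<bar> \<le> 2 * b + 1" using ap[rule_format, OF x] b[of x] by linarith
    then have "\<bar>F x - P x\<bar> * K \<le> (2 * b + 1) * (\<Sum>i\<in>I. (x i)\<^sup>2)"
      using S1 K b0 by (intro mult_mono) auto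
    then show ?thesis using K by (simp add: field_simps)
  qed
  then show ?thesis using P unfolding K_def by blast
qed

text \<open>Replacing \<open>F\<close> by \<open>P k\<close> costs \<open>D / Suc k\<close> in the
  limit and, uniformly in \<open>N \<ge> 1\<close>, before it; for fixed \<open>k\<close> the
  trigonometric averages converge. \<open>E N\<close> is treated as a positive normalised linear
  functional, so that no law of \<open>X\<close> has to be constructed.\<close>

lemma converges_jointly_in_distributionI:
  fixes E :: "nat \<Rightarrow> ('a \<Rightarrow> real) \<Rightarrow> real" and X :: "nat \<Rightarrow> 'i \<Rightarrow> 'a \<Rightarrow> real"
  assumes I: "finite I" and M: "prob_space M" and Z: "\<And>i. i \<in> I \<Longrightarrow> Z i \<in> borel_measurable M"
    and Z2: "\<And>i. i \<in> I \<Longrightarrow> integrable M (\<lambda>w. (Z i w)\<^sup>2)"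
    and add: "\<And>N f g. E N (\<lambda>x. f x + g x) = E N f + E N g"
    and cmult: "\<And>N a f. E N (\<lambda>x. a * f x) = a * E N f"
    and mono: "\<And>N f g. (\<And>x. f x \<le> g x) \<Longrightarrow> E N f \<le> E N g"
    and one: "\<And>N. E N (\<lambda>_. 1) = 1"
    and tight: "\<And>i. i \<in> I \<Longrightarrow> \<exists>C. \<forall>N\<ge>1. E N (\<lambda>x. (X N i x)\<^sup>2) \<le> C"
    and cos: "\<And>t. (\<lambda>N. E N (\<lambda>x. cos (\<Sum>i\<in>I. t i * X N i x))) \<longlonglongrightarrow> (LINT w|M. cos (\<Sum>i\<in>I. t i * Z i w))"
    and sin: "\<And>t. (\<lambda>N. E N (\<lambda>x. sin (\<Sum>i\<in>I. t i * X N i x))) \<longlonglongrightarrow> (LINT w|M. sin (\<Sum>i\<in>I. t i * Z i w))"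
  shows "converges_jointly_in_distribution I E X M Z"
  unfolding converges_jointly_in_distribution_def
proof (intro allI impI)
  interpret prob_space M by (rule M)
  fix F :: "('i \<Rightarrow> real) \<Rightarrow> real"
  assume F: "continuous_on UNIV F \<and> bounded (range F)"
  then have Fc: "continuous_on UNIV F" by blast
  obtain b where b: "\<And>x. \<bar>F x\<bar> \<le> b" using F unfolding bounded_iff by auto
  then have b0: "0 \<le> b" using b[of undefined] by linarith
  have "\<forall>k. \<exists>P. trig_poly I P \<and>
    (\<forall>x\<in>extensional I. \<bar>F x - P x\<bar> \<le> (1 + (2 * b + 1) * (\<Sum>i\<in>I. (x i)\<^sup>2)) / real (Suc k))"
    using trig_poly_approximation_quadratic[OF I Fc b] by blast
  then obtain P where P: "\<forall>k. trig_poly I (P k) \<and>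
    (\<forall>x\<in>extensional I. \<bar>F x - P k x\<bar> \<le> (1 + (2 * b + 1) * (\<Sum>i\<in>I. (x i)\<^sup>2)) / real (Suc k))"
    by (rule choice[THEN exE])
  have trig: "trig_poly I (P k)" for k using P by blast
  have ap: "\<bar>F (\<lambda>i\<in>I. y i) - P k (\<lambda>i\<in>I. y i)\<bar> \<le> (1 + (2 * b + 1) * (\<Sum>i\<in>I. (y i)\<^sup>2)) / real (Suc k)" for k y
    using P[rule_format, of k, THEN conjunct2, rule_format, OF restrict_extensional, of y] by simp
  note conv = trig_poly_integral_tendsto[OF trig M Z add cmult cos sin]
  define a where "a N = E N (\<lambda>x. F (\<lambda>i\<in>I. X N i x))" for N
  define p where "p k N = E N (\<lambda>x. P k (\<lambda>i\<in>I. X N i x))" for k N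
  define a' where "a' = (LINT w|M. F (\<lambda>i\<in>I. Z i w))"
  define p' where "p' k = (LINT w|M. P k (\<lambda>i\<in>I. Z i w))" for k
  have pint: "integrable M (\<lambda>w. P k (\<lambda>i\<in>I. Z i w))" and plim: "p k \<longlonglongrightarrow> p' k" for k
    using conv[of k] unfolding p_def p'_def by blast+
  \<comment> \<open>Obtained as a pointwise limit of \<open>P k\<close>, which avoids comparing the
    Borel sets of the function type with the product sigma-algebra.\<close>
  have "(\<lambda>w. F (\<lambda>i\<in>I. Z i w)) \<in> borel_measurable M"
  proof (rule borel_measurable_LIMSEQ_real)
    show "(\<lambda>w. P k (\<lambda>i\<in>I. Z i w)) \<in> borel_measurable M" for k
      by (rule borel_measurable_integrable[OF pint])
    show "(\<lambda>k. P k (\<lambda>i\<in>I. Z i w)) \<longlonglongrightarrow> F (\<lambda>i\<in>I. Z i w)" for w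
    proof (rule LIM_zero_cancel, rule Lim_null_comparison)
      define c where "c = 1 + (2 * b + 1) * (\<Sum>i\<in>I. (Z i w)\<^sup>2)"
      show "(\<lambda>k. c / real (Suc k)) \<longlonglongrightarrow> 0" by real_asymp
      show "\<forall>\<^sub>F k in sequentially. norm (P k (\<lambda>i\<in>I. Z i w) - F (\<lambda>i\<in>I. Z i w)) \<le> c / real (Suc k)"
        unfolding c_def real_norm_def abs_minus_commute[of "P _ _"] by (rule always_eventually) (intro allI ap)
    qed
  qed
  then have Fint: "integrable M (\<lambda>w. F (\<lambda>i\<in>I. Z i w))"
    using b by (intro integrable_const_bound[where B = b]) auto
  from tight obtain C0 where C0: "\<And>i N. i \<in> I \<Longrightarrow> N \<ge> 1 \<Longrightarrow> E N (\<lambda>x. (X N i x)\<^sup>2) \<le> C0 i" by metis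
  define C where "C = (\<Sum>i\<in>I. \<bar>C0 i\<bar> + (LINT w|M. (Z i w)\<^sup>2))"
  define D where "D = 1 + (2 * b + 1) * C"
  have Esum: "E N (\<lambda>x. \<Sum>i\<in>J. f i x) = (\<Sum>i\<in>J. E N (f i))" if "finite J" for J :: "'i set" and N f
    using that
  proof induction
    case empty show ?case using cmult[of N 0 "\<lambda>_. 0"] by simp
  next
    case (insert j J) then show ?case by (simp add: add)
  qed
  have aN: "\<bar>a N - p k N\<bar> \<le> D / real (Suc k)" if N: "N \<ge> 1" for k N
  proof -
    define H where "H x = (1 / real (Suc k)) * (1 + (2 * b + 1) * (\<Sum>i\<in>I. (X N i x)\<^sup>2))" for x
    have "E N H = (1 / real (Suc k)) * (1 + (2 * b + 1) * (\<Sum>i\<in>I. E N (\<lambda>x. (X N i x)\<^sup>2)))"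
      unfolding H_def cmult add one Esum[OF I] ..
    also have "\<dots> \<le> (1 / real (Suc k)) * (1 + (2 * b + 1) * C)"
    proof -
      have "(\<Sum>i\<in>I. E N (\<lambda>x. (X N i x)\<^sup>2)) \<le> C" unfolding C_def
      proof (rule sum_mono)
        fix i assume "i \<in> I"
        then have "E N (\<lambda>x. (X N i x)\<^sup>2) \<le> \<bar>C0 i\<bar>" using C0[OF _ N, of i] by simp
        moreover have "0 \<le> (LINT w|M. (Z i w)\<^sup>2)" by simp
        ultimately show "E N (\<lambda>x. (X N i x)\<^sup>2) \<le> \<bar>C0 i\<bar> + (LINT w|M. (Z i w)\<^sup>2)" by linarith
      qed
      then show ?thesis using b0 by (intro mult_left_mono add_left_mono) auto
    qed
    finally have H: "E N H \<le> D / real (Suc k)" by (simp add: D_def)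
    have d: "\<bar>F (\<lambda>i\<in>I. X N i x) - P k (\<lambda>i\<in>I. X N i x)\<bar> \<le> H x" for x
      using ap[of "\<lambda>i. X N i x" k] by (simp add: H_def)
    have "a N \<le> E N (\<lambda>x. P k (\<lambda>i\<in>I. X N i x) + H x)"
      unfolding a_def by (rule mono) (use d in \<open>simp add: abs_le_iff algebra_simps\<close>)
    moreover have "p k N \<le> E N (\<lambda>x. F (\<lambda>i\<in>I. X N i x) + H x)"
      unfolding p_def by (rule mono) (use d in \<open>simp add: abs_le_iff algebra_simps\<close>)
    ultimately show ?thesis using H unfolding add a_def[symmetric] p_def[symmetric] by linarith
  qed
  have a': "\<bar>a' - p' k\<bar> \<le> D / real (Suc k)" for k
  proof -
    have i: "integrable M (\<lambda>w. (1 + (2 * b + 1) * (\<Sum>i\<in>I. (Z i w)\<^sup>2)) / real (Suc k))"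
      using Z2 by (intro integrable_divide Bochner_Integration.integrable_add integrable_mult_right
        Bochner_Integration.integrable_sum) auto
    have "\<bar>a' - p' k\<bar> = \<bar>LINT w|M. (F (\<lambda>i\<in>I. Z i w) - P k (\<lambda>i\<in>I. Z i w))\<bar>"
      unfolding a'_def p'_def by (subst Bochner_Integration.integral_diff[OF Fint pint]) simp
    also have "\<dots> \<le> (LINT w|M. \<bar>F (\<lambda>i\<in>I. Z i w) - P k (\<lambda>i\<in>I. Z i w)\<bar>)"
      by (rule integral_abs_bound)
    also have "\<dots> \<le> (LINT w|M. (1 + (2 * b + 1) * (\<Sum>i\<in>I. (Z i w)\<^sup>2)) / real (Suc k))"
      by (intro integral_mono integrable_abs Bochner_Integration.integrable_diff Fint pint i ap)
    also have "\<dots> = (1 + (2 * b + 1) * (\<Sum>i\<in>I. LINT w|M. (Z i w)\<^sup>2)) / real (Suc k)"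
      using Z2 by (simp add: prob_space Bochner_Integration.integral_sum)
    also have "\<dots> \<le> D / real (Suc k)"
      unfolding D_def C_def using b0
      by (intro divide_right_mono add_left_mono mult_left_mono sum_mono) auto
    finally show ?thesis .
  qed
  have "a \<longlonglongrightarrow> a'"
  proof (rule LIMSEQ_I)
    fix e :: real assume e: "0 < e"
    have "(\<lambda>k. D / real (Suc k)) \<longlonglongrightarrow> 0" by real_asymp
    from LIMSEQ_D[OF this, of "e / 3"] e obtain k where "norm (D / real (Suc k) - 0) < e / 3" by auto
    then have k: "D / real (Suc k) < e / 3"
      unfolding real_norm_def diff_0_right by (rule le_less_trans[OF abs_ge_self])
    from LIMSEQ_D[OF plim[of k], of "e / 3"] e obtain N0 where
      N0: "\<And>N. N \<ge> N0 \<Longrightarrow> \<bar>p k N - p' k\<bar> < e / 3" by auto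
    show "\<exists>N0. \<forall>N\<ge>N0. norm (a N - a') < e"
    proof (intro exI[of _ "max 1 N0"] allI impI)
      fix N assume "max 1 N0 \<le> N"
      then have "1 \<le> N" "N0 \<le> N" by simp_all
      then have "\<bar>p k N - p' k\<bar> < e / 3" "\<bar>a N - p k N\<bar> \<le> D / real (Suc k)" using N0 aN by blast+
      then show "norm (a N - a') < e" using a'[of k] k unfolding real_norm_def by linarith
    qed
  qed
  then show "(\<lambda>N. E N (\<lambda>x. F (\<lambda>i\<in>I. X N i x))) \<longlonglongrightarrow> expectation (\<lambda>w. F (\<lambda>i\<in>I. Z i w))"
    unfolding a_def a'_def .
qed

subsection \<open>Positive semidefiniteness and Cholesky decomposition\<close>

definition psd :: "(nat \<Rightarrow> nat \<Rightarrow> real) \<Rightarrow> bool" where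
  "psd a \<longleftrightarrow> (\<forall>p p'. a p p' = a p' p) \<and> (\<forall>n c. 0 \<le> (\<Sum>p\<le>n. \<Sum>p'\<le>n. c p * c p' * a p p'))"

text \<open>The form evaluated at \<open>c\<close> plus \<open>t\<close> times the
  \<open>k\<close>-th unit vector, in a section that contains both.\<close>

lemma psd_quadratic:
  assumes "psd a"
  shows "0 \<le> (\<Sum>p\<le>n. \<Sum>p'\<le>n. c p * c p' * a p p') + 2 * t * (\<Sum>p\<le>n. c p * a p k) + t\<^sup>2 * a k k"
proof -
  define m where "m = max n k"
  define c0 where "c0 p = (if p \<le> n then c p else 0)" for p
  define e where "e p = (if p = k then t else 0)" for p
  have sym: "a p p' = a p' p" for p p' using assms by (simp add: psd_def)
  have ext: "(\<Sum>p\<le>m. c0 p * f p) = (\<Sum>p\<le>n. c p * f p)" for f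
    by (rule sum.mono_neutral_cong_right) (auto simp: c0_def m_def)
  have del: "(\<Sum>p\<le>m. e p * f p) = t * f k" for f
  proof -
    have "(\<Sum>p\<le>m. e p * f p) = (\<Sum>p\<le>m. if p = k then t * f p else 0)"
      by (intro sum.cong) (auto simp: e_def)
    then show ?thesis by (simp add: m_def)
  qed
  have lin: "(\<Sum>p\<le>m. (c0 p + e p) * f p) = (\<Sum>p\<le>n. c p * f p) + t * f k" for f
    by (simp only: distrib_right sum.distrib ext del)
  have "0 \<le> (\<Sum>p\<le>m. \<Sum>p'\<le>m. (c0 p + e p) * (c0 p' + e p') * a p p')"
    using assms by (simp add: psd_def)
  also have "\<dots> = (\<Sum>p\<le>m. (c0 p + e p) * (\<Sum>p'\<le>m. (c0 p' + e p') * a p p'))"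
    by (simp only: sum_distrib_left mult.assoc)
  also have "\<dots> = (\<Sum>p\<le>n. c p * ((\<Sum>p'\<le>n. c p' * a p p') + t * a p k)) + t * ((\<Sum>p'\<le>n. c p' * a k p') + t * a k k)"
    by (simp only: lin)
  also have "(\<Sum>p'\<le>n. c p' * a k p') = (\<Sum>p\<le>n. c p * a p k)" by (intro sum.cong refl) (simp only: sym[of k])
  also have "(\<Sum>p\<le>n. c p * ((\<Sum>p'\<le>n. c p' * a p p') + t * a p k))
     = (\<Sum>p\<le>n. \<Sum>p'\<le>n. c p * c p' * a p p') + t * (\<Sum>p\<le>n. c p * a p k)"
    by (simp add: distrib_left sum.distrib sum_distrib_left mult_ac)
  finally show ?thesis by (simp add: power2_eq_square algebra_simps)
qed

lemma psd_diag: assumes "psd a" shows "0 \<le> a k k"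
proof -
  have "0 \<le> (\<Sum>p\<le>k. \<Sum>p'\<le>k. 0 * 0 * a p p') + 2 * 1 * (\<Sum>p\<le>k. 0 * a p k) + 1\<^sup>2 * a k k"
    by (rule psd_quadratic[OF assms, where c = "\<lambda>_. 0"])
  then show ?thesis by simp
qed

text \<open>With a zero pivot the quadratic polynomial in \<open>t\<close> is affine; being
  nonnegative for all \<open>t\<close>, it has slope zero.\<close>

lemma psd_zero_pivot: assumes "psd a" "a k k = 0" shows "a p k = 0"
proof (rule ccontr)
  assume ne: "a p k \<noteq> 0"
  define c where "c i = (if i = p then 1 else 0 :: real)" for i
  define Q where "Q = (\<Sum>i\<le>p. \<Sum>j\<le>p. c i * c j * a i j)"
  have "(\<Sum>i\<le>p. c i * a i k) = (\<Sum>i\<le>p. if i = p then a i k else 0)"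
    by (intro sum.cong) (auto simp: c_def)
  then have s: "(\<Sum>i\<le>p. c i * a i k) = a p k" by simp
  have "0 \<le> Q + 2 * t * a p k" for t
    using psd_quadratic[OF assms(1), of c p t k] assms(2) unfolding s Q_def by simp
  \<comment> \<open>At this \<open>t\<close> the affine function would take the value -1.\<close>
  from this[of "- (Q + 1) / (2 * a p k)"] have "0 \<le> Q + 2 * (- (Q + 1) / (2 * a p k)) * a p k" .
  moreover have "2 * (- (Q + 1) / (2 * a p k)) * a p k = - (Q + 1)" using ne by simp
  ultimately show False by linarith
qed

text \<open>If the pivot \<open>a k k\<close> of a positive semidefinite \<open>a\<close> vanishes, so does its whole row, and the junk
  value \<open>x / 0 = 0\<close> is the right one.\<close>

definition schur :: "nat \<Rightarrow> (nat \<Rightarrow> nat \<Rightarrow> real) \<Rightarrow> nat \<Rightarrow> nat \<Rightarrow> real" where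
  "schur k a p p' = a p p' - a p k * a p' k / a k k"

text \<open>For a nonzero pivot the new form at \<open>c\<close> is the minimum over
  \<open>t\<close> of the polynomial in \<open>psd_quadratic\<close>, attained at
  \<open>t = - b / a k k\<close>.\<close>

lemma psd_schur: assumes "psd a" shows "psd (schur k a)"
  unfolding psd_def
proof (intro conjI allI)
  show "schur k a p p' = schur k a p' p" for p p'
    using assms by (simp add: schur_def psd_def mult.commute)
  fix n :: nat and c :: "nat \<Rightarrow> real"
  let ?Q = "\<Sum>p\<le>n. \<Sum>p'\<le>n. c p * c p' * a p p'" and ?b = "\<Sum>p\<le>n. c p * a p k"
  have "(\<Sum>p\<le>n. \<Sum>p'\<le>n. c p * c p' * schur k a p p') = ?Q - (\<Sum>p\<le>n. \<Sum>p'\<le>n. (c p * a p k) * (c p' * a p' k)) / a k k"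
    by (simp add: schur_def right_diff_distrib sum_subtractf sum_divide_distrib mult_ac)
  also have "(\<Sum>p\<le>n. \<Sum>p'\<le>n. (c p * a p k) * (c p' * a p' k)) = ?b * ?b"
    by (rule sum_product[symmetric])
  finally have eq: "(\<Sum>p\<le>n. \<Sum>p'\<le>n. c p * c p' * schur k a p p') = ?Q - ?b * ?b / a k k" .
  have q: "0 \<le> ?Q + 2 * t * ?b + t\<^sup>2 * a k k" for t by (rule psd_quadratic[OF assms])
  show "0 \<le> (\<Sum>p\<le>n. \<Sum>p'\<le>n. c p * c p' * schur k a p p')"
  proof (cases "a k k = 0")
    case True
    then show ?thesis unfolding eq using q[of 0] by simp
  next
    case False
    define Q b z where "Q = ?Q" and "b = ?b" and "z = a k k"
    have "Q + 2 * (- b / z) * b + (- b / z)\<^sup>2 * z = Q - b * b / z"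
      using False unfolding z_def[symmetric] by (simp add: field_simps power2_eq_square)
    then show ?thesis unfolding eq using q[of "- ?b / a k k"] unfolding Q_def b_def z_def by simp
  qed
qed

text \<open>Pivots are eliminated in the order 0, 1, 2, ...; after \<open>k\<close> steps all rows
  and columns of index less than \<open>k\<close> vanish, so \<open>a p p'\<close> is exhausted
  after \<open>min p p' + 1\<close> steps. The triangular shape makes each variable a finite
  combination of Gaussians although the index set is infinite.\<close>

lemma cholesky:
  assumes "psd a"
  shows "\<exists>L. \<forall>p p'. a p p' = (\<Sum>k\<le>min p p'. L p k * L p' k)"
proof -
  define s where "s = rec_nat a (\<lambda>k b. schur k b)"
  have s0: "s 0 = a" and sS: "s (Suc k) = schur k (s k)" for k by (simp_all add: s_def)
  have psd: "psd (s k)" for k by (induction k) (simp_all add: s0 sS assms psd_schur)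
  have zero: "p < k \<Longrightarrow> s k p p' = 0 \<and> s k p' p = 0" for k p p'
  proof (induction k arbitrary: p p')
    case (Suc k)
    have sym: "s k x y = s k y x" for x y using psd[of k] by (simp add: psd_def)
    show ?case
    proof (cases "p < k")
      case True
      then show ?thesis using Suc.IH by (simp add: sS schur_def)
    next
      case False
      then have p: "p = k" using Suc.prems by simp
      show ?thesis
      proof (cases "s k k k = 0")
        case True
        then show ?thesis using psd_zero_pivot[OF psd True] by (simp add: p sS schur_def sym[of k])
      next
        case False
        then show ?thesis by (simp add: p sS schur_def sym[of k p'])
      qed
    qed
  qed simp
  define L where "L p k = s k p k / sqrt (s k k k)" for p k
  have step: "s k p p' = L p k * L p' k + s (Suc k) p p'" for k p p'
    using psd_diag[OF psd, of k k] by (simp add: L_def sS schur_def)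
  have "a p p' = (\<Sum>k<m. L p k * L p' k) + s m p p'" for m p p'
  proof (induction m)
    case 0 show ?case by (simp add: s0)
  next
    case (Suc m) then show ?case using step[of m p p'] by simp
  qed
  from this[of _ _ "Suc (min _ _)"] have "a p p' = (\<Sum>k\<le>min p p'. L p k * L p' k) + s (Suc (min p p')) p p'" for p p'
    by (simp only: lessThan_Suc_atMost)
  moreover have "s (Suc (min p p')) p p' = 0" for p p'
    using zero[of p "Suc (min p p')" p'] zero[of p' "Suc (min p p')" p] by (cases "p \<le> p'") auto
  ultimately show ?thesis by (intro exI[of _ L]) simp
qed

text \<open>An alternating sum over the subsets of \<open>S - T\<close>, which vanishes unless that
  set is empty.\<close>

lemma sum_signed_supersets:
  assumes "finite S" "T \<subseteq> S"
  shows "(\<Sum>U\<in>Pow S. (- 1) ^ card (S - U) * (if T \<subseteq> U then 1 else 0)) = (if T = S then 1 else 0 :: real)"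
proof -
  have "(\<Sum>U\<in>Pow S. (- 1) ^ card (S - U) * (if T \<subseteq> U then 1 else 0))
    = (\<Sum>U\<in>{U \<in> Pow S. T \<subseteq> U}. (- 1 :: real) ^ card (S - U))"
    using assms(1) by (subst sum.inter_filter) (auto intro!: sum.cong)
  also have "\<dots> = (\<Sum>X\<in>Pow (S - T). (- 1) ^ card X)"
    by (rule sum.reindex_bij_witness[where i = "\<lambda>X. S - X" and j = "\<lambda>U. S - U"])
      (use assms(2) in \<open>auto simp: double_diff\<close>)
  also have "\<dots> = (\<Sum>j\<le>card (S - T). real (card (S - T) choose j) * (- 1) ^ j)"
    using assms(1) by (subst sum_Pow_card) simp_all
  also have "\<dots> = (if card (S - T) = 0 then 1 else 0)"
    using choose_alternating_sum[of "card (S - T)", where 'a = real] by (auto simp: mult.commute)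
  also have "card (S - T) = 0 \<longleftrightarrow> T = S" using assms by auto
  finally show ?thesis by simp
qed

text \<open>Moebius inversion in both arguments at once: only \<open>T = S\<close> survives the two
  signed sums.\<close>

lemma sum_signed_inter:
  fixes f :: "nat set \<Rightarrow> real"
  assumes "finite S"
  shows "(\<Sum>U\<in>Pow S. \<Sum>U'\<in>Pow S. (- 1) ^ card (S - U) * (- 1) ^ card (S - U') * (\<Sum>T\<in>Pow (U \<inter> U'). f T)) = f S"
proof -
  let ?i = "\<lambda>T U. if T \<subseteq> U then 1 else 0 :: real"
  have inner: "(\<Sum>T\<in>Pow (U \<inter> U'). f T) = (\<Sum>T\<in>Pow S. f T * (?i T U * ?i T U'))" if "U \<in> Pow S" for U U'
    by (rule sum.mono_neutral_cong_left) (use assms that in auto)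
  have "(\<Sum>U\<in>Pow S. \<Sum>U'\<in>Pow S. (- 1) ^ card (S - U) * (- 1) ^ card (S - U') * (\<Sum>T\<in>Pow (U \<inter> U'). f T))
    = (\<Sum>U\<in>Pow S. \<Sum>U'\<in>Pow S. \<Sum>T\<in>Pow S. f T * (((- 1) ^ card (S - U) * ?i T U) * ((- 1) ^ card (S - U') * ?i T U')))"
    by (intro sum.cong refl) (simp add: inner sum_distrib_left mult_ac del: Pow_Int_eq)
  also have "\<dots> = (\<Sum>U\<in>Pow S. \<Sum>T\<in>Pow S. \<Sum>U'\<in>Pow S. f T * (((- 1) ^ card (S - U) * ?i T U) * ((- 1) ^ card (S - U') * ?i T U')))"
    by (rule sum.cong[OF refl], rule sum.swap)
  also have "\<dots> = (\<Sum>T\<in>Pow S. \<Sum>U\<in>Pow S. \<Sum>U'\<in>Pow S. f T * (((- 1) ^ card (S - U) * ?i T U) * ((- 1) ^ card (S - U') * ?i T U')))"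
    by (rule sum.swap)
  also have "\<dots> = (\<Sum>T\<in>Pow S. f T * ((\<Sum>U\<in>Pow S. (- 1) ^ card (S - U) * ?i T U) * (\<Sum>U'\<in>Pow S. (- 1) ^ card (S - U') * ?i T U')))"
    by (intro sum.cong refl) (simp only: sum_distrib_left[symmetric] sum_product)
  also have "\<dots> = (\<Sum>T\<in>Pow S. if T = S then f T else 0)"
    by (intro sum.cong refl) (simp only: sum_signed_supersets[OF assms] PowD split: if_split, simp)
  also have "\<dots> = f S" using assms by simp
  finally show ?thesis .
qed

text \<open>The quadratic term dominates: a negative \<open>a\<close> is refuted by any
  \<open>K\<close> for which \<open>real K - 1\<close> exceeds
  \<open>\<bar>b\<bar> / - a\<close>.\<close>

lemma nonneg_if_linear_bound:
  fixes a b :: real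
  assumes "\<And>K. 0 \<le> real K * b + real K * (real K - 1) * a"
  shows "0 \<le> a"
proof (rule ccontr)
  assume "\<not> 0 \<le> a"
  then have a: "a < 0" by simp
  obtain K :: nat where K: "\<bar>b\<bar> / - a + 1 < real K" using reals_Archimedean2 by blast
  have "0 \<le> \<bar>b\<bar> / - a" using a by (intro divide_nonneg_pos) auto
  then have K0: "0 < real K" using K by linarith
  have "\<bar>b\<bar> / - a < real K - 1" using K by simp
  then have "\<bar>b\<bar> < (real K - 1) * - a" using a by (subst (asm) pos_divide_less_eq) simp_all
  then have "b + (real K - 1) * a < 0" by linarith
  then have "real K * (b + (real K - 1) * a) < 0" using K0 by (simp add: mult_pos_neg)
  then show False using assms[of K] by (simp add: algebra_simps)
qed

context sk_limit
begin

text \<open>\<open>g\<close> may repeat sets; coefficients belonging to the same set are added into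
  \<open>t\<close>, which reduces the claim to \<open>V_nonneg\<close>.\<close>

lemma quadratic_form_nonneg:
  fixes g :: "'j \<Rightarrow> nat set"
  assumes J: "finite J" and g: "g ` J \<subseteq> Pow {1..n}"
  shows "0 \<le> (\<Sum>x\<in>J. \<Sum>y\<in>J. d x * d y * B (g x) (g y))"
proof -
  define t where "t W = (\<Sum>x\<in>{x \<in> J. g x = W}. d x)" for W
  have grp: "(\<Sum>W\<in>Pow {1..n}. t W * f W) = (\<Sum>x\<in>J. d x * f (g x))" for f
  proof -
    have "(\<Sum>W\<in>Pow {1..n}. t W * f W) = (\<Sum>W\<in>Pow {1..n}. \<Sum>x\<in>{x \<in> J. g x = W}. d x * f (g x))"
      unfolding t_def sum_distrib_right by (intro sum.cong) auto
    also have "\<dots> = (\<Sum>x\<in>J. d x * f (g x))" by (rule sum.group[OF J _ g]) simp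
    finally show ?thesis .
  qed
  have "V n t = (\<Sum>W\<in>Pow {1..n}. t W * (\<Sum>S\<in>Pow {1..n}. t S * B W S))"
    unfolding V_def by (simp only: sum_distrib_left mult.assoc)
  also have "\<dots> = (\<Sum>x\<in>J. d x * (\<Sum>y\<in>J. d y * B (g x) (g y)))" unfolding grp ..
  also have "\<dots> = (\<Sum>x\<in>J. \<Sum>y\<in>J. d x * d y * B (g x) (g y))" by (simp only: sum_distrib_left mult.assoc)
  finally show ?thesis using V_nonneg[of n t] by simp
qed

lemma B_card:
  assumes "finite W" "finite S"
  shows "B W S = (\<Sum>j\<le>card (W \<inter> S). real (card (W \<inter> S) choose j) * A j (card W - j) (card S - j))"
  unfolding B_def using assms by (subst sum_Pow_card) simp_all

text \<open>Padding \<open>U \<subseteq> {1..s}\<close> with a block of fresh replicas up to cardinality \<open>s + p\<close> and taking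
  alternating sums over \<open>U\<close>, the covariance between different blocks is exactly \<open>A s\<close>.
  Averaging over many disjoint blocks makes the diagonal blocks negligible.\<close>

lemma psd_A: "psd (A s)"
  unfolding psd_def
proof (intro conjI allI)
  show "A s p p' = A s p' p" for p p' by (rule A_sym)
  fix m :: nat and c :: "nat \<Rightarrow> real"
  \<comment> \<open>Length of a block of fresh replicas: the longest padding is
    \<open>s + m\<close>, for empty \<open>U\<close> and \<open>p = m\<close>.\<close>
  define M where "M = s + m"
  define F where "F k j = {s + k * M + 1..s + k * M + j}" for k j
  define g where "g k p U = U \<union> F k (s - card U + p)" for k p and U :: "nat set"
  define S where "S = {1..s}"
  define d where "d p U = c p * (- 1) ^ card (S - U)" for p and U :: "nat set"
  define I where "I = {..m} \<times> Pow S"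
  have finS: "finite S" "card S = s" by (simp_all add: S_def)
  have Uc: "finite U" "card U \<le> s" if "U \<subseteq> S" for U
    using that finS card_mono[OF finS(1) that] finite_subset by auto
  have UF: "U \<inter> F k j = {}" if "U \<subseteq> S" for U k j using that by (auto simp: F_def S_def)
  have finF: "finite (F k j)" "card (F k j) = j" for k j by (simp_all add: F_def)
  have cg: "card (g k p U) = s + p" and fg: "finite (g k p U)" if "U \<subseteq> S" for k p U
    using Uc[OF that] card_Un_disjoint[OF Uc(1)[OF that] finF(1) UF[OF that]] by (simp_all add: g_def finF)
  have gsub: "g k p U \<subseteq> {1..s + K * M}" if "U \<subseteq> S" "p \<le> m" "k < K" for k p U K
  proof -
    have "Suc k * M \<le> K * M" using that(3) by (intro mult_le_mono1) simp
    then have "k * M + M \<le> K * M" by simp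
    then show ?thesis using that(1,2) by (auto simp: g_def F_def S_def M_def)
  qed
  have FF: "F k j \<inter> F k' j' = {}" if "k \<noteq> k'" "j \<le> M" "j' \<le> M" for k k' j j'
  proof -
    have *: "F k j \<inter> F k' j' = {}" if "k < k'" "j \<le> M" for k k' j j'
    proof -
      have "Suc k * M \<le> k' * M" using that(1) by (intro mult_le_mono1) simp
      then have "k * M + M \<le> k' * M" by simp
      then show ?thesis using that(2) by (auto simp: F_def)
    qed
    show ?thesis using *[of k k' j j'] *[of k' k j' j] that by (cases "k < k'") (auto simp: Int_commute)
  qed
  have off: "g k p U \<inter> g k' p' U' = U \<inter> U'" if "k \<noteq> k'" "U \<subseteq> S" "U' \<subseteq> S" "p \<le> m" "p' \<le> m" for k k' p p' U U'
  proof -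
    have "F k (s - card U + p) \<inter> F k' (s - card U' + p') = {}"
      using that by (intro FF) (simp_all add: M_def)
    then show ?thesis using UF[OF that(2)] UF[OF that(3)] unfolding g_def by blast
  qed
  \<comment> \<open>Paddings in one block are initial segments of it, so the size of the
    intersection does not depend on which block is used.\<close>
  have same: "card (g k p U \<inter> g k p' U') = card (g 0 p U \<inter> g 0 p' U')" if "U \<subseteq> S" "U' \<subseteq> S" for k p p' U U'
  proof -
    have "g k p U \<inter> g k p' U' = (U \<inter> U') \<union> (F k (s - card U + p) \<inter> F k (s - card U' + p'))" for k
      using UF[OF that(1)] UF[OF that(2)] unfolding g_def by blast
    moreover have "F k i \<inter> F k j = F k (min i j)" for k i j by (auto simp: F_def)
    moreover have "card ((U \<inter> U') \<union> F k j) = card (U \<inter> U') + j" for k j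
      using card_Un_disjoint[of "U \<inter> U'" "F k j"] Uc[OF that(1)] UF[OF that(1), of k j] finF[of k j] by auto
    ultimately show ?thesis by simp
  qed
  define a where "a = (\<Sum>p\<le>m. \<Sum>p'\<le>m. c p * c p' * A s p p')"
  define b where "b = (\<Sum>x\<in>I. \<Sum>y\<in>I. d (fst x) (snd x) * d (fst y) (snd y)
    * B (g 0 (fst x) (snd x)) (g 0 (fst y) (snd y)))"
  define G where "G k k' = (\<Sum>x\<in>I. \<Sum>y\<in>I. d (fst x) (snd x) * d (fst y) (snd y)
    * B (g k (fst x) (snd x)) (g k' (fst y) (snd y)))" for k k'
  have Bs: "B (g k p U) (g k p' U') = B (g 0 p U) (g 0 p' U')" if "U \<subseteq> S" "U' \<subseteq> S" for k p p' U U'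
    unfolding B_card[OF fg[OF that(1)] fg[OF that(2)]] cg[OF that(1)] cg[OF that(2)] same[OF that, of k] ..
  have Gb: "G k k = b" for k unfolding G_def b_def
    by (intro sum.cong refl arg_cong2[where f = "(*)"] Bs) (auto simp: I_def)
  \<comment> \<open>Paddings in different blocks are disjoint, so \<open>B\<close> sums over the
    subsets of \<open>U \<inter> U'\<close> only, and the signs single out
    \<open>T = S\<close>.\<close>
  have Ga: "G k k' = a" if ne: "k \<noteq> k'" for k k'
  proof -
    have "G k k' = (\<Sum>p\<le>m. \<Sum>U\<in>Pow S. \<Sum>p'\<le>m. \<Sum>U'\<in>Pow S. d p U * d p' U' * B (g k p U) (g k' p' U'))"
      unfolding G_def I_def by (simp add: sum.cartesian_product')
    also have "\<dots> = (\<Sum>p\<le>m. \<Sum>p'\<le>m. \<Sum>U\<in>Pow S. \<Sum>U'\<in>Pow S. d p U * d p' U' * B (g k p U) (g k' p' U'))"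
      by (intro sum.cong refl) (rule sum.swap)
    also have "\<dots> = a" unfolding a_def
    proof (intro sum.cong refl)
      fix p p' assume p: "p \<in> {..m}" "p' \<in> {..m}"
      let ?f = "\<lambda>T. A (card T) (s + p - card T) (s + p' - card T)"
      have "(\<Sum>U\<in>Pow S. \<Sum>U'\<in>Pow S. d p U * d p' U' * B (g k p U) (g k' p' U'))
         = c p * c p' * (\<Sum>U\<in>Pow S. \<Sum>U'\<in>Pow S. (- 1) ^ card (S - U) * (- 1) ^ card (S - U') * (\<Sum>T\<in>Pow (U \<inter> U'). ?f T))"
        unfolding sum_distrib_left
      proof (intro sum.cong refl)
        fix U U' assume "U \<in> Pow S" "U' \<in> Pow S"
        then have U: "U \<subseteq> S" "U' \<subseteq> S" by simp_all
        have "B (g k p U) (g k' p' U') = (\<Sum>T\<in>Pow (U \<inter> U'). ?f T)"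
          unfolding B_def using off[OF ne U, of p p'] p U by (simp add: cg)
        then show "d p U * d p' U' * B (g k p U) (g k' p' U')
          = (\<Sum>T\<in>Pow (U \<inter> U'). c p * c p' * ((- 1) ^ card (S - U) * (- 1) ^ card (S - U') * ?f T))"
          by (simp add: d_def sum_distrib_left mult_ac)
      qed
      also have "\<dots> = c p * c p' * ?f S" by (simp only: sum_signed_inter[OF finS(1), of ?f])
      finally show "(\<Sum>U\<in>Pow S. \<Sum>U'\<in>Pow S. d p U * d p' U' * B (g k p U) (g k' p' U')) = c p * c p' * A s p p'"
        by (simp add: finS)
    qed
    finally show ?thesis .
  qed
  have "0 \<le> real K * b + real K * (real K - 1) * a" for K
  proof -
    let ?d = "\<lambda>x. d (fst x) (snd x)" and ?g = "\<lambda>k x. g k (fst x) (snd x)"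
    have "0 \<le> (\<Sum>x\<in>{..<K} \<times> I. \<Sum>y\<in>{..<K} \<times> I. ?d (snd x) * ?d (snd y) * B (?g (fst x) (snd x)) (?g (fst y) (snd y)))"
    proof (rule quadratic_form_nonneg[where n = "s + K * M"])
      show "finite ({..<K} \<times> I)" using finS(1) by (simp add: I_def)
      have "g (fst x) (fst (snd x)) (snd (snd x)) \<subseteq> {1..s + K * M}" if "x \<in> {..<K} \<times> I" for x
        using that by (intro gsub) (auto simp: I_def)
      then show "(\<lambda>x. ?g (fst x) (snd x)) ` ({..<K} \<times> I) \<subseteq> Pow {1..s + K * M}" by blast
    qed
    also have "\<dots> = (\<Sum>k<K. \<Sum>i\<in>I. \<Sum>k'<K. \<Sum>j\<in>I. ?d i * ?d j * B (?g k i) (?g k' j))"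
      by (simp add: sum.cartesian_product')
    also have "\<dots> = (\<Sum>k<K. \<Sum>k'<K. G k k')"
      unfolding G_def by (rule sum.cong[OF refl], rule sum.swap)
    also have "\<dots> = (\<Sum>k<K. \<Sum>k'<K. a + (if k' = k then b - a else 0))"
      by (intro sum.cong refl) (auto simp: Gb Ga)
    also have "\<dots> = (\<Sum>k<K. real K * a + (b - a))" by (intro sum.cong refl) (simp add: sum.distrib)
    also have "\<dots> = real K * b + real K * (real K - 1) * a" by (simp add: algebra_simps)
    finally show ?thesis .
  qed
  then show "0 \<le> (\<Sum>p\<le>m. \<Sum>p'\<le>m. c p * c p' * A s p p')" unfolding a_def[symmetric]
    by (rule nonneg_if_linear_bound)
qed

end

subsection \<open>Gaussian families\<close>

lemma std_normal_trig:
  "(LINT y|density lborel std_normal_density. cos (t * y)) = exp (- t\<^sup>2 / 2)"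
  "(LINT y|density lborel std_normal_density. sin (t * y)) = 0"
proof -
  let ?M = "density lborel std_normal_density"
  interpret prob_space ?M by (rule prob_space_std_normal)
  have i: "integrable ?M (\<lambda>y. iexp (t * y))"
    by (rule integrable_iexp) simp_all
  have c: "(CLINT y|?M. iexp (t * y)) = complex_of_real (exp (- t\<^sup>2 / 2))"
    using fun_cong[OF char_std_normal_distribution, of t] by (simp add: char_def)
  have "(LINT y|?M. cos (t * y)) = (LINT y|?M. Re (iexp (t * y)))" by (simp add: Re_exp)
  also have "\<dots> = exp (- t\<^sup>2 / 2)" unfolding integral_Re[OF i] c by simp
  finally show "(LINT y|?M. cos (t * y)) = exp (- t\<^sup>2 / 2)" .
  have "(LINT y|?M. sin (t * y)) = (LINT y|?M. Im (iexp (t * y)))" by (simp add: Im_exp)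
  also have "\<dots> = 0" unfolding integral_Im[OF i] c by simp
  finally show "(LINT y|?M. sin (t * y)) = 0" .
qed

text \<open>A centred \<open>gaussian_rv\<close> is either a nondegenerate normal variable or almost
  surely 0; the formulas agree, with variance 0 in the second case.\<close>

lemma gaussian_rv_centered:
  assumes M: "prob_space M" and X: "gaussian_rv M X" and EX: "prob_space.expectation M X = 0"
  shows "integrable M X" "integrable M (\<lambda>w. (X w)\<^sup>2)"
    "(LINT w|M. cos (X w)) = exp (- (LINT w|M. (X w)\<^sup>2) / 2)" "(LINT w|M. sin (X w)) = 0"
proof -
  interpret prob_space M by (rule M)
  have Xm[measurable]: "X \<in> borel_measurable M" using X by (simp add: gaussian_rv_def)
  have "integrable M X \<and> integrable M (\<lambda>w. (X w)\<^sup>2) \<and>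
    (LINT w|M. cos (X w)) = exp (- (LINT w|M. (X w)\<^sup>2) / 2) \<and> (LINT w|M. sin (X w)) = 0"
  proof -
    obtain \<mu> \<sigma> where "(\<sigma> > 0 \<and> distributed M lborel X (normal_density \<mu> \<sigma>)) \<or> (AE x in M. X x = \<mu>)"
      using X unfolding gaussian_rv_def by blast
    then show ?thesis
    proof (elim disjE conjE)
      assume s: "0 < \<sigma>" and D: "distributed M lborel X (normal_density \<mu> \<sigma>)"
      have \<mu>: "\<mu> = 0" using normal_distributed_expectation[OF s D] EX by simp
      have iX: "integrable M X"
        using distributed_integrable_var[OF D] integrable_normal_moment_nz_1[OF s, of \<mu>] by simp
      have iX2: "integrable M (\<lambda>w. (X w)\<^sup>2)"
        using distributed_integrable[OF D, of "\<lambda>x. x\<^sup>2"] integrable_normal_moment[OF s, of \<mu> 2] \<mu> by simp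
      have V: "expectation (\<lambda>w. (X w)\<^sup>2) = \<sigma>\<^sup>2"
        using normal_distributed_variance[OF s D] by (simp add: EX)
      have DZ: "distributed M lborel (\<lambda>w. X w / \<sigma>) std_normal_density"
        using D normal_standard_normal_convert[OF s, of X \<mu>] \<mu> by simp
      have *: "(LINT y|density lborel std_normal_density. f (\<sigma> * y)) = (LINT w|M. f (X w))"
        if [measurable]: "f \<in> borel_measurable borel" for f :: "real \<Rightarrow> real"
      proof -
        have "(LINT y|density lborel std_normal_density. f (\<sigma> * y)) = (LINT w|M. f (\<sigma> * (X w / \<sigma>)))"
          unfolding distributed_distr_eq_density[OF DZ, symmetric] by (rule integral_distr) measurable
        then show ?thesis using s by simp
      qed
      show ?thesis using iX iX2 std_normal_trig[of \<sigma>] *[of cos] *[of sin] V by simp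
    next
      assume ae: "AE x in M. X x = \<mu>"
      have red: "(LINT w|M. f (X w)) = f \<mu>" "integrable M (\<lambda>w. f (X w))"
        if [measurable]: "f \<in> borel_measurable borel" for f :: "real \<Rightarrow> real"
      proof -
        have ae': "AE w in M. f (X w) = f \<mu>" using ae by eventually_elim simp
        have "(LINT w|M. f (X w)) = (LINT w|M. f \<mu>)" by (rule integral_cong_AE) (use ae' in auto)
        then show "(LINT w|M. f (X w)) = f \<mu>" by (simp add: prob_space)
        have "integrable M (\<lambda>w. f (X w)) = integrable M (\<lambda>w. f \<mu>)" by (rule integrable_cong_AE) (use ae' in auto)
        then show "integrable M (\<lambda>w. f (X w))" by simp
      qed
      have "\<mu> = 0" using red(1)[of "\<lambda>x. x"] EX by simp
      then show ?thesis using red[of "\<lambda>x. x"] red[of "\<lambda>x. x\<^sup>2"] red[of cos] red[of sin] by simp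
    qed
  qed
  then show "integrable M X" "integrable M (\<lambda>w. (X w)\<^sup>2)"
    "(LINT w|M. cos (X w)) = exp (- (LINT w|M. (X w)\<^sup>2) / 2)" "(LINT w|M. sin (X w)) = 0" by blast+
qed

lemma integrable_mult_square:
  fixes X Y :: "'a \<Rightarrow> real"
  assumes "X \<in> borel_measurable M" "Y \<in> borel_measurable M"
    and "integrable M (\<lambda>w. (X w)\<^sup>2)" "integrable M (\<lambda>w. (Y w)\<^sup>2)"
  shows "integrable M (\<lambda>w. X w * Y w)"
proof (rule Bochner_Integration.integrable_bound)
  show "integrable M (\<lambda>w. (X w)\<^sup>2 + (Y w)\<^sup>2)" using assms by simp
  show "(\<lambda>w. X w * Y w) \<in> borel_measurable M" using assms by simp
  have "\<bar>x * y\<bar> \<le> x\<^sup>2 + y\<^sup>2" for x y :: real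
  proof -
    have "0 \<le> (\<bar>x\<bar> - \<bar>y\<bar>)\<^sup>2" "0 \<le> x\<^sup>2 + y\<^sup>2" by simp_all
    then show ?thesis unfolding power2_diff abs_mult power2_abs by linarith
  qed
  then show "AE w in M. norm (X w * Y w) \<le> norm ((X w)\<^sup>2 + (Y w)\<^sup>2)"
    by (intro AE_I2) (simp add: order_trans[OF _ abs_ge_self])
qed

lemma gauss_product_combination:
  fixes c :: "'k \<Rightarrow> real"
  assumes J: "finite J"
  defines "X \<equiv> \<lambda>g :: 'k \<Rightarrow> real. \<Sum>x\<in>J. c x * g x"
  shows "gaussian_rv (gauss_product UNIV) X" "(LINT g|gauss_product UNIV. X g) = 0"
    "(LINT g|gauss_product UNIV. (X g)\<^sup>2) = (\<Sum>x\<in>J. (c x)\<^sup>2)"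
proof -
  let ?M = "gauss_product (UNIV :: 'k set)"
  let ?s = "density lborel std_normal_density"
  interpret prob_space ?M by (rule prob_space_gauss_product)
  \<comment> \<open>Zero coefficients are dropped because the normal law of an independent sum is
    stated for positive standard deviations; if none is left, the variable is the degenerate
    constant 0.\<close>
  define J' where "J' = {x \<in> J. c x \<noteq> 0}"
  have J': "finite J'" using J by (simp add: J'_def)
  have X: "X = (\<lambda>g. \<Sum>x\<in>J'. c x * g x)" unfolding X_def
    by (rule ext, rule sum.mono_neutral_right) (auto simp: J'_def J)
  have S: "(\<Sum>x\<in>J. (c x)\<^sup>2) = (\<Sum>x\<in>J'. (c x)\<^sup>2)"
    by (rule sum.mono_neutral_right) (auto simp: J'_def J)
  have "gaussian_rv ?M X \<and> (LINT g|?M. X g) = 0 \<and> (LINT g|?M. (X g)\<^sup>2) = (\<Sum>x\<in>J. (c x)\<^sup>2)"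
  proof (cases "J' = {}")
    case True
    then show ?thesis by (auto simp: X S gaussian_rv_def)
  next
    case False
    have comp: "distr ?M ?s (\<lambda>g. g x) = ?s" for x
      by (rule distr_PiM_component) (auto simp: prob_space_std_normal)
    have "indep_vars (\<lambda>_. ?s) (\<lambda>x g. g x) J'"
    proof (subst indep_vars_iff_distr_eq_PiM'[OF False])
      show "random_variable ?s (\<lambda>g. g x)" for x by (rule measurable_component_singleton) simp
      have "distr ?M (PiM J' (\<lambda>_. ?s)) (\<lambda>g. \<lambda>x\<in>J'. g x) = PiM J' (\<lambda>_. ?s)"
        using distr_PiM_reindex[of UNIV "\<lambda>_. ?s" "\<lambda>x. x" J'] by (simp add: prob_space_std_normal)
      then show "distr ?M (PiM J' (\<lambda>_. ?s)) (\<lambda>g. \<lambda>x\<in>J'. g x) = PiM J' (\<lambda>x. distr ?M ?s (\<lambda>g. g x))"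
        by (simp only: comp)
    qed
    then have ind: "indep_vars (\<lambda>_. borel) (\<lambda>x g. c x * g x) J'"
      by (rule indep_vars_compose2[where Y = "\<lambda>x y. c x * y"]) simp
    have std: "distributed ?M lborel (\<lambda>g. g x) std_normal_density" for x
      unfolding distributed_def
    proof (intro conjI)
      have "distr ?M lborel (\<lambda>g. g x) = distr ?M ?s (\<lambda>g. g x)" by (rule distr_cong) simp_all
      then show "distr ?M lborel (\<lambda>g. g x) = ?s" by (simp only: comp)
      have "(\<lambda>g. g x) \<in> measurable ?M ?s" by (rule measurable_component_singleton) simp
      then show "random_variable lborel (\<lambda>g. g x)" by simp
    qed simp
    have "distributed ?M lborel (\<lambda>g. 0 + c x * g x) (normal_density (0 + c x * 0) (\<bar>c x\<bar> * 1))" if "x \<in> J'" for x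
      by (rule normal_density_affine[OF std]) (use that in \<open>auto simp: J'_def\<close>)
    then have D: "distributed ?M lborel X (normal_density (\<Sum>x\<in>J'. 0) (sqrt (\<Sum>x\<in>J'. \<bar>c x\<bar>\<^sup>2)))"
      unfolding X by (intro sum_indep_normal[OF J' False ind]) (auto simp: J'_def)
    have pos: "0 < sqrt (\<Sum>x\<in>J'. \<bar>c x\<bar>\<^sup>2)"
      using J' False by (auto simp: J'_def intro!: sum_pos)
    have E: "expectation X = 0" using normal_distributed_expectation[OF pos D] by simp
    have V: "expectation (\<lambda>g. (X g)\<^sup>2) = (\<Sum>x\<in>J'. (c x)\<^sup>2)"
      using normal_distributed_variance[OF pos D] by (simp add: E sum_nonneg)
    have "X \<in> borel_measurable ?M" using distributed_measurable[OF D] by simp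
    then have "gaussian_rv ?M X" using D pos unfolding gaussian_rv_def by blast
    then show ?thesis using E V S by simp
  qed
  then show "gaussian_rv ?M X" "(LINT g|?M. X g) = 0" "(LINT g|?M. (X g)\<^sup>2) = (\<Sum>x\<in>J. (c x)\<^sup>2)"
    by blast+
qed

text \<open>Polarisation of the variance formula.\<close>

lemma gauss_product_covariance:
  fixes c d :: "'k \<Rightarrow> real"
  assumes J: "finite J"
  shows "(LINT g|gauss_product UNIV. (\<Sum>x\<in>J. c x * g x) * (\<Sum>x\<in>J. d x * g x)) = (\<Sum>x\<in>J. c x * d x)"
proof -
  let ?M = "gauss_product (UNIV :: 'k set)"
  note comb = gauss_product_combination[OF J] and sq = gaussian_rv_centered(2)[OF prob_space_gauss_product]
  define X where "X c g = (\<Sum>x\<in>J. c x * g x)" for c and g :: "'k \<Rightarrow> real"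
  have i: "integrable ?M (\<lambda>g. (X c g)\<^sup>2)" for c unfolding X_def by (rule sq[OF comb(1,2)])
  have eq: "(\<lambda>g. X c g * X d g) = (\<lambda>g. 1 / 4 * ((X (\<lambda>x. c x + d x) g)\<^sup>2 - (X (\<lambda>x. c x - d x) g)\<^sup>2))"
    by (rule ext) (simp add: X_def distrib_right left_diff_distrib sum.distrib sum_subtractf power2_eq_square algebra_simps)
  have "(LINT g|?M. X c g * X d g)
      = 1 / 4 * ((LINT g|?M. (X (\<lambda>x. c x + d x) g)\<^sup>2) - (LINT g|?M. (X (\<lambda>x. c x - d x) g)\<^sup>2))"
    unfolding eq integral_mult_right_zero Bochner_Integration.integral_diff[OF i i] ..
  also have "\<dots> = 1 / 4 * (\<Sum>x\<in>J. (c x + d x)\<^sup>2 - (c x - d x)\<^sup>2)"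
    unfolding X_def comb(3) sum_subtractf ..
  also have "\<dots> = (\<Sum>x\<in>J. c x * d x)"
    unfolding sum_distrib_left by (intro sum.cong refl) (simp add: power2_eq_square algebra_simps)
  finally show ?thesis unfolding X_def .
qed

lemma integral_double_sum:
  fixes f :: "'i \<Rightarrow> 'j \<Rightarrow> 'a \<Rightarrow> real"
  assumes "\<And>i j. i \<in> I \<Longrightarrow> j \<in> J \<Longrightarrow> integrable M (f i j)"
  shows "(LINT w|M. (\<Sum>i\<in>I. \<Sum>j\<in>J. f i j w)) = (\<Sum>i\<in>I. \<Sum>j\<in>J. LINT w|M. f i j w)"
proof -
  have "(LINT w|M. (\<Sum>i\<in>I. \<Sum>j\<in>J. f i j w)) = (\<Sum>i\<in>I. LINT w|M. (\<Sum>j\<in>J. f i j w))"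
    by (rule Bochner_Integration.integral_sum) (intro Bochner_Integration.integrable_sum assms)
  also have "\<dots> = (\<Sum>i\<in>I. \<Sum>j\<in>J. LINT w|M. f i j w)"
    by (rule sum.cong[OF refl]) (rule Bochner_Integration.integral_sum, rule assms)
  finally show ?thesis .
qed

text \<open>Different sets \<open>S\<close> share variables \<open>Y (S', p)\<close>, while joint
  Gaussianity is formulated for distinct indices; the coefficients of equal ones are collected
  here.\<close>

lemma sum_push_forward:
  fixes c :: "'j \<Rightarrow> real"
  assumes "finite Z"
  shows "(\<Sum>z\<in>Z. c z * F (f z)) = (\<Sum>x\<in>f ` Z. (\<Sum>z\<in>{z \<in> Z. f z = x}. c z) * F x)"
proof -
  have "(\<Sum>z\<in>Z. c z * F (f z)) = (\<Sum>x\<in>f ` Z. \<Sum>z\<in>{z \<in> Z. f z = x}. c z * F (f z))"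
    by (rule sum.image_gen[OF assms])
  also have "\<dots> = (\<Sum>x\<in>f ` Z. (\<Sum>z\<in>{z \<in> Z. f z = x}. c z) * F x)"
    unfolding sum_distrib_right by (intro sum.cong refl) auto
  finally show ?thesis .
qed

context sk_limit
begin

text \<open>\<open>Y (S, p)\<close> is row \<open>p\<close> of the Cholesky factor of
  \<open>A (card S)\<close> applied to independent Gaussians attached to \<open>S\<close>. Different
  sets use disjoint coordinates and are therefore uncorrelated.\<close>

lemma exists_limit_family:
  "\<exists>(M :: (nat set \<times> nat \<Rightarrow> real) measure) Y. sk_limit_family \<beta> h M Y"
proof -
  have "\<forall>s. \<exists>L. \<forall>p p'. A s p p' = (\<Sum>k\<le>min p p'. L p k * L p' k)"
    using cholesky[OF psd_A] by blast
  then obtain C where C: "\<forall>s p p'. A s p p' = (\<Sum>k\<le>min p p'. C s p k * C s p' k)" by metis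
  let ?M = "gauss_product (UNIV :: (nat set \<times> nat) set)"
  interpret prob_space ?M by (rule prob_space_gauss_product)
  define e where "e y x = (if fst x = fst y \<and> snd x \<le> snd y then C (card (fst y)) (snd y) (snd x) else 0)"
    for x y :: "nat set \<times> nat"
  define D where "D y = {fst y} \<times> {..snd y}" for y :: "nat set \<times> nat"
  define Y where "Y y g = (\<Sum>x\<in>D y. e y x * g x)" for y and g :: "nat set \<times> nat \<Rightarrow> real"
  have finD: "finite (D y)" for y by (simp add: D_def)
  have ext: "Y y g = (\<Sum>x\<in>J. e y x * g x)" if "finite J" "D y \<subseteq> J" for y J g
    unfolding Y_def by (rule sum.mono_neutral_left) (use that in \<open>auto simp: D_def e_def\<close>)
  have comb: "(\<Sum>y\<in>I. a y * Y y g) = (\<Sum>x\<in>(\<Union>y\<in>I. D y). (\<Sum>y\<in>I. a y * e y x) * g x)" if I: "finite I" for I a g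
  proof -
    have "(\<Sum>y\<in>I. a y * Y y g) = (\<Sum>y\<in>I. \<Sum>x\<in>(\<Union>y\<in>I. D y). a y * e y x * g x)"
    proof (rule sum.cong[OF refl])
      fix y assume "y \<in> I"
      then have "Y y g = (\<Sum>x\<in>(\<Union>y\<in>I. D y). e y x * g x)" using I finD by (intro ext) auto
      then show "a y * Y y g = (\<Sum>x\<in>(\<Union>y\<in>I. D y). a y * e y x * g x)"
        by (simp only: sum_distrib_left mult.assoc)
    qed
    also have "\<dots> = (\<Sum>x\<in>(\<Union>y\<in>I. D y). \<Sum>y\<in>I. a y * e y x * g x)" by (rule sum.swap)
    finally show ?thesis by (simp only: sum_distrib_right)
  qed
  have fin: "finite (\<Union>y\<in>I. D y)" if "finite I" for I using that finD by auto
  have gauss: "jointly_gaussian ({S. finite S} \<times> UNIV) ?M Y"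
    unfolding jointly_gaussian_def
  proof (intro conjI allI impI)
    fix J :: "(nat set \<times> nat) set" and c :: "nat set \<times> nat \<Rightarrow> real"
    assume "finite J \<and> J \<subseteq> {S. finite S} \<times> UNIV"
    then have J: "finite J" by blast
    show "gaussian_rv ?M (\<lambda>g. \<Sum>y\<in>J. c y * Y y g)"
      unfolding comb[OF J] by (rule gauss_product_combination(1)[OF fin[OF J]])
  qed (rule prob_space_gauss_product)
  have cen: "expectation (Y y) = 0" for y
    unfolding Y_def using gauss_product_combination(2)[OF finD, of "e y" y] by simp
  have cov: "expectation (\<lambda>g. Y (S, p) g * Y (S', p') g) = (if S = S' then sk_A \<beta> h (card S) p p' else 0)"
    for S S' p p'
  proof -
    define J where "J = D (S, p) \<union> D (S', p')"
    have J: "finite J" by (simp add: J_def finD)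
    have "expectation (\<lambda>g. Y (S, p) g * Y (S', p') g)
      = expectation (\<lambda>g. (\<Sum>x\<in>J. e (S, p) x * g x) * (\<Sum>x\<in>J. e (S', p') x * g x))"
      using ext[OF J, of "(S, p)"] ext[OF J, of "(S', p')"] by (simp add: J_def)
    also have "\<dots> = (\<Sum>x\<in>J. e (S, p) x * e (S', p') x)" by (rule gauss_product_covariance[OF J])
    also have "\<dots> = (if S = S' then A (card S) p p' else 0)"
    proof (cases "S = S'")
      case True
      have "(\<Sum>x\<in>J. e (S, p) x * e (S', p') x) = (\<Sum>x\<in>{S} \<times> {..min p p'}. e (S, p) x * e (S', p') x)"
        by (rule sum.mono_neutral_right[OF J]) (auto simp: J_def D_def e_def True)
      also have "\<dots> = (\<Sum>k\<le>min p p'. C (card S) p k * C (card S) p' k)"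
        by (subst sum.cartesian_product') (auto simp: e_def True intro!: sum.cong)
      finally show ?thesis using True C by simp
    next
      case False
      then have "e (S, p) x * e (S', p') x = 0" for x by (cases "fst x = S") (simp_all add: e_def)
      then have "(\<Sum>x\<in>J. e (S, p) x * e (S', p') x) = 0" by (intro sum.neutral ballI)
      then show ?thesis using False by simp
    qed
    finally show ?thesis by (simp add: sk_A_eq)
  qed
  have "sk_limit_family \<beta> h ?M Y"
    unfolding sk_limit_family_def centered_gaussian_family_def using gauss cen cov by blast
  then show ?thesis by blast
qed

section \<open>The family \<open>sk_Z\<close> of a given limit family\<close>

context
  fixes M :: "'b measure" and Y :: "nat set \<times> nat \<Rightarrow> 'b \<Rightarrow> real"
  assumes Y: "sk_limit_family \<beta> h M Y"
begin

lemma limit_prob_space: "prob_space M"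
  using Y by (simp add: sk_limit_family_def centered_gaussian_family_def jointly_gaussian_def)

lemma limit_gaussian:
  assumes "finite J" "J \<subseteq> {S. finite S} \<times> UNIV"
  shows "gaussian_rv M (\<lambda>w. \<Sum>i\<in>J. c i * Y i w)"
  using Y assms unfolding sk_limit_family_def centered_gaussian_family_def jointly_gaussian_def by blast

lemma limit_Y:
  assumes "finite S"
  shows "gaussian_rv M (Y (S, p))" "prob_space.expectation M (Y (S, p)) = 0"
proof -
  show "gaussian_rv M (Y (S, p))" using limit_gaussian[of "{(S, p)}" "\<lambda>_. 1"] assms by simp
  show "prob_space.expectation M (Y (S, p)) = 0"
    using Y assms unfolding sk_limit_family_def centered_gaussian_family_def by blast
qed

lemma limit_Y_integrable:
  assumes "finite S" "finite S'"
  shows "integrable M (Y (S, p))" "integrable M (\<lambda>w. Y (S, p) w * Y (S', p') w)"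
proof -
  note G = gaussian_rv_centered[OF limit_prob_space limit_Y[OF assms(1), of p]]
    gaussian_rv_centered(2)[OF limit_prob_space limit_Y[OF assms(2), of p']]
  have "Y (S, p) \<in> borel_measurable M" "Y (S', p') \<in> borel_measurable M"
    using limit_Y(1)[OF assms(1), of p] limit_Y(1)[OF assms(2), of p'] by (simp_all add: gaussian_rv_def)
  then show "integrable M (\<lambda>w. Y (S, p) w * Y (S', p') w)" using G by (intro integrable_mult_square)
  show "integrable M (Y (S, p))" by (rule G(1))
qed

lemma limit_Z_gaussian:
  assumes "J \<subseteq> Pow {1..n}"
  shows "gaussian_rv M (\<lambda>w. \<Sum>S\<in>J. c S * sk_Z Y S w)"
proof -
  have J: "finite J" and JS: "S \<in> J \<Longrightarrow> finite S" for S
    using assms finite_subset[OF assms] finite_subset[of S "{1..n}"] by auto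
  define Z where "Z = (SIGMA S:J. Pow S)"
  define f where "f z = (snd z, card (fst z) - card (snd z))" for z :: "nat set \<times> nat set"
  have Z: "finite Z" using J JS by (auto simp: Z_def)
  have eq: "(\<Sum>S\<in>J. c S * sk_Z Y S w) = (\<Sum>x\<in>f ` Z. (\<Sum>z\<in>{z \<in> Z. f z = x}. c (fst z)) * Y x w)" for w
  proof -
    have "(\<Sum>S\<in>J. c S * sk_Z Y S w) = (\<Sum>z\<in>Z. c (fst z) * Y (f z) w)"
      unfolding sk_Z_def sum_distrib_left Z_def f_def using J JS by (subst sum.Sigma) (auto simp: case_prod_beta)
    then show ?thesis unfolding sum_push_forward[OF Z, of "\<lambda>z. c (fst z)" "\<lambda>x. Y x w" f] .
  qed
  have "f ` Z \<subseteq> {S. finite S} \<times> UNIV"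
  proof
    fix x assume "x \<in> f ` Z"
    then obtain S where "S \<in> J" "fst x \<subseteq> S" by (auto simp: Z_def f_def)
    then have "finite (fst x)" using JS finite_subset by blast
    then show "x \<in> {S. finite S} \<times> UNIV" by (simp add: mem_Times_iff)
  qed
  then show ?thesis unfolding eq using Z by (intro limit_gaussian) simp_all
qed

lemma limit_Z_mean:
  assumes "S \<subseteq> {1..n}"
  shows "prob_space.expectation M (sk_Z Y S) = 0" "integrable M (sk_Z Y S)"
proof -
  have fin: "finite T" if "T \<in> Pow S" for T
    by (rule finite_subset[of _ "{1..n}"]) (use that assms in auto)
  have i: "integrable M (Y (T, card S - card T))" if "T \<in> Pow S" for T
    by (rule limit_Y_integrable(1)[OF fin[OF that] fin[OF that]])
  show "integrable M (sk_Z Y S)" unfolding sk_Z_def[abs_def] by (intro Bochner_Integration.integrable_sum i)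
  have "integral\<^sup>L M (sk_Z Y S) = (\<Sum>T\<in>Pow S. integral\<^sup>L M (Y (T, card S - card T)))"
    unfolding sk_Z_def[abs_def] by (rule Bochner_Integration.integral_sum[OF i])
  also have "\<dots> = 0" by (intro sum.neutral ballI limit_Y(2) fin)
  finally show "integral\<^sup>L M (sk_Z Y S) = 0" .
qed

text \<open>In the expanded product distinct subsets are uncorrelated, so only common subsets of
  \<open>S\<close> and \<open>S'\<close> remain.\<close>

lemma limit_Z_covariance:
  assumes S: "S \<subseteq> {1..n}" and S': "S' \<subseteq> {1..n}"
  shows "(LINT w|M. sk_Z Y S w * sk_Z Y S' w) = B S S'" "integrable M (\<lambda>w. sk_Z Y S w * sk_Z Y S' w)"
proof -
  have fin: "finite T" if "T \<in> Pow S \<or> T \<in> Pow S'" for T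
    by (rule finite_subset[of _ "{1..n}"]) (use that S S' in auto)
  have finS: "finite S" "finite S'" using fin[of S] fin[of S'] by simp_all
  let ?y = "\<lambda>T T' w. Y (T, card S - card T) w * Y (T', card S' - card T') w"
  have i: "integrable M (?y T T')" if "T \<in> Pow S" "T' \<in> Pow S'" for T T'
    using that by (intro limit_Y_integrable(2) fin) auto
  have eq: "(\<lambda>w. sk_Z Y S w * sk_Z Y S' w) = (\<lambda>w. \<Sum>T\<in>Pow S. \<Sum>T'\<in>Pow S'. ?y T T' w)"
    unfolding sk_Z_def sum_product ..
  show "integrable M (\<lambda>w. sk_Z Y S w * sk_Z Y S' w)"
    unfolding eq by (intro Bochner_Integration.integrable_sum i)
  have "(LINT w|M. sk_Z Y S w * sk_Z Y S' w) = (\<Sum>T\<in>Pow S. \<Sum>T'\<in>Pow S'. integral\<^sup>L M (?y T T'))"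
    unfolding eq by (rule integral_double_sum) (rule i)
  also have "\<dots> = (\<Sum>T\<in>Pow S. \<Sum>T'\<in>Pow S'. if T' = T then A (card T) (card S - card T) (card S' - card T) else 0)"
  proof (intro sum.cong refl)
    fix T T' assume "T \<in> Pow S" "T' \<in> Pow S'"
    then have "finite T" "finite T'" using fin by blast+
    then show "integral\<^sup>L M (?y T T') = (if T' = T then A (card T) (card S - card T) (card S' - card T) else 0)"
      using Y unfolding sk_limit_family_def sk_A_eq by auto
  qed
  also have "\<dots> = (\<Sum>T\<in>Pow S. if T \<in> Pow S' then A (card T) (card S - card T) (card S' - card T) else 0)"
    using finS by (intro sum.cong refl) (simp add: sum.delta)
  also have "\<dots> = B S S'"
    unfolding B_def using finS by (subst sum.inter_restrict[symmetric]) (simp_all del: PowD Pow_iff add: Pow_Int_eq)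
  finally show "(LINT w|M. sk_Z Y S w * sk_Z Y S' w) = B S S'" .
qed

lemma limit_Z_family: "centered_gaussian_family (Pow {1..n}) M (sk_Z Y)"
  unfolding centered_gaussian_family_def jointly_gaussian_def
  using limit_prob_space limit_Z_gaussian limit_Z_mean(1) by blast

lemma limit_Z_trig:
  "(LINT w|M. cos (\<Sum>S\<in>Pow {1..n}. t S * sk_Z Y S w)) = exp (- V n t / 2)"
  "(LINT w|M. sin (\<Sum>S\<in>Pow {1..n}. t S * sk_Z Y S w)) = 0"
proof -
  let ?X = "\<lambda>w. \<Sum>S\<in>Pow {1..n}. t S * sk_Z Y S w"
  have E: "(LINT w|M. ?X w) = 0"
    using limit_Z_mean by (subst Bochner_Integration.integral_sum) auto
  have "(\<lambda>w. (?X w)\<^sup>2) = (\<lambda>w. \<Sum>W\<in>Pow {1..n}. \<Sum>S\<in>Pow {1..n}. t W * t S * (sk_Z Y W w * sk_Z Y S w))"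
    by (rule ext) (simp add: power2_eq_square sum_product mult_ac)
  then have "(LINT w|M. (?X w)\<^sup>2)
      = (LINT w|M. (\<Sum>W\<in>Pow {1..n}. \<Sum>S\<in>Pow {1..n}. t W * t S * (sk_Z Y W w * sk_Z Y S w)))"
    by (rule arg_cong)
  also have "\<dots> = (\<Sum>W\<in>Pow {1..n}. \<Sum>S\<in>Pow {1..n}. LINT w|M. t W * t S * (sk_Z Y W w * sk_Z Y S w))"
    by (rule integral_double_sum) (intro integrable_mult_right limit_Z_covariance(2), auto)
  also have "\<dots> = V n t"
    unfolding V_def integral_mult_right_zero
    by (intro sum.cong refl arg_cong2[where f = "(*)"] limit_Z_covariance(1)) auto
  finally have V: "(LINT w|M. (?X w)\<^sup>2) = V n t" .
  note G = gaussian_rv_centered(3,4)[OF limit_prob_space limit_Z_gaussian[OF subset_refl] E]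
  show "(LINT w|M. cos (?X w)) = exp (- V n t / 2)" using G(1) unfolding V .
  show "(LINT w|M. sin (?X w)) = 0" by (rule G(2))
qed

lemma limit_convergence:
  "converges_jointly_in_distribution (Pow {1..n}) (\<lambda>N. sk_nu N n \<beta> h)
     (\<lambda>N S \<sigma>. sqrt (real N) * (sk_overlap N S \<sigma> - sk_q \<beta> h (card S))) M (sk_Z Y)"
proof (rule converges_jointly_in_distributionI)
  show "finite (Pow {1..n})" by simp
  show "prob_space M" by (rule limit_prob_space)
  show "sk_Z Y S \<in> borel_measurable M" if "S \<in> Pow {1..n}" for S
    using limit_Z_mean(2)[of S n] that by auto
  show "integrable M (\<lambda>w. (sk_Z Y S w)\<^sup>2)" if "S \<in> Pow {1..n}" for S
    using limit_Z_covariance(2)[of S n S] that by (simp add: power2_eq_square)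
  show "sk_nu N n \<beta> h (\<lambda>x. f x + g x) = sk_nu N n \<beta> h f + sk_nu N n \<beta> h g" for N f g
    unfolding sk_nu_eq_sk_avg by (rule sk_avg_add)
  show "sk_nu N n \<beta> h (\<lambda>x. a * f x) = a * sk_nu N n \<beta> h f" for N a f
    unfolding sk_nu_eq_sk_avg by (rule sk_avg_cmult)
  show "sk_nu N n \<beta> h f \<le> sk_nu N n \<beta> h g" if "\<And>x. f x \<le> g x" for N f g
    unfolding sk_nu_eq_sk_avg by (rule sk_avg_mono) (rule that)
  show "sk_nu N n \<beta> h (\<lambda>_. 1) = 1" for N
    unfolding sk_nu_eq_sk_avg by (rule sk_avg_const) simp
  show "\<exists>C. \<forall>N\<ge>1. sk_nu N n \<beta> h (\<lambda>\<sigma>. (sqrt (real N) * (sk_overlap N S \<sigma> - sk_q \<beta> h (card S)))\<^sup>2) \<le> C"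
    if "S \<in> Pow {1..n}" for S
  proof -
    from that have "S \<subseteq> {1..n}" by simp
    from multi_overlap_moment[OF this] obtain C where
      C: "\<forall>N\<ge>1. \<forall>M\<ge>n. sk_avg N \<beta> h {1..M} (\<lambda>\<sigma>. (sk_overlap N S \<sigma> - qq (card S))\<^sup>2) \<le> C / real N" by blast
    have "sk_nu N n \<beta> h (\<lambda>\<sigma>. (sqrt (real N) * (sk_overlap N S \<sigma> - sk_q \<beta> h (card S)))\<^sup>2) \<le> C" if "N \<ge> 1" for N
    proof -
      have "sk_avg N \<beta> h {1..n} (\<lambda>\<sigma>. (sk_overlap N S \<sigma> - sk_q \<beta> h (card S))\<^sup>2) \<le> C / real N"
        using C that unfolding qq_eq by blast
      then have "real N * sk_avg N \<beta> h {1..n} (\<lambda>\<sigma>. (sk_overlap N S \<sigma> - sk_q \<beta> h (card S))\<^sup>2) \<le> C"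
        using that by (simp add: field_simps)
      then show ?thesis unfolding sk_nu_eq_sk_avg power_mult_distrib by (simp add: sk_avg_cmult)
    qed
    then show ?thesis by blast
  qed
  have fl: "(\<Sum>S\<in>Pow {1..n}. t S * (sqrt (real N) * (sk_overlap N S \<sigma> - sk_q \<beta> h (card S)))) = fluct N n t \<sigma>" for N t \<sigma>
    unfolding fluct_def qq_eq ..
  show "(\<lambda>N. sk_nu N n \<beta> h (\<lambda>\<sigma>. cos (\<Sum>S\<in>Pow {1..n}. t S * (sqrt (real N) * (sk_overlap N S \<sigma> - sk_q \<beta> h (card S))))))
    \<longlonglongrightarrow> (LINT w|M. cos (\<Sum>S\<in>Pow {1..n}. t S * sk_Z Y S w))" for t
    unfolding fl limit_Z_trig by (rule cos_tendsto)
  show "(\<lambda>N. sk_nu N n \<beta> h (\<lambda>\<sigma>. sin (\<Sum>S\<in>Pow {1..n}. t S * (sqrt (real N) * (sk_overlap N S \<sigma> - sk_q \<beta> h (card S))))))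
    \<longlonglongrightarrow> (LINT w|M. sin (\<Sum>S\<in>Pow {1..n}. t S * sk_Z Y S w))" for t
    unfolding fl limit_Z_trig by (rule sin_tendsto)
qed

end

end

subsection \<open>The limit theorem\<close>

text \<open>At fixed disorder the two replicas are independent, so the average of
  \<open>\<sigma> 1 i * \<sigma> 2 i\<close> is the square of a Gibbs mean.\<close>

lemma sk_avg_overlap_nonneg: "0 \<le> sk_avg N \<beta> h {1..2} (\<lambda>\<sigma>. sk_overlap N {1, 2} \<sigma>)"
proof -
  have "0 \<le> sk_avg N \<beta> h {1..2} (\<lambda>\<sigma>. \<sigma> 1 i * \<sigma> 2 i)" for i
    unfolding sk_avg_def gauss_avg_def
  proof (rule integral_nonneg_AE, rule AE_I2)
    fix g :: "nat \<times> nat \<Rightarrow> real"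
    let ?p = "boltzmann (sk_configs N) (gauss_energy (sk_pairs N) (\<lambda>\<sigma>. \<beta> * h * (\<Sum>j=1..N. \<sigma> j))
      (\<lambda>(j, k) \<sigma>. \<beta> / sqrt (real N) * \<sigma> j * \<sigma> k) g)"
    let ?r = "replica_avg {1..2} (sk_configs N) ?p"
    have p: "sum ?p (sk_configs N) = 1" by (rule sum_boltzmann[OF finite_sk_configs sk_configs_nonempty])
    have "?r (\<lambda>\<sigma>. \<sigma> 1 i * \<sigma> 2 i) = ?r (\<lambda>\<sigma>. \<sigma> 1 i) * (\<Sum>\<tau>\<in>sk_configs N. ?p \<tau> * \<tau> i)"
      by (rule replica_avg_factor[OF _ _ p, where v = "\<lambda>\<tau>. \<tau> i"]) (auto simp: depends_on_def)
    also have "?r (\<lambda>\<sigma>. 1 * \<sigma> 1 i) = ?r (\<lambda>_. 1) * (\<Sum>\<tau>\<in>sk_configs N. ?p \<tau> * \<tau> i)"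
      by (rule replica_avg_factor[OF _ _ p, where v = "\<lambda>\<tau>. \<tau> i"]) (auto simp: depends_on_def)
    then have "?r (\<lambda>\<sigma>. \<sigma> 1 i) = (\<Sum>\<tau>\<in>sk_configs N. ?p \<tau> * \<tau> i)" using replica_avg_one[OF _ p] by simp
    finally show "0 \<le> ?r (\<lambda>\<sigma>. \<sigma> 1 i * \<sigma> 2 i)" by simp
  qed
  moreover have "sk_avg N \<beta> h {1..2} (\<lambda>\<sigma>. sk_overlap N {1, 2} \<sigma>)
    = 1 / real N * (\<Sum>i=1..N. sk_avg N \<beta> h {1..2} (\<lambda>\<sigma>. \<sigma> 1 i * \<sigma> 2 i))"
    unfolding sk_overlap_def sk_avg_cmult sk_avg_sum by simp
  ultimately show ?thesis by (simp add: sum_nonneg)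
qed

text \<open>\<open>u \<le> exp u\<close> at \<open>u = real N / L * x\<close> turns the exponential
  moment bound \<open>L\<close> into the second-moment bound
  \<open>L\<^sup>2 / real N\<close>.\<close>

lemma sk_limit_if_high_temperature:
  assumes "sk_high_temperature \<beta>0" "0 < \<beta>" "\<beta> < \<beta>0" "0 < h"
  shows "\<exists>L. sk_limit \<beta> h L"
proof -
  define q where "q = sk_q2 \<beta> h"
  obtain L where L: "L > 0" and exp_bound: "\<And>N. N \<ge> 1 \<Longrightarrow>
     sk_avg N \<beta> h {1..2} (\<lambda>\<sigma>. exp (real N / L * (sk_overlap N {1, 2} \<sigma> - q)\<^sup>2)) \<le> L"
    using assms unfolding sk_high_temperature_def sk_nu_eq_sk_avg q_def by blast
  have pair: "sk_avg N \<beta> h {1..2} (\<lambda>\<sigma>. (sk_overlap N {1, 2} \<sigma> - q)\<^sup>2) \<le> L\<^sup>2 / real N" if N: "N \<ge> 1" for N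
  proof -
    have "x \<le> L / real N * exp (real N / L * x)" for x
    proof -
      have "real N / L * x \<le> exp (real N / L * x)" using exp_ge_add_one_self[of "real N / L * x"] by linarith
      then have "L / real N * (real N / L * x) \<le> L / real N * exp (real N / L * x)"
        using L by (intro mult_left_mono) auto
      then show ?thesis using L N by simp
    qed
    then have "sk_avg N \<beta> h {1..2} (\<lambda>\<sigma>. (sk_overlap N {1, 2} \<sigma> - q)\<^sup>2)
      \<le> sk_avg N \<beta> h {1..2} (\<lambda>\<sigma>. L / real N * exp (real N / L * (sk_overlap N {1, 2} \<sigma> - q)\<^sup>2))"
      by (intro sk_avg_mono)
    also have "\<dots> = L / real N * sk_avg N \<beta> h {1..2} (\<lambda>\<sigma>. exp (real N / L * (sk_overlap N {1, 2} \<sigma> - q)\<^sup>2))"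
      by (rule sk_avg_cmult)
    also have "\<dots> \<le> L / real N * L" using exp_bound[OF N] L by (intro mult_left_mono) auto
    finally show ?thesis by (simp add: power2_eq_square)
  qed
  \<comment> \<open>Unfolding the \<open>THE\<close> in \<open>sk_q2\<close> would require existence
    and uniqueness. Instead, an overlap with nonnegative mean cannot concentrate at a negative
    value.\<close>
  have "0 \<le> q"
  proof (rule ccontr)
    assume "\<not> 0 \<le> q"
    then have q: "q < 0" by simp
    have le: "q\<^sup>2 \<le> L\<^sup>2 / real N" if N: "N \<ge> 1" for N
    proof -
      have "sk_avg N \<beta> h {1..2} (\<lambda>\<sigma>. - (2 * q) * sk_overlap N {1, 2} \<sigma> + q\<^sup>2)
        \<le> sk_avg N \<beta> h {1..2} (\<lambda>\<sigma>. (sk_overlap N {1, 2} \<sigma> - q)\<^sup>2)"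
        by (rule sk_avg_mono) (simp add: power2_diff algebra_simps)
      moreover have "sk_avg N \<beta> h {1..2} (\<lambda>\<sigma>. - (2 * q) * sk_overlap N {1, 2} \<sigma> + q\<^sup>2)
        = - (2 * q) * sk_avg N \<beta> h {1..2} (sk_overlap N {1, 2}) + q\<^sup>2"
        unfolding sk_avg_add sk_avg_cmult by (simp add: sk_avg_const)
      moreover have "0 \<le> - (2 * q) * sk_avg N \<beta> h {1..2} (sk_overlap N {1, 2})"
        using q sk_avg_overlap_nonneg[of N \<beta> h] by (intro mult_nonneg_nonneg) auto
      ultimately show ?thesis using pair[OF N] by linarith
    qed
    have "(\<lambda>N. L\<^sup>2 / real N) \<longlonglongrightarrow> 0" by real_asymp
    then have "q\<^sup>2 \<le> 0" by (rule LIMSEQ_le_const) (use le in blast)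
    then show False using q by simp
  qed
  then have "sk_limit \<beta> h (L\<^sup>2)"
    using pair assms(2,4) unfolding q_def by unfold_locales auto
  then show ?thesis by blast
qed

theorem corollary2p5:
  fixes \<beta>0 \<beta> h :: real and n :: nat
  assumes "sk_high_temperature \<beta>0"
    and "0 < \<beta>" and "\<beta> < \<beta>0" and "0 < h"
  shows "(\<exists>(M :: (nat set \<times> nat \<Rightarrow> real) measure) Y. sk_limit_family \<beta> h M Y) \<and>
    (\<forall>(M :: 'b measure) Y. sk_limit_family \<beta> h M Y \<longrightarrow>
       centered_gaussian_family (Pow {1..n}) M (sk_Z Y) \<and>
       (\<forall>S\<subseteq>{1..n}. \<forall>S'\<subseteq>{1..n}.
          prob_space.expectation M (\<lambda>\<omega>. sk_Z Y S \<omega> * sk_Z Y S' \<omega>)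
            = (\<Sum>T\<in>Pow (S \<inter> S'). sk_A \<beta> h (card T) (card S - card T) (card S' - card T))) \<and>
       converges_jointly_in_distribution (Pow {1..n})
         (\<lambda>N. sk_nu N n \<beta> h)
         (\<lambda>N S \<sigma>. sqrt (real N) * (sk_overlap N S \<sigma> - sk_q \<beta> h (card S)))
         M (sk_Z Y))"
proof -
  obtain L where "sk_limit \<beta> h L" using sk_limit_if_high_temperature[OF assms] by blast
  then interpret sk_limit \<beta> h L .
  show ?thesis
  proof (intro conjI allI impI)
    show "\<exists>(M :: (nat set \<times> nat \<Rightarrow> real) measure) Y. sk_limit_family \<beta> h M Y" by (rule exists_limit_family)
    fix M :: "'b measure" and Y assume Y: "sk_limit_family \<beta> h M Y"
    show "centered_gaussian_family (Pow {1..n}) M (sk_Z Y)" by (rule limit_Z_family[OF Y])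
    show "prob_space.expectation M (\<lambda>\<omega>. sk_Z Y S \<omega> * sk_Z Y S' \<omega>)
        = (\<Sum>T\<in>Pow (S \<inter> S'). sk_A \<beta> h (card T) (card S - card T) (card S' - card T))"
      if "S \<subseteq> {1..n}" "S' \<subseteq> {1..n}" for S S'
      using limit_Z_covariance(1)[OF Y that] by (simp only: sk_A_eq B_def)
    show "converges_jointly_in_distribution (Pow {1..n}) (\<lambda>N. sk_nu N n \<beta> h)
         (\<lambda>N S \<sigma>. sqrt (real N) * (sk_overlap N S \<sigma> - sk_q \<beta> h (card S))) M (sk_Z Y)"
      by (rule limit_convergence[OF Y])
  qed
qed

end
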